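(* Let $G$, $H_0$, $V$, $H=H_0+V$, $R(\kappa)=(H+\kappa^2)^{-1}$ be as in the context. Assume that the threshold $0$ is an exceptional point of the third kind, i.e. $\mathcal E\supsetneq\mathsf E\supsetneq\{0\}$, and that $V$ satisfies the assumption $(\mathrm A_\beta)$ of the context for some integer $\beta\ge 4$. Then, as $\kappa\to0$ with $\mathop{\mathrm{Re}}\kappa>0$, $$R(\kappa)=\sum_{j=-2}^{\beta-6}\kappa^jG_j+\mathcal O(\kappa^{\beta-5})\quad\text{in }\mathcal B^{\beta-2},$$ with $G_j\in\mathcal B^{j+3}$ for $j$ even and $G_j\in\mathcal B^{j+2}$ for $j$ odd. The coefficients $G_j$ can be computed explicitly. In particular, $$G_{-2}=\mathsf P\ne0,\qquad G_{-1}=\mathcal P\neq0.$$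
   Context: Graph. Let $(K,E_0)$ be a connected, finite, undirected, simple graph (no loops, no multiple edges), and for $\alpha=1,\dots,N$ let $(L_\alpha,E_\alpha)$ be a copy of the discrete half-line, $L_\alpha=\{1,2,\dots\}$, $E_\alpha=\{\{n,n+1\}: n\in L_\alpha\}$. Fix vertices $x_1,\dots,x_N\in K$ (not necessarily distinct). Let $G=K\cup L_1\cup\dots\cup L_N$ (disjoint union), with edges those of $E_0,E_1,\dots,E_N$ together with $\{x_\alpha,1^{(\alpha)}\}$, $\alpha=1,\dots,N$, where $1^{(\alpha)}$ is the point $1\in L_\alpha$. Free operator. For $u\colon K\to\mathbb C$ set $(h_0u)[x]=\sum_{y\in K,\{x,y\}\in E_0}(u[x]-u[y])+\sum_{\alpha=1}^Ns_\alpha[x]u[x]$, where $s_\alpha[x]=1$ if $x=x_\alpha$ and $0$ otherwise. For $u\colon L_\alpha\to\mathbb C$ set $(h_\alpha u)[1]=2u[1]-u[2]$ and $(h_\alpha u)[n]=2u[n]-u[n+1]-u[n-1]$ for $n\ge2$. Let $H_0=h_0\oplus h_1\oplus\dots\oplus h_N$, acting on all functions on $G$ decomposed as functions on $K,L_1,\dots,L_N$; on $\mathcal H=\ell^2(G)$ it is bounded and self-adjoint. Spaces. For $s\in\mathbb R$, $\mathcal L^s=\ell^{1,s}(G)$ is the space of $u\colon G\to\mathbb C$ with $\sum_{x\in K}|u[x]|+\sum_{\alpha}\sum_{n\in L_\alpha}(1+n^2)^{s/2}|u[n]|<\infty$; its dual $(\mathcal L^s)^*=\ell^{\infty,-s}(G)$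 is the space of $u$ with $\sup_{x\in K}|u[x]|<\infty$ and $\sup_{n\in L_\alpha}(1+n^2)^{-s/2}|u[n]|<\infty$ for all $\alpha$. Put $\mathcal B^s=\mathcal B(\mathcal L^s,(\mathcal L^s)^* )$, the bounded operators from $\mathcal L^s$ to $(\mathcal L^s)^*$. $\langle u,w\rangle=\sum_{x\in G}\overline{u[x]}w[x]$ whenever this converges absolutely, and $|\Psi\rangle\langle\Phi|$ is the operator $u\mapsto\langle\Phi,u\rangle\Psi$. $(\Phi\cdot\Psi)[x]=\Phi[x]\Psi[x]$ is the pointwise product. Assumption $(\mathrm A_\beta)$, $\beta\ge1$: $V\in\mathcal B(\mathcal H)$ is self-adjoint, and there exist a Hilbert space $\mathcal K$, an injective operator $v\in\mathcal B(\mathcal K,\mathcal L^\beta)$ and a self-adjoint unitary operator $U\in\mathcal B(\mathcal K)$ such that $V=vUv^*\in\mathcal B((\mathcal L^\beta)^*,\mathcal L^\beta)$. Put $H=H_0+V$ and $R(\kappa)=(H+\kappa^2)^{-1}$ for $-\kappa^2\notin\sigma(H)$. Eigenspaces. Let $\mathbf n^{(\alpha)}[x]=m$ if $x=m\in L_\alpha$ and $0$ otherwise; $\mathbf 1^{(\alpha)}[x]=1$ if $x\in L_\alpha$ and $0$ otherwise; $\mathbb C\mathbf n=\bigoplus_\alpha\mathbb C\mathbf n^{(\alpha)}$, $\mathbb C\mathbf 1=\bigoplus_\alpha\mathbb C\mathbf 1^{(\alpha)}$. Define $\widetilde{\mathcal E}=\{\Psi\in(\mathcal L^\beta)^*: H\Psi=0\}$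 (it is contained in $\mathbb C\mathbf n\oplus\mathbb C\mathbf 1\oplus\mathcal L^{\beta-2}$), $\mathcal E=\widetilde{\mathcal E}\cap(\mathbb C\mathbf 1\oplus\mathcal L^{\beta-2})$, $\mathsf E=\widetilde{\mathcal E}\cap\mathcal L^{\beta-2}$. Projections. A set $\{\Psi_\gamma\}\subset\mathcal E$ is an orthonormal resonance basis if the classes $[\Psi_\gamma]$ form a basis of $\mathcal E/\mathsf E$, for every $\gamma$ and $\Psi\in\mathsf E$ one has $\overline\Psi\cdot\Psi_\gamma\in\mathcal L^0$ and $\langle\Psi,\Psi_\gamma\rangle=0$, and there is an orthonormal system $\{c^{(\gamma)}\}\subset\mathbb C^N$ with $\Psi_\gamma-\sum_\alpha c^{(\gamma)}_\alpha\mathbf 1^{(\alpha)}\in\mathcal L^{\beta-2}$ for every $\gamma$. The orthogonal resonance projection is $\mathcal P=\sum_\gamma|\Psi_\gamma\rangle\langle\Psi_\gamma|$. A basis $\{\Psi_\gamma\}$ of $\mathsf E$ is an orthonormal bound basis if $\overline{\Psi_{\gamma'}}\cdot\Psi_\gamma\in\mathcal L^0$ and $\langle\Psi_{\gamma'},\Psi_\gamma\rangle=\delta_{\gamma\gamma'}$ for all $\gamma,\gamma'$; the orthogonal bound projection is $\mathsf P=\sum_\gamma|\Psi_\gamma\rangle\langle\Psi_\gamma|$, the sum being over such a basis. Both projections are independent of the choice of orthonormal bases. *)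

theory Defs
  imports "HOL-Analysis.Analysis" "HOL-Library.Function_Algebras" "HOL-Library.Landau_Symbols"
begin

section \<open>Complex Hilbert spaces\<close>

text \<open>The inner product is conjugate-linear in its first argument. The real inner product
  (hence norm, topology and completeness) is the one induced by \<open>cinner\<close>; positive
  definiteness is inherited from \<^class>\<open>real_inner\<close>. The zero space is allowed.\<close>

class chilbert_space = real_inner + complete_space +
  fixes scaleC :: "complex \<Rightarrow> 'a \<Rightarrow> 'a"
    and cinner :: "'a \<Rightarrow> 'a \<Rightarrow> complex"
  assumes scaleC_of_real: "scaleC (complex_of_real r) x = scaleR r x"
    and scaleC_add_right: "scaleC a (x + y) = scaleC a x + scaleC a y"
    and scaleC_add_left: "scaleC (a + b) x = scaleC a x + scaleC b x"
    and scaleC_scaleC: "scaleC a (scaleC b x) = scaleC (a * b) x"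
    and cinner_commute: "cinner x y = cnj (cinner y x)"
    and cinner_add_right: "cinner x (y + z) = cinner x y + cinner x z"
    and cinner_scaleC_right: "cinner x (scaleC a y) = a * cinner x y"
    and Re_cinner: "Re (cinner x y) = inner x y"

instantiation complex :: chilbert_space
begin

definition scaleC_complex :: "complex \<Rightarrow> complex \<Rightarrow> complex" where
  "scaleC_complex a x = a * x"

definition cinner_complex :: "complex \<Rightarrow> complex \<Rightarrow> complex" where
  "cinner_complex x y = cnj x * y"

instance
  by intro_classes
    (auto simp: scaleC_complex_def cinner_complex_def scaleR_conv_of_real inner_complex_def
      algebra_simps)

end

definition selfadjoint_unitary :: "('h::chilbert_space \<Rightarrow> 'h) \<Rightarrow> bool" where
  "selfadjoint_unitary U \<longleftrightarrow>
     (\<forall>x y. U (x + y) = U x + U y) \<and> (\<forall>a x. U (scaleC a x) = scaleC a (U x)) \<and>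
     (\<forall>x y. cinner (U x) y = cinner x (U y)) \<and>
     surj U \<and> (\<forall>x y. cinner (U x) (U y) = cinner x y)"


section \<open>The graph and spaces of functions on it\<close>

text \<open>The vertex set of the finite graph is a whole finite type \<open>'k\<close>; edges are unordered pairs.\<close>

definition connected_simple_graph :: "'k::finite set set \<Rightarrow> bool" where
  "connected_simple_graph E0 \<longleftrightarrow>
     (\<forall>e\<in>E0. card e = 2) \<and> (\<forall>x y. (x, y) \<in> {(a, b). {a, b} \<in> E0}\<^sup>*)"

text \<open>The half-lines are indexed by a finite type \<open>'a\<close>. Since they start at 1 while \<^typ>\<open>nat\<close>
  starts at 0, \<open>Ray \<alpha> m\<close> is the point \<open>m + 1\<close> of the half-line \<open>\<alpha>\<close>.\<close>

datatype ('k, 'a) vertex = Core 'k | Ray 'a nat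

type_synonym ('k, 'a) gfun = "('k, 'a) vertex \<Rightarrow> complex"

definition cscale :: "complex \<Rightarrow> ('g \<Rightarrow> complex) \<Rightarrow> 'g \<Rightarrow> complex" where
  "cscale c u = (\<lambda>x. c * u x)"

interpretation cfun: vector_space "cscale :: complex \<Rightarrow> ('g \<Rightarrow> complex) \<Rightarrow> 'g \<Rightarrow> complex"
  by unfold_locales (auto simp: cscale_def algebra_simps fun_eq_iff)

fun weight :: "real \<Rightarrow> ('k, 'a) vertex \<Rightarrow> real" where
  "weight s (Core x) = 1"
| "weight s (Ray \<alpha> m) = (1 + (real m + 1)\<^sup>2) powr (s / 2)"

text \<open>\<open>l1w s\<close> is \<open>\<L>\<^sup>s\<close>, and \<open>linfw s\<close> is its dual \<open>(\<L>\<^sup>s)\<^sup>*\<close>, with weight exponent \<open>-s\<close>.\<close>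

definition l1w :: "real \<Rightarrow> ('k, 'a) gfun set" where
  "l1w s = {u. (\<lambda>x. weight s x * norm (u x)) summable_on UNIV}"

definition l1w_norm :: "real \<Rightarrow> ('k, 'a) gfun \<Rightarrow> real" where
  "l1w_norm s u = (\<Sum>\<^sub>\<infinity>x. weight s x * norm (u x))"

definition linfw :: "real \<Rightarrow> ('k, 'a) gfun set" where
  "linfw s = {u. bdd_above (range (\<lambda>x. weight (- s) x * norm (u x)))}"

definition linfw_norm :: "real \<Rightarrow> ('k, 'a) gfun \<Rightarrow> real" where
  "linfw_norm s u = (SUP x. weight (- s) x * norm (u x))"

definition ell2 :: "('g \<Rightarrow> complex) set" where
  "ell2 = {u. (\<lambda>x. (norm (u x))\<^sup>2) summable_on UNIV}"

definition ell2_norm :: "('g \<Rightarrow> complex) \<Rightarrow> real" where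
  "ell2_norm u = sqrt (\<Sum>\<^sub>\<infinity>x. (norm (u x))\<^sup>2)"

definition pairing :: "('g \<Rightarrow> complex) \<Rightarrow> ('g \<Rightarrow> complex) \<Rightarrow> complex" where
  "pairing u w = (\<Sum>\<^sub>\<infinity>x. cnj (u x) * w x)"

definition ketbra :: "('g \<Rightarrow> complex) \<Rightarrow> ('g \<Rightarrow> complex) \<Rightarrow> ('g \<Rightarrow> complex) \<Rightarrow> 'g \<Rightarrow> complex" where
  "ketbra \<Psi> \<Phi> u = cscale (pairing \<Phi> u) \<Psi>"


section \<open>Operators between function spaces\<close>

text \<open>An operator from \<open>X\<close> to \<open>Y\<close> is a map on all functions of which only the restriction to
  \<open>X\<close> matters.\<close>

definition bounded_op ::
    "('g \<Rightarrow> complex) set \<Rightarrow> (('g \<Rightarrow> complex) \<Rightarrow> real) \<Rightarrow> ('g \<Rightarrow> complex) set \<Rightarrow>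
     (('g \<Rightarrow> complex) \<Rightarrow> real) \<Rightarrow> (('g \<Rightarrow> complex) \<Rightarrow> 'g \<Rightarrow> complex) \<Rightarrow> bool" where
  "bounded_op X normX Y normY T \<longleftrightarrow>
     T ` X \<subseteq> Y \<and>
     (\<forall>u\<in>X. \<forall>w\<in>X. T (u + w) = T u + T w) \<and>
     (\<forall>c. \<forall>u\<in>X. T (cscale c u) = cscale c (T u)) \<and>
     (\<exists>C. \<forall>u\<in>X. normY (T u) \<le> C * normX u)"

definition Bs :: "real \<Rightarrow> (('k, 'a) gfun \<Rightarrow> ('k, 'a) gfun) set" where
  "Bs s = {T. bounded_op (l1w s) (l1w_norm s) (linfw s) (linfw_norm s) T}"

text \<open>Operator norm of \<open>Bs s\<close>, in the form of \<^const>\<open>onorm\<close>; \<open>0 / 0 = 0\<close> takes care of \<open>u = 0\<close>.\<close>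

definition Bs_norm :: "real \<Rightarrow> (('k, 'a) gfun \<Rightarrow> ('k, 'a) gfun) \<Rightarrow> real" where
  "Bs_norm s T = (SUP u\<in>l1w s. linfw_norm s (T u) / l1w_norm s u)"

definition spectrum :: "(('g \<Rightarrow> complex) \<Rightarrow> 'g \<Rightarrow> complex) \<Rightarrow> complex set" where
  "spectrum H = {z. \<not> (bij_betw (\<lambda>u. H u - cscale z u) ell2 ell2 \<and>
       bounded_op ell2 ell2_norm ell2 ell2_norm (inv_into ell2 (\<lambda>u. H u - cscale z u)))}"

definition resolvent ::
    "(('g \<Rightarrow> complex) \<Rightarrow> 'g \<Rightarrow> complex) \<Rightarrow> complex \<Rightarrow> ('g \<Rightarrow> complex) \<Rightarrow> 'g \<Rightarrow> complex" where
  "resolvent H \<kappa> = inv_into ell2 (\<lambda>u. H u + cscale (\<kappa>\<^sup>2) u)"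


section \<open>The free operator and the perturbation\<close>

fun H0 :: "'k::finite set set \<Rightarrow> ('a::finite \<Rightarrow> 'k) \<Rightarrow> ('k, 'a) gfun \<Rightarrow> ('k, 'a) gfun" where
  "H0 E0 r u (Core x) = (\<Sum>y | {x, y} \<in> E0. u (Core x) - u (Core y)) +
     (\<Sum>\<alpha>\<in>UNIV. (if x = r \<alpha> then 1 else 0) * u (Core x))"
| "H0 E0 r u (Ray \<alpha> 0) = 2 * u (Ray \<alpha> 0) - u (Ray \<alpha> 1)"
| "H0 E0 r u (Ray \<alpha> (Suc m)) = 2 * u (Ray \<alpha> (Suc m)) - u (Ray \<alpha> (Suc (Suc m))) - u (Ray \<alpha> m)"

definition bounded_selfadjoint :: "(('g \<Rightarrow> complex) \<Rightarrow> 'g \<Rightarrow> complex) \<Rightarrow> bool" where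
  "bounded_selfadjoint V \<longleftrightarrow>
     bounded_op ell2 ell2_norm ell2 ell2_norm V \<and>
     (\<forall>u\<in>ell2. \<forall>w\<in>ell2. pairing u (V w) = pairing (V u) w)"

definition bounded_into_l1w :: "real \<Rightarrow> ('h::chilbert_space \<Rightarrow> ('k, 'a) gfun) \<Rightarrow> bool" where
  "bounded_into_l1w s v \<longleftrightarrow>
     range v \<subseteq> l1w s \<and>
     (\<forall>h k. v (h + k) = v h + v k) \<and> (\<forall>c h. v (scaleC c h) = cscale c (v h)) \<and>
     (\<exists>C. \<forall>h. l1w_norm s (v h) \<le> C * norm h)"

text \<open>The defining relation of the adjoint \<open>v\<^sup>* : (\<L>\<^sup>s)\<^sup>* \<rightarrow> \<K>\<close> of \<open>v : \<K> \<rightarrow> \<L>\<^sup>s\<close>; by the Riesz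
  theorem it has exactly one solution on \<open>(\<L>\<^sup>s)\<^sup>*\<close>.\<close>

definition is_adjoint ::
    "real \<Rightarrow> ('h::chilbert_space \<Rightarrow> ('k, 'a) gfun) \<Rightarrow> (('k, 'a) gfun \<Rightarrow> 'h) \<Rightarrow> bool" where
  "is_adjoint s v v' \<longleftrightarrow> (\<forall>u\<in>linfw s. \<forall>h. cinner (v' u) h = pairing u (v h))"

text \<open>The auxiliary Hilbert space \<open>\<K>\<close> is the type \<open>'h\<close>: HOL has no existential quantifier over
  types, so "there is a Hilbert space \<open>\<K>\<close>" in a hypothesis becomes universal quantification
  over \<open>'h\<close> in the theorem. A single map \<open>V\<close> represents both the operator on \<open>\<ell>\<^sup>2\<close> and its
  extension \<open>v U v\<^sup>*\<close> to the larger space \<open>(\<L>\<^sup>\<beta>)\<^sup>*\<close>.\<close>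

definition assumption_A ::
    "'h::chilbert_space itself \<Rightarrow> real \<Rightarrow> (('k, 'a) gfun \<Rightarrow> ('k, 'a) gfun) \<Rightarrow> bool" where
  "assumption_A _ \<beta> V \<longleftrightarrow>
     bounded_selfadjoint V \<and>
     (\<exists>(v :: 'h \<Rightarrow> ('k, 'a) gfun) v' U.
        bounded_into_l1w \<beta> v \<and> inj v \<and> is_adjoint \<beta> v v' \<and> selfadjoint_unitary U \<and>
        (\<forall>u\<in>linfw \<beta>. V u = v (U (v' u))))"


section \<open>Threshold eigenspaces and their projections\<close>

fun ray_one :: "'a \<Rightarrow> ('k, 'a) gfun" where
  "ray_one \<alpha> (Core x) = 0"
| "ray_one \<alpha> (Ray \<alpha>' m) = (if \<alpha>' = \<alpha> then 1 else 0)"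

definition ray_const :: "('a::finite \<Rightarrow> complex) \<Rightarrow> ('k, 'a) gfun" where
  "ray_const c = (\<Sum>\<alpha>\<in>UNIV. cscale (c \<alpha>) (ray_one \<alpha>))"

text \<open>\<open>gen_space\<close>, \<open>res_space\<close>, \<open>bound_space\<close> are \<open>\<E>\<close> with tilde, \<open>\<E>\<close>, and sans-serif \<open>E\<close>.\<close>

definition gen_space :: "(('k, 'a) gfun \<Rightarrow> ('k, 'a) gfun) \<Rightarrow> real \<Rightarrow> ('k, 'a) gfun set" where
  "gen_space H \<beta> = {\<Psi> \<in> linfw \<beta>. H \<Psi> = 0}"

definition res_space :: "(('k, 'a::finite) gfun \<Rightarrow> ('k, 'a) gfun) \<Rightarrow> real \<Rightarrow> ('k, 'a) gfun set" where
  "res_space H \<beta> = gen_space H \<beta> \<inter> {ray_const c + u | c u. u \<in> l1w (\<beta> - 2)}"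

definition bound_space :: "(('k, 'a) gfun \<Rightarrow> ('k, 'a) gfun) \<Rightarrow> real \<Rightarrow> ('k, 'a) gfun set" where
  "bound_space H \<beta> = gen_space H \<beta> \<inter> l1w (\<beta> - 2)"

text \<open>The classes of the elements of \<open>B\<close> (taken distinct) form a basis of \<open>E / F\<close>.\<close>

definition quotient_basis ::
    "('g \<Rightarrow> complex) set \<Rightarrow> ('g \<Rightarrow> complex) set \<Rightarrow> ('g \<Rightarrow> complex) set \<Rightarrow> bool" where
  "quotient_basis E F B \<longleftrightarrow>
     B \<subseteq> E \<and>
     (\<forall>\<Psi>\<in>E. \<exists>\<Phi>\<in>cfun.span B. \<Psi> - \<Phi> \<in> F) \<and>
     (\<forall>S a. finite S \<and> S \<subseteq> B \<and> (\<Sum>\<Psi>\<in>S. cscale (a \<Psi>) \<Psi>) \<in> F \<longrightarrow> (\<forall>\<Psi>\<in>S. a \<Psi> = 0))"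

definition orthonormal_resonance_basis ::
    "(('k, 'a::finite) gfun \<Rightarrow> ('k, 'a) gfun) \<Rightarrow> real \<Rightarrow> ('k, 'a) gfun set \<Rightarrow> bool" where
  "orthonormal_resonance_basis H \<beta> B \<longleftrightarrow>
     quotient_basis (res_space H \<beta>) (bound_space H \<beta>) B \<and>
     (\<forall>\<Phi>\<in>B. \<forall>\<Psi>\<in>bound_space H \<beta>. (\<lambda>x. cnj (\<Psi> x) * \<Phi> x) \<in> l1w 0 \<and> pairing \<Psi> \<Phi> = 0) \<and>
     (\<exists>c :: ('k, 'a) gfun \<Rightarrow> 'a \<Rightarrow> complex.
        (\<forall>\<Phi>\<in>B. \<forall>\<Phi>'\<in>B. (\<Sum>\<alpha>\<in>UNIV. cnj (c \<Phi> \<alpha>) * c \<Phi>' \<alpha>) = (if \<Phi> = \<Phi>' then 1 else 0)) \<and>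
        (\<forall>\<Phi>\<in>B. \<Phi> - ray_const (c \<Phi>) \<in> l1w (\<beta> - 2)))"

definition orthonormal_bound_basis ::
    "(('k, 'a) gfun \<Rightarrow> ('k, 'a) gfun) \<Rightarrow> real \<Rightarrow> ('k, 'a) gfun set \<Rightarrow> bool" where
  "orthonormal_bound_basis H \<beta> B \<longleftrightarrow>
     cfun.independent B \<and> cfun.span B = bound_space H \<beta> \<and>
     (\<forall>\<Phi>\<in>B. \<forall>\<Psi>\<in>B. (\<lambda>x. cnj (\<Psi> x) * \<Phi> x) \<in> l1w 0 \<and>
        pairing \<Psi> \<Phi> = (if \<Phi> = \<Psi> then 1 else 0))"

text \<open>Under the hypotheses of the theorem, such bases exist, are finite, and the resulting
  operators on \<open>\<L>\<^sup>1\<close> do not depend on the one chosen.\<close>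

definition res_projection ::
    "(('k, 'a::finite) gfun \<Rightarrow> ('k, 'a) gfun) \<Rightarrow> real \<Rightarrow> ('k, 'a) gfun \<Rightarrow> ('k, 'a) gfun" where
  "res_projection H \<beta> u =
     (\<Sum>\<Psi>\<in>(SOME B. orthonormal_resonance_basis H \<beta> B). ketbra \<Psi> \<Psi> u)"

definition bound_projection ::
    "(('k, 'a) gfun \<Rightarrow> ('k, 'a) gfun) \<Rightarrow> real \<Rightarrow> ('k, 'a) gfun \<Rightarrow> ('k, 'a) gfun" where
  "bound_projection H \<beta> u =
     (\<Sum>\<Psi>\<in>(SOME B. orthonormal_bound_basis H \<beta> B). ketbra \<Psi> \<Psi> u)"

end

theory Submission imports Defs
begin

text \<open>Cut the first \<open>n\<close> points off every half-line. The Dirichlet Green function of what remains is explicit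
  in terms of the root \<open>s\<close> of \<open>s\<^sup>2 + \<kappa> s = 1\<close>, and for large \<open>n\<close> the perturbation is so small there that
  the exterior resolvent is analytic up to \<open>\<kappa> = 0\<close>, to the order allowed by the weights. A Schur complement
  reduces the inversion of \<open>H + \<kappa>\<^sup>2\<close> to a finite matrix with such an expansion; self-adjointness bounds
  its inverse by \<open>1 / \<bar>\<kappa>\<bar>\<^sup>2\<close> on the ray \<open>arg \<kappa> = \<pi> / 4\<close>, so the inverse has at most a double pole.
  The leading coefficients are then identified from limits: \<open>\<kappa>\<^sup>2 R(\<kappa>) u\<close> converges to an \<open>\<ell>\<^sup>2\<close> null
  vector with the same pairings with bound states as \<open>u\<close>; and if that limit vanishes, \<open>\<kappa> R(\<kappa>) u\<close>
  converges to a resonance, whose constants at infinity are read off by pairing with the approximate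
  solutions that decay like \<open>s ^ (2 l)\<close> along the half-lines.\<close>

section \<open>Expansions with graded weights\<close>

text \<open>At an exceptional threshold the usual operator on the auxiliary Hilbert space, which may
  be infinite-dimensional, loses its inverse as \<kappa> tends to 0. Cutting the half-lines
  separates the difficulty: outside, the sandwiched Green function has norm at most 1/2 against the
  unitary \<open>U\<close>, uniformly in \<kappa>, so a contraction inverts the sum; inside,
  finitely many vertices remain. The weights of \<open>V\<close> give expansions to order \<beta> -
  1 only, so nothing is analytic and a determinant could vanish beyond the visible order. The ray
  arg \<kappa> = \<pi> / 4 excludes this: there \<kappa>^2 = i t^2, at distance t^2 from the real
  spectrum. Inverting costs two orders, so \<kappa>^2 times the resolvent has coefficients of order
  0 to \<beta> - 4, that is j = -2 to \<beta> - 6. The kernel of order i is bounded by the i-th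
  power of \<open>wt x * wt y\<close>, whence the spaces of the coefficients. For \<beta> = 4 the
  sum ends at j = -2, so the second coefficient is identified for \<beta> \<ge> 5 only, while the
  resonance projection is nonzero for every \<beta>.\<close>

instance chilbert_space \<subseteq> banach ..

section \<open>Algebra of complex Hilbert spaces\<close>

lemma scaleC_one [simp]: "scaleC 1 (x::'h::chilbert_space) = x"
  using scaleC_of_real[of 1 x] by simp

lemma scaleC_zero_right [simp]: "scaleC a (0::'h::chilbert_space) = 0"
  using scaleC_add_right[of a 0 0] by simp

lemma scaleC_minus_right: "scaleC a (- x::'h::chilbert_space) = - scaleC a x"
  using scaleC_add_right[of a x "-x"] by (simp add: eq_neg_iff_add_eq_0 add.commute)

lemma scaleC_diff_right: "scaleC a (x - y::'h::chilbert_space) = scaleC a x - scaleC a y"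
  using scaleC_add_right[of a x "-y"] by (simp add: scaleC_minus_right)

lemma scaleC_minus_one: "scaleC (- 1) (x::'h::chilbert_space) = - x"
  using scaleC_of_real[of "-1" x] by simp

lemma scaleC_sum_right: "scaleC a (\<Sum>i\<in>A. f i::'h::chilbert_space) = (\<Sum>i\<in>A. scaleC a (f i))"
  by (induction A rule: infinite_finite_induct) (auto simp: scaleC_add_right)

lemma cinner_add_left: "cinner (x + y) (z::'h::chilbert_space) = cinner x z + cinner y z"
  by (metis cinner_add_right cinner_commute complex_cnj_add)

lemma cinner_scaleC_left: "cinner (scaleC a x) (y::'h::chilbert_space) = cnj a * cinner x y"
  by (metis cinner_commute cinner_scaleC_right complex_cnj_mult)

lemma cinner_self: "cinner x (x::'h::chilbert_space) = of_real ((norm x)\<^sup>2)"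
proof (rule complex_eqI)
  show "Re (cinner x x) = Re (of_real ((norm x)\<^sup>2))"
    by (simp add: Re_cinner power2_norm_eq_inner)
  show "Im (cinner x x) = Im (of_real ((norm x)\<^sup>2))"
    using arg_cong[OF cinner_commute[of x x], of Im] by simp
qed

lemma norm_scaleC [simp]: "norm (scaleC a (x::'h::chilbert_space)) = norm a * norm x"
proof -
  have "complex_of_real ((norm (scaleC a x))\<^sup>2) = of_real ((norm a * norm x)\<^sup>2)"
    unfolding cinner_self[symmetric] cinner_scaleC_left cinner_scaleC_right
    by (simp only: cinner_self power_mult_distrib of_real_mult complex_norm_square mult_ac)
  then show ?thesis
    by (metis mult_nonneg_nonneg norm_ge_zero of_real_eq_iff power2_eq_imp_eq)
qed

lemma cinner_ext: "(\<And>z. cinner x z = cinner y (z::'h::chilbert_space)) \<Longrightarrow> x = y"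
  by (metis Re_cinner inner_commute vector_eq_rdot)

lemma scaleC_complex [simp]: "scaleC a (z::complex) = a * z"
  by (simp add: scaleC_complex_def)

text \<open>On the side Re \<kappa> > 0 the decaying root on a half-line exists, and -\<kappa>^2
  avoids the positive axis. All expansions are uniform on such a set; analyticity never
  enters.\<close>

definition half_disc :: "real \<Rightarrow> complex set" where
  "half_disc \<delta> = {\<kappa>. 0 < Re \<kappa> \<and> norm \<kappa> < \<delta>}"

lemma half_disc_nz: "\<kappa> \<in> half_disc \<delta> \<Longrightarrow> \<kappa> \<noteq> 0"
  by (auto simp: half_disc_def)

lemma half_disc_of_real: "0 < t \<Longrightarrow> t < \<delta> \<Longrightarrow> complex_of_real t \<in> half_disc \<delta>"
  by (auto simp: half_disc_def)

text \<open>A family indexed by \<open>i\<close> has scale \<open>P i\<close> if its \<open>j\<close>-th coefficient and remainder behave like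
  \<open>P i ^ j\<close>. Bounding the remainders of all orders up to \<open>J\<close>, not only of the last one, is what makes
  the notion stable under products: for \<open>P i * norm \<kappa> > 1\<close> they do not follow from each other.\<close>

definition gexp :: "real \<Rightarrow> nat \<Rightarrow> ('i \<Rightarrow> real) \<Rightarrow> ('i \<Rightarrow> real) \<Rightarrow>
    ('i \<Rightarrow> complex \<Rightarrow> 'h::chilbert_space) \<Rightarrow> bool" where
  "gexp \<delta> J Q P f \<longleftrightarrow> (\<forall>i. 0 \<le> Q i \<and> 0 \<le> P i) \<and>
     (\<exists>b C. 0 \<le> C \<and> (\<forall>J'\<le>J. \<forall>i. \<forall>\<kappa>\<in>half_disc \<delta>.
        norm (f i \<kappa> - (\<Sum>j<J'. scaleC (\<kappa> ^ j) (b j i))) \<le> C * Q i * (P i * norm \<kappa>) ^ J'))"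

text \<open>A coefficient is the difference of two consecutive remainders, read off at one small
  real \<kappa>. The doubling is the only loss, since that point may depend on
  \<open>P\<close>.\<close>

lemma coeff_bound:
  fixes f :: "complex \<Rightarrow> 'h::chilbert_space"
  assumes "0 < \<delta>" "0 \<le> P" "0 \<le> Q" "0 \<le> C" "j < J"
    and r: "\<And>J' \<kappa>. J' \<le> J \<Longrightarrow> \<kappa> \<in> half_disc \<delta> \<Longrightarrow>
      norm (f \<kappa> - (\<Sum>j<J'. scaleC (\<kappa> ^ j) (b j))) \<le> C * Q * (P * norm \<kappa>) ^ J'"
  shows "norm (b j) \<le> 2 * C * Q * P ^ j"
proof -
  \<comment> \<open>Inside the half disc and with \<open>P * t \<le> 1\<close>, so the higher
    remainder is no larger than the lower one; powers of \<open>t\<close> cancel in the end.\<close>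
  define t where "t = min (\<delta>/2) (1 / (1 + P))"
  have t: "0 < t" "t < \<delta>" using assms unfolding t_def by (auto simp: min_def)
  have "P * t \<le> P * (1 / (1 + P))" using assms unfolding t_def by (intro mult_left_mono) auto
  also have "\<dots> \<le> 1" using assms by simp
  finally have t: "0 < t" "t < \<delta>" "P * t \<le> 1" using t by auto
  have "norm (scaleC (of_real t ^ j) (b j)) \<le> C * Q * (P * t) ^ Suc j + C * Q * (P * t) ^ j"
  proof -
    have "scaleC (of_real t ^ j) (b j) = (f (of_real t) - (\<Sum>j<j. scaleC (of_real t ^ j) (b j)))
       - (f (of_real t) - (\<Sum>j<Suc j. scaleC (of_real t ^ j) (b j)))" by simp
    also have "norm \<dots> \<le> C * Q * (P * norm (complex_of_real t)) ^ j + C * Q * (P * norm (complex_of_real t)) ^ Suc j"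
      by (intro order_trans[OF norm_triangle_ineq4] add_mono r half_disc_of_real) (use assms t in auto)
    finally show ?thesis using t by simp
  qed
  also have "C * Q * (P * t) ^ Suc j \<le> C * Q * (P * t) ^ j"
    using t assms by (intro mult_left_mono) (auto intro!: mult_left_le_one_le)
  finally have "t ^ j * norm (b j) \<le> t ^ j * (2 * C * Q * P ^ j)"
    using t by (simp add: norm_power power_mult_distrib algebra_simps)
  then show ?thesis using t by simp
qed

text \<open>Names the witnesses of \<open>gexp\<close>, which the final kernel expansion has to
  exhibit, together with the coefficient bounds that \<open>coeff_bound\<close> supplies.\<close>

definition gexp_coeff :: "real \<Rightarrow> nat \<Rightarrow> ('i \<Rightarrow> real) \<Rightarrow> ('i \<Rightarrow> real) \<Rightarrow>
    ('i \<Rightarrow> complex \<Rightarrow> 'h::chilbert_space) \<Rightarrow> (nat \<Rightarrow> 'i \<Rightarrow> 'h) \<Rightarrow> real \<Rightarrow> bool" where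
  "gexp_coeff \<delta> J Q P f b C \<longleftrightarrow> 0 \<le> C \<and> (\<forall>J'\<le>J. \<forall>i. \<forall>\<kappa>\<in>half_disc \<delta>.
       norm (f i \<kappa> - (\<Sum>j<J'. scaleC (\<kappa> ^ j) (b j i))) \<le> C * Q i * (P i * norm \<kappa>) ^ J') \<and>
    (\<forall>j<J. \<forall>i. norm (b j i) \<le> C * Q i * P i ^ j)"

lemma gexp_coeffD:
  assumes "gexp_coeff \<delta> J Q P f b C"
  shows "0 \<le> C"
    "\<And>J' i \<kappa>. J' \<le> J \<Longrightarrow> \<kappa> \<in> half_disc \<delta> \<Longrightarrow>
       norm (f i \<kappa> - (\<Sum>j<J'. scaleC (\<kappa> ^ j) (b j i))) \<le> C * Q i * (P i * norm \<kappa>) ^ J'"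
    "\<And>j i. j < J \<Longrightarrow> norm (b j i) \<le> C * Q i * P i ^ j"
  using assms unfolding gexp_coeff_def by auto

lemma gexpE:
  assumes "gexp \<delta> J Q P f" "0 < \<delta>"
  obtains b C where "gexp_coeff \<delta> J Q P f b C"
proof -
  from assms obtain b C where C: "0 \<le> C" and pos: "\<And>i. 0 \<le> Q i" "\<And>i. 0 \<le> P i"
    and r: "\<And>J' i \<kappa>. J' \<le> J \<Longrightarrow> \<kappa> \<in> half_disc \<delta> \<Longrightarrow>
       norm (f i \<kappa> - (\<Sum>j<J'. scaleC (\<kappa> ^ j) (b j i))) \<le> C * Q i * (P i * norm \<kappa>) ^ J'"
    unfolding gexp_def by blast
  have "norm (b j i) \<le> 2 * C * Q i * P i ^ j" if "j < J" for j i
    by (rule coeff_bound[OF assms(2) pos(2) pos(1) C that r])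
  moreover have "norm (f i \<kappa> - (\<Sum>j<J'. scaleC (\<kappa> ^ j) (b j i))) \<le> 2 * C * Q i * (P i * norm \<kappa>) ^ J'"
    if "J' \<le> J" "\<kappa> \<in> half_disc \<delta>" for J' i \<kappa>
  proof -
    have "0 \<le> C * Q i * (P i * norm \<kappa>) ^ J'" using C pos by simp
    then show ?thesis using r[OF that, of i] by simp
  qed
  ultimately have "gexp_coeff \<delta> J Q P f b (2 * C)" using C unfolding gexp_coeff_def by auto
  then show ?thesis by (rule that)
qed

lemma gexp_nonneg: "gexp \<delta> J Q P f \<Longrightarrow> 0 \<le> Q i" "gexp \<delta> J Q P f \<Longrightarrow> 0 \<le> P i"
  by (auto simp: gexp_def)

lemma gexpI:
  assumes "\<And>i. 0 \<le> Q i" "\<And>i. 0 \<le> P i" "0 \<le> C"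
    "\<And>J' i \<kappa>. J' \<le> J \<Longrightarrow> \<kappa> \<in> half_disc \<delta> \<Longrightarrow>
       norm (f i \<kappa> - (\<Sum>j<J'. scaleC (\<kappa> ^ j) (b j i))) \<le> C * Q i * (P i * norm \<kappa>) ^ J'"
  shows "gexp \<delta> J Q P f"
  using assms unfolding gexp_def by blast

lemma gexp_bound:
  assumes "gexp \<delta> J Q P f" "0 < \<delta>"
  obtains C where "0 \<le> C" "\<And>i \<kappa>. \<kappa> \<in> half_disc \<delta> \<Longrightarrow> norm (f i \<kappa>) \<le> C * Q i"
proof -
  obtain b C where C: "0 \<le> C" and
    r: "\<And>J' i \<kappa>. J' \<le> J \<Longrightarrow> \<kappa> \<in> half_disc \<delta> \<Longrightarrow>
       norm (f i \<kappa> - (\<Sum>j<J'. scaleC (\<kappa> ^ j) (b j i))) \<le> C * Q i * (P i * norm \<kappa>) ^ J'"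
    using assms(1) unfolding gexp_def by blast
  show ?thesis
  proof (rule that[OF C])
    show "norm (f i \<kappa>) \<le> C * Q i" if "\<kappa> \<in> half_disc \<delta>" for i \<kappa>
      using r[of 0 \<kappa> i] that by simp
  qed
qed

lemma gexp_cong:
  assumes "gexp \<delta> J Q P f" "\<And>i \<kappa>. \<kappa> \<in> half_disc \<delta> \<Longrightarrow> f i \<kappa> = g i \<kappa>"
  shows "gexp \<delta> J Q P g"
  using assms unfolding gexp_def by simp

lemma gexp_restrict:
  assumes "gexp \<delta> J Q P f" "J' \<le> J" "\<delta>' \<le> \<delta>"
  shows "gexp \<delta>' J' Q P f"
proof -
  have "half_disc \<delta>' \<subseteq> half_disc \<delta>" using assms by (auto simp: half_disc_def)
  then show ?thesis
    using assms unfolding gexp_def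
    by (elim conjE exE, intro conjI, simp) (rule_tac x=b in exI, rule_tac x=C in exI, auto)
qed

lemma gexp_reindex: "gexp \<delta> J Q P f \<Longrightarrow> gexp \<delta> J (\<lambda>i. Q (g i)) (\<lambda>i. P (g i)) (\<lambda>i. f (g i))"
  unfolding gexp_def
  by (elim conjE exE, intro conjI allI, simp, simp, rule_tac x="\<lambda>j i. b j (g i)" in exI) auto

lemma gexp_mono:
  assumes "gexp \<delta> J Q P f" "\<And>i. Q i \<le> c * Q' i" "\<And>i. P i \<le> d * P' i" "\<And>i. 0 \<le> Q' i" "\<And>i. 0 \<le> P' i"
    "0 \<le> c" "0 \<le> d"
  shows "gexp \<delta> J Q' P' f"
proof -
  from assms(1) obtain b C where C: "0 \<le> C" and pos: "\<And>i. 0 \<le> Q i" "\<And>i. 0 \<le> P i"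
    and r: "\<And>J' i \<kappa>. J' \<le> J \<Longrightarrow> \<kappa> \<in> half_disc \<delta> \<Longrightarrow>
       norm (f i \<kappa> - (\<Sum>j<J'. scaleC (\<kappa> ^ j) (b j i))) \<le> C * Q i * (P i * norm \<kappa>) ^ J'"
    unfolding gexp_def by blast
  show ?thesis
  \<comment> \<open>One constant has to absorb \<open>d ^ J'\<close> for all orders
    \<open>J'\<close> up to \<open>J\<close>, hence the maximum with 1.\<close>
  proof (rule gexpI[where b=b and C="C * c * (max 1 d) ^ J"])
    fix J' i \<kappa> assume *: "J' \<le> J" "\<kappa> \<in> half_disc \<delta>"
    have "C * Q i * (P i * norm \<kappa>) ^ J' \<le> C * (c * Q' i) * (d * P' i * norm \<kappa>) ^ J'"
      using C pos assms by (intro mult_mono power_mono mult_nonneg_nonneg) auto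
    also have "\<dots> = (C * c * Q' i * (P' i * norm \<kappa>) ^ J') * d ^ J'" by (simp add: power_mult_distrib)
    also have "\<dots> \<le> (C * c * Q' i * (P' i * norm \<kappa>) ^ J') * max 1 d ^ J"
    proof (rule mult_left_mono)
      have "d ^ J' \<le> max 1 d ^ J'" using assms by (intro power_mono) auto
      also have "\<dots> \<le> max 1 d ^ J" using * by (intro power_increasing) auto
      finally show "d ^ J' \<le> max 1 d ^ J" .
    qed (use C assms in simp)
    finally show "norm (f i \<kappa> - (\<Sum>j<J'. scaleC (\<kappa> ^ j) (b j i))) \<le> C * c * (max 1 d) ^ J * Q' i * (P' i * norm \<kappa>) ^ J'"
      using r[OF *, of i] by (simp add: mult_ac)
  qed (use C assms in auto)
qed

lemma gexp_const:
  assumes "\<And>i. norm (x i) \<le> c * Q i" "\<And>i. 0 \<le> Q i" "\<And>i. 0 \<le> P i" "0 \<le> c"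
  shows "gexp \<delta> J Q P (\<lambda>i \<kappa>. x i)"
proof (rule gexpI[where b="\<lambda>j i. if j = 0 then x i else 0" and C=c])
  fix J' i and \<kappa> :: complex assume "J' \<le> J"
  have *: "(\<Sum>j<J'. scaleC (\<kappa> ^ j) (if j = 0 then x i else 0)) = (if J' = 0 then 0 else x i)"
    by (induction J') auto
  show "norm (x i - (\<Sum>j<J'. scaleC (\<kappa> ^ j) (if j = 0 then x i else 0))) \<le> c * Q i * (P i * norm \<kappa>) ^ J'"
    unfolding * using assms by auto
qed (use assms in auto)

lemma gexp_add:
  assumes "gexp \<delta> J Q P f" "gexp \<delta> J Q P g"
  shows "gexp \<delta> J Q P (\<lambda>i \<kappa>. f i \<kappa> + g i \<kappa>)"
proof -
  from assms(1) obtain b C where C: "0 \<le> C" and pos: "\<And>i. 0 \<le> Q i" "\<And>i. 0 \<le> P i"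
    and r: "\<And>J' i \<kappa>. J' \<le> J \<Longrightarrow> \<kappa> \<in> half_disc \<delta> \<Longrightarrow>
       norm (f i \<kappa> - (\<Sum>j<J'. scaleC (\<kappa> ^ j) (b j i))) \<le> C * Q i * (P i * norm \<kappa>) ^ J'"
    unfolding gexp_def by blast
  from assms(2) obtain b' C' where C': "0 \<le> C'"
    and r': "\<And>J' i \<kappa>. J' \<le> J \<Longrightarrow> \<kappa> \<in> half_disc \<delta> \<Longrightarrow>
       norm (g i \<kappa> - (\<Sum>j<J'. scaleC (\<kappa> ^ j) (b' j i))) \<le> C' * Q i * (P i * norm \<kappa>) ^ J'"
    unfolding gexp_def by blast
  show ?thesis
  proof (rule gexpI[where b="\<lambda>j i. b j i + b' j i" and C="C + C'"])
    fix J' i \<kappa> assume *: "J' \<le> J" "\<kappa> \<in> half_disc \<delta>"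
    have "f i \<kappa> + g i \<kappa> - (\<Sum>j<J'. scaleC (\<kappa> ^ j) (b j i + b' j i))
      = (f i \<kappa> - (\<Sum>j<J'. scaleC (\<kappa> ^ j) (b j i))) + (g i \<kappa> - (\<Sum>j<J'. scaleC (\<kappa> ^ j) (b' j i)))"
      by (simp add: scaleC_add_right sum.distrib)
    then show "norm (f i \<kappa> + g i \<kappa> - (\<Sum>j<J'. scaleC (\<kappa> ^ j) (b j i + b' j i))) \<le> (C + C') * Q i * (P i * norm \<kappa>) ^ J'"
      using norm_triangle_mono[OF r[OF *, of i] r'[OF *, of i]] by (simp add: algebra_simps)
  qed (use C C' pos in auto)
qed

text \<open>Gains one order from f = f0 + \<kappa> h. A factor \<kappa> is paid for by a factor of
  the scale, hence the amplitude \<open>Q i * P i\<close> of \<open>h\<close>. The separate bound on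
  \<open>f\<close> supplies the remainder of order 0, which the expansion of \<open>h\<close> cannot
  control where \<open>P i * norm \<kappa>\<close> is large.\<close>

lemma gexp_shift:
  assumes h: "gexp \<delta> J (\<lambda>i. Q i * P i) P h"
    and f: "\<And>i \<kappa>. \<kappa> \<in> half_disc \<delta> \<Longrightarrow> f i \<kappa> = f0 i + scaleC \<kappa> (h i \<kappa>)"
    and bd: "\<And>i \<kappa>. \<kappa> \<in> half_disc \<delta> \<Longrightarrow> norm (f i \<kappa>) \<le> D * Q i"
    and "\<And>i. 0 \<le> Q i" "0 \<le> D"
  shows "gexp \<delta> (Suc J) Q P f"
proof -
  from h obtain b C where C: "0 \<le> C" and pos: "\<And>i. 0 \<le> P i"
    and r: "\<And>J' i \<kappa>. J' \<le> J \<Longrightarrow> \<kappa> \<in> half_disc \<delta> \<Longrightarrow>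
       norm (h i \<kappa> - (\<Sum>j<J'. scaleC (\<kappa> ^ j) (b j i))) \<le> C * (Q i * P i) * (P i * norm \<kappa>) ^ J'"
    unfolding gexp_def by blast
  show ?thesis
  proof (rule gexpI[where b="\<lambda>j i. if j = 0 then f0 i else b (j - 1) i" and C="C + D"])
    fix J' i \<kappa> assume *: "J' \<le> Suc J" "\<kappa> \<in> half_disc \<delta>"
    show "norm (f i \<kappa> - (\<Sum>j<J'. scaleC (\<kappa> ^ j) (if j = 0 then f0 i else b (j - 1) i)))
      \<le> (C + D) * Q i * (P i * norm \<kappa>) ^ J'"
    proof (cases J')
      case 0
      have "norm (f i \<kappa>) \<le> D * Q i" using bd *(2) .
      also have "\<dots> \<le> (C + D) * Q i" using C assms(4) by (intro mult_right_mono) auto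
      finally show ?thesis using 0 by simp
    next
      case (Suc K)
      have "f i \<kappa> - (\<Sum>j<J'. scaleC (\<kappa> ^ j) (if j = 0 then f0 i else b (j - 1) i))
        = scaleC \<kappa> (h i \<kappa> - (\<Sum>j<K. scaleC (\<kappa> ^ j) (b j i)))"
        unfolding Suc sum.lessThan_Suc_shift f[OF *(2)]
        by (simp add: scaleC_diff_right scaleC_sum_right scaleC_scaleC)
      then have "norm (f i \<kappa> - (\<Sum>j<J'. scaleC (\<kappa> ^ j) (if j = 0 then f0 i else b (j - 1) i)))
        = norm \<kappa> * norm (h i \<kappa> - (\<Sum>j<K. scaleC (\<kappa> ^ j) (b j i)))" by simp
      also have "\<dots> \<le> norm \<kappa> * (C * (Q i * P i) * (P i * norm \<kappa>) ^ K)"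
        using * Suc by (intro mult_left_mono r) auto
      also have "\<dots> = C * Q i * (P i * norm \<kappa>) ^ J'" using Suc by (simp add: mult_ac)
      also have "\<dots> \<le> (C + D) * Q i * (P i * norm \<kappa>) ^ J'"
        using assms(4,5) pos by (intro mult_right_mono) auto
      finally show ?thesis .
    qed
  qed (use assms C pos in auto)
qed

text \<open>The inverse operation of \<open>gexp_shift\<close>; it provides the difference quotient
  of an operator family at \<kappa> = 0. The last bound lets \<open>f0\<close> be recognised as a
  limit.\<close>

lemma gexp_unshift:
  assumes "gexp \<delta> (Suc J) Q P f" "0 < \<delta>"
  obtains f0 C where "gexp \<delta> J (\<lambda>i. Q i * P i) P (\<lambda>i \<kappa>. scaleC (1/\<kappa>) (f i \<kappa> - f0 i))" "0 \<le> C"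
    "\<And>i. norm (f0 i) \<le> C * Q i"
    "\<And>i \<kappa>. \<kappa> \<in> half_disc \<delta> \<Longrightarrow> norm (f i \<kappa> - f0 i) \<le> C * Q i * (P i * norm \<kappa>)"
proof -
  obtain b C where bC: "gexp_coeff \<delta> (Suc J) Q P f b C" using gexpE[OF assms] .
  note C = gexp_coeffD(1)[OF bC] and r = gexp_coeffD(2)[OF bC] and bb = gexp_coeffD(3)[OF bC]
  show ?thesis
  proof (rule that[of "b 0" C])
    show "0 \<le> C" by fact
    show "norm (b 0 i) \<le> C * Q i" for i using bb[of 0 i] by simp
    show "norm (f i \<kappa> - b 0 i) \<le> C * Q i * (P i * norm \<kappa>)" if "\<kappa> \<in> half_disc \<delta>" for i \<kappa>
      using r[of 1 \<kappa> i] that by simp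
    show "gexp \<delta> J (\<lambda>i. Q i * P i) P (\<lambda>i \<kappa>. scaleC (1 / \<kappa>) (f i \<kappa> - b 0 i))"
    proof (rule gexpI[where b="\<lambda>j. b (Suc j)" and C=C])
      fix J' i \<kappa> assume *: "J' \<le> J" "\<kappa> \<in> half_disc \<delta>"
      have nz: "\<kappa> \<noteq> 0" using * half_disc_nz by auto
      have "scaleC (1/\<kappa>) (f i \<kappa> - b 0 i) - (\<Sum>j<J'. scaleC (\<kappa> ^ j) (b (Suc j) i))
        = scaleC (1/\<kappa>) (f i \<kappa> - (\<Sum>j<Suc J'. scaleC (\<kappa> ^ j) (b j i)))"
        unfolding sum.lessThan_Suc_shift using nz
        by (simp add: scaleC_diff_right scaleC_add_right scaleC_sum_right scaleC_scaleC)
      also have "norm \<dots> \<le> norm (1/\<kappa>) * (C * Q i * (P i * norm \<kappa>) ^ Suc J')"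
        unfolding norm_scaleC using * by (intro mult_left_mono r) auto
      also have "\<dots> = C * (Q i * P i) * (P i * norm \<kappa>) ^ J'" using nz by (simp add: norm_divide field_simps)
      finally show "norm (scaleC (1/\<kappa>) (f i \<kappa> - b 0 i) - (\<Sum>j<J'. scaleC (\<kappa> ^ j) (b (Suc j) i)))
         \<le> C * (Q i * P i) * (P i * norm \<kappa>) ^ J'" .
    qed (use gexp_nonneg[OF assms(1)] C in auto)
  qed
qed

text \<open>A linear map that respects the size bounds of every admissible order acts coefficient by
  coefficient. The domain \<open>X\<close> is there because infinite sums and the adjoint
  \<open>v'\<close> are linear only where they make sense.\<close>

lemma gexp_functional:
  fixes f :: "'i \<times> 'x \<Rightarrow> complex \<Rightarrow> complex" and T :: "'i \<Rightarrow> ('x \<Rightarrow> complex) \<Rightarrow> 'h::chilbert_space"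
  assumes f: "gexp \<delta> J Q P f" and "0 < \<delta>"
    and X: "\<And>i J' A u. J' \<le> J \<Longrightarrow> 0 \<le> A \<Longrightarrow> (\<And>x. norm (u x) \<le> A * Q (i, x) * P (i, x) ^ J') \<Longrightarrow>
        u \<in> X i \<and> norm (T i u) \<le> A * Q' i * P' i ^ J'"
    and lin: "\<And>i u w c. u \<in> X i \<Longrightarrow> w \<in> X i \<Longrightarrow>
        (\<lambda>x. u x + c * w x) \<in> X i \<and> T i (\<lambda>x. u x + c * w x) = T i u + scaleC c (T i w)"
    and pos: "\<And>i. 0 \<le> Q' i" "\<And>i. 0 \<le> P' i"
  shows "gexp \<delta> J Q' P' (\<lambda>i \<kappa>. T i (\<lambda>x. f (i, x) \<kappa>))"
proof -
  obtain b C where bC: "gexp_coeff \<delta> J Q P f b C" using gexpE[OF f \<open>0 < \<delta>\<close>] .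
  note C = gexp_coeffD(1)[OF bC] and r = gexp_coeffD(2)[OF bC] and bb = gexp_coeffD(3)[OF bC]
  show ?thesis
  proof (rule gexpI[where b="\<lambda>j i. T i (\<lambda>x. b j (i, x))" and C=C])
    fix J' i \<kappa> assume *: "J' \<le> J" "\<kappa> \<in> half_disc \<delta>"
    have fX: "(\<lambda>x. f (i, x) \<kappa>) \<in> X i"
      using X[of 0 C "\<lambda>x. f (i, x) \<kappa>" i] r[of 0 \<kappa>] * C by simp
    have bX: "(\<lambda>x. b j (i, x)) \<in> X i" if "j < J" for j
      using X[of j C "\<lambda>x. b j (i, x)" i] bb[OF that] that C by simp
    \<comment> \<open>The coefficients are subtracted one at a time, since linearity is given for
      two members of \<open>X i\<close> only.\<close>
    have *: "J' \<le> J \<Longrightarrow> (\<lambda>x. f (i, x) \<kappa> - (\<Sum>j<J'. \<kappa> ^ j * b j (i, x))) \<in> X i \<and>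
      T i (\<lambda>x. f (i, x) \<kappa> - (\<Sum>j<J'. \<kappa> ^ j * b j (i, x)))
        = T i (\<lambda>x. f (i, x) \<kappa>) - (\<Sum>j<J'. scaleC (\<kappa> ^ j) (T i (\<lambda>x. b j (i, x))))" for J'
    proof (induction J')
      case 0 then show ?case using fX by simp
    next
      case (Suc J')
      have "scaleC (- (\<kappa> ^ J')) y = - scaleC (\<kappa> ^ J') y" for y :: 'h
        by (metis mult_minus1 scaleC_minus_one scaleC_scaleC)
      moreover have "(\<lambda>x. f (i, x) \<kappa> - (\<Sum>j<Suc J'. \<kappa> ^ j * b j (i, x)))
        = (\<lambda>x. (f (i, x) \<kappa> - (\<Sum>j<J'. \<kappa> ^ j * b j (i, x))) + (- (\<kappa> ^ J')) * b J' (i, x))"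
        by (simp add: fun_eq_iff)
      ultimately show ?case
        using Suc lin[OF _ bX[of J'], of "\<lambda>x. f (i, x) \<kappa> - (\<Sum>j<J'. \<kappa> ^ j * b j (i, x))" "- (\<kappa> ^ J')"]
        by simp
    qed
    have "norm (T i (\<lambda>x. f (i, x) \<kappa> - (\<Sum>j<J'. \<kappa> ^ j * b j (i, x)))) \<le> (C * norm \<kappa> ^ J') * Q' i * P' i ^ J'"
      using r[OF \<open>J' \<le> J\<close> \<open>\<kappa> \<in> _\<close>] C
      by (intro X[THEN conjunct2] \<open>J' \<le> J\<close>) (auto simp: power_mult_distrib mult_ac)
    then show "norm (T i (\<lambda>x. f (i, x) \<kappa>) - (\<Sum>j<J'. scaleC (\<kappa> ^ j) (T i (\<lambda>x. b j (i, x)))))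
       \<le> C * Q' i * (P' i * norm \<kappa>) ^ J'"
      using * \<open>J' \<le> J\<close> by (simp add: power_mult_distrib mult_ac)
  qed (use pos C in auto)
qed

text \<open>Approximating the vector first and the operator afterwards splits the remainder into
  pieces of total order exactly \<open>J\<close>: the l-th coefficient of the vector meets the
  operator remainder of order J - l. No higher order occurs, which matters when scale times
  \<open>norm \<kappa>\<close> exceeds 1.\<close>

lemma Cauchy_product_remainder:
  fixes N :: "'h::chilbert_space \<Rightarrow> 'h2::chilbert_space"
  assumes add: "\<And>x y. N (x + y) = N x + N y" and sc: "\<And>c x. N (scaleC c x) = scaleC c (N x)"
  shows "N x - (\<Sum>j<J. scaleC (\<kappa> ^ j) (\<Sum>l\<le>j. B (j - l) (e l)))
    = N (x - (\<Sum>l<J. scaleC (\<kappa> ^ l) (e l)))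
      + (\<Sum>l<J. scaleC (\<kappa> ^ l) (N (e l) - (\<Sum>j<J-l. scaleC (\<kappa> ^ j) (B j (e l)))))"
proof -
  have z: "N 0 = 0" using add[of 0 0] by simp
  have sm: "N (sum g A) = (\<Sum>i\<in>A. N (g i))" for g and A :: "nat set"
    by (induction A rule: infinite_finite_induct) (auto simp: z add)
  have df: "N (x - y) = N x - N y" for x y
    using add[of "x - y" y] by simp
  \<comment> \<open>Both sides run over the triangle of pairs of total order below
    \<open>J\<close>.\<close>
  have "(\<Sum>j<J. \<Sum>l\<le>j. scaleC (\<kappa> ^ j) (B (j - l) (e l)))
     = (\<Sum>l<J. \<Sum>j<J-l. scaleC (\<kappa> ^ (l + j)) (B j (e l)))"
  proof (induction J)
    case (Suc J)
    have "(\<Sum>l<Suc J. \<Sum>j<Suc J-l. scaleC (\<kappa> ^ (l + j)) (B j (e l)))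
      = (\<Sum>l<Suc J. (\<Sum>j<J-l. scaleC (\<kappa> ^ (l + j)) (B j (e l))) + scaleC (\<kappa> ^ J) (B (J - l) (e l)))"
      by (intro sum.cong) (auto simp: Suc_diff_le less_Suc_eq_le)
    moreover have "(\<Sum>l<Suc J. \<Sum>j<J-l. scaleC (\<kappa> ^ (l + j)) (B j (e l)))
      = (\<Sum>l<J. \<Sum>j<J-l. scaleC (\<kappa> ^ (l + j)) (B j (e l)))" by simp
    moreover have "(\<Sum>j<Suc J. \<Sum>l\<le>j. scaleC (\<kappa> ^ j) (B (j - l) (e l)))
      = (\<Sum>j<J. \<Sum>l\<le>j. scaleC (\<kappa> ^ j) (B (j - l) (e l))) + (\<Sum>l<Suc J. scaleC (\<kappa> ^ J) (B (J - l) (e l)))"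
      by (subst sum.lessThan_Suc) (simp only: lessThan_Suc_atMost)
    ultimately show ?case unfolding Suc by (simp only: sum.distrib)
  qed simp
  then show ?thesis
    by (simp add: df sm sc scaleC_diff_right scaleC_sum_right scaleC_scaleC sum_subtractf power_add)
qed

text \<open>Indexing the operator by pairs (i, k) with amplitude proportional to
  \<open>norm k\<close> expresses an expansion in operator norm. Each piece of
  \<open>Cauchy_product_remainder\<close> then has the size of a remainder of full order, and at
  most J + 1 pieces occur.\<close>

lemma gexp_apply:
  fixes N :: "'i \<Rightarrow> complex \<Rightarrow> 'h::chilbert_space \<Rightarrow> 'h2::chilbert_space"
  assumes N: "gexp \<delta> J (\<lambda>(i, k). Qn i * norm k) (\<lambda>(i, k). P i) (\<lambda>(i, k) \<kappa>. N i \<kappa> k)"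
    and add: "\<And>i \<kappa> x y. \<kappa> \<in> half_disc \<delta> \<Longrightarrow> N i \<kappa> (x + y) = N i \<kappa> x + N i \<kappa> y"
    and sc: "\<And>i \<kappa> c x. \<kappa> \<in> half_disc \<delta> \<Longrightarrow> N i \<kappa> (scaleC c x) = scaleC c (N i \<kappa> x)"
    and e: "gexp \<delta> J Qe P e" and "0 < \<delta>" and pos: "\<And>i. 0 \<le> Qn i"
  shows "gexp \<delta> J (\<lambda>i. Qn i * Qe i) P (\<lambda>i \<kappa>. N i \<kappa> (e i \<kappa>))"
proof -
  obtain b C where bC: "gexp_coeff \<delta> J Qe P e b C" using gexpE[OF e \<open>0 < \<delta>\<close>] .
  note C = gexp_coeffD(1)[OF bC] and r = gexp_coeffD(2)[OF bC] and bb = gexp_coeffD(3)[OF bC]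
  obtain B D where BD: "gexp_coeff \<delta> J (\<lambda>(i, k). Qn i * norm k) (\<lambda>(i, k). P i) (\<lambda>(i, k) \<kappa>. N i \<kappa> k) B D"
    using gexpE[OF N \<open>0 < \<delta>\<close>] .
  note D = gexp_coeffD(1)[OF BD] and R = gexp_coeffD(2)[OF BD]
  have R: "norm (N i \<kappa> k - (\<Sum>j<J'. scaleC (\<kappa> ^ j) (B j (i, k)))) \<le> D * (Qn i * norm k) * (P i * norm \<kappa>) ^ J'"
    if "J' \<le> J" "\<kappa> \<in> half_disc \<delta>" for J' i k \<kappa>
    using R[OF that, of "(i, k)"] by simp
  note pos' = gexp_nonneg[OF e]
  show ?thesis
  proof (rule gexpI[where b="\<lambda>j i. \<Sum>l\<le>j. B (j - l) (i, b l i)" and C="D * C * (J + 1)"])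
    fix J' i \<kappa> assume *: "J' \<le> J" "\<kappa> \<in> half_disc \<delta>"
    define t where "t = P i * norm \<kappa>"
    have t: "0 \<le> t" using pos' by (simp add: t_def)
    have 1: "norm (N i \<kappa> (e i \<kappa> - (\<Sum>l<J'. scaleC (\<kappa> ^ l) (b l i)))) \<le> D * C * (Qn i * Qe i) * t ^ J'"
    proof -
      have "norm (N i \<kappa> (e i \<kappa> - (\<Sum>l<J'. scaleC (\<kappa> ^ l) (b l i)))) \<le>
         D * (Qn i * norm (e i \<kappa> - (\<Sum>l<J'. scaleC (\<kappa> ^ l) (b l i))))"
        using R[of 0 \<kappa> i "e i \<kappa> - (\<Sum>l<J'. scaleC (\<kappa> ^ l) (b l i))"] * by simp
      also have "\<dots> \<le> D * (Qn i * (C * Qe i * (P i * norm \<kappa>) ^ J'))"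
        using D pos * by (intro mult_left_mono r) auto
      finally show ?thesis by (simp add: mult_ac t_def)
    qed
    have 2: "norm (scaleC (\<kappa> ^ l) (N i \<kappa> (b l i) - (\<Sum>j<J'-l. scaleC (\<kappa> ^ j) (B j (i, b l i)))))
       \<le> D * C * (Qn i * Qe i) * t ^ J'" if "l < J'" for l
    proof -
      have "norm (scaleC (\<kappa> ^ l) (N i \<kappa> (b l i) - (\<Sum>j<J'-l. scaleC (\<kappa> ^ j) (B j (i, b l i)))))
        \<le> norm \<kappa> ^ l * (D * (Qn i * norm (b l i)) * t ^ (J' - l))"
        unfolding norm_scaleC norm_power t_def using * that by (intro mult_left_mono R) auto
      also have "\<dots> \<le> norm \<kappa> ^ l * (D * (Qn i * (C * Qe i * P i ^ l)) * t ^ (J' - l))"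
        using D pos * that t by (intro mult_left_mono mult_right_mono bb) auto
      also have "\<dots> = D * C * (Qn i * Qe i) * (t ^ l * t ^ (J' - l))"
        by (simp add: t_def power_mult_distrib mult_ac)
      also have "t ^ l * t ^ (J' - l) = t ^ J'" using that by (simp flip: power_add)
      finally show ?thesis .
    qed
    have "norm (N i \<kappa> (e i \<kappa>) - (\<Sum>j<J'. scaleC (\<kappa> ^ j) (\<Sum>l\<le>j. B (j - l) (i, b l i))))
      \<le> D * C * (Qn i * Qe i) * t ^ J' + (\<Sum>l<J'. D * C * (Qn i * Qe i) * t ^ J')"
      unfolding Cauchy_product_remainder[of "N i \<kappa>" "e i \<kappa>" \<kappa> "\<lambda>j k. B j (i, k)" "\<lambda>l. b l i" J', OF add sc, OF *(2) *(2)]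
      using 1 2 by (intro norm_triangle_mono norm_sum[THEN order_trans] sum_mono) auto
    also have "\<dots> = D * C * (J' + 1) * (Qn i * Qe i) * t ^ J'" by (simp add: algebra_simps)
    also have "\<dots> \<le> D * C * (J + 1) * (Qn i * Qe i) * t ^ J'"
      using D C pos pos' t * by (intro mult_right_mono mult_left_mono) auto
    finally show "norm (N i \<kappa> (e i \<kappa>) - (\<Sum>j<J'. scaleC (\<kappa> ^ j) (\<Sum>l\<le>j. B (j - l) (i, b l i))))
      \<le> D * C * (J + 1) * (Qn i * Qe i) * (P i * norm \<kappa>) ^ J'" by (simp add: t_def add.commute)
  qed (use C D pos pos' in auto)
qed

lemma gexp_mult:
  fixes f g :: "'i \<Rightarrow> complex \<Rightarrow> complex"
  assumes f: "gexp \<delta> J Qf P f" and g: "gexp \<delta> J Qg P g" and "0 < \<delta>"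
  shows "gexp \<delta> J (\<lambda>i. Qf i * Qg i) P (\<lambda>i \<kappa>. f i \<kappa> * g i \<kappa>)"
proof (rule gexp_apply[OF _ _ _ g \<open>0 < \<delta>\<close>])
  from f obtain b C where C: "0 \<le> C" and pos: "\<And>i. 0 \<le> Qf i" "\<And>i. 0 \<le> P i"
    and r: "\<And>J' i \<kappa>. J' \<le> J \<Longrightarrow> \<kappa> \<in> half_disc \<delta> \<Longrightarrow>
       norm (f i \<kappa> - (\<Sum>j<J'. scaleC (\<kappa> ^ j) (b j i))) \<le> C * Qf i * (P i * norm \<kappa>) ^ J'"
    unfolding gexp_def by blast
  show "gexp \<delta> J (\<lambda>(i, k). Qf i * norm k) (\<lambda>(i, k). P i) (\<lambda>(i, k) \<kappa>. f i \<kappa> * k)"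
  proof (rule gexpI[where b="\<lambda>j (i, k). b j i * k" and C=C], goal_cases)
    case (4 J' ik \<kappa>)
    obtain i and k :: complex where ik: "ik = (i, k)" by (cases ik)
    have "f i \<kappa> * k - (\<Sum>j<J'. \<kappa> ^ j * (b j i * k)) = (f i \<kappa> - (\<Sum>j<J'. \<kappa> ^ j * b j i)) * k"
      by (simp add: left_diff_distrib sum_distrib_right mult.assoc)
    then show ?case using mult_right_mono[OF r[OF 4, of i], of "norm k"]
      by (simp add: ik norm_mult mult_ac)
  qed (use C pos in \<open>auto simp: split_def\<close>)
qed (use f in \<open>auto simp: algebra_simps gexp_def\<close>)

lemma gexp_bigsum:
  fixes f :: "'i \<times> 'x \<Rightarrow> complex \<Rightarrow> complex"
  assumes f: "gexp \<delta> J Q P f" and "0 < \<delta>"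
    and b: "\<And>i J'. J' \<le> J \<Longrightarrow> (\<Sum>x\<in>A i. Q (i, x) * P (i, x) ^ J') \<le> Q' i * P' i ^ J'"
    and pos: "\<And>i. 0 \<le> Q' i" "\<And>i. 0 \<le> P' i"
  shows "gexp \<delta> J Q' P' (\<lambda>i \<kappa>. \<Sum>x\<in>A i. f (i, x) \<kappa>)"
proof (rule gexp_functional[OF f \<open>0 < \<delta>\<close>, where X="\<lambda>_. UNIV" and T="\<lambda>i u. \<Sum>x\<in>A i. u x"])
  fix i J' a and u :: "'x \<Rightarrow> complex"
  assume *: "J' \<le> J" "0 \<le> a" and u: "\<And>x. norm (u x) \<le> a * Q (i, x) * P (i, x) ^ J'"
  have "norm (sum u (A i)) \<le> (\<Sum>x\<in>A i. a * (Q (i, x) * P (i, x) ^ J'))"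
    using u by (intro sum_norm_le) (simp add: mult.assoc)
  also have "\<dots> \<le> a * (Q' i * P' i ^ J')" unfolding sum_distrib_left[symmetric]
    using * b by (intro mult_left_mono) auto
  finally show "u \<in> UNIV \<and> norm (sum u (A i)) \<le> a * Q' i * P' i ^ J'" by (simp add: mult.assoc)
qed (use pos in \<open>auto simp: sum.distrib sum_distrib_left\<close>)

text \<open>The decay of \<open>g\<close> must absorb the growth of the coefficients at every order
  up to \<open>J\<close>; this is where weights are turned into orders of expansion.\<close>

lemma gexp_infsum:
  fixes f :: "'i \<times> 'x \<Rightarrow> complex \<Rightarrow> complex"
  assumes f: "gexp \<delta> J Q P f" and "0 < \<delta>"
    and s: "\<And>i J'. J' \<le> J \<Longrightarrow> (\<lambda>x. Q (i, x) * P (i, x) ^ J' * norm (g i x)) summable_on UNIV"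
    and b: "\<And>i J'. J' \<le> J \<Longrightarrow> (\<Sum>\<^sub>\<infinity>x. Q (i, x) * P (i, x) ^ J' * norm (g i x)) \<le> Q' i * P' i ^ J'"
    and pos: "\<And>i. 0 \<le> Q' i" "\<And>i. 0 \<le> P' i"
  shows "gexp \<delta> J Q' P' (\<lambda>i \<kappa>. \<Sum>\<^sub>\<infinity>x. f (i, x) \<kappa> * g i x)"
proof (rule gexp_functional[OF f \<open>0 < \<delta>\<close>,
    where X="\<lambda>i. {u. (\<lambda>x. u x * g i x) summable_on UNIV}" and T="\<lambda>i u. \<Sum>\<^sub>\<infinity>x. u x * g i x"])
  fix i J' a and u :: "'x \<Rightarrow> complex"
  assume *: "J' \<le> J" "0 \<le> a" and u: "\<And>x. norm (u x) \<le> a * Q (i, x) * P (i, x) ^ J'"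
  have s': "(\<lambda>x. a * (Q (i, x) * P (i, x) ^ J' * norm (g i x))) summable_on UNIV"
    using s[OF *(1)] by (rule summable_on_cmult_right)
  have le: "norm (u x * g i x) \<le> a * (Q (i, x) * P (i, x) ^ J' * norm (g i x))" for x
    using mult_right_mono[OF u[of x], of "norm (g i x)"] by (simp add: norm_mult mult_ac)
  have as: "(\<lambda>x. norm (u x * g i x)) summable_on UNIV"
    by (rule Infinite_Sum.abs_summable_on_comparison_test'[OF s' le])
  have "norm (\<Sum>\<^sub>\<infinity>x. u x * g i x) \<le> (\<Sum>\<^sub>\<infinity>x. a * (Q (i, x) * P (i, x) ^ J' * norm (g i x)))"
    by (rule order_trans[OF norm_infsum_bound[OF as] infsum_mono[OF as s' le]])
  also have "\<dots> = a * (\<Sum>\<^sub>\<infinity>x. (Q (i, x) * P (i, x) ^ J' * norm (g i x)))"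
    by (rule infsum_cmult_right')
  also have "\<dots> \<le> a * (Q' i * P' i ^ J')" using * b by (intro mult_left_mono) auto
  finally show "u \<in> {u. (\<lambda>x. u x * g i x) summable_on UNIV} \<and> norm (\<Sum>\<^sub>\<infinity>x. u x * g i x) \<le> a * Q' i * P' i ^ J'"
    using abs_summable_summable[OF as] by (simp add: mult.assoc)
next
  fix i and u w :: "'x \<Rightarrow> complex" and c
  assume "u \<in> {u. (\<lambda>x. u x * g i x) summable_on UNIV}" "w \<in> {u. (\<lambda>x. u x * g i x) summable_on UNIV}"
  then have 1: "(\<lambda>x. u x * g i x) summable_on UNIV" and 2: "(\<lambda>x. c * (w x * g i x)) summable_on UNIV"
    by (auto intro: summable_on_cmult_right)
  have eq: "(u x + c * w x) * g i x = u x * g i x + c * (w x * g i x)" for x by (simp add: algebra_simps)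
  show "(\<lambda>x. u x + c * w x) \<in> {u. (\<lambda>x. u x * g i x) summable_on UNIV} \<and>
    (\<Sum>\<^sub>\<infinity>x. (u x + c * w x) * g i x) = (\<Sum>\<^sub>\<infinity>x. u x * g i x) + scaleC c (\<Sum>\<^sub>\<infinity>x. w x * g i x)"
    using summable_on_add[OF 1 2] infsum_add[OF 1 2] by (auto simp: eq infsum_cmult_right')
qed (use pos in auto)

section \<open>The decaying solution on a half-line\<close>

text \<open>The root \<open>s\<close> of \<open>s\<^sup>2 + \<kappa> s = 1\<close> inside the unit disc; \<open>s\<^sup>2\<close> is the decay factor of the
  solutions of \<open>2 u n - u (n + 1) - u (n - 1) + \<kappa>\<^sup>2 u n = 0\<close>.\<close>

lemma decay_root_exists:
  assumes "0 < Re \<kappa>"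
  shows "\<exists>s. s\<^sup>2 + \<kappa> * s = 1 \<and> norm s < 1 \<and> 0 < Re s"
proof -
  \<comment> \<open>One root by the quadratic formula; the roots have product -1, so the other one
    is \<open>- 1 / s1\<close>.\<close>
  define s1 where "s1 = - \<kappa>/2 + csqrt (1 + (\<kappa>/2)\<^sup>2)"
  have e1: "s1\<^sup>2 + \<kappa> * s1 = 1"
  proof -
    have "s1\<^sup>2 + \<kappa> * s1 = (csqrt (1 + (\<kappa>/2)\<^sup>2))\<^sup>2 - (\<kappa>/2)\<^sup>2"
      unfolding s1_def by (simp add: power2_eq_square field_simps)
    then show ?thesis by simp
  qed
  \<comment> \<open>Real parts in s + \<kappa> = 1 / s give Re \<kappa> = Re s (1 / |s|^2 - 1). So
    the sign of Re s decides between inside and outside of the unit circle, and the circle itself is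
    excluded.\<close>
  have key: "0 < Re s \<and> norm s < 1 \<or> Re s < 0 \<and> 1 < norm s" if e: "s\<^sup>2 + \<kappa> * s = 1" for s
  proof -
    have nz: "s \<noteq> 0" using e by auto
    have "s + \<kappa> = 1 / s" using e nz by (simp add: field_simps power2_eq_square)
    then have "Re s + Re \<kappa> = Re (1 / s)" by (metis plus_complex.simps(1))
    also have "\<dots> = Re s / (norm s)\<^sup>2" by (simp add: Re_divide cmod_power2)
    finally have eq: "Re \<kappa> = Re s * (1 / (norm s)\<^sup>2 - 1)" by (simp add: algebra_simps)
    then have "0 < Re s * (1 / (norm s)\<^sup>2 - 1)" using assms by simp
    then have "0 < Re s \<and> 0 < 1 / (norm s)\<^sup>2 - 1 \<or> Re s < 0 \<and> 1 / (norm s)\<^sup>2 - 1 < 0"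
      by (simp add: zero_less_mult_iff)
    moreover have "norm s \<noteq> - 1" using norm_ge_zero[of s] by linarith
    then have "0 < 1 / (norm s)\<^sup>2 - 1 \<longleftrightarrow> norm s < 1" "1 / (norm s)\<^sup>2 - 1 < 0 \<longleftrightarrow> 1 < norm s"
      using nz abs_square_le_1[of "norm s"] by (auto simp: field_simps abs_square_less_1 not_le[symmetric] power2_eq_1_iff)
    ultimately show ?thesis by blast
  qed
  show ?thesis
  proof (cases "norm s1 < 1")
    case True then show ?thesis using key[OF e1] e1 by (intro exI[of _ s1]) auto
  next
    case False
    have nz: "s1 \<noteq> 0" using e1 by auto
    have "\<kappa> = 1 / s1 - s1" using e1 nz by (simp add: field_simps power2_eq_square)
    then have e2: "(- 1 / s1)\<^sup>2 + \<kappa> * (- 1 / s1) = 1" using nz by (simp add: field_simps power2_eq_square)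
    have "norm (- 1 / s1) \<le> 1" using False nz by (simp add: norm_divide)
    then show ?thesis using key[OF e2] e2 by (intro exI[of _ "- 1 / s1"]) auto
  qed
qed

definition decay_root :: "complex \<Rightarrow> complex" where
  "decay_root \<kappa> = (SOME s. s\<^sup>2 + \<kappa> * s = 1 \<and> norm s < 1 \<and> 0 < Re s)"

lemma decay_root:
  assumes "0 < Re \<kappa>"
  shows "(decay_root \<kappa>)\<^sup>2 + \<kappa> * decay_root \<kappa> = 1" "norm (decay_root \<kappa>) < 1" "0 < Re (decay_root \<kappa>)"
  using someI_ex[OF decay_root_exists[OF assms]] unfolding decay_root_def[symmetric] by blast+

text \<open>The two roots have product -1, so they cannot both have modulus below 1.\<close>

lemma decay_root_unique:
  assumes "0 < Re \<kappa>" "s\<^sup>2 + \<kappa> * s = 1" "norm s < 1"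
  shows "s = decay_root \<kappa>"
proof (rule ccontr)
  assume ne: "s \<noteq> decay_root \<kappa>"
  note d = decay_root[OF assms(1)]
  have "(s - decay_root \<kappa>) * (s + decay_root \<kappa> + \<kappa>) = 0"
    using assms(2) d(1) by (simp add: algebra_simps power2_eq_square)
  then have "s + (decay_root \<kappa> + \<kappa>) = 0" using ne by (simp add: add.assoc)
  then have "s = - (decay_root \<kappa> + \<kappa>)" by (rule eq_neg_iff_add_eq_0[THEN iffD2])
  then have "s * decay_root \<kappa> = - ((decay_root \<kappa>)\<^sup>2 + \<kappa> * decay_root \<kappa>)"
    by (simp only:) (simp add: algebra_simps power2_eq_square)
  then have "s * decay_root \<kappa> = - 1" using d(1) by simp
  then have "norm s * norm (decay_root \<kappa>) = 1" by (metis norm_minus_cancel norm_mult norm_one)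
  then show False using assms(3) d(2) by (metis less_irrefl mult_strict_mono' norm_ge_zero mult_1)
qed

lemma decay_root_cnj:
  assumes "0 < Re \<kappa>"
  shows "decay_root (cnj \<kappa>) = cnj (decay_root \<kappa>)"
proof (rule decay_root_unique[symmetric])
  show "(cnj (decay_root \<kappa>))\<^sup>2 + cnj \<kappa> * cnj (decay_root \<kappa>) = 1"
    using arg_cong[OF decay_root(1)[OF assms], of cnj] by simp
qed (use decay_root[OF assms] assms in auto)

text \<open>By (1 - s)(1 + s) = \<kappa> s, the root s and y = 1 / (1 + s) satisfy s = 1 - \<kappa>
  s y and y = 1/2 + \<kappa> s y^2 / 2. The right sides need one order less, so both expansions grow
  together; Re s > 0 gives the uniform bounds.\<close>

lemma gexp_decay_root:
  assumes "0 < \<delta>"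
  shows "gexp \<delta> J (\<lambda>_::unit. 1) (\<lambda>_. 1) (\<lambda>_. decay_root) \<and>
    gexp \<delta> J (\<lambda>_::unit. 1) (\<lambda>_. 1) (\<lambda>_ \<kappa>. 1 / (1 + decay_root \<kappa>))"
proof (induction J)
  have b: "norm (decay_root \<kappa>) \<le> 1 \<and> norm (1 / (1 + decay_root \<kappa>)) \<le> 1" if "\<kappa> \<in> half_disc \<delta>" for \<kappa>
  proof -
    have "0 < Re \<kappa>" using that by (simp add: half_disc_def)
    note d = decay_root[OF this]
    have "1 \<le> Re (1 + decay_root \<kappa>)" using d by simp
    also have "\<dots> \<le> norm (1 + decay_root \<kappa>)" by (rule complex_Re_le_cmod)
    finally show ?thesis using d by (auto simp: norm_divide divide_le_eq_1)
  qed
  case 0 show ?case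
    by (intro conjI gexpI[where b="\<lambda>_ _. 0" and C=1]) (use b in auto)
  case (Suc J)
  define y where "y \<kappa> = 1 / (1 + decay_root \<kappa>)" for \<kappa>
  have s1: "decay_root \<kappa> = 1 + \<kappa> * (- 1 * (decay_root \<kappa> * y \<kappa>))"
    and y1: "y \<kappa> = 1/2 + \<kappa> * ((1/2) * (decay_root \<kappa> * (y \<kappa> * y \<kappa>)))" if "\<kappa> \<in> half_disc \<delta>" for \<kappa>
  proof -
    have "0 < Re \<kappa>" using that by (simp add: half_disc_def)
    note d = decay_root[OF this]
    have nz: "1 + decay_root \<kappa> \<noteq> 0" using d by (metis add_pos_pos less_irrefl one_complex.sel(1) plus_complex.simps(1) zero_complex.sel(1) zero_less_one)
    have "(1 - decay_root \<kappa>) * (1 + decay_root \<kappa>) = \<kappa> * decay_root \<kappa>"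
      using d(1) by (simp add: algebra_simps power2_eq_square)
    then have *: "1 - decay_root \<kappa> = \<kappa> * decay_root \<kappa> * y \<kappa>"
      unfolding y_def using nz by (simp add: field_simps)
    then show s: "decay_root \<kappa> = 1 + \<kappa> * (- 1 * (decay_root \<kappa> * y \<kappa>))" by (simp add: algebra_simps)
    have "y \<kappa> * (1 + decay_root \<kappa>) = 1" using nz by (simp add: y_def)
    then have "y \<kappa> = 1/2 + (1 - decay_root \<kappa>) * y \<kappa> / 2" by (simp add: algebra_simps) (simp add: field_simps)
    then show "y \<kappa> = 1/2 + \<kappa> * ((1/2) * (decay_root \<kappa> * (y \<kappa> * y \<kappa>)))"
      unfolding * by (simp add: algebra_simps)
  qed
  note IH = Suc[folded y_def]
  have c: "gexp \<delta> J (\<lambda>_::unit. 1) (\<lambda>_. 1) (\<lambda>_ \<kappa>. c)" for c :: complex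
    by (rule gexp_const[where c="norm c"]) auto
  note m = gexp_mult[OF _ _ assms, where Qf="\<lambda>_::unit. 1" and Qg="\<lambda>_::unit. 1" and P="\<lambda>_. 1", unfolded mult_1]
  have 1: "gexp \<delta> J (\<lambda>_::unit. 1 * 1) (\<lambda>_. 1) (\<lambda>_ \<kappa>. - 1 * (decay_root \<kappa> * y \<kappa>))"
    unfolding mult_1 using IH by (intro m c) auto
  have 2: "gexp \<delta> J (\<lambda>_::unit. 1 * 1) (\<lambda>_. 1) (\<lambda>_ \<kappa>. (1/2) * (decay_root \<kappa> * (y \<kappa> * y \<kappa>)))"
    unfolding mult_1 using IH by (intro m c) auto
  show ?case unfolding y_def[symmetric]
    using gexp_shift[OF 1, of "\<lambda>_. decay_root" "\<lambda>_. 1" 1] gexp_shift[OF 2, of "\<lambda>_. y" "\<lambda>_. 1/2" 1] s1 y1 b[folded y_def]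
    by auto
qed

text \<open>Writing s - 1 = \<kappa> y, the power satisfies s^l - 1 = \<kappa> y (1 + s + ... +
  s^(l-1)). These l summands have scale at most l + 1, so each order costs one factor l + 1.\<close>

lemma gexp_decay_root_power:
  assumes "0 < \<delta>"
  shows "gexp \<delta> J (\<lambda>_::nat. 1) (\<lambda>l. real l + 1) (\<lambda>l \<kappa>. decay_root \<kappa> ^ l)"
proof (induction J)
  have b: "norm (decay_root \<kappa> ^ l) \<le> 1" if "\<kappa> \<in> half_disc \<delta>" for \<kappa> l
    using decay_root(2)[of \<kappa>] that unfolding norm_power half_disc_def by (intro power_le_one) auto
  case 0 show ?case by (intro gexpI[where b="\<lambda>_ _. 0" and C=1]) (use b in auto)
  case (Suc J)
  define y where "y \<kappa> = - 1 * (decay_root \<kappa> * (1 / (1 + decay_root \<kappa>)))" for \<kappa>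
  have y: "gexp \<delta> J (\<lambda>_::nat. 1) (\<lambda>_. 1) (\<lambda>_. y)"
  proof -
    have c: "gexp \<delta> J (\<lambda>_::unit. 1) (\<lambda>_. 1) (\<lambda>_ \<kappa>. -1::complex)"
      by (rule gexp_const[where c=1]) auto
    have "gexp \<delta> J (\<lambda>_::unit. 1 * (1 * 1)) (\<lambda>_. 1) (\<lambda>_. y)"
      unfolding y_def[abs_def] using gexp_decay_root[OF assms, of J] by (intro gexp_mult c assms) auto
    from gexp_reindex[OF this] show ?thesis by simp
  qed
  have "gexp \<delta> J (\<lambda>l. real l) (\<lambda>l. real l + 1) (\<lambda>l \<kappa>. \<Sum>k<l. decay_root \<kappa> ^ k)"
  proof (rule gexp_bigsum[where f="\<lambda>(l, k) \<kappa>. decay_root \<kappa> ^ k" and Q="\<lambda>_. 1" and P="\<lambda>(l, k). real k + 1"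
      and A="\<lambda>l. {..<l}", simplified])
    show "gexp \<delta> J (\<lambda>_. 1) (\<lambda>(l::nat, k). real k + 1) (\<lambda>(l, k) \<kappa>. decay_root \<kappa> ^ k)"
      using gexp_reindex[OF Suc, where g=snd] by (simp add: split_def)
    show "(\<Sum>x<i. (real x + 1) ^ J') \<le> real i * (real i + 1) ^ J'" for i J'
    proof -
      have "(\<Sum>x<i. (real x + 1) ^ J') \<le> of_nat (card {..<i}) * (real i + 1) ^ J'"
        by (intro sum_bounded_above power_mono) auto
      then show ?thesis by simp
    qed
  qed (use assms in auto)
  note S = this
  have "gexp \<delta> J (\<lambda>_::nat. 1) (\<lambda>l. real l + 1) (\<lambda>_. y)"
    by (rule gexp_mono[OF y, where c=1 and d=1]) auto
  from gexp_mult[OF this S assms]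
  have 1: "gexp \<delta> J (\<lambda>l. 1 * real l) (\<lambda>l. real l + 1) (\<lambda>l \<kappa>. y \<kappa> * (\<Sum>k<l. decay_root \<kappa> ^ k))" by simp
  have 2: "gexp \<delta> J (\<lambda>l. 1 * (real l + 1)) (\<lambda>l. real l + 1) (\<lambda>l \<kappa>. y \<kappa> * (\<Sum>k<l. decay_root \<kappa> ^ k))"
    by (rule gexp_mono[OF 1, where c=1 and d=1]) auto
  show ?case
  proof (rule gexp_shift[OF 2, where ?f0.0="\<lambda>_. 1" and D=1])
    fix l \<kappa> assume k: "\<kappa> \<in> half_disc \<delta>"
    then have "0 < Re \<kappa>" by (simp add: half_disc_def)
    note d = decay_root[OF this]
    have nz: "1 + decay_root \<kappa> \<noteq> 0" using d by (metis add_pos_pos less_irrefl one_complex.sel(1) plus_complex.simps(1) zero_complex.sel(1) zero_less_one)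
    have "(decay_root \<kappa> - 1) * (1 + decay_root \<kappa>) = - \<kappa> * decay_root \<kappa>"
      using d(1) by (simp add: algebra_simps power2_eq_square)
    then have "decay_root \<kappa> - 1 = \<kappa> * y \<kappa>" unfolding y_def using nz by (simp add: field_simps)
    moreover have "decay_root \<kappa> ^ l - 1 = (decay_root \<kappa> - 1) * (\<Sum>k<l. decay_root \<kappa> ^ k)"
      by (rule power_diff_1_eq)
    ultimately show "decay_root \<kappa> ^ l = 1 + scaleC \<kappa> (y \<kappa> * (\<Sum>k<l. decay_root \<kappa> ^ k))"
      by (simp add: algebra_simps)
  qed (use b in auto)
qed

text \<open>Subtracting the value at 0 leaves a numerator divisible by \<kappa> over the same
  denominator, so the induction runs over all numerators at once.\<close>

lemma gexp_rational:
  fixes p q :: "complex poly"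
  assumes "0 < \<delta>" "0 < c" and q: "\<And>\<kappa>. \<kappa> \<in> half_disc \<delta> \<Longrightarrow> c \<le> norm (poly q \<kappa>)" and q0: "poly q 0 \<noteq> 0"
  shows "gexp \<delta> J (\<lambda>_::unit. 1) (\<lambda>_. 1) (\<lambda>_ \<kappa>. poly p \<kappa> / poly q \<kappa>)"
proof (induction J arbitrary: p)
  have b: "\<exists>D\<ge>0. \<forall>\<kappa>\<in>half_disc \<delta>. norm (poly p \<kappa> / poly q \<kappa>) \<le> D" for p
  proof -
    have "compact (poly p ` cball 0 \<delta>)" by (intro compact_continuous_image continuous_intros) auto
    then obtain B where B: "B > 0" "\<And>z. z \<in> cball 0 \<delta> \<Longrightarrow> norm (poly p z) \<le> B"
      by (metis bounded_pos compact_imp_bounded image_eqI)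
    have "norm (poly p \<kappa> / poly q \<kappa>) \<le> B / c" if "\<kappa> \<in> half_disc \<delta>" for \<kappa>
      unfolding norm_divide using q[OF that] B(1) assms that
      by (intro frac_le B(2)) (auto simp: half_disc_def)
    then show ?thesis using B assms by (intro exI[of _ "B / c"]) auto
  qed
  case 0
  from b obtain D where "D \<ge> 0" "\<And>\<kappa>. \<kappa> \<in> half_disc \<delta> \<Longrightarrow> norm (poly p \<kappa> / poly q \<kappa>) \<le> D" by blast
  then show ?case by (intro gexpI[where b="\<lambda>_ _. 0" and C=D]) auto
  case (Suc J)
  define a where "a = poly p 0 / poly q 0"
  have "poly (p - smult a q) 0 = 0" using q0 by (simp add: a_def)
  then obtain r where r: "p - smult a q = [:0, 1:] * r"
    by (metis dvdE poly_eq_0_iff_dvd minus_zero)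
  have e: "poly p \<kappa> = a * poly q \<kappa> + \<kappa> * poly r \<kappa>" for \<kappa>
    using arg_cong[OF r, of "\<lambda>s. poly s \<kappa>"] by (simp add: algebra_simps)
  from b obtain D where D: "D \<ge> 0" "\<And>\<kappa>. \<kappa> \<in> half_disc \<delta> \<Longrightarrow> norm (poly p \<kappa> / poly q \<kappa>) \<le> D" by blast
  have 1: "gexp \<delta> J (\<lambda>_::unit. 1 * 1) (\<lambda>_. 1) (\<lambda>_ \<kappa>. poly r \<kappa> / poly q \<kappa>)" using Suc by simp
  show ?case
  proof (rule gexp_shift[OF 1, where ?f0.0="\<lambda>_. a" and D=D])
    fix \<kappa> assume "\<kappa> \<in> half_disc \<delta>"
    from q[OF this] have "poly q \<kappa> \<noteq> 0" using \<open>0 < c\<close> by auto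
    then show "poly p \<kappa> / poly q \<kappa> = a + scaleC \<kappa> (poly r \<kappa> / poly q \<kappa>)"
      unfolding e by (simp add: field_simps)
  qed (use D in auto)
qed

section \<open>Matrices with an expansion\<close>

text \<open>Fraction-free elimination: it will be applied to polynomial entries, where a pivot may
  be multiplied by but not divided by. The reduced system consists of 2 by 2 minors.\<close>

lemma homogeneous_system_nontrivial:
  fixes M :: "'i \<Rightarrow> 'j \<Rightarrow> 'a::idom"
  assumes "finite I" "finite J" "card I < card J"
  shows "\<exists>v. (\<exists>j\<in>J. v j \<noteq> 0) \<and> (\<forall>i\<in>I. (\<Sum>j\<in>J. M i j * v j) = 0)"
  using assms
proof (induction I arbitrary: J M rule: finite_induct)
  case empty
  then obtain j where "j \<in> J" by fastforce
  then show ?case by (intro exI[of _ "\<lambda>_. 1"]) auto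
next
  case (insert i I)
  show ?case
  proof (cases "\<forall>j\<in>J. M i j = 0")
    case True
    have "card I < card J" using insert by simp
    from insert.IH[OF insert.prems(1) this, of M] True show ?thesis by auto
  next
    case False
    then obtain j0 where j0: "j0 \<in> J" "M i j0 \<noteq> 0" by blast
    define J' where "J' = J - {j0}"
    have J': "finite J'" "card I < card J'"
      using insert.prems insert.hyps j0 by (auto simp: J'_def)
    obtain v where v: "\<exists>j\<in>J'. v j \<noteq> 0"
      and sol: "\<And>k. k \<in> I \<Longrightarrow> (\<Sum>j\<in>J'. (M i j0 * M k j - M k j0 * M i j) * v j) = 0"
      using insert.IH[OF J', of "\<lambda>k j. M i j0 * M k j - M k j0 * M i j"] by blast
    define s where "s k = (\<Sum>j\<in>J'. M k j * v j)" for k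
    \<comment> \<open>The pivot unknown makes row i vanish; all other unknowns are multiplied by the
      pivot.\<close>
    define w where "w j = (if j = j0 then - s i else M i j0 * v j)" for j
    have row: "(\<Sum>j\<in>J. M k j * w j) = M i j0 * s k - M k j0 * s i" for k
    proof -
      have "(\<Sum>j\<in>J. M k j * w j) = M k j0 * w j0 + (\<Sum>j\<in>J'. M k j * w j)"
        unfolding J'_def by (rule sum.remove[OF insert.prems(1) j0(1)])
      also have "(\<Sum>j\<in>J'. M k j * w j) = (\<Sum>j\<in>J'. M i j0 * (M k j * v j))"
        by (rule sum.cong) (auto simp: w_def J'_def mult_ac)
      also have "\<dots> = M i j0 * s k" unfolding s_def by (rule sum_distrib_left[symmetric])
      finally show ?thesis by (simp add: w_def)
    qed
    have "M i j0 * s k - M k j0 * s i = 0" if "k \<in> I" for k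
    proof -
      have "M i j0 * s k - M k j0 * s i = (\<Sum>j\<in>J'. (M i j0 * M k j - M k j0 * M i j) * v j)"
        unfolding s_def sum_distrib_left sum_subtractf[symmetric] by (rule sum.cong) (auto simp: algebra_simps)
      then show ?thesis by (simp add: sol[OF that])
    qed
    then have "\<forall>k\<in>insert i I. (\<Sum>j\<in>J. M k j * w j) = 0" unfolding row by simp
    moreover have "\<exists>j\<in>J. w j \<noteq> 0" using v j0 by (auto simp: w_def J'_def)
    ultimately show ?thesis by (intro exI[of _ w]) simp
  qed
qed

text \<open>A stand-in for adjugate and determinant. Solving T v = c e_j is a homogeneous system
  with the extra unknown c, and injectivity makes c nonzero. Multiplying each column by the
  constants of the others makes \<open>\<Delta>\<close> common to all.\<close>

lemma injective_matrix_scaled_inverse: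
  fixes T :: "'x \<Rightarrow> 'x \<Rightarrow> 'a::idom"
  assumes F: "finite F" and inj: "\<And>v. (\<And>i. i \<in> F \<Longrightarrow> (\<Sum>l\<in>F. T i l * v l) = 0) \<Longrightarrow> \<forall>i\<in>F. v i = 0"
  obtains A \<Delta> where "\<Delta> \<noteq> 0"
    "\<And>i j. i \<in> F \<Longrightarrow> j \<in> F \<Longrightarrow> (\<Sum>l\<in>F. T i l * A l j) = (if i = j then \<Delta> else 0)"
    "\<And>i j. i \<in> F \<Longrightarrow> j \<in> F \<Longrightarrow> (\<Sum>l\<in>F. A i l * T l j) = (if i = j then \<Delta> else 0)"
proof -
  have "\<exists>v c. c \<noteq> 0 \<and> (\<forall>i\<in>F. (\<Sum>l\<in>F. T i l * v l) = (if i = j then c else 0))" if j: "j \<in> F" for j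
  proof -
    \<comment> \<open>The extra column \<open>None\<close> carries minus the j-th unit vector, so
      its unknown becomes the right-hand side.\<close>
    define M where "M i l = (case l of None \<Rightarrow> - (if i = j then 1 else 0) | Some l \<Rightarrow> T i l)" for i l
    define J where "J = insert None (Some ` F)"
    have J: "finite J" "card F < card J" using F by (auto simp: J_def card_insert_if card_image)
    obtain w where w: "\<exists>l\<in>J. w l \<noteq> 0" and sol: "\<And>i. i \<in> F \<Longrightarrow> (\<Sum>l\<in>J. M i l * w l) = 0"
      using homogeneous_system_nontrivial[OF F J, of M] by blast
    define v where "v l = w (Some l)" for l
    have eq: "(\<Sum>l\<in>F. T i l * v l) = (if i = j then w None else 0)" if i: "i \<in> F" for i
    proof -
      have "(\<Sum>l\<in>J. M i l * w l) = M i None * w None + (\<Sum>l\<in>Some ` F. M i l * w l)"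
        unfolding J_def using F by (intro sum.insert) auto
      also have "(\<Sum>l\<in>Some ` F. M i l * w l) = (\<Sum>l\<in>F. T i l * v l)"
        by (subst sum.reindex) (auto simp: M_def v_def)
      finally have "- (if i = j then 1 else 0) * w None + (\<Sum>l\<in>F. T i l * v l) = 0" using sol[OF i] by (simp add: M_def)
      then show ?thesis by (auto split: if_splits)
    qed
    have "w None \<noteq> 0"
    proof
      assume 0: "w None = 0"
      have "\<forall>l\<in>F. v l = 0" by (rule inj) (simp add: eq 0)
      then show False using w 0 by (auto simp: J_def v_def)
    qed
    then show ?thesis using eq by blast
  qed
  then obtain v c where vc: "\<And>j. j \<in> F \<Longrightarrow> c j \<noteq> 0 \<and> (\<forall>i\<in>F. (\<Sum>l\<in>F. T i l * v j l) = (if i = j then c j else 0))"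
    by metis
  define \<Delta> where "\<Delta> = (\<Prod>j\<in>F. c j)"
  define A where "A l j = v j l * (\<Prod>j'\<in>F - {j}. c j')" for l j
  have 1: "(\<Sum>l\<in>F. T i l * A l j) = (if i = j then \<Delta> else 0)" if ij: "i \<in> F" "j \<in> F" for i j
  proof -
    have "(\<Sum>l\<in>F. T i l * A l j) = (\<Sum>l\<in>F. T i l * v j l) * (\<Prod>j'\<in>F - {j}. c j')"
      unfolding A_def sum_distrib_right by (rule sum.cong) (auto simp: mult.assoc)
    also have "(\<Sum>l\<in>F. T i l * v j l) = (if i = j then c j else 0)" using vc[OF ij(2)] ij(1) by blast
    finally show ?thesis unfolding \<Delta>_def by (simp add: prod.remove[OF F ij(2)])
  qed
  have 2: "(\<Sum>l\<in>F. A i l * T l j) = (if i = j then \<Delta> else 0)" if ij: "i \<in> F" "j \<in> F" for i j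
  proof -
    \<comment> \<open>The defect of the left inverse is annihilated by \<open>T\<close>, because the
      right inverse is already known; injectivity makes it vanish.\<close>
    define u where "u k = (\<Sum>l\<in>F. A k l * T l j) - (if k = j then \<Delta> else 0)" for k
    have "(\<Sum>k\<in>F. T i' k * u k) = 0" if i': "i' \<in> F" for i'
    proof -
      have "(\<Sum>k\<in>F. T i' k * (\<Sum>l\<in>F. A k l * T l j)) = (\<Sum>l\<in>F. (\<Sum>k\<in>F. T i' k * A k l) * T l j)"
        unfolding sum_distrib_left sum_distrib_right by (subst sum.swap) (simp add: mult.assoc)
      also have "\<dots> = (\<Sum>l\<in>F. if i' = l then \<Delta> * T l j else 0)"
        by (rule sum.cong) (auto simp: 1[OF i'])
      also have "\<dots> = \<Delta> * T i' j" using F i' by simp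
      finally have a: "(\<Sum>k\<in>F. T i' k * (\<Sum>l\<in>F. A k l * T l j)) = \<Delta> * T i' j" .
      have "(\<Sum>k\<in>F. T i' k * (if k = j then \<Delta> else 0)) = (\<Sum>k\<in>F. if k = j then T i' k * \<Delta> else 0)"
        by (rule sum.cong) auto
      then have "(\<Sum>k\<in>F. T i' k * (if k = j then \<Delta> else 0)) = \<Delta> * T i' j"
        using F ij(2) by (simp add: mult.commute)
      then show ?thesis unfolding u_def right_diff_distrib sum_subtractf a by simp
    qed
    then have "\<forall>i\<in>F. u i = 0" by (rule inj)
    then show ?thesis using ij(1) by (simp add: u_def)
  qed
  have "\<Delta> \<noteq> 0" unfolding \<Delta>_def using vc F by simp
  then show thesis by (rule that[OF _ 1 2])
qed

text \<open>Boundedness along a single ray compares orders of vanishing at 0. Once \<open>p\<close>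
  vanishes at least to the order of \<open>q\<close>, cancelling powers of \<kappa> makes the
  quotient regular at 0 from every direction.\<close>

lemma poly_quotient_reduce:
  fixes p q :: "complex poly"
  assumes "q \<noteq> 0" and "0 < \<delta>" and "norm \<omega> = 1"
    and le: "\<And>t. 0 < t \<Longrightarrow> t < \<delta> \<Longrightarrow> norm (poly p (of_real t * \<omega>)) \<le> C * norm (poly q (of_real t * \<omega>))"
  obtains p' q' where "poly q' 0 \<noteq> 0" "p * q' = p' * q"
proof (cases "p = 0")
  case True then show ?thesis using that[of 1 0] by simp
next
  case False
  obtain p1 where p1: "p = [:-0, 1:] ^ order 0 p * p1" "\<not> [:-0, 1:] dvd p1" using order_decomp[OF False] by blast
  obtain q1 where q1: "q = [:-0, 1:] ^ order 0 q * q1" "\<not> [:-0, 1:] dvd q1" using order_decomp[OF assms(1)] by blast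
  define e where "e = order 0 p"
  define d where "d = order 0 q"
  have nz: "poly p1 0 \<noteq> 0" "poly q1 0 \<noteq> 0" using p1 q1 by (auto simp: poly_eq_0_iff_dvd)
  have ev: "poly p \<kappa> = \<kappa> ^ e * poly p1 \<kappa>" "poly q \<kappa> = \<kappa> ^ d * poly q1 \<kappa>" for \<kappa>
    by (subst p1(1), simp add: e_def, subst q1(1), simp add: d_def)
  \<comment> \<open>Otherwise division by t^e leaves a bound of size t^(d - e), which forces
    \<open>p1\<close> to vanish at 0.\<close>
  have "d \<le> e"
  proof (rule ccontr)
    assume "\<not> d \<le> e" then have "e < d" by simp
    define g where "g t = norm (poly p1 (of_real t * \<omega>))" for t
    define h where "h t = C * (t ^ (d - e) * norm (poly q1 (of_real t * \<omega>)))" for t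
    have "g t \<le> h t" if t: "0 < t" "t < \<delta>" for t
    proof -
      have "t ^ e * norm (poly p1 (of_real t * \<omega>)) \<le> C * (t ^ d * norm (poly q1 (of_real t * \<omega>)))"
        using le[OF t] t assms(3) unfolding ev by (simp add: norm_mult norm_power power_mult_distrib)
      also have "t ^ d = t ^ e * t ^ (d - e)" using \<open>e < d\<close> by (simp flip: power_add)
      finally have "t ^ e * g t \<le> t ^ e * h t" by (simp add: g_def h_def mult_ac)
      then show ?thesis using t by simp
    qed
    moreover have "(g \<longlongrightarrow> norm (poly p1 0)) (at_right 0)" unfolding g_def
      by (rule tendsto_eq_intros filterlim_ident refl | simp)+
    moreover have "(h \<longlongrightarrow> C * (0 ^ (d - e) * norm (poly q1 (of_real 0 * \<omega>)))) (at_right 0)"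
      unfolding h_def by (intro tendsto_intros)
    then have "(h \<longlongrightarrow> 0) (at_right 0)" using \<open>e < d\<close> by (simp add: power_0_left)
    moreover have "eventually (\<lambda>t. g t \<le> h t) (at_right 0)"
      using eventually_at_right_real[OF \<open>0 < \<delta>\<close>] by eventually_elim (use calculation(1) in auto)
    ultimately have "norm (poly p1 0) \<le> 0"
      by (intro tendsto_le[of "at_right 0" h 0 g]) auto
    then show False using nz by simp
  qed
  then have "[:-0, 1:] ^ e = [:0, 1::complex:] ^ (e - d) * [:-0, 1:] ^ d" by (simp flip: power_add)
  then have "p * q1 = ([:0, 1:] ^ (e - d) * p1) * q"
    by (subst p1(1), subst q1(1)) (simp add: e_def d_def mult_ac)
  then show ?thesis using that nz by blast
qed

lemma poly_bounded_below:
  fixes q :: "complex poly"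
  assumes "poly q 0 \<noteq> 0"
  obtains \<delta> c where "0 < \<delta>" "0 < c" "\<And>\<kappa>. norm \<kappa> < \<delta> \<Longrightarrow> c \<le> norm (poly q \<kappa>)"
proof -
  have "isCont (poly q) 0" by simp
  then obtain \<delta> where d: "0 < \<delta>" "\<And>\<kappa>. dist \<kappa> 0 < \<delta> \<Longrightarrow> dist (poly q \<kappa>) (poly q 0) < norm (poly q 0) / 2"
    using assms unfolding continuous_at_eps_delta by (metis half_gt_zero zero_less_norm_iff)
  have "norm (poly q 0) / 2 \<le> norm (poly q \<kappa>)" if "norm \<kappa> < \<delta>" for \<kappa>
    using d(2)[of \<kappa>] that norm_triangle_ineq2[of "poly q 0" "poly q \<kappa>"]
    by (simp add: dist_norm norm_minus_commute)
  then show ?thesis using that[of \<delta> "norm (poly q 0) / 2"] d assms by auto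
qed

lemma gexp_eq_poly:
  assumes "gexp \<delta> J (\<lambda>_::unit. 1) (\<lambda>_. 1) (\<lambda>_. f)" "0 < \<delta>"
  obtains p C where "0 \<le> C" "\<And>\<kappa>. \<kappa> \<in> half_disc \<delta> \<Longrightarrow> norm (f \<kappa> - poly p \<kappa>) \<le> C * norm \<kappa> ^ J"
proof -
  obtain b C where b: "gexp_coeff \<delta> J (\<lambda>_::unit. 1) (\<lambda>_. 1) (\<lambda>_. f) b C"
    using gexpE[OF assms] .
  define p where "p = (\<Sum>j<J. monom (b j ()) j)"
  have "poly p \<kappa> = (\<Sum>j<J. \<kappa> ^ j * b j ())" for \<kappa>
    by (simp add: p_def poly_sum poly_monom mult.commute)
  then show ?thesis using that[of C p] gexp_coeffD(1,2)[OF b] by simp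
qed

lemma matrix_injective_imp_inverse:
  fixes S :: "'x \<Rightarrow> 'x \<Rightarrow> complex"
  assumes F: "finite F" and inj: "\<And>v. (\<And>i. i \<in> F \<Longrightarrow> (\<Sum>l\<in>F. S i l * v l) = 0) \<Longrightarrow> \<forall>i\<in>F. v i = 0"
  shows "\<exists>X. (\<forall>i\<in>F. \<forall>j\<in>F. (\<Sum>l\<in>F. S i l * X l j) = (if i = j then 1 else 0)) \<and>
    (\<forall>i\<in>F. \<forall>j\<in>F. (\<Sum>l\<in>F. X i l * S l j) = (if i = j then 1 else 0))"
proof -
  obtain A \<Delta> where nz: "\<Delta> \<noteq> 0"
    and A: "\<And>i j. i \<in> F \<Longrightarrow> j \<in> F \<Longrightarrow> (\<Sum>l\<in>F. S i l * A l j) = (if i = j then \<Delta> else 0)"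
    "\<And>i j. i \<in> F \<Longrightarrow> j \<in> F \<Longrightarrow> (\<Sum>l\<in>F. A i l * S l j) = (if i = j then \<Delta> else 0)"
    by (rule injective_matrix_scaled_inverse[OF F inj]) (assumption, rule that)
  show ?thesis
  proof (intro exI[of _ "\<lambda>i j. A i j / \<Delta>"] conjI ballI)
    fix i j assume ij: "i \<in> F" "j \<in> F"
    have "(\<Sum>l\<in>F. S i l * (A l j / \<Delta>)) = (\<Sum>l\<in>F. S i l * A l j) / \<Delta>" by (simp add: sum_divide_distrib)
    then show "(\<Sum>l\<in>F. S i l * (A l j / \<Delta>)) = (if i = j then 1 else 0)" using A(1)[OF ij] nz by simp
    have "(\<Sum>l\<in>F. A i l / \<Delta> * S l j) = (\<Sum>l\<in>F. A i l * S l j) / \<Delta>" by (simp add: sum_divide_distrib)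
    then show "(\<Sum>l\<in>F. A i l / \<Delta> * S l j) = (if i = j then 1 else 0)" using A(2)[OF ij] nz by simp
  qed
qed

text \<open>Truncating the entries to polynomials makes the inverse rational; its pole at 0 is then
  controlled by the bound on a single ray. The truncation error is of lower order because \<open>J \<ge> 3\<close>.\<close>

lemma matrix_inverse_expansion:
  fixes S :: "complex \<Rightarrow> 'x \<Rightarrow> 'x \<Rightarrow> complex"
  assumes F: "finite F" and \<delta>: "0 < \<delta>" and J: "3 \<le> J" and \<omega>: "norm \<omega> = 1" "0 < Re \<omega>"
    and S: "\<And>i j. i \<in> F \<Longrightarrow> j \<in> F \<Longrightarrow> gexp \<delta> J (\<lambda>_::unit. 1) (\<lambda>_. 1) (\<lambda>_ \<kappa>. S \<kappa> i j)"
    and apriori: "\<And>t a j. 0 < t \<Longrightarrow> t < \<delta> \<Longrightarrow> j \<in> F \<Longrightarrow>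
      norm (a j) \<le> C / t\<^sup>2 * (\<Sum>i\<in>F. norm (\<Sum>l\<in>F. S (of_real t * \<omega>) i l * a l))"
  obtains \<delta>' X where "0 < \<delta>'" "\<delta>' \<le> \<delta>" "\<delta>' \<le> 1"
    "\<And>\<kappa> i j. \<kappa> \<in> half_disc \<delta>' \<Longrightarrow> i \<in> F \<Longrightarrow> j \<in> F \<Longrightarrow> (\<Sum>l\<in>F. S \<kappa> i l * X \<kappa> l j) = (if i = j then 1 else 0)"
    "\<And>\<kappa> i j. \<kappa> \<in> half_disc \<delta>' \<Longrightarrow> i \<in> F \<Longrightarrow> j \<in> F \<Longrightarrow> (\<Sum>l\<in>F. X \<kappa> i l * S \<kappa> l j) = (if i = j then 1 else 0)"
    "\<And>i j. i \<in> F \<Longrightarrow> j \<in> F \<Longrightarrow> gexp \<delta>' (J - 2) (\<lambda>_::unit. 1) (\<lambda>_. 1) (\<lambda>_ \<kappa>. \<kappa>\<^sup>2 * X \<kappa> i j)"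
proof -
  define n where "n = real (card F)"
  obtain K where K: "J = K + 3" using J by (metis le_add_diff_inverse2)
  have pw: "x ^ J = x ^ (J - 3) * x * x\<^sup>2" "x ^ J = x ^ (J - 2) * x\<^sup>2" "x ^ (J - 2) = x * x ^ (J - 3)"
    for x :: real by (simp_all add: K power_add power2_eq_square power3_eq_cube mult_ac)
  have "\<exists>p c. 0 \<le> c \<and> (\<forall>\<kappa>\<in>half_disc \<delta>. norm (S \<kappa> i j - poly p \<kappa>) \<le> c * norm \<kappa> ^ J)"
    if "i \<in> F" "j \<in> F" for i j
    using gexp_eq_poly[OF S[OF that] \<delta>] by metis
  then obtain T cc where T0: "\<And>i j. i \<in> F \<Longrightarrow> j \<in> F \<Longrightarrow> 0 \<le> cc i j \<and>
      (\<forall>\<kappa>\<in>half_disc \<delta>. norm (S \<kappa> i j - poly (T i j) \<kappa>) \<le> cc i j * norm \<kappa> ^ J)" by metis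
  define E where "E = (\<Sum>i\<in>F. \<Sum>j\<in>F. cc i j)"
  have E: "0 \<le> E" unfolding E_def using T0 by (intro sum_nonneg) auto
  have T: "(\<Sum>i\<in>F. \<Sum>l\<in>F. norm (S \<kappa> i l - poly (T i l) \<kappa>)) \<le> E * norm \<kappa> ^ J" if "\<kappa> \<in> half_disc \<delta>" for \<kappa>
    unfolding E_def sum_distrib_right using T0 that by (intro sum_mono) auto
  have ray: "of_real t * \<omega> \<in> half_disc \<delta>" "norm (of_real t * \<omega>) = t" if "0 < t" "t < \<delta>" for t
    using that \<omega> by (auto simp: half_disc_def norm_mult)
  \<comment> \<open>The a priori factor t^-2 times the truncation error t^J keeps a positive power
    of t; this radius makes the product, with its constants, at most 1/2.\<close>
  define \<delta>1 where "\<delta>1 = min \<delta> (min 1 (1 / (2 * (n * \<bar>C\<bar> * E + 1))))"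
  have nCE: "0 \<le> n * \<bar>C\<bar> * E" using E by (simp add: n_def)
  have "1 / (2 * (n * \<bar>C\<bar> * E + 1)) \<le> 1" using nCE by (simp add: field_simps)
  then have \<delta>1: "0 < \<delta>1" "\<delta>1 \<le> \<delta>" "\<delta>1 \<le> 1"
    using \<delta> nCE unfolding \<delta>1_def min_less_iff_conj by (simp, simp, metis min.cobounded1 min.coboundedI2)
  have small1: "n * (\<bar>C\<bar> / t\<^sup>2 * (E * t ^ J)) \<le> 1/2" if t: "0 < t" "t < \<delta>1" for t
  proof -
    have "t ^ J = t ^ (J - 3) * t * t\<^sup>2" by (rule pw)
    then have "n * (\<bar>C\<bar> / t\<^sup>2 * (E * t ^ J)) = (n * \<bar>C\<bar> * E) * (t ^ (J - 3) * t)" using t by simp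
    also have "\<dots> \<le> (n * \<bar>C\<bar> * E) * (1 * t)"
      using t \<delta>1 nCE by (intro mult_left_mono mult_right_mono power_le_one) auto
    also have "\<dots> \<le> (n * \<bar>C\<bar> * E) * (1 / (2 * (n * \<bar>C\<bar> * E + 1)))"
      using t nCE by (intro mult_left_mono) (auto simp: \<delta>1_def)
    also have "\<dots> \<le> 1/2" using nCE by (simp add: field_simps)
    finally show ?thesis .
  qed
  define Tk where "Tk \<kappa> a i = (\<Sum>l\<in>F. poly (T i l) \<kappa> * a l)" for \<kappa> a i
  define l1 where "l1 a = (\<Sum>i\<in>F. norm (a i))" for a :: "'x \<Rightarrow> complex"
  have diff: "l1 (\<lambda>i. \<Sum>l\<in>F. (S \<kappa> i l - poly (T i l) \<kappa>) * a l) \<le> E * norm \<kappa> ^ J * l1 a" if "\<kappa> \<in> half_disc \<delta>" for \<kappa> a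
  proof -
    have "l1 (\<lambda>i. \<Sum>l\<in>F. (S \<kappa> i l - poly (T i l) \<kappa>) * a l)
       \<le> (\<Sum>i\<in>F. \<Sum>l\<in>F. norm (S \<kappa> i l - poly (T i l) \<kappa>) * l1 a)"
      unfolding l1_def
      by (intro sum_mono order_trans[OF norm_sum] sum_mono)
        (auto simp: norm_mult F intro!: mult_left_mono member_le_sum)
    also have "\<dots> = (\<Sum>i\<in>F. \<Sum>l\<in>F. norm (S \<kappa> i l - poly (T i l) \<kappa>)) * l1 a" by (simp add: sum_distrib_right)
    also have "\<dots> \<le> E * norm \<kappa> ^ J * l1 a" by (intro mult_right_mono T that) (simp add: l1_def sum_nonneg)
    finally show ?thesis .
  qed
  have split: "(\<Sum>l\<in>F. S \<kappa> i l * a l) = Tk \<kappa> a i + (\<Sum>l\<in>F. (S \<kappa> i l - poly (T i l) \<kappa>) * a l)" for \<kappa> a i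
    unfolding Tk_def by (simp add: algebra_simps sum_subtractf)
  have l1_add: "l1 (\<lambda>i. f i + g i) \<le> l1 f + l1 g" for f g
    unfolding l1_def sum.distrib[symmetric] by (intro sum_mono norm_triangle_ineq)
  have l1_nn: "0 \<le> l1 a" for a by (simp add: l1_def sum_nonneg)
  \<comment> \<open>The estimate on the ray survives truncation, because the error term is absorbed
    into the left side. The factor \<open>n\<close> comes from summing over the components.\<close>
  have Tray: "l1 a \<le> 2 * n * \<bar>C\<bar> / t\<^sup>2 * l1 (Tk (of_real t * \<omega>) a)" if t: "0 < t" "t < \<delta>1" for t a
  proof -
    have t': "0 < t" "t < \<delta>" using t \<delta>1 by auto
    note r = ray[OF t']
    let ?\<kappa> = "of_real t * \<omega>"
    have "l1 a \<le> (\<Sum>j\<in>F. \<bar>C\<bar> / t\<^sup>2 * l1 (\<lambda>i. \<Sum>l\<in>F. S ?\<kappa> i l * a l))"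
      unfolding l1_def
      by (intro sum_mono order_trans[OF apriori[OF t']] mult_right_mono sum_nonneg divide_right_mono) auto
    also have "\<dots> = n * (\<bar>C\<bar> / t\<^sup>2 * l1 (\<lambda>i. \<Sum>l\<in>F. S ?\<kappa> i l * a l))" by (simp add: n_def)
    also have "\<dots> \<le> n * (\<bar>C\<bar> / t\<^sup>2 * (l1 (Tk ?\<kappa> a) + E * t ^ J * l1 a))"
      unfolding split using l1_add[of "Tk ?\<kappa> a" "\<lambda>i. \<Sum>l\<in>F. (S ?\<kappa> i l - poly (T i l) ?\<kappa>) * a l"] diff[OF r(1), of a] r(2)
      by (intro mult_left_mono) (auto simp: n_def)
    also have "\<dots> = n * \<bar>C\<bar> / t\<^sup>2 * l1 (Tk ?\<kappa> a) + n * (\<bar>C\<bar> / t\<^sup>2 * (E * t ^ J)) * l1 a"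
      by (simp add: algebra_simps)
    also have "\<dots> \<le> n * \<bar>C\<bar> / t\<^sup>2 * l1 (Tk ?\<kappa> a) + 1/2 * l1 a"
      by (intro add_left_mono mult_right_mono small1 t l1_nn)
    finally show ?thesis by (simp add: field_simps)
  qed
  \<comment> \<open>A polynomial vector annihilated by \<open>T\<close> vanishes at every point of a
    segment of the ray, which is infinite, so it is zero.\<close>
  have Tinj: "\<forall>i\<in>F. v i = 0" if v: "\<And>i. i \<in> F \<Longrightarrow> (\<Sum>l\<in>F. T i l * v l) = 0" for v
  proof (intro ballI, rule ccontr)
    fix i assume i: "i \<in> F" "v i \<noteq> 0"
    have "poly (v i) (of_real t * \<omega>) = 0" if t: "0 < t" "t < \<delta>1" for t
    proof -
      define a where "a l = poly (v l) (of_real t * \<omega>)" for l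
      have "Tk (of_real t * \<omega>) a k = 0" if "k \<in> F" for k
        using arg_cong[OF v[OF that], of "\<lambda>p. poly p (of_real t * \<omega>)"] by (simp add: Tk_def a_def poly_sum)
      then have "l1 a \<le> 0" using Tray[OF t, of a] by (simp add: l1_def)
      moreover have "norm (a i) \<le> l1 a" unfolding l1_def using i F by (intro member_le_sum) auto
      ultimately have "norm (a i) \<le> 0" by linarith
      then show ?thesis by (simp add: a_def)
    qed
    then have "(\<lambda>t. of_real t * \<omega>) ` {0<..<\<delta>1} \<subseteq> {x. poly (v i) x = 0}" by auto
    then have "finite ((\<lambda>t. of_real t * \<omega>) ` {0<..<\<delta>1})" using poly_roots_finite[OF i(2)] by (rule finite_subset)
    moreover have "inj_on (\<lambda>t. of_real t * \<omega>) {0<..<\<delta>1}" using \<omega>(2) by (intro inj_onI) auto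
    ultimately have "finite {0<..<\<delta>1}" by (rule finite_imageD)
    then show False using \<delta>1(1) infinite_Ioo by blast
  qed
  obtain A \<Delta> where "\<Delta> \<noteq> 0"
    and A: "\<And>i j. i \<in> F \<Longrightarrow> j \<in> F \<Longrightarrow> (\<Sum>l\<in>F. T i l * A l j) = (if i = j then \<Delta> else 0)"
    "\<And>i j. i \<in> F \<Longrightarrow> j \<in> F \<Longrightarrow> (\<Sum>l\<in>F. A i l * T l j) = (if i = j then \<Delta> else 0)"
    by (rule injective_matrix_scaled_inverse[OF F Tinj]) (assumption, rule that)
  \<comment> \<open>Column j of \<open>A\<close> solves the system with right side
    \<open>\<Delta>\<close> times a unit vector, so the estimate on the ray bounds \<kappa>^2 A /
    \<open>\<Delta>\<close> there.\<close>
  have adj: "norm (poly ([:0, 0, 1:] * A i j) (of_real t * \<omega>)) \<le> 2 * n * \<bar>C\<bar> * norm (poly \<Delta> (of_real t * \<omega>))"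
    if ij: "i \<in> F" "j \<in> F" and t: "0 < t" "t < \<delta>1" for i j t
  proof -
    let ?\<kappa> = "of_real t * \<omega>"
    define a where "a l = poly (A l j) ?\<kappa>" for l
    have "Tk ?\<kappa> a i = (if i = j then poly \<Delta> ?\<kappa> else 0)" if "i \<in> F" for i
      using arg_cong[OF A(1)[OF that ij(2)], of "\<lambda>p. poly p ?\<kappa>"] by (auto simp: Tk_def a_def poly_sum)
    then have "l1 (Tk ?\<kappa> a) = (\<Sum>i\<in>F. norm (if i = j then poly \<Delta> ?\<kappa> else 0))"
      unfolding l1_def by (intro sum.cong) auto
    also have "\<dots> = norm (poly \<Delta> ?\<kappa>)" using F ij by (simp add: if_distrib cong: if_cong)
    finally have "l1 a \<le> 2 * n * \<bar>C\<bar> / t\<^sup>2 * norm (poly \<Delta> ?\<kappa>)" using Tray[OF t, of a] by simp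
    moreover have "norm (a i) \<le> l1 a" unfolding l1_def using ij F by (intro member_le_sum) auto
    ultimately have "norm (a i) \<le> 2 * n * \<bar>C\<bar> / t\<^sup>2 * norm (poly \<Delta> ?\<kappa>)" by linarith
    then have "t\<^sup>2 * norm (a i) \<le> 2 * n * \<bar>C\<bar> * norm (poly \<Delta> ?\<kappa>)" using t by (simp add: field_simps)
    then show ?thesis using t \<omega> by (simp add: norm_mult a_def power2_eq_square mult_ac)
  qed
  have "\<exists>p' q'. poly q' 0 \<noteq> 0 \<and> ([:0, 0, 1:] * A i j) * q' = p' * \<Delta>" if "i \<in> F" "j \<in> F" for i j
    using poly_quotient_reduce[OF \<open>\<Delta> \<noteq> 0\<close> \<delta>1(1) \<omega>(1) adj[OF that]] by metis
  then obtain p' q' where pq: "\<And>i j. i \<in> F \<Longrightarrow> j \<in> F \<Longrightarrow> poly (q' i j) 0 \<noteq> 0 \<and> ([:0, 0, 1:] * A i j) * q' i j = p' i j * \<Delta>"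
    by metis
  \<comment> \<open>A common denominator that is nonzero at 0, so that all entries are controlled on
    one disc.\<close>
  define q where "q = (\<Prod>i\<in>F. \<Prod>j\<in>F. q' i j)"
  have q0: "poly q 0 \<noteq> 0" unfolding q_def poly_prod using pq F by simp
  have "\<exists>p. ([:0, 0, 1:] * A i j) * q = p * \<Delta>" if "i \<in> F" "j \<in> F" for i j
  proof -
    have "q = q' i j * (\<Prod>j\<in>F - {j}. q' i j) * (\<Prod>i\<in>F - {i}. \<Prod>j\<in>F. q' i j)"
      unfolding q_def by (subst prod.remove[OF F that(1)], subst prod.remove[OF F that(2)]) simp
    then have "([:0, 0, 1:] * A i j) * q
       = (([:0, 0, 1:] * A i j) * q' i j) * ((\<Prod>j\<in>F - {j}. q' i j) * (\<Prod>i\<in>F - {i}. \<Prod>j\<in>F. q' i j))"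
      by (simp only: mult.assoc)
    also have "\<dots> = (p' i j * ((\<Prod>j\<in>F - {j}. q' i j) * (\<Prod>i\<in>F - {i}. \<Prod>j\<in>F. q' i j))) * \<Delta>"
      using pq[OF that] by (simp only: mult_ac)
    finally show ?thesis by blast
  qed
  then obtain p where p: "\<And>i j. i \<in> F \<Longrightarrow> j \<in> F \<Longrightarrow> ([:0, 0, 1:] * A i j) * q = p i j * \<Delta>" by metis
  \<comment> \<open>With its zero at 0 split off, \<open>\<Delta>\<close> is seen to have no other
    zero in a small disc, so the pointwise inverse \<open>Y\<close> exists there.\<close>
  obtain d where d: "\<Delta> = [:-0, 1:] ^ order 0 \<Delta> * d" "\<not> [:-0, 1:] dvd d" using order_decomp[OF \<open>\<Delta> \<noteq> 0\<close>] by blast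
  have d0: "poly d 0 \<noteq> 0" using d by (auto simp: poly_eq_0_iff_dvd)
  obtain \<delta>2 c where \<delta>2: "0 < \<delta>2" "0 < c" "\<And>\<kappa>. norm \<kappa> < \<delta>2 \<Longrightarrow> c \<le> norm (poly q \<kappa>)"
    using poly_bounded_below[OF q0] by metis
  obtain \<delta>3 c3 where \<delta>3: "0 < \<delta>3" "0 < c3" "\<And>\<kappa>. norm \<kappa> < \<delta>3 \<Longrightarrow> c3 \<le> norm (poly d \<kappa>)"
    using poly_bounded_below[OF d0] by metis
  define \<delta>4 where "\<delta>4 = min \<delta>1 (min \<delta>2 \<delta>3)"
  have \<delta>4: "0 < \<delta>4" "\<delta>4 \<le> \<delta>" "\<delta>4 \<le> 1" using \<delta>1 \<delta>2 \<delta>3 by (auto simp: \<delta>4_def)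
  have sub4: "half_disc \<delta>4 \<subseteq> half_disc \<delta>" using \<delta>4 by (auto simp: half_disc_def)
  define Y where "Y \<kappa> i j = poly (A i j) \<kappa> / poly \<Delta> \<kappa>" for \<kappa> i j
  have Dnz: "poly \<Delta> \<kappa> \<noteq> 0" if "\<kappa> \<in> half_disc \<delta>4" for \<kappa>
  proof -
    have "poly d \<kappa> \<noteq> 0" using \<delta>3(2) \<delta>3(3)[of \<kappa>] that by (auto simp: \<delta>4_def half_disc_def)
    then show ?thesis by (subst d(1)) (use half_disc_nz[OF that] in simp)
  qed
  have Y: "\<kappa>\<^sup>2 * Y \<kappa> i j = poly (p i j) \<kappa> / poly q \<kappa>" if "\<kappa> \<in> half_disc \<delta>4" "i \<in> F" "j \<in> F" for \<kappa> i j
  proof -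
    have "poly q \<kappa> \<noteq> 0" using \<delta>2(2) \<delta>2(3)[of \<kappa>] that(1) by (auto simp: \<delta>4_def half_disc_def)
    moreover have "\<kappa>\<^sup>2 * poly (A i j) \<kappa> * poly q \<kappa> = poly (p i j) \<kappa> * poly \<Delta> \<kappa>"
      using arg_cong[OF p[OF that(2,3)], of "\<lambda>p. poly p \<kappa>"] by (simp add: power2_eq_square mult_ac)
    ultimately show ?thesis unfolding Y_def using Dnz[OF that(1)] by (simp add: field_simps)
  qed
  have Yexp: "gexp \<delta>4 K (\<lambda>_::unit. 1) (\<lambda>_. 1) (\<lambda>_ \<kappa>. \<kappa>\<^sup>2 * Y \<kappa> i j)" if "i \<in> F" "j \<in> F" for i j K
  proof (rule gexp_cong)
    show "gexp \<delta>4 K (\<lambda>_::unit. 1) (\<lambda>_. 1) (\<lambda>_ \<kappa>. poly (p i j) \<kappa> / poly q \<kappa>)"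
      by (rule gexp_rational[OF \<delta>4(1) \<delta>2(2) _ q0]) (use \<delta>2(3) in \<open>auto simp: half_disc_def \<delta>4_def\<close>)
  qed (use Y that in auto)
  have "\<exists>c\<ge>0. \<forall>\<kappa>\<in>half_disc \<delta>4. norm (\<kappa>\<^sup>2 * Y \<kappa> i j) \<le> c" if "i \<in> F" "j \<in> F" for i j
    using gexp_bound[OF Yexp[OF that, of 0] \<delta>4(1)] by (metis mult_1_right)
  then obtain bY where bY: "\<And>i j. i \<in> F \<Longrightarrow> j \<in> F \<Longrightarrow> 0 \<le> bY i j \<and> (\<forall>\<kappa>\<in>half_disc \<delta>4. norm (\<kappa>\<^sup>2 * Y \<kappa> i j) \<le> bY i j)"
    by metis
  define B where "B = (\<Sum>i\<in>F. \<Sum>j\<in>F. bY i j)"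
  have B: "0 \<le> B" unfolding B_def using bY by (intro sum_nonneg) auto
  have YB: "norm (\<kappa>\<^sup>2 * Y \<kappa> i j) \<le> B" if "\<kappa> \<in> half_disc \<delta>4" "i \<in> F" "j \<in> F" for \<kappa> i j
  proof -
    have "norm (\<kappa>\<^sup>2 * Y \<kappa> i j) \<le> bY i j" using bY that by blast
    also have "\<dots> \<le> (\<Sum>j\<in>F. bY i j)" using that bY F by (intro member_le_sum) auto
    also have "\<dots> \<le> B" unfolding B_def using that bY F by (intro member_le_sum sum_nonneg) auto
    finally show ?thesis .
  qed
  have YT: "(\<Sum>l\<in>F. Y \<kappa> i l * poly (T l j) \<kappa>) = (if i = j then 1 else 0)"
    if "\<kappa> \<in> half_disc \<delta>4" "i \<in> F" "j \<in> F" for \<kappa> i j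
  proof -
    have "(\<Sum>l\<in>F. Y \<kappa> i l * poly (T l j) \<kappa>) = poly (\<Sum>l\<in>F. A i l * T l j) \<kappa> / poly \<Delta> \<kappa>"
      by (simp add: Y_def poly_sum sum_divide_distrib)
    then show ?thesis unfolding A(2)[OF that(2,3)] using Dnz[OF that(1)] by auto
  qed
  have YTk: "(\<Sum>l\<in>F. Y \<kappa> i l * Tk \<kappa> a l) = a i" if "\<kappa> \<in> half_disc \<delta>4" "i \<in> F" for \<kappa> a i
  proof -
    have "(\<Sum>l\<in>F. Y \<kappa> i l * Tk \<kappa> a l) = (\<Sum>m\<in>F. (\<Sum>l\<in>F. Y \<kappa> i l * poly (T l m) \<kappa>) * a m)"
      unfolding Tk_def sum_distrib_left sum_distrib_right mult.assoc[symmetric] by (rule sum.swap)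
    also have "\<dots> = (\<Sum>m\<in>F. (if i = m then a m else 0))"
      using that YT by (intro sum.cong) auto
    finally show ?thesis using that F by simp
  qed
  have Yl1: "norm \<kappa> ^ 2 * norm (\<Sum>l\<in>F. Y \<kappa> i l * b l) \<le> B * l1 b" if "\<kappa> \<in> half_disc \<delta>4" "i \<in> F" for \<kappa> b i
  proof -
    have "norm \<kappa> ^ 2 * norm (\<Sum>l\<in>F. Y \<kappa> i l * b l) = norm (\<Sum>l\<in>F. (\<kappa>\<^sup>2 * Y \<kappa> i l) * b l)"
      by (simp add: norm_mult norm_power sum_distrib_left mult.assoc flip: norm_power)
        (simp add: sum_distrib_left[symmetric] norm_mult norm_power)
    also have "\<dots> \<le> (\<Sum>l\<in>F. B * norm (b l))"
      using that YB by (intro sum_norm_le) (auto simp: norm_mult intro!: mult_right_mono)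
    finally show ?thesis by (simp add: l1_def sum_distrib_left)
  qed
  define \<delta>5 where "\<delta>5 = min \<delta>4 (1 / (2 * (n * B * E + 1)))"
  have nBE: "0 \<le> n * B * E" using B E by (simp add: n_def)
  have \<delta>5: "0 < \<delta>5" "\<delta>5 \<le> \<delta>4" using \<delta>4 nBE by (auto simp: \<delta>5_def)
  have sub5: "half_disc \<delta>5 \<subseteq> half_disc \<delta>4" using \<delta>5 by (auto simp: half_disc_def)
  \<comment> \<open>The bound on \<kappa>^2 Y takes over the role of the ray estimate and holds on
    the whole half disc; the same absorption gives a lower bound for \<open>S\<close> itself, hence
    its invertibility.\<close>
  have Sbd: "norm \<kappa> ^ 2 * l1 a \<le> 2 * n * B * l1 (\<lambda>i. \<Sum>l\<in>F. S \<kappa> i l * a l)" if k: "\<kappa> \<in> half_disc \<delta>5" for \<kappa> a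
  proof -
    have k4: "\<kappa> \<in> half_disc \<delta>4" "\<kappa> \<in> half_disc \<delta>" using k sub5 sub4 by auto
    define t where "t = norm \<kappa>"
    have t: "0 < t" "t < \<delta>5" "t \<le> 1" using k half_disc_nz[OF k] \<delta>5 \<delta>4 by (auto simp: t_def half_disc_def)
    have "t ^ 2 * l1 a = (\<Sum>i\<in>F. t ^ 2 * norm (\<Sum>l\<in>F. Y \<kappa> i l * Tk \<kappa> a l))"
      unfolding l1_def sum_distrib_left using YTk[OF k4(1)] by simp
    also have "\<dots> \<le> (\<Sum>i\<in>F. B * l1 (Tk \<kappa> a))" unfolding t_def by (intro sum_mono Yl1 k4)
    also have "\<dots> = n * B * l1 (Tk \<kappa> a)" by (simp add: n_def)
    also have "\<dots> \<le> n * B * (l1 (\<lambda>i. \<Sum>l\<in>F. S \<kappa> i l * a l) + E * t ^ J * l1 a)"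
    proof (rule mult_left_mono)
      have "Tk \<kappa> a i = (\<Sum>l\<in>F. S \<kappa> i l * a l) + - (\<Sum>l\<in>F. (S \<kappa> i l - poly (T i l) \<kappa>) * a l)" for i
        using split[of \<kappa> i a] by simp
      then have "l1 (Tk \<kappa> a) \<le> l1 (\<lambda>i. \<Sum>l\<in>F. S \<kappa> i l * a l) + l1 (\<lambda>i. - (\<Sum>l\<in>F. (S \<kappa> i l - poly (T i l) \<kappa>) * a l))"
        using l1_add by presburger
      also have "l1 (\<lambda>i. - (\<Sum>l\<in>F. (S \<kappa> i l - poly (T i l) \<kappa>) * a l)) = l1 (\<lambda>i. (\<Sum>l\<in>F. (S \<kappa> i l - poly (T i l) \<kappa>) * a l))"
        by (simp add: l1_def)
      finally show "l1 (Tk \<kappa> a) \<le> l1 (\<lambda>i. \<Sum>l\<in>F. S \<kappa> i l * a l) + E * t ^ J * l1 a"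
        using diff[OF k4(2), of a] by (simp add: t_def)
    qed (use B in \<open>simp add: n_def\<close>)
    also have "\<dots> = n * B * l1 (\<lambda>i. \<Sum>l\<in>F. S \<kappa> i l * a l) + (n * B * E * t ^ (J - 2)) * (t ^ 2 * l1 a)"
    proof -
      have "t ^ J = t ^ (J - 2) * t ^ 2" by (rule pw)
      then show ?thesis by (simp add: algebra_simps)
    qed
    also have "\<dots> \<le> n * B * l1 (\<lambda>i. \<Sum>l\<in>F. S \<kappa> i l * a l) + 1/2 * (t ^ 2 * l1 a)"
    proof (intro add_left_mono mult_right_mono)
      have "t ^ (J - 2) = t * t ^ (J - 3)" by (rule pw)
      also have "\<dots> \<le> t * 1" using t by (intro mult_left_mono power_le_one) auto
      finally have "n * B * E * t ^ (J - 2) \<le> n * B * E * (1 / (2 * (n * B * E + 1)))"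
        using t nBE by (intro mult_left_mono) (auto simp: \<delta>5_def)
      also have "\<dots> \<le> 1/2" using nBE by (simp add: field_simps)
      finally show "n * B * E * t ^ (J - 2) \<le> 1/2" .
    qed (use l1_nn in simp)
    finally show ?thesis unfolding t_def by (simp add: algebra_simps)
  qed
  define inv where "inv \<kappa> X \<longleftrightarrow> (\<forall>i\<in>F. \<forall>j\<in>F. (\<Sum>l\<in>F. S \<kappa> i l * X l j) = (if i = j then 1 else 0)) \<and>
      (\<forall>i\<in>F. \<forall>j\<in>F. (\<Sum>l\<in>F. X i l * S \<kappa> l j) = (if i = j then 1 else 0))" for \<kappa> X
  have "\<exists>X. inv \<kappa> X" if k: "\<kappa> \<in> half_disc \<delta>5" for \<kappa>
    unfolding inv_def
  proof (rule matrix_injective_imp_inverse[OF F])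
    show "\<forall>i\<in>F. v i = 0" if "\<And>i. i \<in> F \<Longrightarrow> (\<Sum>l\<in>F. S \<kappa> i l * v l) = 0" for v
    proof -
      have "norm \<kappa> ^ 2 * l1 v \<le> 0" using Sbd[OF k, of v] that by (simp add: l1_def)
      then have "l1 v \<le> 0" using half_disc_nz[OF k] by (simp add: mult_le_0_iff)
      then have "l1 v = 0" using l1_nn[of v] by simp
      then show ?thesis unfolding l1_def using F by (simp add: sum_nonneg_eq_0_iff)
    qed
  qed
  then obtain X where "\<And>\<kappa>. \<kappa> \<in> half_disc \<delta>5 \<Longrightarrow> inv \<kappa> (X \<kappa>)" by metis
  then have X: "\<And>\<kappa> i j. \<kappa> \<in> half_disc \<delta>5 \<Longrightarrow> i \<in> F \<Longrightarrow> j \<in> F \<Longrightarrow> (\<Sum>l\<in>F. S \<kappa> i l * X \<kappa> l j) = (if i = j then 1 else 0)"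
    "\<And>\<kappa> i j. \<kappa> \<in> half_disc \<delta>5 \<Longrightarrow> i \<in> F \<Longrightarrow> j \<in> F \<Longrightarrow> (\<Sum>l\<in>F. X \<kappa> i l * S \<kappa> l j) = (if i = j then 1 else 0)"
    unfolding inv_def by blast+
  show ?thesis
  proof (rule that[of \<delta>5 X])
    fix i j assume ij: "i \<in> F" "j \<in> F"
    have eq: "\<kappa>\<^sup>2 * X \<kappa> i j = \<kappa>\<^sup>2 * Y \<kappa> i j + \<kappa>\<^sup>2 * (X \<kappa> i j - Y \<kappa> i j)" for \<kappa> by (simp add: algebra_simps)
    \<comment> \<open>In X - Y = - Y (S - T) X two factors are of size \<kappa>^-2 and one of size
      \<kappa>^J, so the error of \<kappa>^2 X has order J - 2.\<close>
    have bd: "norm (\<kappa>\<^sup>2 * (X \<kappa> i j - Y \<kappa> i j)) \<le> (B * E * (2 * n * B)) * norm \<kappa> ^ (J - 2)" if k: "\<kappa> \<in> half_disc \<delta>5" for \<kappa>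
    proof -
      have k4: "\<kappa> \<in> half_disc \<delta>4" "\<kappa> \<in> half_disc \<delta>" using k sub5 sub4 by auto
      have kp: "0 < norm \<kappa>" using half_disc_nz[OF k] by simp
      define x where "x l = X \<kappa> l j" for l
      have Sx: "(\<Sum>l\<in>F. S \<kappa> i l * x l) = (if i = j then 1 else 0)" if "i \<in> F" for i
        using X(1)[OF k that ij(2)] by (simp add: x_def)
      have l1Sx: "l1 (\<lambda>i. \<Sum>l\<in>F. S \<kappa> i l * x l) = 1"
      proof -
        have "l1 (\<lambda>i. \<Sum>l\<in>F. S \<kappa> i l * x l) = (\<Sum>i\<in>F. if i = j then 1 else 0)"
          unfolding l1_def using Sx by (intro sum.cong) auto
        then show ?thesis using ij F by simp
      qed
      have "x i - Y \<kappa> i j = - (\<Sum>m\<in>F. Y \<kappa> i m * (\<Sum>l\<in>F. (S \<kappa> m l - poly (T m l) \<kappa>) * x l))"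
      proof -
        have "x i = (\<Sum>m\<in>F. Y \<kappa> i m * Tk \<kappa> x m)" using YTk[OF k4(1) ij(1)] by simp
        also have "\<dots> = (\<Sum>m\<in>F. Y \<kappa> i m * (if m = j then 1 else 0) - Y \<kappa> i m * (\<Sum>l\<in>F. (S \<kappa> m l - poly (T m l) \<kappa>) * x l))"
        proof (rule sum.cong[OF refl])
          fix m assume m: "m \<in> F"
          have "Tk \<kappa> x m = (if m = j then 1 else 0) - (\<Sum>l\<in>F. (S \<kappa> m l - poly (T m l) \<kappa>) * x l)"
            using split[of \<kappa> m x] Sx[OF m] by (simp add: algebra_simps)
          then show "Y \<kappa> i m * Tk \<kappa> x m = Y \<kappa> i m * (if m = j then 1 else 0) - Y \<kappa> i m * (\<Sum>l\<in>F. (S \<kappa> m l - poly (T m l) \<kappa>) * x l)"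
            by (simp only: right_diff_distrib)
        qed
        also have "\<dots> = Y \<kappa> i j - (\<Sum>m\<in>F. Y \<kappa> i m * (\<Sum>l\<in>F. (S \<kappa> m l - poly (T m l) \<kappa>) * x l))"
          using ij F by (simp add: sum_subtractf if_distrib[of "(*) _"] cong: if_cong)
        finally show ?thesis by simp
      qed
      then have "norm (\<kappa>\<^sup>2 * (x i - Y \<kappa> i j))
         = norm \<kappa> ^ 2 * norm (\<Sum>m\<in>F. Y \<kappa> i m * (\<Sum>l\<in>F. (S \<kappa> m l - poly (T m l) \<kappa>) * x l))"
        by (simp only: norm_mult norm_power norm_minus_cancel)
      also have "\<dots> \<le> B * (E * norm \<kappa> ^ J * l1 x)"
        using B by (intro order_trans[OF Yl1[OF k4(1) ij(1)]] mult_left_mono diff k4) auto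
      also have "\<dots> = B * E * norm \<kappa> ^ (J - 2) * (norm \<kappa> ^ 2 * l1 x)"
      proof -
        have "norm \<kappa> ^ J = norm \<kappa> ^ (J - 2) * norm \<kappa> ^ 2" by (rule pw)
        then show ?thesis by simp
      qed
      also have "\<dots> \<le> B * E * norm \<kappa> ^ (J - 2) * (2 * n * B * 1)"
        using Sbd[OF k, of x] B E unfolding l1Sx by (intro mult_left_mono) auto
      finally show ?thesis by (simp add: x_def mult_ac)
    qed
    have 2: "gexp \<delta>5 (J - 2) (\<lambda>_::unit. 1) (\<lambda>_. 1) (\<lambda>_ \<kappa>. \<kappa>\<^sup>2 * (X \<kappa> i j - Y \<kappa> i j))"
    \<comment> \<open>All coefficients are 0: the difference is already a remainder of the full
      order.\<close>
    proof (rule gexpI[where b="\<lambda>_ _. 0" and C="B * E * (2 * n * B)"])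
      fix J' and u :: unit and \<kappa> assume *: "J' \<le> J - 2" "\<kappa> \<in> half_disc \<delta>5"
      have "norm \<kappa> ^ (J - 2) \<le> norm \<kappa> ^ J'"
        using * \<delta>5 \<delta>4 by (intro power_decreasing) (auto simp: half_disc_def)
      then have "(B * E * (2 * n * B)) * norm \<kappa> ^ (J - 2) \<le> (B * E * (2 * n * B)) * norm \<kappa> ^ J'"
        using B E by (intro mult_left_mono) (auto simp: n_def)
      from order_trans[OF bd[OF *(2)] this]
      show "norm (\<kappa>\<^sup>2 * (X \<kappa> i j - Y \<kappa> i j) - (\<Sum>j<J'. scaleC (\<kappa> ^ j) 0)) \<le> B * E * (2 * n * B) * 1 * (1 * norm \<kappa>) ^ J'"
        by (simp only: scaleC_zero_right sum.neutral_const diff_zero mult_1 mult_1_right)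
    qed (use B E in \<open>auto simp: n_def\<close>)
    show "gexp \<delta>5 (J - 2) (\<lambda>_::unit. 1) (\<lambda>_. 1) (\<lambda>_ \<kappa>. \<kappa>\<^sup>2 * X \<kappa> i j)"
      unfolding eq by (rule gexp_add[OF gexp_restrict[OF Yexp[OF ij] order_refl \<delta>5(2)] 2])
  qed (use X \<delta>5 \<delta>4 in auto)
qed

section \<open>Square-summable functions\<close>

text \<open>Estimates are kept for the square of the norm; a factor 2 replaces the triangle
  inequality.\<close>

definition sqn :: "('g \<Rightarrow> complex) \<Rightarrow> real" where
  "sqn u = (\<Sum>\<^sub>\<infinity>x. (norm (u x))\<^sup>2)"

definition delta :: "'g \<Rightarrow> 'g \<Rightarrow> complex" where
  "delta y = (\<lambda>x. if x = y then 1 else 0)"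

lemma ell2_norm_sqn: "ell2_norm u = sqrt (sqn u)"
  by (simp add: ell2_norm_def sqn_def)

lemma sqn_nonneg [simp]: "0 \<le> sqn u"
  unfolding sqn_def by (intro infsum_nonneg) auto

lemma ell2_summable: "u \<in> ell2 \<longleftrightarrow> (\<lambda>x. (norm (u x))\<^sup>2) summable_on UNIV"
  by (simp add: ell2_def)

lemma ell2_bound:
  assumes "(\<lambda>x. f x) summable_on UNIV" "\<And>x. (norm (u x))\<^sup>2 \<le> f x"
  shows "u \<in> ell2" "sqn u \<le> infsum f UNIV"
proof -
  show *: "u \<in> ell2" unfolding ell2_summable by (rule summable_on_comparison_test[OF assms]) auto
  show "sqn u \<le> infsum f UNIV" unfolding sqn_def
    by (rule infsum_mono) (use * assms in \<open>auto simp: ell2_summable\<close>)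
qed

lemma norm_add_sq: "(norm (a + b :: complex))\<^sup>2 \<le> 2 * (norm a)\<^sup>2 + 2 * (norm b)\<^sup>2"
proof -
  have "(norm (a + b))\<^sup>2 \<le> (norm a + norm b)\<^sup>2" by (intro power_mono norm_triangle_ineq) auto
  also have "\<dots> \<le> 2 * (norm a)\<^sup>2 + 2 * (norm b)\<^sup>2"
    using sum_squares_bound[of "norm a" "norm b"] by (simp add: power2_sum)
  finally show ?thesis .
qed

lemma ell2_add:
  assumes "u \<in> ell2" "w \<in> ell2"
  shows "(\<lambda>x. u x + w x) \<in> ell2" "sqn (\<lambda>x. u x + w x) \<le> 2 * sqn u + 2 * sqn w"
proof -
  have 1: "(\<lambda>x. 2 * (norm (u x))\<^sup>2) summable_on UNIV" "(\<lambda>x. 2 * (norm (w x))\<^sup>2) summable_on UNIV"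
    using assms by (auto simp: ell2_summable intro: summable_on_cmult_right)
  note b = ell2_bound[OF summable_on_add[OF 1], of "\<lambda>x. u x + w x", OF norm_add_sq]
  show "(\<lambda>x. u x + w x) \<in> ell2" by (rule b)
  show "sqn (\<lambda>x. u x + w x) \<le> 2 * sqn u + 2 * sqn w"
    using b(2) unfolding infsum_add[OF 1] by (simp add: sqn_def infsum_cmult_right')
qed

lemma ell2_scale:
  shows "u \<in> ell2 \<Longrightarrow> (\<lambda>x. c * u x) \<in> ell2" "sqn (\<lambda>x. c * u x) = (norm c)\<^sup>2 * sqn u"
  by (auto simp: ell2_summable sqn_def norm_mult power_mult_distrib infsum_cmult_right'
      intro: summable_on_cmult_right)

lemma ell2_diff:
  assumes "u \<in> ell2" "w \<in> ell2"
  shows "(\<lambda>x. u x - w x) \<in> ell2" "sqn (\<lambda>x. u x - w x) \<le> 2 * sqn u + 2 * sqn w"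
  using ell2_add[OF assms(1) ell2_scale(1)[OF assms(2), of "-1"]] ell2_scale(2)[of "-1" w] by simp_all

lemma ell2_finite_support:
  assumes "finite A" "\<And>x. x \<notin> A \<Longrightarrow> u x = 0"
  shows "u \<in> ell2"
  unfolding ell2_summable
  by (rule finite_nonzero_values_imp_summable_on) (rule finite_subset[OF _ assms(1)], use assms(2) in auto)

lemma ell2_zero [simp]: "(\<lambda>x. 0) \<in> ell2"
  by (simp add: ell2_summable)

lemma ell2_delta [simp]: "delta y \<in> ell2"
  by (rule ell2_finite_support[of "{y}"]) (auto simp: delta_def)

lemma ell2_sum:
  assumes "finite A" "\<And>i. i \<in> A \<Longrightarrow> f i \<in> ell2"
  shows "(\<lambda>x. \<Sum>i\<in>A. f i x) \<in> ell2"
  using assms by (induction A) (auto intro: ell2_add)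

lemma norm_le_sqn:
  assumes "u \<in> ell2"
  shows "(norm (u x))\<^sup>2 \<le> sqn u"
  using finite_sum_le_infsum[of "\<lambda>x. (norm (u x))\<^sup>2" UNIV "{x}"] assms by (simp add: sqn_def ell2_summable)

lemma l1_imp_ell2:
  assumes "(\<lambda>x. norm (u x)) summable_on UNIV"
  shows "u \<in> ell2" "sqn u \<le> (\<Sum>\<^sub>\<infinity>x. norm (u x))\<^sup>2"
proof -
  define N where "N = (\<Sum>\<^sub>\<infinity>x. norm (u x))"
  have le: "norm (u x) \<le> N" for x
    using finite_sum_le_infsum[of "\<lambda>x. norm (u x)" UNIV "{x}"] assms by (simp add: N_def)
  have s: "(\<lambda>x. N * norm (u x)) summable_on UNIV" using assms by (rule summable_on_cmult_right)
  note b = ell2_bound[OF s, of u]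
  have l: "(norm (u x))\<^sup>2 \<le> N * norm (u x)" for x
    using le[of x] by (simp add: power2_eq_square mult_right_mono)
  show "u \<in> ell2" by (rule b(1)[OF l])
  show "sqn u \<le> N\<^sup>2" using b(2)[OF l] by (simp add: infsum_cmult_right' N_def power2_eq_square)
qed

lemma mult_le_sq_add:
  fixes a b :: real
  assumes "0 \<le> a" "0 \<le> b"
  shows "a * b \<le> a\<^sup>2 + b\<^sup>2"
  using sum_squares_bound[of a b] mult_nonneg_nonneg[OF assms] by linarith

lemma ell2_pairing_summable:
  assumes "u \<in> ell2" "w \<in> ell2"
  shows "(\<lambda>x. norm (cnj (u x) * w x)) summable_on UNIV"
proof -
  have "(\<lambda>x. (norm (u x))\<^sup>2 + (norm (w x))\<^sup>2) summable_on UNIV"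
    using assms by (auto simp: ell2_summable intro: summable_on_add)
  then show ?thesis
  proof (rule summable_on_comparison_test)
    show "norm (cnj (u x) * w x) \<le> (norm (u x))\<^sup>2 + (norm (w x))\<^sup>2" for x
      by (simp add: norm_mult mult_le_sq_add)
  qed auto
qed

lemma pairing_cnj: "pairing w u = cnj (pairing u w)"
proof -
  have "pairing w u = (\<Sum>\<^sub>\<infinity>x. cnj (cnj (u x) * w x))"
    unfolding pairing_def by (intro infsum_cong) simp
  also have "\<dots> = cnj (\<Sum>\<^sub>\<infinity>x. cnj (u x) * w x)" by (rule infsum_cnj)
  finally show ?thesis unfolding pairing_def .
qed

lemma pairing_add_right:
  assumes "(\<lambda>x. norm (cnj (u x) * f x)) summable_on UNIV" "(\<lambda>x. norm (cnj (u x) * g x)) summable_on UNIV"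
  shows "pairing u (\<lambda>x. f x + g x) = pairing u f + pairing u g"
  unfolding pairing_def distrib_left
  by (rule infsum_add[OF abs_summable_summable[OF assms(1)] abs_summable_summable[OF assms(2)]])

lemma pairing_scale_right: "pairing u (\<lambda>x. c * f x) = c * pairing u f"
  unfolding pairing_def by (simp add: mult.left_commute infsum_cmult_right')

lemma pairing_scale_left: "pairing (\<lambda>x. c * u x) f = cnj c * pairing u f"
  unfolding pairing_def by (simp add: mult.assoc infsum_cmult_right')

lemma pairing_diff_right:
  assumes "(\<lambda>x. norm (cnj (u x) * f x)) summable_on UNIV" "(\<lambda>x. norm (cnj (u x) * g x)) summable_on UNIV"
  shows "pairing u (\<lambda>x. f x - g x) = pairing u f - pairing u g"
  using pairing_add_right[of u f "\<lambda>x. - 1 * g x"] pairing_scale_right[of u "-1" g] assms by simp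

lemma pairing_delta_left [simp]: "pairing (delta x) u = u x"
proof -
  have "pairing (delta x) u = (\<Sum>\<^sub>\<infinity>y\<in>{x}. u y)"
    unfolding pairing_def by (rule infsum_cong_neutral) (auto simp: delta_def)
  then show ?thesis by simp
qed

lemma pairing_self: "u \<in> ell2 \<Longrightarrow> pairing u u = of_real (sqn u)"
  unfolding pairing_def sqn_def ell2_summable
  by (intro infsumI) (simp add: complex_norm_square[symmetric] mult.commute[of "cnj _"] has_sum_of_real del: of_real_power)

lemma sqn_eq_0: "u \<in> ell2 \<Longrightarrow> sqn u = 0 \<Longrightarrow> u x = 0"
  using norm_le_sqn[of u x] by simp

text \<open>A weighted arithmetic-geometric inequality in place of Cauchy-Schwarz; the free
  parameter \<open>e\<close> lets one of the two terms be absorbed.\<close>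

lemma norm_pairing_le:
  assumes "u \<in> ell2" "w \<in> ell2" "0 < e"
  shows "norm (pairing u w) \<le> e / 2 * sqn u + 1 / (2 * e) * sqn w"
proof -
  have s: "(\<lambda>x. e / 2 * (norm (u x))\<^sup>2) summable_on UNIV" "(\<lambda>x. 1 / (2 * e) * (norm (w x))\<^sup>2) summable_on UNIV"
    using assms by (simp_all only: ell2_summable summable_on_cmult_right)
  have le: "norm (cnj (u x) * w x) \<le> e / 2 * (norm (u x))\<^sup>2 + 1 / (2 * e) * (norm (w x))\<^sup>2" for x
  proof -
    have "0 \<le> (e * norm (u x) - norm (w x))\<^sup>2" by simp
    then have "2 * e * (norm (u x) * norm (w x)) \<le> 2 * e * (e / 2 * (norm (u x))\<^sup>2 + 1 / (2 * e) * (norm (w x))\<^sup>2)"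
      using assms by (simp add: power2_diff algebra_simps power2_eq_square)
    then show ?thesis using assms by (simp add: norm_mult)
  qed
  have "norm (pairing u w) \<le> (\<Sum>\<^sub>\<infinity>x. norm (cnj (u x) * w x))"
    unfolding pairing_def by (rule norm_infsum_bound[OF ell2_pairing_summable[OF assms(1,2)]])
  also have "\<dots> \<le> (\<Sum>\<^sub>\<infinity>x. e / 2 * (norm (u x))\<^sup>2 + 1 / (2 * e) * (norm (w x))\<^sup>2)"
    by (rule infsum_mono[OF ell2_pairing_summable[OF assms(1,2)] summable_on_add[OF s] le])
  also have "\<dots> = e / 2 * sqn u + 1 / (2 * e) * sqn w"
    unfolding infsum_add[OF s] by (simp only: sqn_def infsum_cmult_right')
  finally show ?thesis .
qed

section \<open>Symmetric kernels and the Schur test\<close>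

definition kop :: "('g \<Rightarrow> 'g \<Rightarrow> complex) \<Rightarrow> ('g \<Rightarrow> complex) \<Rightarrow> 'g \<Rightarrow> complex" where
  "kop k u x = (\<Sum>\<^sub>\<infinity>y. k x y * u y)"

text \<open>The kernels are symmetric rather than Hermitian, as Green functions at complex \<kappa>
  are, so a bound on row sums is also one on column sums. Positivity of \<open>C\<close> permits
  division by it.\<close>

definition schur :: "('g \<Rightarrow> 'g \<Rightarrow> complex) \<Rightarrow> real \<Rightarrow> bool" where
  "schur k C \<longleftrightarrow> 0 < C \<and> (\<forall>x y. k x y = k y x) \<and>
     (\<forall>x. (\<lambda>y. norm (k x y)) summable_on UNIV \<and> (\<Sum>\<^sub>\<infinity>y. norm (k x y)) \<le> C)"

lemma schur_product_summable:
  assumes "schur k C" "u \<in> ell2"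
  shows "(\<lambda>(x, y). norm (k x y) * (norm (u y))\<^sup>2) summable_on UNIV \<times> UNIV"
    "(\<Sum>\<^sub>\<infinity>x. \<Sum>\<^sub>\<infinity>y. norm (k x y) * (norm (u y))\<^sup>2) \<le> C * sqn u"
    "(\<lambda>(x, y). norm (k x y) * (norm (u x))\<^sup>2) summable_on UNIV \<times> UNIV"
proof -
  have k: "(\<lambda>y. norm (k x y)) summable_on UNIV" "(\<Sum>\<^sub>\<infinity>y. norm (k x y)) \<le> C" "k x y = k y x" for x y
    using assms by (auto simp: schur_def)
  have hs: "((\<lambda>x. norm (k y x) * (norm (u y))\<^sup>2) has_sum (\<Sum>\<^sub>\<infinity>x. norm (k y x)) * (norm (u y))\<^sup>2) UNIV" for y
    by (intro has_sum_cmult_left has_sum_infsum k)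
  have s: "(\<lambda>y. C * (norm (u y))\<^sup>2) summable_on UNIV"
    using assms by (auto simp: ell2_summable intro: summable_on_cmult_right)
  have s2: "(\<lambda>y. (\<Sum>\<^sub>\<infinity>x. norm (k y x)) * (norm (u y))\<^sup>2) summable_on UNIV"
    by (rule summable_on_comparison_test[OF s]) (auto intro!: mult_right_mono k infsum_nonneg mult_nonneg_nonneg)
  show S: "(\<lambda>(y, x). norm (k y x) * (norm (u y))\<^sup>2) summable_on UNIV \<times> UNIV"
    by (rule summable_on_SigmaI[OF _ s2]) (use hs in auto)
  have "(\<lambda>(y, x). norm (k y x) * (norm (u y))\<^sup>2) = (\<lambda>(y, x). (\<lambda>(x, y). norm (k x y) * (norm (u y))\<^sup>2) (x, y))"
  proof (rule ext)
    fix z :: "'a \<times> 'a"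
    show "(\<lambda>(y, x). norm (k y x) * (norm (u y))\<^sup>2) z = (\<lambda>(y, x). (\<lambda>(x, y). norm (k x y) * (norm (u y))\<^sup>2) (x, y)) z"
      using k(3)[of "fst z" "snd z"] by (simp add: case_prod_unfold)
  qed
  then show S': "(\<lambda>(x, y). norm (k x y) * (norm (u y))\<^sup>2) summable_on UNIV \<times> UNIV"
    using S summable_on_swap[of "\<lambda>(x, y). norm (k x y) * (norm (u y))\<^sup>2" UNIV UNIV] by simp
  have "(\<Sum>\<^sub>\<infinity>x. \<Sum>\<^sub>\<infinity>y. norm (k x y) * (norm (u y))\<^sup>2) = (\<Sum>\<^sub>\<infinity>y. \<Sum>\<^sub>\<infinity>x. norm (k x y) * (norm (u y))\<^sup>2)"
    by (rule infsum_swap_banach[OF S'])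
  also have "\<dots> = (\<Sum>\<^sub>\<infinity>y. (\<Sum>\<^sub>\<infinity>x. norm (k y x)) * (norm (u y))\<^sup>2)"
  proof (intro infsum_cong)
    fix y
    have "(\<lambda>x. norm (k x y) * (norm (u y))\<^sup>2) = (\<lambda>x. norm (k y x) * (norm (u y))\<^sup>2)"
      by (rule ext, subst k(3), rule refl)
    then show "(\<Sum>\<^sub>\<infinity>x. norm (k x y) * (norm (u y))\<^sup>2) = (\<Sum>\<^sub>\<infinity>x. norm (k y x)) * (norm (u y))\<^sup>2"
      by (simp add: infsum_cmult_left')
  qed
  also have "\<dots> \<le> (\<Sum>\<^sub>\<infinity>y. C * (norm (u y))\<^sup>2)"
    by (intro infsum_mono s s2 mult_right_mono k) auto
  finally show "(\<Sum>\<^sub>\<infinity>x. \<Sum>\<^sub>\<infinity>y. norm (k x y) * (norm (u y))\<^sup>2) \<le> C * sqn u"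
    by (simp add: sqn_def infsum_cmult_right')
qed

lemma schur_row_summable:
  assumes "schur k C" "\<And>y. norm (u y) \<le> B"
  shows "(\<lambda>y. norm (k x y * u y)) summable_on UNIV"
proof (rule summable_on_comparison_test)
  show "(\<lambda>y. norm (k x y) * B) summable_on UNIV"
    using assms unfolding schur_def by (intro summable_on_cmult_left) blast
qed (use assms in \<open>auto simp: norm_mult intro!: mult_left_mono\<close>)

lemma schur_row_summable_ell2:
  assumes "schur k C" "u \<in> ell2"
  shows "(\<lambda>y. norm (k x y * u y)) summable_on UNIV"
proof (rule schur_row_summable[OF assms(1)])
  show "norm (u y) \<le> sqrt (sqn u)" for y using norm_le_sqn[OF assms(2), of y] by (rule real_le_rsqrt)
qed

lemma schur_ell2:
  assumes k: "schur k C" and u: "u \<in> ell2"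
  shows "kop k u \<in> ell2" "sqn (kop k u) \<le> C\<^sup>2 * sqn u"
proof -
  have C: "0 < C" and kr: "(\<lambda>y. norm (k x y)) summable_on UNIV" "(\<Sum>\<^sub>\<infinity>y. norm (k x y)) \<le> C" for x
    using k by (auto simp: schur_def)
  note S = schur_product_summable[OF k u]
  have row: "(\<lambda>y. norm (k x y) * (norm (u y))\<^sup>2) summable_on UNIV" for x
    using summable_on_SigmaD1[of "\<lambda>x y. norm (k x y) * (norm (u y))\<^sup>2" UNIV "\<lambda>_. UNIV" x] S(1) by simp
  have outer: "(\<lambda>x. \<Sum>\<^sub>\<infinity>y. norm (k x y) * (norm (u y))\<^sup>2) summable_on UNIV"
    using summable_on_Sigma_banach[OF S(1)] by simp
  have le: "(norm (kop k u x))\<^sup>2 \<le> C * (\<Sum>\<^sub>\<infinity>y. norm (k x y) * (norm (u y))\<^sup>2)" for x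
  proof -
    define m where "m = (\<Sum>\<^sub>\<infinity>y. norm (k x y) * norm (u y))"
    define q where "q = (\<Sum>\<^sub>\<infinity>y. norm (k x y) * (norm (u y))\<^sup>2)"
    have sm: "(\<lambda>y. norm (k x y) * norm (u y)) summable_on UNIV"
      using schur_row_summable_ell2[OF k u] by (simp add: norm_mult)
    have "norm (kop k u x) \<le> m"
      using norm_infsum_bound[OF schur_row_summable_ell2[OF k u, of x]] by (simp add: kop_def m_def norm_mult)
    then have "(norm (kop k u x))\<^sup>2 \<le> m\<^sup>2" by (intro power_mono) auto
    also have "m\<^sup>2 \<le> C * q"
    proof -
      \<comment> \<open>The optimal parameter in 2 t m \<le> q + t^2 C; it yields m^2 \<le> C q
        without a square root.\<close>
      define t where "t = m / C"
      have "2 * t * m = (\<Sum>\<^sub>\<infinity>y. 2 * t * (norm (k x y) * norm (u y)))" by (simp add: m_def infsum_cmult_right')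
      also have "\<dots> \<le> (\<Sum>\<^sub>\<infinity>y. norm (k x y) * (norm (u y))\<^sup>2 + t\<^sup>2 * norm (k x y))"
      proof (rule infsum_mono)
        fix y
        have "0 \<le> norm (k x y) * (norm (u y) - t)\<^sup>2" by simp
        then show "2 * t * (norm (k x y) * norm (u y)) \<le> norm (k x y) * (norm (u y))\<^sup>2 + t\<^sup>2 * norm (k x y)"
          by (simp add: power2_diff algebra_simps)
      qed (auto intro!: summable_on_add summable_on_cmult_right sm row kr)
      also have "\<dots> = q + t\<^sup>2 * (\<Sum>\<^sub>\<infinity>y. norm (k x y))"
        by (subst infsum_add) (auto intro!: summable_on_cmult_right row kr simp: q_def infsum_cmult_right')
      also have "\<dots> \<le> q + t\<^sup>2 * C" by (intro add_left_mono mult_left_mono kr) auto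
      finally have "2 * (m\<^sup>2 / C) \<le> q + m\<^sup>2 / C" unfolding t_def using C by (simp add: power2_eq_square)
      then have "m\<^sup>2 / C \<le> q" by linarith
      then show ?thesis using C by (simp add: pos_divide_le_eq mult.commute)
    qed
    finally show ?thesis by (simp add: q_def)
  qed
  have s: "(\<lambda>x. C * (\<Sum>\<^sub>\<infinity>y. norm (k x y) * (norm (u y))\<^sup>2)) summable_on UNIV"
    by (intro summable_on_cmult_right outer)
  show "kop k u \<in> ell2" by (rule ell2_bound(1)[OF s le])
  have "sqn (kop k u) \<le> C * (\<Sum>\<^sub>\<infinity>x. \<Sum>\<^sub>\<infinity>y. norm (k x y) * (norm (u y))\<^sup>2)"
    using ell2_bound(2)[OF s le] by (simp add: infsum_cmult_right')
  also have "\<dots> \<le> C * (C * sqn u)" using S(2) C by simp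
  finally show "sqn (kop k u) \<le> C\<^sup>2 * sqn u" by (simp add: power2_eq_square)
qed

text \<open>The adjoint kernel is the conjugate transpose, which by symmetry is the plain conjugate.
  Absolute convergence of the double sum justifies the exchange.\<close>

lemma schur_pairing:
  assumes k: "schur k C" and u: "u \<in> ell2" and w: "w \<in> ell2"
  shows "pairing u (kop k w) = pairing (kop (\<lambda>x y. cnj (k x y)) u) w"
proof -
  have ksym: "k x y = k y x" for x y using k by (auto simp: schur_def)
  have 1: "(\<lambda>(x, y). norm (k x y) * (norm (w y))\<^sup>2) summable_on UNIV \<times> UNIV"
    by (rule schur_product_summable[OF k w])
  have 2: "(\<lambda>(x, y). norm (k x y) * (norm (u x))\<^sup>2) summable_on UNIV \<times> UNIV"
    by (rule schur_product_summable[OF k u])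
  have S: "(\<lambda>z. norm ((\<lambda>(x, y). cnj (u x) * (k x y * w y)) z)) summable_on UNIV \<times> UNIV"
  proof (rule summable_on_comparison_test[OF summable_on_add[OF 2 1]])
    fix z :: "'a \<times> 'a"
    obtain x y where z: "z = (x, y)" by (cases z)
    have "norm (u x) * norm (w y) \<le> (norm (u x))\<^sup>2 + (norm (w y))\<^sup>2"
      by (rule mult_le_sq_add) auto
    from mult_left_mono[OF this, of "norm (k x y)"]
    show "norm ((\<lambda>(x, y). cnj (u x) * (k x y * w y)) z)
      \<le> (\<lambda>(x, y). norm (k x y) * (norm (u x))\<^sup>2) z + (\<lambda>(x, y). norm (k x y) * (norm (w y))\<^sup>2) z"
      unfolding z by (simp add: norm_mult algebra_simps)
  qed auto
  have "pairing u (kop k w) = (\<Sum>\<^sub>\<infinity>x. \<Sum>\<^sub>\<infinity>y. cnj (u x) * (k x y * w y))"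
    by (simp add: pairing_def kop_def infsum_cmult_right')
  also have "\<dots> = (\<Sum>\<^sub>\<infinity>y. \<Sum>\<^sub>\<infinity>x. cnj (u x) * (k x y * w y))"
    by (rule infsum_swap_banach[OF abs_summable_summable[OF S]])
  also have "\<dots> = (\<Sum>\<^sub>\<infinity>y. (\<Sum>\<^sub>\<infinity>x. k y x * cnj (u x)) * w y)"
  proof (intro infsum_cong)
    fix y
    have "(\<lambda>x. cnj (u x) * (k x y * w y)) = (\<lambda>x. (k y x * cnj (u x)) * w y)"
      by (rule ext, subst ksym) (simp only: mult_ac)
    then show "(\<Sum>\<^sub>\<infinity>x. cnj (u x) * (k x y * w y)) = (\<Sum>\<^sub>\<infinity>x. k y x * cnj (u x)) * w y"
      by (simp only: infsum_cmult_left')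
  qed
  also have "\<dots> = pairing (kop (\<lambda>x y. cnj (k x y)) u) w"
  proof -
    have "cnj (kop (\<lambda>x y. cnj (k x y)) u y) = (\<Sum>\<^sub>\<infinity>x. k y x * cnj (u x))" for y
    proof -
      have "(\<Sum>\<^sub>\<infinity>x. k y x * cnj (u x)) = (\<Sum>\<^sub>\<infinity>x. cnj (cnj (k y x) * u x))"
        by (intro infsum_cong) simp
      also have "\<dots> = cnj (\<Sum>\<^sub>\<infinity>x. cnj (k y x) * u x)" by (rule infsum_cnj)
      finally show ?thesis unfolding kop_def by (rule sym)
    qed
    then show ?thesis by (simp only: pairing_def)
  qed
  finally show ?thesis .
qed

section \<open>Weighted spaces and the free operator\<close>

abbreviation wt :: "('k, 'a) vertex \<Rightarrow> real" where
  "wt \<equiv> weight 1"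

lemma weight_ge_1: "0 \<le> s \<Longrightarrow> 1 \<le> weight s x"
  by (cases x) (auto intro!: ge_one_powr_ge_zero)

lemma wt_ge_1: "1 \<le> wt x" by (simp add: weight_ge_1)

lemma wt_pos: "0 < wt x" using wt_ge_1[of x] by linarith

lemma wt_nonneg: "0 \<le> wt x" using wt_ge_1[of x] by linarith

text \<open>Integer exponents turn all weights into powers of one function, so that estimates become
  power arithmetic.\<close>

lemma weight_nat: "weight (real n) x = wt x ^ n"
proof (cases x)
  case (Ray \<alpha> m)
  have "0 < 1 + (real m + 1)\<^sup>2" by (simp add: add_pos_nonneg)
  then have "((1 + (real m + 1)\<^sup>2) powr (1/2)) ^ n = ((1 + (real m + 1)\<^sup>2) powr (1/2)) powr real n"
    by (intro powr_realpow[symmetric]) simp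
  then show ?thesis by (simp add: Ray powr_powr)
qed simp

lemma weight_minus: "weight (- s) x = 1 / weight s x"
  by (cases x) (auto simp: powr_minus divide_simps)

text \<open>The vertex \<open>Ray \<alpha> m\<close> is the point m + 1, which is what its weight is
  comparable with.\<close>

lemma wt_Ray: "real m + 1 \<le> wt (Ray \<alpha> m)" "wt (Ray \<alpha> m) \<le> 2 * (real m + 1)"
proof -
  have eq: "wt (Ray \<alpha> m) = sqrt (1 + (real m + 1)\<^sup>2)"
    by (simp add: powr_half_sqrt add_nonneg_nonneg)
  show "real m + 1 \<le> wt (Ray \<alpha> m)" unfolding eq by (rule real_le_rsqrt) simp
  have "1 + (real m + 1)\<^sup>2 \<le> (2 * (real m + 1))\<^sup>2" by (simp add: power2_eq_square algebra_simps)
  then show "wt (Ray \<alpha> m) \<le> 2 * (real m + 1)" unfolding eq by (intro real_le_lsqrt) auto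
qed

lemma wt_power_mono: "m \<le> n \<Longrightarrow> wt x ^ m \<le> wt x ^ n"
  by (intro power_increasing wt_ge_1)

lemma l1w_nat: "u \<in> l1w (real n) \<longleftrightarrow> (\<lambda>x. wt x ^ n * norm (u x)) summable_on UNIV"
  by (simp add: l1w_def weight_nat)

lemma l1w_norm_nat: "l1w_norm (real n) u = (\<Sum>\<^sub>\<infinity>x. wt x ^ n * norm (u x))"
  by (simp add: l1w_norm_def weight_nat)

lemma l1w_norm_nonneg: "0 \<le> l1w_norm (real n) u"
  unfolding l1w_norm_nat by (intro infsum_nonneg mult_nonneg_nonneg zero_le_power wt_nonneg) auto

lemma linfw_nat: "u \<in> linfw (real n) \<longleftrightarrow> (\<exists>A. \<forall>x. norm (u x) \<le> A * wt x ^ n)"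
proof -
  have "weight (- real n) x * norm (u x) \<le> A \<longleftrightarrow> norm (u x) \<le> A * wt x ^ n" for x A
    using wt_pos[of x] by (simp add: weight_minus weight_nat pos_divide_le_eq)
  then show ?thesis unfolding linfw_def bdd_above_def by auto
qed

lemma linfwI: "(\<And>x. norm (u x) \<le> A * wt x ^ n) \<Longrightarrow> u \<in> linfw (real n)"
  unfolding linfw_nat by blast

lemma linfwE:
  fixes u :: "('k, 'a) gfun"
  assumes "u \<in> linfw (real n)"
  obtains A where "0 \<le> A" "\<And>x. norm (u x) \<le> A * wt x ^ n"
proof -
  from assms obtain A where A: "\<And>x. norm (u x) \<le> A * wt x ^ n" unfolding linfw_nat by blast
  have "0 \<le> A * wt (undefined :: ('k, 'a) vertex) ^ n" by (rule order_trans[OF norm_ge_zero A])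
  moreover have "0 < wt (undefined :: ('k, 'a) vertex) ^ n" by (intro zero_less_power wt_pos)
  ultimately have "0 \<le> A" by (metis linorder_not_le mult_neg_pos)
  then show ?thesis using that A by blast
qed

lemma linfw_norm_le:
  assumes "\<And>x. norm (u x) \<le> A * wt x ^ n"
  shows "linfw_norm (real n) u \<le> A"
  unfolding linfw_norm_def
proof (rule cSUP_least)
  show "weight (- real n) x * norm (u x) \<le> A" for x
    using assms[of x] wt_pos[of x] by (simp add: weight_minus weight_nat pos_divide_le_eq)
qed simp

lemma linfw_norm_nonneg: "u \<in> linfw (real n) \<Longrightarrow> 0 \<le> linfw_norm (real n) u"
  unfolding linfw_norm_def linfw_def mem_Collect_eq
  by (erule cSUP_upper2[of _ _ undefined]) (simp_all add: weight_minus weight_nat wt_nonneg)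

lemma linfw_norm_bound:
  assumes "u \<in> linfw (real n)"
  shows "norm (u x) \<le> linfw_norm (real n) u * wt x ^ n"
proof -
  have "weight (- real n) x * norm (u x) \<le> linfw_norm (real n) u"
    unfolding linfw_norm_def using assms by (intro cSUP_upper) (auto simp: linfw_def)
  then show ?thesis using wt_pos[of x] by (simp add: weight_minus weight_nat pos_divide_le_eq)
qed

lemma l1w_mono:
  assumes "u \<in> l1w (real n)" "m \<le> n"
  shows "u \<in> l1w (real m)"
  using assms unfolding l1w_nat
  by (elim summable_on_comparison_test)
    (auto intro!: mult_right_mono wt_power_mono mult_nonneg_nonneg zero_le_power wt_nonneg)

lemma l1w_l1: "u \<in> l1w (real n) \<Longrightarrow> (\<lambda>x. norm (u x)) summable_on UNIV"
  using l1w_mono[of u n 0] l1w_nat[of u 0] by simp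

lemma l1w_ell2: "u \<in> l1w (real n) \<Longrightarrow> u \<in> ell2"
  by (rule l1_imp_ell2[OF l1w_l1])

lemma linfw_mono: "u \<in> linfw (real m) \<Longrightarrow> m \<le> n \<Longrightarrow> u \<in> linfw (real n)"
proof (elim linfwE, rule linfwI)
  fix A x assume "0 \<le> A" "\<And>x. norm (u x) \<le> A * wt x ^ m" "m \<le> n"
  then show "norm (u x) \<le> A * wt x ^ n"
    using mult_left_mono[OF wt_power_mono[of m n x], of A] by (meson order_trans)
qed

lemma ell2_linfw: "u \<in> ell2 \<Longrightarrow> norm (u x) \<le> sqrt (sqn u) * wt x ^ n"
proof -
  assume u: "u \<in> ell2"
  have "norm (u x) \<le> sqrt (sqn u) * 1" using norm_le_sqn[OF u, of x] by (simp add: real_le_rsqrt)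
  also have "\<dots> \<le> sqrt (sqn u) * wt x ^ n" by (intro mult_left_mono one_le_power wt_ge_1) auto
  finally show ?thesis .
qed

lemma ell2_in_linfw: "u \<in> ell2 \<Longrightarrow> u \<in> linfw (real n)"
  by (rule linfwI[OF ell2_linfw])

lemma l1w_linfw_product:
  assumes "\<And>x. norm (f x) \<le> A * wt x ^ n" "g \<in> l1w (real n)"
  shows "(\<lambda>x. norm (cnj (f x) * g x)) summable_on UNIV" "norm (pairing f g) \<le> A * l1w_norm (real n) g"
    "(\<lambda>x. norm (cnj (g x) * f x)) summable_on UNIV" "norm (pairing g f) \<le> A * l1w_norm (real n) g"
proof -
  have s: "(\<lambda>x. A * (wt x ^ n * norm (g x))) summable_on UNIV"
    using assms(2) unfolding l1w_nat by (rule summable_on_cmult_right)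
  have le: "norm (cnj (f x) * g x) \<le> A * (wt x ^ n * norm (g x))" for x
    using mult_right_mono[OF assms(1)[of x], of "norm (g x)"] by (simp add: norm_mult mult.assoc)
  show 1: "(\<lambda>x. norm (cnj (f x) * g x)) summable_on UNIV"
    by (rule summable_on_comparison_test[OF s le]) auto
  then show "(\<lambda>x. norm (cnj (g x) * f x)) summable_on UNIV" by (simp add: norm_mult mult.commute)
  have "norm (pairing f g) \<le> (\<Sum>\<^sub>\<infinity>x. norm (cnj (f x) * g x))"
    unfolding pairing_def by (rule norm_infsum_bound[OF 1])
  also have "\<dots> \<le> (\<Sum>\<^sub>\<infinity>x. A * (wt x ^ n * norm (g x)))" by (rule infsum_mono[OF 1 s le])
  also have "\<dots> = A * l1w_norm (real n) g" by (simp add: l1w_norm_nat infsum_cmult_right')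
  finally show "norm (pairing f g) \<le> A * l1w_norm (real n) g" .
  then show "norm (pairing g f) \<le> A * l1w_norm (real n) g" unfolding pairing_cnj[of g f] by simp
qed

lemma l1w_add: "u \<in> l1w (real n) \<Longrightarrow> w \<in> l1w (real n) \<Longrightarrow> (\<lambda>x. u x + w x) \<in> l1w (real n)"
proof -
  assume a: "u \<in> l1w (real n)" "w \<in> l1w (real n)"
  have "(\<lambda>x. wt x ^ n * norm (u x) + wt x ^ n * norm (w x)) summable_on UNIV"
    using a unfolding l1w_nat by (intro summable_on_add)
  then show ?thesis unfolding l1w_nat
  proof (rule summable_on_comparison_test)
    show "wt x ^ n * norm (u x + w x) \<le> wt x ^ n * norm (u x) + wt x ^ n * norm (w x)" for x
      unfolding distrib_left[symmetric]
      by (intro mult_left_mono norm_triangle_ineq zero_le_power wt_nonneg)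
  qed (auto intro!: mult_nonneg_nonneg zero_le_power wt_nonneg)
qed

lemma l1w_scale: "u \<in> l1w (real n) \<Longrightarrow> (\<lambda>x. c * u x) \<in> l1w (real n)"
  unfolding l1w_nat norm_mult mult.left_commute[of _ "norm c"] by (rule summable_on_cmult_right)

lemma l1w_finite_support:
  assumes "finite A" "\<And>x. x \<notin> A \<Longrightarrow> u x = 0"
  shows "u \<in> l1w (real n)"
  unfolding l1w_nat
  by (rule finite_nonzero_values_imp_summable_on) (rule finite_subset[OF _ assms(1)], use assms(2) in auto)

lemma linfw_lin:
  assumes "u \<in> linfw (real n)" "w \<in> linfw (real n)"
  shows "(\<lambda>x. u x + c * w x) \<in> linfw (real n)"
proof -
  from assms(1) obtain A where A: "0 \<le> A" "\<And>x. norm (u x) \<le> A * wt x ^ n" by (rule linfwE) (rule that)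
  from assms(2) obtain B where B: "0 \<le> B" "\<And>x. norm (w x) \<le> B * wt x ^ n" by (rule linfwE) (rule that)
  show ?thesis
  proof (rule linfwI)
    fix x
    have "norm (u x + c * w x) \<le> norm (u x) + norm c * norm (w x)"
      using norm_triangle_ineq[of "u x" "c * w x"] by (simp add: norm_mult)
    also have "\<dots> \<le> A * wt x ^ n + norm c * (B * wt x ^ n)"
      by (intro add_mono A B mult_left_mono) auto
    finally show "norm (u x + c * w x) \<le> (A + norm c * B) * wt x ^ n" by (simp add: algebra_simps)
  qed
qed

lemma UNIV_vertex: "(UNIV :: ('k, 'a) vertex set) = range Core \<union> (\<Union>\<alpha>. range (Ray \<alpha>))"
proof -
  have "x \<in> range Core \<union> (\<Union>\<alpha>. range (Ray \<alpha>))" for x :: "('k, 'a) vertex" by (cases x) auto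
  then show ?thesis by auto
qed

lemma has_sum_vertex:
  fixes f :: "('k::finite, 'a::finite) vertex \<Rightarrow> 'b::{real_normed_vector}"
  assumes "\<And>\<alpha>. ((\<lambda>m. f (Ray \<alpha> m)) has_sum S \<alpha>) UNIV"
  shows "(f has_sum ((\<Sum>x\<in>UNIV. f (Core x)) + (\<Sum>\<alpha>\<in>UNIV. S \<alpha>))) UNIV"
proof -
  have 1: "(f has_sum (\<Sum>x\<in>UNIV. f (Core x))) (range Core)"
    by (rule has_sum_finiteI) (auto simp: sum.reindex inj_on_def)
  have 2: "(f has_sum S \<alpha>) (range (Ray \<alpha>))" for \<alpha>
    using assms[of \<alpha>] by (subst has_sum_reindex) (auto simp: inj_on_def o_def)
  have 3: "(f has_sum (\<Sum>\<alpha>\<in>UNIV. S \<alpha>)) (\<Union>\<alpha>\<in>UNIV. range (Ray \<alpha>))"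
    by (rule sum_has_sum) (use 2 in auto)
  show ?thesis unfolding UNIV_vertex by (rule has_sum_Un_disjoint[OF 1 3]) auto
qed

lemma summable_vertex:
  fixes f :: "('k::finite, 'a::finite) vertex \<Rightarrow> real"
  assumes "\<And>\<alpha>. summable (\<lambda>m. f (Ray \<alpha> m))" "\<And>x. 0 \<le> f x"
  shows "f summable_on UNIV"
proof -
  have "(\<lambda>m. f (Ray \<alpha> m)) summable_on UNIV" for \<alpha>
    using assms summable_on_UNIV_nonneg_real_iff[of "\<lambda>m. f (Ray \<alpha> m)"] by auto
  from has_sum_vertex[of f, OF has_sum_infsum[OF this]] show ?thesis by (rule has_sum_imp_summable)
qed

lemma summable_on_ray:
  fixes f :: "('k, 'a) vertex \<Rightarrow> 'b::banach"
  assumes "f summable_on UNIV"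
  shows "(\<lambda>m. f (Ray \<alpha> m)) summable_on UNIV"
proof -
  have "f summable_on range (Ray \<alpha>)" using assms by (rule summable_on_subset_banach) auto
  then show ?thesis by (subst (asm) summable_on_reindex) (auto simp: inj_on_def o_def)
qed

text \<open>The finite core never affects summability, so only the half-lines have to be
  inspected.\<close>

lemma l1w_Ray_iff:
  fixes u :: "('k::finite, 'a::finite) gfun"
  shows "u \<in> l1w (real n) \<longleftrightarrow> (\<forall>\<alpha>. summable (\<lambda>m. (real m + 1) ^ n * norm (u (Ray \<alpha> m))))"
proof (intro iffI allI)
  fix \<alpha> assume "u \<in> l1w (real n)"
  then have "summable (\<lambda>m. wt (Ray \<alpha> m :: ('k,'a) vertex) ^ n * norm (u (Ray \<alpha> m)))"
    unfolding l1w_nat by (intro summable_on_imp_summable summable_on_ray)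
  then show "summable (\<lambda>m. (real m + 1) ^ n * norm (u (Ray \<alpha> m)))"
    by (rule summable_comparison_test') (auto intro!: mult_right_mono power_mono wt_Ray simp del: weight.simps)
next
  assume *: "\<forall>\<alpha>. summable (\<lambda>m. (real m + 1) ^ n * norm (u (Ray \<alpha> m)))"
  show "u \<in> l1w (real n)" unfolding l1w_nat
  proof (rule summable_vertex)
    fix \<alpha>
    have "summable (\<lambda>m. 2 ^ n * ((real m + 1) ^ n * norm (u (Ray \<alpha> m))))" using * by (intro summable_mult) auto
    then show "summable (\<lambda>m. wt (Ray \<alpha> m :: ('k,'a) vertex) ^ n * norm (u (Ray \<alpha> m)))"
    proof (rule summable_comparison_test')
      fix m
      have le: "wt (Ray \<alpha> m :: ('k,'a) vertex) ^ n \<le> 2 ^ n * (real m + 1) ^ n"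
        unfolding power_mult_distrib[symmetric] by (intro power_mono wt_Ray wt_nonneg)
      then show "norm (wt (Ray \<alpha> m :: ('k,'a) vertex) ^ n * norm (u (Ray \<alpha> m))) \<le> 2 ^ n * ((real m + 1) ^ n * norm (u (Ray \<alpha> m)))"
        using mult_right_mono[OF le, of "norm (u (Ray \<alpha> m))"] wt_nonneg[of "Ray \<alpha> m :: ('k,'a) vertex"]
        by (simp add: mult.assoc del: weight.simps)
    qed
  qed (auto intro!: mult_nonneg_nonneg zero_le_power wt_nonneg)
qed

section \<open>Locality and symmetry of the free operator\<close>

lemma H0_lin: "H0 E0 r (\<lambda>x. u x + c * w x) x = H0 E0 r u x + c * H0 E0 r w x"
proof (cases x)
  case (Core k)
  have "(\<Sum>y | {k, y} \<in> E0. u (Core k) + c * w (Core k) - (u (Core y) + c * w (Core y)))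
    = (\<Sum>y | {k, y} \<in> E0. u (Core k) - u (Core y)) + c * (\<Sum>y | {k, y} \<in> E0. w (Core k) - w (Core y))"
    unfolding sum_distrib_left sum.distrib[symmetric] by (intro sum.cong) (auto simp: algebra_simps)
  moreover have "(\<Sum>\<alpha>\<in>UNIV. (if k = r \<alpha> then 1 else 0) * (u (Core k) + c * w (Core k)))
    = (\<Sum>\<alpha>\<in>UNIV. (if k = r \<alpha> then 1 else 0) * u (Core k)) + c * (\<Sum>\<alpha>\<in>UNIV. (if k = r \<alpha> then 1 else 0) * w (Core k))"
    unfolding sum_distrib_left sum.distrib[symmetric] by (intro sum.cong) (auto simp: algebra_simps)
  ultimately show ?thesis by (simp add: Core algebra_simps)
next
  case (Ray \<alpha> m) then show ?thesis by (cases m) (auto simp: algebra_simps)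
qed

text \<open>The free operator is a direct sum, so a half-line never sees the core. For a core vertex
  the set is generous: only its finiteness and the locality of \<open>H0\<close> matter.\<close>

fun nbhd :: "('k, 'a) vertex \<Rightarrow> ('k, 'a) vertex set" where
  "nbhd (Core x) = range Core"
| "nbhd (Ray \<alpha> 0) = {Ray \<alpha> 0, Ray \<alpha> 1}"
| "nbhd (Ray \<alpha> (Suc m)) = {Ray \<alpha> m, Ray \<alpha> (Suc m), Ray \<alpha> (Suc (Suc m))}"

definition h0 :: "'k::finite set set \<Rightarrow> ('a::finite \<Rightarrow> 'k) \<Rightarrow> ('k, 'a) vertex \<Rightarrow> ('k, 'a) vertex \<Rightarrow> complex" where
  "h0 E0 r x y = H0 E0 r (delta y) x"

lemma finite_nbhd: "finite (nbhd (x :: ('k::finite, 'a) vertex))"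
  by (cases x rule: nbhd.cases) auto

lemma H0_cong: "(\<And>y. y \<in> nbhd x \<Longrightarrow> u y = w y) \<Longrightarrow> H0 E0 r u x = H0 E0 r w x"
  by (cases x rule: nbhd.cases) auto

lemma H0_zero: "H0 E0 r (\<lambda>_. 0) x = 0"
  by (cases x rule: nbhd.cases) auto

lemma H0_sum: "finite A \<Longrightarrow> H0 E0 r (\<lambda>x. \<Sum>y\<in>A. f y * u y x) x = (\<Sum>y\<in>A. f y * H0 E0 r (u y) x)"
proof (induction A rule: finite_induct)
  case (insert a A)
  have "(\<lambda>x. \<Sum>y\<in>insert a A. f y * u y x) = (\<lambda>x. (\<Sum>y\<in>A. f y * u y x) + f a * u a x)"
    using insert by (simp add: add.commute)
  then show ?case using insert H0_lin[of E0 r "\<lambda>x. \<Sum>y\<in>A. f y * u y x" "f a" "u a" x] by simp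
qed (simp add: H0_zero)

lemma h0_outside: "y \<notin> nbhd x \<Longrightarrow> h0 E0 r x y = 0"
  unfolding h0_def
  by (subst H0_cong[of x _ "\<lambda>_. 0"]) (auto simp: delta_def H0_zero)

lemma H0_eq_sum: "H0 E0 r u x = (\<Sum>y\<in>nbhd x. h0 E0 r x y * u y)"
proof -
  have "H0 E0 r u x = H0 E0 r (\<lambda>z. \<Sum>y\<in>nbhd x. u y * delta y z) x"
    by (rule H0_cong) (simp add: delta_def finite_nbhd if_distrib[of "(*) _"] cong: if_cong)
  also have "\<dots> = (\<Sum>y\<in>nbhd x. u y * H0 E0 r (delta y) x)" by (rule H0_sum[OF finite_nbhd])
  finally show ?thesis by (simp add: h0_def mult.commute)
qed

lemma H0_kop: "H0 E0 r u = kop (h0 E0 r) u"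
proof
  fix x
  have "kop (h0 E0 r) u x = (\<Sum>\<^sub>\<infinity>y\<in>nbhd x. h0 E0 r x y * u y)"
    unfolding kop_def by (rule infsum_cong_neutral) (auto simp: h0_outside)
  then show "H0 E0 r u x = kop (h0 E0 r) u x" by (simp add: H0_eq_sum finite_nbhd)
qed

lemma h0_sym: "h0 E0 r x y = h0 E0 r y x"
proof (cases x)
  case x: (Core k)
  show ?thesis
  proof (cases y)
    case y: (Core l)
    show ?thesis
    proof (cases "k = l")
      case False
      have "(\<Sum>z | {k, z} \<in> E0. (delta (Core l) (Core k) :: complex) - delta (Core l) (Core z :: ('a, 'b) vertex)) = (if {k, l} \<in> E0 then -1 else 0)"
        using False by (simp add: delta_def sum_negf)
      moreover have "(\<Sum>z | {l, z} \<in> E0. (delta (Core k) (Core l) :: complex) - delta (Core k) (Core z :: ('a, 'b) vertex)) = (if {k, l} \<in> E0 then -1 else 0)"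
        using False by (simp add: delta_def sum_negf insert_commute)
      ultimately show ?thesis using False by (simp add: h0_def x y) (simp add: delta_def)
    qed (simp add: x y)
  next
    case (Ray \<alpha> m) then show ?thesis using x by (cases m) (auto simp: h0_def delta_def)
  qed
next
  case x: (Ray \<alpha> m)
  show ?thesis
  proof (cases y)
    case (Core l) then show ?thesis using x by (cases m) (auto simp: h0_def delta_def)
  next
    case (Ray \<alpha>' m') then show ?thesis using x by (cases m; cases m') (auto simp: h0_def delta_def)
  qed
qed

lemma H0_cnj: "H0 E0 r (\<lambda>x. cnj (u x)) x = cnj (H0 E0 r u x)"
proof (cases x)
  case (Core k)
  have "(\<Sum>\<alpha>\<in>UNIV. (if k = r \<alpha> then 1 else 0) * cnj (u (Core k))) = cnj (\<Sum>\<alpha>\<in>UNIV. (if k = r \<alpha> then 1 else 0) * u (Core k))"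
    unfolding cnj_sum by (intro sum.cong) auto
  then show ?thesis by (simp only: Core H0.simps complex_cnj_add complex_cnj_diff cnj_sum)
next
  case (Ray \<alpha> m) then show ?thesis by (cases m) auto
qed

lemma h0_real: "cnj (h0 E0 r x y) = h0 E0 r x y"
proof -
  have "(\<lambda>x. cnj (delta y x)) = delta y" by (auto simp: delta_def)
  then show ?thesis using H0_cnj[of E0 r "delta y" x] by (simp add: h0_def)
qed

lemma h0_schur: "\<exists>C. schur (h0 E0 r) C"
proof -
  have fin: "((\<lambda>y. norm (h0 E0 r x y)) has_sum (\<Sum>y\<in>nbhd x. norm (h0 E0 r x y))) UNIV" for x
    by (rule has_sum_finite_neutralI) (auto simp: finite_nbhd h0_outside)
  \<comment> \<open>A row on a half-line has absolute sum at most 2 + 1 + 1 = 4; the finitely many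
    core rows are simply added.\<close>
  define C where "C = (\<Sum>x\<in>range Core. \<Sum>y\<in>nbhd x. norm (h0 E0 r x y)) + 4"
  have C0: "0 \<le> (\<Sum>x\<in>range Core. \<Sum>y\<in>nbhd x. norm (h0 E0 r x y))" by (intro sum_nonneg) auto
  have "(\<Sum>y\<in>nbhd x. norm (h0 E0 r x y)) \<le> C" for x
  proof (cases x rule: nbhd.cases)
    case (1 k)
    then have "(\<Sum>y\<in>nbhd x. norm (h0 E0 r x y)) \<le> (\<Sum>x\<in>range Core. \<Sum>y\<in>nbhd x. norm (h0 E0 r x y))"
      by (intro member_le_sum[of x]) (auto intro: sum_nonneg)
    then show ?thesis by (simp add: C_def)
  next
    case (2 \<alpha>) then show ?thesis using C0 by (simp add: C_def) (simp add: h0_def delta_def)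
  next
    case (3 \<alpha> m) then show ?thesis using C0 by (simp add: C_def) (simp add: h0_def delta_def)
  qed
  moreover have "0 < C" using C0 by (simp add: C_def)
  ultimately have "schur (h0 E0 r) C"
    unfolding schur_def using has_sum_imp_summable[OF fin] infsumI[OF fin] h0_sym[of E0 r] by auto
  then show ?thesis ..
qed

lemma H0_ell2:
  assumes "u \<in> ell2"
  shows "H0 E0 r u \<in> ell2"
  using h0_schur[of E0 r] schur_ell2(1) assms unfolding H0_kop by blast

lemma H0_symmetric:
  assumes "u \<in> ell2" "w \<in> ell2"
  shows "pairing u (H0 E0 r w) = pairing (H0 E0 r u) w"
  using h0_schur[of E0 r] schur_pairing[OF _ assms, of "h0 E0 r"] unfolding H0_kop h0_real by blast

section \<open>The exterior Green function\<close>

text \<open>The Dirichlet Green function (z^|i-j| - z^(i+j+2)) / (z^-1 - z) of the half-line,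
  written as a finite geometric sum so that z = 1, that is \<kappa> = 0, needs no division. The two
  truncated differences add up to |i - j|.\<close>

definition ray_green :: "complex \<Rightarrow> nat \<Rightarrow> nat \<Rightarrow> complex" where
  "ray_green z i j = (\<Sum>k\<le>min i j. z ^ ((i - j) + (j - i) + 1 + 2 * k))"

lemma ray_green_commute: "ray_green z i j = ray_green z j i"
  by (simp add: ray_green_def min.commute add.commute)

lemma ray_green_closed:
  fixes z :: complex
  shows "(1 - z\<^sup>2) * ray_green z i j = z ^ ((i - j) + (j - i) + 1) * (1 - z ^ (2 * Suc (min i j)))"
proof -
  have pw: "z ^ (2 * k) = (z\<^sup>2) ^ k" for k by (rule power_mult)
  have 1: "ray_green z i j = z ^ ((i - j) + (j - i) + 1) * (\<Sum>k\<le>min i j. (z\<^sup>2) ^ k)"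
    unfolding ray_green_def sum_distrib_left by (simp only: power_add pw mult.assoc)
  have 2: "(1 - z\<^sup>2) * (\<Sum>k\<le>min i j. (z\<^sup>2) ^ k) = 1 - (z\<^sup>2) ^ Suc (min i j)"
    using one_diff_power_eq[of "z\<^sup>2" "Suc (min i j)"] by (simp only: lessThan_Suc_atMost)
  show ?thesis unfolding 1 mult.left_commute[of "1 - z\<^sup>2"] 2 pw ..
qed

lemma ray_green_closed':
  fixes z :: complex
  shows "(1 - z\<^sup>2) * ray_green z i j = z * (z ^ ((i - j) + (j - i)) - z ^ (i + j + 2))"
proof -
  have "(i - j) + (j - i) + 2 * Suc (min i j) = i + j + 2" by (simp add: min_def)
  then have *: "z ^ ((i - j) + (j - i)) * z ^ (2 * Suc (min i j)) = z ^ (i + j + 2)"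
    by (simp only: power_add[symmetric])
  have gen: "z ^ (a + 1) * (1 - b) = z * (z ^ a - z ^ a * b)" for a b by (simp add: algebra_simps)
  show ?thesis unfolding ray_green_closed gen * ..
qed

lemma ray_green_square: "ray_green (s\<^sup>2) i j = (\<Sum>k\<le>min i j. s ^ (2 * ((i - j) + (j - i) + 1 + 2 * k)))"
  by (simp only: ray_green_def power_mult)

lemma geometric_partial_sum:
  fixes a :: real
  assumes "0 \<le> a" "a < 1"
  shows "(\<Sum>k<m. a ^ k) \<le> 1 / (1 - a)"
  using assms unfolding sum_gp_strict by (auto intro!: divide_right_mono)

text \<open>Multiplying the difference equation by z and using 1 + z^2 = (2 + \<kappa>^2) z removes
  \<kappa>; the resulting identity in z is checked after multiplication by 1 - z^2. The missing
  neighbour of the first point counts as 0.\<close>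

lemma ray_green_eq:
  assumes nz: "1 - z\<^sup>2 \<noteq> 0"
  shows "(1 + z\<^sup>2) * ray_green z 0 j - z * ray_green z 1 j = (if j = 0 then z else 0)"
    "(1 + z\<^sup>2) * ray_green z (Suc i) j - z * ray_green z (Suc (Suc i)) j - z * ray_green z i j
       = (if j = Suc i then z else 0)"
proof -
  let ?g = "\<lambda>i. (1 - z\<^sup>2) * ray_green z i j"
  have "(1 + z\<^sup>2) * ?g 0 - z * ?g 1 = (1 - z\<^sup>2) * (if j = 0 then z else 0)"
  proof (cases j)
    case (Suc k) then show ?thesis
      unfolding ray_green_closed' by (simp add: algebra_simps power2_eq_square)
  next
    case 0 then show ?thesis
      unfolding ray_green_closed' by (simp add: algebra_simps power2_eq_square)
  qed
  then have "(1 - z\<^sup>2) * ((1 + z\<^sup>2) * ray_green z 0 j - z * ray_green z 1 j) = (1 - z\<^sup>2) * (if j = 0 then z else 0)"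
    by (simp only: right_diff_distrib mult.left_commute)
  then show "(1 + z\<^sup>2) * ray_green z 0 j - z * ray_green z 1 j = (if j = 0 then z else 0)" using nz by simp
  have "(1 + z\<^sup>2) * ?g (Suc i) - z * ?g (Suc (Suc i)) - z * ?g i = (1 - z\<^sup>2) * (if j = Suc i then z else 0)"
  proof (cases "j \<le> i")
    case True
    then obtain d where d: "i = j + d" using le_Suc_ex by blast
    show ?thesis unfolding ray_green_closed' d by (simp add: algebra_simps power2_eq_square power_add)
  next
    case False
    show ?thesis
    proof (cases "j = Suc i")
      case True then show ?thesis unfolding ray_green_closed' by (simp add: algebra_simps power2_eq_square power_add)
    next
      case False
      with \<open>\<not> j \<le> i\<close> obtain d where d: "j = Suc (Suc (i + d))" using less_imp_Suc_add[of "Suc i" j] by auto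
      have e: "Suc i - j = 0" "j - Suc i = Suc d" "Suc (Suc i) - j = 0" "j - Suc (Suc i) = d" "i - j = 0" "j - i = Suc (Suc d)"
        using d by auto
      show ?thesis unfolding ray_green_closed' e using False by (simp add: d algebra_simps power2_eq_square power_add)
    qed
  qed
  then have "(1 - z\<^sup>2) * ((1 + z\<^sup>2) * ray_green z (Suc i) j - z * ray_green z (Suc (Suc i)) j - z * ray_green z i j)
     = (1 - z\<^sup>2) * (if j = Suc i then z else 0)"
    by (simp only: right_diff_distrib mult.left_commute)
  then show "(1 + z\<^sup>2) * ray_green z (Suc i) j - z * ray_green z (Suc (Suc i)) j - z * ray_green z i j
       = (if j = Suc i then z else 0)" using nz by simp
qed

text \<open>The Green function of the rays with their first \<open>n\<close> points removed.\<close>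

fun ext_green :: "nat \<Rightarrow> complex \<Rightarrow> ('k, 'a) vertex \<Rightarrow> ('k, 'a) vertex \<Rightarrow> complex" where
  "ext_green n \<kappa> (Ray \<alpha> i) (Ray \<beta> j) =
     (if \<alpha> = \<beta> \<and> n \<le> i \<and> n \<le> j then ray_green ((decay_root \<kappa>)\<^sup>2) (i - n) (j - n) else 0)"
| "ext_green n \<kappa> _ _ = 0"

definition exterior :: "nat \<Rightarrow> ('k, 'a) vertex set" where
  "exterior n = {Ray \<alpha> m | \<alpha> m. n \<le> m}"

lemma finite_core_region: "finite (- exterior n :: ('k::finite, 'a::finite) vertex set)"
proof -
  have "x \<in> range Core \<union> (\<lambda>(\<alpha>, m). Ray \<alpha> m) ` (UNIV \<times> {..<n})" if "x \<in> - exterior n" for x :: "('k, 'a) vertex"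
    using that by (cases x) (auto simp: exterior_def image_iff)
  then show ?thesis by (rule finite_subset[OF subsetI]) auto
qed

lemma ext_green_commute: "ext_green n \<kappa> x y = ext_green n \<kappa> y x"
  by (cases x; cases y) (auto simp: ray_green_commute)

lemma ext_green_outside: "x \<notin> exterior n \<Longrightarrow> ext_green n \<kappa> x y = 0" "y \<notin> exterior n \<Longrightarrow> ext_green n \<kappa> x y = 0"
  by (cases x; cases y; auto simp: exterior_def)+

lemma ext_green_cnj: "0 < Re \<kappa> \<Longrightarrow> cnj (ext_green n \<kappa> x y) = ext_green n (cnj \<kappa>) x y"
  by (cases x; cases y) (auto simp: ray_green_def decay_root_cnj)

text \<open>Squaring \<kappa> s = 1 - s^2 gives the dispersion relation for z = s^2, the decay
  factor from one vertex to the next.\<close>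

lemma decay_sq:
  assumes "0 < Re \<kappa>"
  defines "z \<equiv> (decay_root \<kappa>)\<^sup>2"
  shows "norm z < 1" "z \<noteq> 0" "1 - z\<^sup>2 \<noteq> 0" "1 + z\<^sup>2 = (2 + \<kappa>\<^sup>2) * z"
proof -
  note d = decay_root[OF assms(1)]
  show 1: "norm z < 1" unfolding z_def norm_power using d by (simp add: power_less_one_iff)
  have s: "decay_root \<kappa> \<noteq> 0" using d by auto
  then show "z \<noteq> 0" by (simp add: z_def)
  show "1 - z\<^sup>2 \<noteq> 0"
  proof
    assume "1 - z\<^sup>2 = 0" then have "norm z ^ 2 = 1" by (metis eq_iff_diff_eq_0 norm_one norm_power)
    then show False using 1 by (metis less_irrefl norm_ge_zero power2_eq_1_iff not_numeral_le_zero neg_0_le_iff_le zero_le_one order_less_le_trans abs_norm_cancel abs_1 abs_minus_cancel)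
  qed
  have k: "\<kappa> * decay_root \<kappa> = 1 - z" using d(1) by (simp add: z_def algebra_simps)
  have "\<kappa>\<^sup>2 * z = (\<kappa> * decay_root \<kappa>)\<^sup>2" by (simp add: z_def power_mult_distrib)
  then have "\<kappa>\<^sup>2 * z = (1 - z)\<^sup>2" unfolding k .
  then show "1 + z\<^sup>2 = (2 + \<kappa>\<^sup>2) * z" by (simp add: algebra_simps power2_diff)
qed

text \<open>Each term has modulus at most 1, so the number of terms is a bound. It is uniform up to
  \<kappa> = 0, where the decay estimate degenerates.\<close>

lemma norm_ray_green_le:
  assumes "norm z \<le> 1"
  shows "norm (ray_green z i j) \<le> real (min i j) + 1"
proof -
  have "norm (ray_green z i j) \<le> (\<Sum>k\<le>min i j. 1)"
    unfolding ray_green_def by (intro sum_norm_le) (simp only: norm_power power_le_one assms norm_ge_zero)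
  then show ?thesis by simp
qed

text \<open>For fixed \<kappa> the kernel decays away from the diagonal, which gives boundedness on
  square-summable functions; the constant blows up as \<kappa> tends to 0.\<close>

lemma norm_ray_green_decay:
  assumes "norm z < 1"
  shows "norm (ray_green z i j) \<le> norm z ^ ((i - j) + (j - i)) / (1 - norm z)"
proof -
  define a where "a = norm z"
  have a: "0 \<le> a" "a < 1" using assms by (auto simp: a_def)
  have "norm (ray_green z i j) \<le> (\<Sum>k\<le>min i j. a ^ ((i - j) + (j - i)) * a ^ k)"
    unfolding ray_green_def
  proof (rule sum_norm_le)
    fix k
    have "norm (z ^ ((i - j) + (j - i) + 1 + 2 * k)) = a ^ ((i - j) + (j - i) + 1 + 2 * k)"
      by (simp only: norm_power a_def)
    also have "\<dots> \<le> a ^ ((i - j) + (j - i) + k)" using a by (intro power_decreasing) auto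
    finally show "norm (z ^ ((i - j) + (j - i) + 1 + 2 * k)) \<le> a ^ ((i - j) + (j - i)) * a ^ k"
      by (simp only: power_add)
  qed
  also have "\<dots> = a ^ ((i - j) + (j - i)) * (\<Sum>k<Suc (min i j). a ^ k)"
    by (simp only: sum_distrib_left lessThan_Suc_atMost)
  also have "\<dots> \<le> a ^ ((i - j) + (j - i)) * (1 / (1 - a))"
    using a by (intro mult_left_mono geometric_partial_sum) auto
  finally show ?thesis by (simp add: a_def)
qed

lemma geometric_dist_sum:
  fixes a :: real
  assumes "0 \<le> a" "a < 1"
  shows "summable (\<lambda>j. a ^ ((i - j) + (j - i)))" "(\<Sum>j. a ^ ((i - j) + (j - i))) \<le> 2 / (1 - a)"
proof -
  have p: "(\<Sum>j<n. a ^ ((i - j) + (j - i))) \<le> 2 / (1 - a)" for n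
  proof -
    have geo: "(\<Sum>k<m. a ^ k) \<le> 1 / (1 - a)" for m
      by (rule geometric_partial_sum[OF assms])
    have "(\<Sum>j<n. a ^ ((i - j) + (j - i))) \<le> (\<Sum>j\<in>{..i} \<union> {i..<i + n}. a ^ ((i - j) + (j - i)))"
      using assms by (intro sum_mono2) auto
    also have "\<dots> \<le> (\<Sum>j\<le>i. a ^ ((i - j) + (j - i))) + (\<Sum>j\<in>{i..<i + n}. a ^ ((i - j) + (j - i)))"
      using assms sum.union_inter[of "{..i}" "{i..<i+n}" "\<lambda>j. a ^ ((i - j) + (j - i))"]
        sum_nonneg[of "{..i} \<inter> {i..<i+n}" "\<lambda>j. a ^ ((i - j) + (j - i))"] by simp
    also have "(\<Sum>j\<le>i. a ^ ((i - j) + (j - i))) = (\<Sum>k<Suc i. a ^ k)"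
      unfolding lessThan_Suc_atMost by (rule sum.reindex_bij_witness[of _ "\<lambda>k. i - k" "\<lambda>j. i - j"]) auto
    also have "(\<Sum>j\<in>{i..<i + n}. a ^ ((i - j) + (j - i))) = (\<Sum>k<n. a ^ k)"
      by (rule sum.reindex_bij_witness[of _ "\<lambda>k. i + k" "\<lambda>j. j - i"]) auto
    finally show ?thesis using geo[of "Suc i"] geo[of n] by simp
  qed
  show s: "summable (\<lambda>j. a ^ ((i - j) + (j - i)))"
    by (rule summableI_nonneg_bounded[OF _ p]) (use assms in auto)
  show "(\<Sum>j. a ^ ((i - j) + (j - i))) \<le> 2 / (1 - a)" by (rule suminf_le_const[OF s p])
qed

lemma ext_green_schur:
  assumes "0 < Re \<kappa>"
  shows "\<exists>C. schur (ext_green n \<kappa> :: ('k::finite, 'a::finite) vertex \<Rightarrow> _) C"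
proof -
  define a where "a = norm ((decay_root \<kappa>)\<^sup>2)"
  have a: "0 \<le> a" "a < 1" using decay_sq[OF assms] by (auto simp: a_def)
  define C where "C = 2 / (1 - a) / (1 - a)"
  have C: "0 < C" using a by (simp add: C_def)
  have row: "(\<lambda>y. norm (ext_green n \<kappa> x y)) summable_on UNIV \<and> (\<Sum>\<^sub>\<infinity>y. norm (ext_green n \<kappa> x y)) \<le> C"
    for x :: "('k, 'a) vertex"
  proof (cases "x \<in> exterior n")
    case False then show ?thesis using C by (simp add: ext_green_outside)
  next
    case True
    then obtain \<alpha> m where x: "x = Ray \<alpha> m" "n \<le> m" by (auto simp: exterior_def)
    define i where "i = m - n"
    define g where "g j = a ^ ((i - j) + (j - i)) / (1 - a)" for j
    have g: "summable g" "suminf g \<le> C" "\<And>j. 0 \<le> g j"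
      using geometric_dist_sum[OF a, of i] a unfolding g_def C_def
      by (auto simp only: suminf_divide intro!: summable_divide divide_right_mono divide_nonneg_pos zero_le_power)
    define G where "G = (\<lambda>y. norm (ext_green n \<kappa> x (y :: ('k, 'a) vertex)))"
    have inj: "inj (\<lambda>j. Ray \<alpha> (n + j) :: ('k, 'a) vertex)" by (auto simp: inj_on_def)
    have Gj: "G (Ray \<alpha> (n + j)) \<le> g j" for j
      using norm_ray_green_decay[of "(decay_root \<kappa>)\<^sup>2" i j] a x
      by (simp add: G_def g_def a_def i_def)
    have gs: "(g has_sum suminf g) UNIV"
      by (rule sums_nonneg_imp_has_sum) (use g in \<open>auto simp: summable_sums\<close>)
    have s1: "(\<lambda>j. G (Ray \<alpha> (n + j))) summable_on UNIV"
      by (rule summable_on_comparison_test[OF has_sum_imp_summable[OF gs]]) (use Gj in \<open>auto simp: G_def\<close>)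
    have "(G has_sum (\<Sum>\<^sub>\<infinity>j. G (Ray \<alpha> (n + j)))) (range (\<lambda>j. Ray \<alpha> (n + j)))"
      using has_sum_reindex[OF inj, of G] has_sum_infsum[OF s1] by (simp add: o_def)
    moreover have "G y = 0" if "y \<notin> range (\<lambda>j. Ray \<alpha> (n + j))" for y
    proof (cases y)
      case (Ray \<beta> j)
      have "\<not> (\<beta> = \<alpha> \<and> n \<le> j)" using that Ray by (auto simp: image_iff dest: le_Suc_ex)
      then show ?thesis using x Ray by (auto simp: G_def)
    qed (simp add: G_def x)
    ultimately have hs: "(G has_sum (\<Sum>\<^sub>\<infinity>j. G (Ray \<alpha> (n + j)))) UNIV"
      by (subst has_sum_cong_neutral[where T="range (\<lambda>j. Ray \<alpha> (n + j))" and g=G]) auto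
    have "(\<Sum>\<^sub>\<infinity>j. G (Ray \<alpha> (n + j))) \<le> (\<Sum>\<^sub>\<infinity>j. g j)"
      by (rule infsum_mono[OF s1 has_sum_imp_summable[OF gs] Gj])
    also have "\<dots> \<le> C" using g infsumI[OF gs] by simp
    finally show ?thesis using hs has_sum_imp_summable[OF hs] infsumI[OF hs] by (simp add: G_def)
  qed
  show ?thesis unfolding schur_def using C row ext_green_commute by blast
qed

lemma ext_green_bound:
  fixes x y :: "('k, 'a) vertex"
  assumes "0 < Re \<kappa>"
  shows "norm (ext_green n \<kappa> x y) \<le> wt x" "norm (ext_green n \<kappa> x y) \<le> wt y"
proof -
  have *: "norm (ext_green n \<kappa> x y) \<le> wt x" for x y :: "('k, 'a) vertex"
  proof (cases x)
    case x: (Ray \<alpha> i)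
    show ?thesis
    proof (cases y)
      case y: (Ray \<beta> j)
      have "norm (ray_green ((decay_root \<kappa>)\<^sup>2) (i - n) (j - n)) \<le> real (min (i - n) (j - n)) + 1"
        using decay_sq(1)[OF assms] by (intro norm_ray_green_le) simp
      also have "\<dots> \<le> real i + 1" by simp
      also have "\<dots> \<le> wt (Ray \<alpha> i :: ('k, 'a) vertex)" by (rule wt_Ray)
      finally show ?thesis using wt_nonneg[of x] by (cases "\<alpha> = \<beta>") (auto simp: x y simp del: weight.simps)
    qed (use wt_nonneg x in simp)
  qed (use wt_nonneg in simp)
  show "norm (ext_green n \<kappa> x y) \<le> wt x" by (rule *)
  show "norm (ext_green n \<kappa> x y) \<le> wt y" unfolding ext_green_commute[of _ _ x] by (rule *)
qed

text \<open>At the first retained point the removed neighbour carries the value 0, so the cut acts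
  as a Dirichlet condition. For \<open>y\<close> outside the exterior both sides vanish.\<close>

lemma ext_green_eq:
  assumes "0 < Re \<kappa>" "x \<in> exterior n"
  shows "H0 E0 r (\<lambda>x. ext_green n \<kappa> x y) x + \<kappa>\<^sup>2 * ext_green n \<kappa> x y = delta y x"
proof -
  obtain \<alpha> m where x: "x = Ray \<alpha> m" "n \<le> m" using assms(2) by (auto simp: exterior_def)
  show ?thesis
  proof (cases "\<exists>j. y = Ray \<alpha> j \<and> n \<le> j")
    case False
    then have "ext_green n \<kappa> (Ray \<alpha> l) y = 0" for l by (cases y) auto
    moreover have "x \<noteq> y" using False x by auto
    ultimately show ?thesis using x by (cases m) (auto simp: delta_def)
  next
    case True
    then obtain j where y: "y = Ray \<alpha> j" "n \<le> j" by blast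
    define z where "z = (decay_root \<kappa>)\<^sup>2"
    note z = decay_sq[OF assms(1), folded z_def]
    define G where "G i = ray_green z i (j - n)" for i
    have mul: "A = B" if "z * A = z * B" for A B using that z(2) by simp
    show ?thesis
    proof (cases "m = n")
      case True
      have "z * ((2 + \<kappa>\<^sup>2) * G 0 - G 1) = z * (if j - n = 0 then 1 else 0)"
        using ray_green_eq(1)[OF z(3), of "j - n"] unfolding z(4) G_def by (auto simp: algebra_simps)
      from mul[OF this] have "(2 + \<kappa>\<^sup>2) * G 0 - G 1 = (if j - n = 0 then 1 else 0)" .
      then show ?thesis using x y True
        by (cases m) (auto simp: delta_def G_def z_def algebra_simps)
    next
      case False
      then obtain i where i: "m = Suc (n + i)" using x less_imp_Suc_add[of n m] by auto
      have "z * ((2 + \<kappa>\<^sup>2) * G (Suc i) - G (Suc (Suc i)) - G i) = z * (if j - n = Suc i then 1 else 0)"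
        using ray_green_eq(2)[OF z(3), of i "j - n"] unfolding z(4) G_def by (auto simp: algebra_simps)
      from mul[OF this] have "(2 + \<kappa>\<^sup>2) * G (Suc i) - G (Suc (Suc i)) - G i = (if j - n = Suc i then 1 else 0)" .
      then show ?thesis using x y i
        by (auto simp: delta_def G_def z_def algebra_simps Suc_diff_le)
    qed
  qed
qed

text \<open>The kernel is a sum of powers of the decay root. The number of powers gives the
  amplitude; the exponents, additive in the two positions, are bounded by a multiple of the product
  so that the scale factorises in \<open>x\<close> and \<open>y\<close>.\<close>

lemma gexp_ext_green:
  assumes "0 < \<delta>"
  shows "gexp \<delta> J (\<lambda>(x, y). min (wt x) (wt y)) (\<lambda>(x, y). wt x * wt y)
    (\<lambda>(x :: ('k, 'a) vertex, y) \<kappa>. ext_green n \<kappa> x y)"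
proof -
  define e where "e x y k = (case (x, y) of (Ray \<alpha> i, Ray \<beta> j) \<Rightarrow>
      2 * (((i - n) - (j - n)) + ((j - n) - (i - n)) + 1 + 2 * k) | _ \<Rightarrow> 0)" for x y :: "('k, 'a) vertex" and k :: nat
  define A where "A x y = (case (x, y) of (Ray \<alpha> i, Ray \<beta> j) \<Rightarrow>
      if \<alpha> = \<beta> \<and> n \<le> i \<and> n \<le> j then {..min (i - n) (j - n)} else {} | _ \<Rightarrow> {})" for x y :: "('k, 'a) vertex"
  have eq: "ext_green n \<kappa> x y = (\<Sum>k\<in>A x y. decay_root \<kappa> ^ e x y k)" for x y \<kappa>
    by (cases x; cases y) (auto simp: A_def e_def ray_green_square)
  have le: "real (e x y k) + 1 \<le> 4 * (wt x * wt y)" if k: "k \<in> A x y" for x y k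
  proof (cases x)
    case x: (Ray \<alpha> i)
    show ?thesis
    proof (cases y)
      case y: (Ray \<beta> j)
      have c: "\<alpha> = \<beta>" "n \<le> i" "n \<le> j" "k \<le> min (i - n) (j - n)"
        using k by (auto simp: A_def x y split: if_splits)
      have "e x y k \<le> 2 * ((i - n) + (j - n) + 1)" using c by (auto simp: e_def x y min_def split: if_splits)
      then have "real (e x y k) + 1 \<le> 2 * (real i + real j + 1) + 1" using c by simp
      also have "\<dots> \<le> 4 * ((real i + 1) * (real j + 1))" by (simp add: algebra_simps)
      also have "\<dots> \<le> 4 * (wt x * wt y)" unfolding x y
        by (intro mult_left_mono mult_mono wt_Ray wt_nonneg) auto
      finally show ?thesis .
    qed (use k in \<open>simp add: A_def x\<close>)
  qed (use k in \<open>simp add: A_def\<close>)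
  have card: "real (card (A x y)) \<le> min (wt x) (wt y)" for x y
  proof (cases "\<exists>\<alpha> i j. x = Ray \<alpha> i \<and> y = Ray \<alpha> j \<and> n \<le> i \<and> n \<le> j")
    case True
    then obtain \<alpha> i j where xy: "x = Ray \<alpha> i" "y = Ray \<alpha> j" "n \<le> i" "n \<le> j" by blast
    have "real (card (A x y)) \<le> min (real i + 1) (real j + 1)" by (auto simp: A_def xy)
    also have "\<dots> \<le> min (wt x) (wt y)" unfolding xy by (intro min.mono wt_Ray)
    finally show ?thesis .
  next
    case False
    then have "A x y = {}" by (cases x; cases y) (auto simp: A_def)
    then show ?thesis using wt_nonneg[of x] wt_nonneg[of y] by simp
  qed
  have "gexp \<delta> J (\<lambda>(x, y). min (wt x) (wt y)) (\<lambda>(x, y). 4 * (wt x * wt y))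
     (\<lambda>xy \<kappa>. \<Sum>k\<in>A (fst xy) (snd xy). decay_root \<kappa> ^ e (fst xy) (snd xy) k)"
  proof (rule gexp_bigsum[where f="\<lambda>(xy, k) \<kappa>. decay_root \<kappa> ^ e (fst xy) (snd xy) k" and Q="\<lambda>_. 1"
      and P="\<lambda>(xy, k). real (e (fst xy) (snd xy) k) + 1", simplified])
    show "gexp \<delta> J (\<lambda>_. 1) (\<lambda>(xy, k). real (e (fst xy) (snd xy) k) + 1) (\<lambda>(xy, k) \<kappa>. decay_root \<kappa> ^ e (fst xy) (snd xy) k)"
      using gexp_reindex[OF gexp_decay_root_power[OF assms, of J], where g="\<lambda>(xy, k). e (fst xy) (snd xy) k"]
      by (simp add: case_prod_unfold)
    fix i :: "('k, 'a) vertex \<times> ('k, 'a) vertex" and J' :: nat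
    obtain x y where i: "i = (x, y)" by (cases i)
    have "(\<Sum>k\<in>A x y. (real (e x y k) + 1) ^ J') \<le> real (card (A x y)) * (4 * (wt x * wt y)) ^ J'"
      by (intro sum_bounded_above power_mono le) auto
    also have "\<dots> \<le> min (wt x) (wt y) * (4 * (wt x * wt y)) ^ J'"
      by (intro mult_right_mono card zero_le_power mult_nonneg_nonneg wt_nonneg) auto
    finally show "(\<Sum>k\<in>A (fst i) (snd i). (real (e (fst i) (snd i) k) + 1) ^ J')
       \<le> (case i of (x, y) \<Rightarrow> min (wt x) (wt y)) * (case i of (x, y) \<Rightarrow> 4 * (wt x * wt y)) ^ J'"
      by (simp add: i)
  qed (auto simp: assms wt_nonneg)
  then have "gexp \<delta> J (\<lambda>(x, y). min (wt x) (wt y)) (\<lambda>(x, y). wt x * wt y)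
     (\<lambda>xy \<kappa>. \<Sum>k\<in>A (fst xy) (snd xy). decay_root \<kappa> ^ e (fst xy) (snd xy) k)"
    by (rule gexp_mono[where c=1 and d=4]) (auto simp: wt_nonneg)
  then show ?thesis by (rule gexp_cong) (auto simp: eq)
qed

section \<open>The exterior problem for the perturbed operator\<close>

lemma pairing_add_left:
  assumes "(\<lambda>x. norm (cnj (f x) * u x)) summable_on UNIV" "(\<lambda>x. norm (cnj (g x) * u x)) summable_on UNIV"
  shows "pairing (\<lambda>x. f x + c * g x) u = pairing f u + cnj c * pairing g u"
proof -
  have 1: "(\<lambda>x. cnj (f x) * u x) summable_on UNIV" "(\<lambda>x. cnj c * (cnj (g x) * u x)) summable_on UNIV"
    by (rule abs_summable_summable[OF assms(1)],
        rule summable_on_cmult_right[OF abs_summable_summable[OF assms(2)]])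
  show ?thesis using infsum_add[OF 1] by (simp add: pairing_def infsum_cmult_right' distrib_right mult.assoc)
qed

lemma has_sum_finite_combination:
  fixes f :: "'i \<Rightarrow> 'x \<Rightarrow> complex"
  assumes "finite A" "\<And>i. i \<in> A \<Longrightarrow> (f i has_sum S i) UNIV"
  shows "((\<lambda>x. \<Sum>i\<in>A. c i * f i x) has_sum (\<Sum>i\<in>A. c i * S i)) UNIV"
  using assms
proof (induction A)
  case (insert i A)
  have "((\<lambda>x. c i * f i x + (\<Sum>i\<in>A. c i * f i x)) has_sum c i * S i + (\<Sum>i\<in>A. c i * S i)) UNIV"
  proof -
    have "(f i has_sum S i) UNIV" "((\<lambda>x. \<Sum>i\<in>A. c i * f i x) has_sum (\<Sum>i\<in>A. c i * S i)) UNIV"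
      using insert by auto
    then show ?thesis by (rule has_sum_add[OF has_sum_cmult_right])
  qed
  then show ?case using insert by simp
qed simp

lemma kop_has_sum:
  assumes "schur k C" "u \<in> ell2"
  shows "((\<lambda>y. k x y * u y) has_sum kop k u x) UNIV"
  unfolding kop_def by (rule has_sum_infsum[OF abs_summable_summable[OF schur_row_summable_ell2[OF assms]]])

lemma kop_lin:
  assumes "schur k C" "u \<in> ell2" "w \<in> ell2"
  shows "kop k (\<lambda>y. u y + c * w y) x = kop k u x + c * kop k w x"
proof -
  have "((\<lambda>y. k x y * u y + c * (k x y * w y)) has_sum kop k u x + c * kop k w x) UNIV"
    by (rule has_sum_add[OF kop_has_sum[OF assms(1,2)] has_sum_cmult_right[OF kop_has_sum[OF assms(1,3)]]])
  then show ?thesis unfolding kop_def[of k "\<lambda>y. u y + c * w y"] by (intro infsumI) (simp add: algebra_simps)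
qed

lemma kop_delta [simp]: "kop k (delta y) x = k x y"
proof -
  have "kop k (delta y) x = (\<Sum>\<^sub>\<infinity>z\<in>{y}. k x z * delta y z)"
    unfolding kop_def by (rule infsum_cong_neutral) (auto simp: delta_def)
  then show ?thesis by (simp add: delta_def)
qed

lemma ext_green_H0_kop:
  assumes \<kappa>: "0 < Re \<kappa>" and x: "x \<in> exterior n" and u: "u \<in> ell2"
  shows "H0 E0 r (kop (ext_green n \<kappa>) u) x + \<kappa>\<^sup>2 * kop (ext_green n \<kappa>) u x = u x"
proof -
  obtain C where C: "schur (ext_green n \<kappa> :: ('a::finite, 'b::finite) vertex \<Rightarrow> _) C"
    using ext_green_schur[OF \<kappa>] by blast
  note hs = kop_has_sum[OF C u]
  have "((\<lambda>z. (\<Sum>y\<in>nbhd x. h0 E0 r x y * (ext_green n \<kappa> y z * u z)) + \<kappa>\<^sup>2 * (ext_green n \<kappa> x z * u z)) has_sum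
     (\<Sum>y\<in>nbhd x. h0 E0 r x y * kop (ext_green n \<kappa>) u y) + \<kappa>\<^sup>2 * kop (ext_green n \<kappa>) u x) UNIV"
    by (rule has_sum_add[OF has_sum_finite_combination[OF finite_nbhd hs] has_sum_cmult_right[OF hs]])
  moreover have "(\<Sum>y\<in>nbhd x. h0 E0 r x y * (ext_green n \<kappa> y z * u z)) + \<kappa>\<^sup>2 * (ext_green n \<kappa> x z * u z)
      = cnj (delta x z) * u z" for z
  proof -
    have "(\<Sum>y\<in>nbhd x. h0 E0 r x y * (ext_green n \<kappa> y z * u z)) + \<kappa>\<^sup>2 * (ext_green n \<kappa> x z * u z)
      = (H0 E0 r (\<lambda>y. ext_green n \<kappa> y z) x + \<kappa>\<^sup>2 * ext_green n \<kappa> x z) * u z"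
      by (simp add: H0_eq_sum sum_distrib_right distrib_right mult.assoc)
    then show ?thesis unfolding ext_green_eq[OF \<kappa> x] by (simp add: delta_def)
  qed
  ultimately have "((\<lambda>z. cnj (delta x z) * u z) has_sum
     H0 E0 r (kop (ext_green n \<kappa>) u) x + \<kappa>\<^sup>2 * kop (ext_green n \<kappa>) u x) UNIV"
    by (simp add: H0_eq_sum)
  then show ?thesis using infsumI pairing_delta_left[of x u] unfolding pairing_def by metis
qed

text \<open>Pairing with the Green function at conjugate \<kappa> moves the operator to the other
  side by symmetry. That function vanishes off the exterior, so the equation is used only where it
  is known.\<close>

lemma ext_green_left_inverse:
  assumes \<kappa>: "0 < Re \<kappa>" and y: "y \<in> ell2" "\<And>x. x \<notin> exterior n \<Longrightarrow> y x = 0"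
    and q: "q \<in> ell2" "\<And>x. x \<in> exterior n \<Longrightarrow> H0 E0 r y x + \<kappa>\<^sup>2 * y x = q x"
  shows "y = kop (ext_green n \<kappa>) q"
proof
  fix x
  show "y x = kop (ext_green n \<kappa>) q x"
  proof (cases "x \<in> exterior n")
    case False then show ?thesis by (simp add: y kop_def ext_green_outside)
  next
    case True
    obtain C where C: "schur (ext_green n (cnj \<kappa>) :: ('a::finite, 'b::finite) vertex \<Rightarrow> _) C"
      using ext_green_schur[of "cnj \<kappa>"] \<kappa> by auto
    define \<phi> where "\<phi> = (\<lambda>z. ext_green n (cnj \<kappa>) z x)"
    have \<phi>: "\<phi> \<in> ell2"
      using schur_ell2(1)[OF C ell2_delta[of x]] unfolding \<phi>_def by (simp only: kop_delta eta_contract_eq kop_delta[abs_def])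
    have "kop (ext_green n \<kappa>) q x = pairing \<phi> q"
      unfolding kop_def pairing_def \<phi>_def
      using \<kappa> by (intro infsum_cong) (simp add: ext_green_cnj ext_green_commute[of n \<kappa> x])
    also have "\<dots> = pairing \<phi> (\<lambda>z. H0 E0 r y z + \<kappa>\<^sup>2 * y z)"
      unfolding pairing_def \<phi>_def using q(2)
      by (intro infsum_cong) (metis ext_green_outside(1) complex_cnj_zero mult_zero_left)
    also have "\<dots> = pairing \<phi> (H0 E0 r y) + \<kappa>\<^sup>2 * pairing \<phi> y"
      using \<phi> y by (subst pairing_add_right) (auto intro!: ell2_pairing_summable H0_ell2 ell2_scale simp: pairing_scale_right)
    also have "pairing \<phi> (H0 E0 r y) = pairing (H0 E0 r \<phi>) y" by (rule H0_symmetric[OF \<phi> y(1)])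
    also have "pairing (H0 E0 r \<phi>) y + \<kappa>\<^sup>2 * pairing \<phi> y = pairing (\<lambda>z. H0 E0 r \<phi> z + (cnj \<kappa>)\<^sup>2 * \<phi> z) y"
      using \<phi> y by (subst pairing_add_left) (auto intro!: ell2_pairing_summable H0_ell2)
    also have "\<dots> = pairing (delta x) y"
      unfolding pairing_def
    proof (rule infsum_cong)
      fix z
      show "cnj (H0 E0 r \<phi> z + (cnj \<kappa>)\<^sup>2 * \<phi> z) * y z = cnj (delta x z) * y z"
      proof (cases "z \<in> exterior n")
        case True
        then show ?thesis using ext_green_eq[of "cnj \<kappa>" z n E0 r x] \<kappa> unfolding \<phi>_def by simp
      qed (simp add: y)
    qed
    finally show ?thesis by simp
  qed
qed

text \<open>Fixes one factorisation of the potential and the length \<open>n\<close> of the removed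
  pieces. The last assumption is what bounds the sandwiched exterior Green function by 1/2.\<close>

locale schroedinger =
  fixes E0 :: "'k::finite set set" and r :: "'a::finite \<Rightarrow> 'k"
    and V :: "('k, 'a) gfun \<Rightarrow> ('k, 'a) gfun" and b :: nat
    and v :: "'h::chilbert_space \<Rightarrow> ('k, 'a) gfun" and v' :: "('k, 'a) gfun \<Rightarrow> 'h" and U :: "'h \<Rightarrow> 'h"
    and Cv :: real and n :: nat
  assumes b4: "4 \<le> b"
    and V_selfadjoint: "bounded_selfadjoint V"
    and v_l1w: "\<And>h. v h \<in> l1w (real b)"
    and v_add: "\<And>h k. v (h + k) = v h + v k"
    and v_scale: "\<And>c h. v (scaleC c h) = cscale c (v h)"
    and v_norm: "\<And>h. l1w_norm (real b) (v h) \<le> Cv * norm h"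
    and Cv: "0 < Cv"
    and adjoint: "is_adjoint (real b) v v'"
    and U: "selfadjoint_unitary U"
    and V_eq: "\<And>u. u \<in> linfw (real b) \<Longrightarrow> V u = v (U (v' u))"
    and n_large: "2 * Cv\<^sup>2 \<le> real n + 1"
begin

lemma v_lin: "v (h + scaleC c k) x = v h x + c * v k x"
  by (simp add: v_add v_scale cscale_def)

lemma v_ell2: "v h \<in> ell2"
  by (rule l1w_ell2[OF v_l1w])

lemma cinner_v': "u \<in> linfw (real b) \<Longrightarrow> cinner (v' u) h = pairing u (v h)"
  using adjoint by (simp add: is_adjoint_def)

lemma v'_norm:
  assumes "\<And>x. norm (u x) \<le> A * wt x ^ b" "0 \<le> A"
  shows "norm (v' u) \<le> Cv * A"
proof (cases "v' u = 0")
  case True then show ?thesis using Cv assms by simp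
next
  case False
  have "norm (v' u) * norm (v' u) = norm (cinner (v' u) (v' u))"
    by (simp add: cinner_self power2_eq_square flip: of_real_mult)
  also have "\<dots> = norm (pairing u (v (v' u)))" by (simp only: cinner_v'[OF linfwI[OF assms(1)]])
  also have "\<dots> \<le> A * l1w_norm (real b) (v (v' u))" by (rule l1w_linfw_product(2)[OF assms(1) v_l1w])
  also have "\<dots> \<le> A * (Cv * norm (v' u))" by (rule mult_left_mono[OF v_norm assms(2)])
  finally show ?thesis using False by (simp add: mult_ac)
qed

lemma v'_lin:
  assumes "u \<in> linfw (real b)" "w \<in> linfw (real b)"
  shows "v' (\<lambda>x. u x + c * w x) = v' u + scaleC c (v' w)"
proof (rule cinner_ext)
  fix h
  from assms(1) obtain A where A: "\<And>x. norm (u x) \<le> A * wt x ^ b" by (rule linfwE) (rule that)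
  from assms(2) obtain B where B: "\<And>x. norm (w x) \<le> B * wt x ^ b" by (rule linfwE) (rule that)
  show "cinner (v' (\<lambda>x. u x + c * w x)) h = cinner (v' u + scaleC c (v' w)) h"
    unfolding cinner_add_left cinner_scaleC_left cinner_v'[OF assms(1)] cinner_v'[OF assms(2)]
      cinner_v'[OF linfw_lin[OF assms]]
    by (rule pairing_add_left[OF l1w_linfw_product(1)[OF A v_l1w] l1w_linfw_product(1)[OF B v_l1w]])
qed

lemma U_add: "U (h + k) = U h + U k" and U_scale: "U (scaleC c h) = scaleC c (U h)"
  and U_sym: "cinner (U h) k = cinner h (U k)" and U_iso: "cinner (U h) (U k) = cinner h k"
  using U by (auto simp: selfadjoint_unitary_def)

lemma U_U [simp]: "U (U h) = h"
  by (rule cinner_ext) (metis U_sym U_iso)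

lemma norm_U [simp]: "norm (U h) = norm h"
  using U_iso[of h h] unfolding cinner_self of_real_eq_iff by (simp add: power2_eq_iff_nonneg)

lemma V_lin:
  assumes "u \<in> linfw (real b)" "w \<in> linfw (real b)"
  shows "V (\<lambda>x. u x + c * w x) x = V u x + c * V w x"
  unfolding V_eq[OF linfw_lin[OF assms]] V_eq[OF assms(1)] V_eq[OF assms(2)]
  by (simp add: v'_lin[OF assms] U_add U_scale v_lin)

lemma V_l1w: "u \<in> linfw (real b) \<Longrightarrow> V u \<in> l1w (real b)"
  by (simp add: V_eq v_l1w)

lemma V_norm:
  assumes "\<And>x. norm (u x) \<le> A * wt x ^ b" "0 \<le> A"
  shows "l1w_norm (real b) (V u) \<le> Cv\<^sup>2 * A"
proof -
  have "l1w_norm (real b) (V u) \<le> Cv * norm (v' u)"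
    using v_norm[of "U (v' u)"] by (simp add: V_eq[OF linfwI[OF assms(1)]])
  also have "\<dots> \<le> Cv * (Cv * A)" using Cv v'_norm[OF assms] by (intro mult_left_mono) auto
  finally show ?thesis by (simp add: power2_eq_square mult.assoc)
qed

lemma V_symmetric:
  assumes "f \<in> linfw (real b)" "g \<in> linfw (real b)"
  shows "pairing f (V g) = pairing (V f) g"
proof -
  have "pairing f (V g) = cinner (v' f) (U (v' g))" by (simp add: V_eq[OF assms(2)] cinner_v'[OF assms(1)])
  also have "\<dots> = cnj (cinner (v' g) (U (v' f)))" by (metis U_sym cinner_commute)
  also have "\<dots> = pairing (V f) g"
    by (simp add: V_eq[OF assms(1)] cinner_v'[OF assms(2)] pairing_cnj[of "v _" g])
  finally show ?thesis .
qed

definition HH :: "('k, 'a) gfun \<Rightarrow> ('k, 'a) gfun" where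
  "HH u = (\<lambda>x. H0 E0 r u x + V u x)"

lemma HH_lin:
  assumes "u \<in> linfw (real b)" "w \<in> linfw (real b)"
  shows "HH (\<lambda>x. u x + c * w x) x = HH u x + c * HH w x"
  unfolding HH_def H0_lin V_lin[OF assms] by (simp add: algebra_simps)

lemma HH_zero: "HH (\<lambda>x. 0) x = 0"
  using HH_lin[OF ell2_in_linfw[OF ell2_zero] ell2_in_linfw[OF ell2_zero], of "-1" x] by simp

lemma HH_sum:
  assumes "finite A" "\<And>i. i \<in> A \<Longrightarrow> u i \<in> ell2"
  shows "HH (\<lambda>x. \<Sum>i\<in>A. c i * u i x) x = (\<Sum>i\<in>A. c i * HH (u i) x)"
  using assms
proof (induction A)
  case (insert i A)
  have "(\<lambda>x. \<Sum>i\<in>insert i A. c i * u i x) = (\<lambda>x. (\<Sum>i\<in>A. c i * u i x) + c i * u i x)"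
    using insert by (simp add: add.commute)
  moreover have "(\<lambda>x. \<Sum>i\<in>A. c i * u i x) \<in> ell2" using insert by (intro ell2_sum ell2_scale) auto
  ultimately show ?case using insert HH_lin[OF ell2_in_linfw ell2_in_linfw, of "\<lambda>x. \<Sum>i\<in>A. c i * u i x" "u i" "c i" x]
    by simp
qed (simp add: HH_zero)

lemma V_ell2: "u \<in> ell2 \<Longrightarrow> V u \<in> ell2"
  by (rule l1w_ell2[OF V_l1w[OF ell2_in_linfw]])

lemma HH_ell2: "u \<in> ell2 \<Longrightarrow> HH u \<in> ell2"
  unfolding HH_def by (intro ell2_add H0_ell2 V_ell2)

lemma HH_symmetric:
  assumes "u \<in> ell2" "w \<in> ell2"
  shows "pairing u (HH w) = pairing (HH u) w"
proof -
  note s = ell2_pairing_summable[OF assms(1) H0_ell2[OF assms(2)]] ell2_pairing_summable[OF assms(1) V_ell2[OF assms(2)]]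
  have "pairing u (HH w) = pairing u (H0 E0 r w) + pairing u (V w)" unfolding HH_def by (rule pairing_add_right[OF s])
  also have "\<dots> = pairing (H0 E0 r u) w + 1 * pairing (V u) w"
    using V_symmetric[OF ell2_in_linfw ell2_in_linfw] assms H0_symmetric[OF assms] by simp
  also have "\<dots> = pairing (HH u) w"
    unfolding HH_def using pairing_add_left[of "H0 E0 r u" w "V u" 1] assms
    by (simp add: ell2_pairing_summable H0_ell2 V_ell2)
  finally show ?thesis .
qed

abbreviation G :: "complex \<Rightarrow> ('k, 'a) vertex \<Rightarrow> ('k, 'a) vertex \<Rightarrow> complex" where
  "G \<equiv> ext_green n"

lemma G_schur: "0 < Re \<kappa> \<Longrightarrow> \<exists>C. schur (G \<kappa>) C"
  by (rule ext_green_schur)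

lemma G_ell2: "0 < Re \<kappa> \<Longrightarrow> u \<in> ell2 \<Longrightarrow> kop (G \<kappa>) u \<in> ell2"
  using G_schur schur_ell2(1) by blast

lemma G_lin:
  assumes "0 < Re \<kappa>" "u \<in> ell2" "w \<in> ell2"
  shows "kop (G \<kappa>) (\<lambda>y. u y + c * w y) = (\<lambda>x. kop (G \<kappa>) u x + c * kop (G \<kappa>) w x)"
proof -
  obtain C where "schur (G \<kappa>) C" using G_schur[OF assms(1)] by blast
  from kop_lin[OF this assms(2,3)] show ?thesis by blast
qed

lemma G_outside: "x \<notin> exterior n \<Longrightarrow> kop (G \<kappa>) u x = 0"
  by (simp add: kop_def ext_green_outside)

text \<open>One power of the weight bounds the Green function and another, at least n + 1 on the
  exterior, is to spare since \<open>b\<close> is at least 4. The gain is uniform in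
  \<kappa>.\<close>

lemma G_small:
  assumes "0 < Re \<kappa>" "f \<in> l1w (real b)"
  shows "norm (kop (G \<kappa>) f x) \<le> l1w_norm (real b) f / (real n + 1)"
proof -
  have s: "(\<lambda>y. (wt y ^ b * norm (f y)) / (real n + 1)) summable_on UNIV"
    using assms(2) unfolding l1w_nat divide_inverse by (rule summable_on_cmult_left)
  have le: "norm (G \<kappa> x y * f y) \<le> (wt y ^ b * norm (f y)) / (real n + 1)" for y
  proof (cases "y \<in> exterior n")
    case False then show ?thesis using wt_nonneg[of y] by (simp add: ext_green_outside)
  next
    case True
    then obtain \<alpha> m where y: "y = Ray \<alpha> m" "n \<le> m" by (auto simp: exterior_def)
    then have "real n + 1 \<le> wt y" using wt_Ray(1)[of m \<alpha>, where ?'a='k] by (simp del: weight.simps)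
    then have "wt y * (real n + 1) \<le> wt y * wt y" using wt_nonneg[of y] by (intro mult_left_mono) auto
    also have "\<dots> = wt y ^ 2" by (simp add: power2_eq_square)
    also have "\<dots> \<le> wt y ^ b" using b4 by (intro wt_power_mono) auto
    finally have "wt y \<le> wt y ^ b / (real n + 1)" by (simp add: pos_le_divide_eq)
    then have "norm (G \<kappa> x y) \<le> wt y ^ b / (real n + 1)" using ext_green_bound(2)[OF assms(1), of n x y] by linarith
    from mult_right_mono[OF this, of "norm (f y)"] show ?thesis by (simp add: norm_mult)
  qed
  have 1: "(\<lambda>y. norm (G \<kappa> x y * f y)) summable_on UNIV" by (rule summable_on_comparison_test[OF s le]) auto
  have "norm (kop (G \<kappa>) f x) \<le> (\<Sum>\<^sub>\<infinity>y. norm (G \<kappa> x y * f y))" unfolding kop_def by (rule norm_infsum_bound[OF 1])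
  also have "\<dots> \<le> (\<Sum>\<^sub>\<infinity>y. (wt y ^ b * norm (f y)) / (real n + 1))" by (rule infsum_mono[OF 1 s le])
  also have "\<dots> = l1w_norm (real b) f / (real n + 1)" unfolding divide_inverse l1w_norm_nat by (rule infsum_cmult_left')
  finally show ?thesis .
qed

text \<open>The Birman-Schwinger operator of the exterior problem.\<close>

definition DD :: "complex \<Rightarrow> 'h \<Rightarrow> 'h" where
  "DD \<kappa> h = v' (kop (G \<kappa>) (v h))"

lemma DD_lin: "0 < Re \<kappa> \<Longrightarrow> DD \<kappa> (h + scaleC c k) = DD \<kappa> h + scaleC c (DD \<kappa> k)"
proof -
  assume k: "0 < Re \<kappa>"
  have "v (h + scaleC c k) = (\<lambda>x. v h x + c * v k x)" by (simp add: fun_eq_iff v_lin)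
  then show ?thesis unfolding DD_def
    by (simp only: G_lin[OF k v_ell2 v_ell2]) (rule v'_lin; intro ell2_in_linfw G_ell2 k v_ell2)
qed

lemma DD_norm: "0 < Re \<kappa> \<Longrightarrow> norm (DD \<kappa> h) \<le> norm h / 2"
proof -
  assume k: "0 < Re \<kappa>"
  have "norm (DD \<kappa> h) \<le> Cv * (Cv * norm h / (real n + 1))" unfolding DD_def
  proof (rule v'_norm)
    fix x
    have "norm (kop (G \<kappa>) (v h) x) \<le> l1w_norm (real b) (v h) / (real n + 1)" by (rule G_small[OF k v_l1w])
    also have "\<dots> \<le> Cv * norm h / (real n + 1) * 1" using v_norm by (simp add: divide_right_mono)
    also have "\<dots> \<le> Cv * norm h / (real n + 1) * wt x ^ b" using Cv by (intro mult_left_mono one_le_power wt_ge_1) auto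
    finally show "norm (kop (G \<kappa>) (v h) x) \<le> Cv * norm h / (real n + 1) * wt x ^ b" .
  qed (use Cv in auto)
  also have "\<dots> = Cv\<^sup>2 / (real n + 1) * norm h" by (simp add: power2_eq_square)
  also have "\<dots> \<le> 1/2 * norm h" using n_large by (intro mult_right_mono) (auto simp: pos_divide_le_eq)
  finally show ?thesis by simp
qed

text \<open>As \<open>U\<close> is an isometric involution, the equation reads k = U (h - D k), and
  the right side contracts by 1/2.\<close>

lemma U_plus_small_bij:
  assumes lin: "\<And>h c k. D (h + scaleC c k) = D h + scaleC c (D k)" and nrm: "\<And>h. norm (D h) \<le> norm h / 2"
  shows "\<exists>!k. U k + D k = h"
proof -
  have U_minus: "U (h - k) = U h - U k" for h k using U_add[of "h - k" k] by simp
  have D_minus: "D h - D k = D (h - k)" for h k using lin[of h "-1" k] by (simp add: scaleC_minus_one)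
  have eq: "U k + D k = h \<longleftrightarrow> U (h - D k) = k" for k
    by (metis U_U add_diff_cancel_right' diff_add_cancel)
  have "\<exists>!k. U (h - D k) = k"
  proof (rule banach_fix_type[of "1/2"])
    show "\<forall>x y. dist (U (h - D x)) (U (h - D y)) \<le> 1/2 * dist x y"
    proof (intro allI)
      fix x y
      have "dist (U (h - D x)) (U (h - D y)) = norm (D y - D x)"
        unfolding dist_norm U_minus[symmetric] norm_U by (rule arg_cong[where f=norm]) simp
      also have "\<dots> \<le> norm (y - x) / 2" unfolding D_minus by (rule nrm)
      finally show "dist (U (h - D x)) (U (h - D y)) \<le> 1/2 * dist x y" by (simp add: dist_norm norm_minus_commute)
    qed
  qed auto
  then show ?thesis unfolding eq .
qed

definition NN :: "complex \<Rightarrow> 'h \<Rightarrow> 'h" where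
  "NN \<kappa> h = (THE k. U k + DD \<kappa> k = h)"

lemma NN_eq: "0 < Re \<kappa> \<Longrightarrow> U (NN \<kappa> h) + DD \<kappa> (NN \<kappa> h) = h"
  unfolding NN_def by (rule theI', rule U_plus_small_bij[OF DD_lin DD_norm])

lemma NN_unique: "0 < Re \<kappa> \<Longrightarrow> U k + DD \<kappa> k = h \<Longrightarrow> k = NN \<kappa> h"
  using U_plus_small_bij[of "DD \<kappa>" h, OF DD_lin DD_norm] NN_eq[of \<kappa> h] by blast

lemma NN_lin: "0 < Re \<kappa> \<Longrightarrow> NN \<kappa> (h + scaleC c k) = NN \<kappa> h + scaleC c (NN \<kappa> k)"
proof (rule NN_unique[symmetric])
  assume k: "0 < Re \<kappa>"
  have "U (NN \<kappa> h + scaleC c (NN \<kappa> k)) + DD \<kappa> (NN \<kappa> h + scaleC c (NN \<kappa> k))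
    = (U (NN \<kappa> h) + DD \<kappa> (NN \<kappa> h)) + scaleC c (U (NN \<kappa> k) + DD \<kappa> (NN \<kappa> k))"
    by (simp only: U_add U_scale DD_lin[OF k] scaleC_add_right add_ac)
  then show "U (NN \<kappa> h + scaleC c (NN \<kappa> k)) + DD \<kappa> (NN \<kappa> h + scaleC c (NN \<kappa> k)) = h + scaleC c k"
    by (simp only: NN_eq[OF k])
qed

lemma NN_add: "0 < Re \<kappa> \<Longrightarrow> NN \<kappa> (h + k) = NN \<kappa> h + NN \<kappa> k"
  using NN_lin[of \<kappa> h 1 k] by simp

lemma NN_zero: "0 < Re \<kappa> \<Longrightarrow> NN \<kappa> 0 = 0"
  using NN_add[of \<kappa> 0 0] by simp

lemma NN_scale: "0 < Re \<kappa> \<Longrightarrow> NN \<kappa> (scaleC c k) = scaleC c (NN \<kappa> k)"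
  using NN_lin[of \<kappa> 0 c k] NN_zero[of \<kappa>] by simp

lemma norm_le_U_plus_small:
  assumes "norm (D k) \<le> norm k / 2" "U k + D k = h"
  shows "norm k \<le> 2 * norm h"
proof -
  have "norm k = norm (h - D k)" using assms(2) by (metis add_diff_cancel_right' norm_U)
  also have "\<dots> \<le> norm h + norm k / 2" using assms(1) norm_triangle_ineq4[of h "D k"] by linarith
  finally show ?thesis by simp
qed

lemma NN_norm: "0 < Re \<kappa> \<Longrightarrow> norm (NN \<kappa> h) \<le> 2 * norm h"
  by (rule norm_le_U_plus_small[of "DD \<kappa>", OF DD_norm NN_eq])

text \<open>The symmetric form of the second resolvent identity, with \<open>NN\<close> the inverse
  of U + \<open>DD\<close> in the middle.\<close>

definition Rc :: "complex \<Rightarrow> ('k, 'a) gfun \<Rightarrow> ('k, 'a) gfun" where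
  "Rc \<kappa> g = (\<lambda>x. kop (G \<kappa>) g x - kop (G \<kappa>) (v (NN \<kappa> (v' (kop (G \<kappa>) g)))) x)"

lemma Rc_ell2: "0 < Re \<kappa> \<Longrightarrow> g \<in> ell2 \<Longrightarrow> Rc \<kappa> g \<in> ell2"
  unfolding Rc_def by (intro ell2_diff G_ell2 v_ell2)

lemma Rc_outside: "x \<notin> exterior n \<Longrightarrow> Rc \<kappa> g x = 0"
  by (simp add: Rc_def G_outside)

text \<open>If N inverts U + D, then e - D N e = U N e. Since \<open>U\<close> is an involution,
  applying \<open>V\<close> to \<open>Rc\<close> therefore returns exactly the vector inside the
  correction term of \<open>Rc\<close>.\<close>

lemma v'_Rc:
  assumes "0 < Re \<kappa>" "g \<in> ell2"
  shows "v' (Rc \<kappa> g) = U (NN \<kappa> (v' (kop (G \<kappa>) g)))"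
proof -
  have "v' (Rc \<kappa> g) = v' (kop (G \<kappa>) g) + scaleC (- 1) (v' (kop (G \<kappa>) (v (NN \<kappa> (v' (kop (G \<kappa>) g))))))"
    unfolding Rc_def using v'_lin[of "kop (G \<kappa>) g" "kop (G \<kappa>) (v (NN \<kappa> (v' (kop (G \<kappa>) g))))" "-1"] assms
    by (simp add: ell2_in_linfw G_ell2 v_ell2)
  also have "\<dots> = U (NN \<kappa> (v' (kop (G \<kappa>) g)))"
    using NN_eq[OF assms(1), of "v' (kop (G \<kappa>) g)"] by (simp add: scaleC_minus_one DD_def algebra_simps)
  finally show ?thesis .
qed

lemma V_Rc:
  assumes "0 < Re \<kappa>" "g \<in> ell2"
  shows "V (Rc \<kappa> g) = v (NN \<kappa> (v' (kop (G \<kappa>) g)))"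
  by (simp add: V_eq ell2_in_linfw Rc_ell2 assms v'_Rc)

lemma Rc_eq:
  assumes "0 < Re \<kappa>" "g \<in> ell2" "x \<in> exterior n"
  shows "HH (Rc \<kappa> g) x + \<kappa>\<^sup>2 * Rc \<kappa> g x = g x"
proof -
  let ?w = "v (NN \<kappa> (v' (kop (G \<kappa>) g)))"
  have R: "Rc \<kappa> g = (\<lambda>x. kop (G \<kappa>) g x + (- 1) * kop (G \<kappa>) ?w x)" by (simp add: Rc_def)
  have "H0 E0 r (Rc \<kappa> g) x + \<kappa>\<^sup>2 * Rc \<kappa> g x
    = (H0 E0 r (kop (G \<kappa>) g) x + \<kappa>\<^sup>2 * kop (G \<kappa>) g x) - (H0 E0 r (kop (G \<kappa>) ?w) x + \<kappa>\<^sup>2 * kop (G \<kappa>) ?w x)"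
    unfolding R H0_lin by (simp add: algebra_simps)
  also have "\<dots> = g x - ?w x"
    unfolding ext_green_H0_kop[OF assms(1,3) assms(2)] ext_green_H0_kop[OF assms(1,3) v_ell2] ..
  finally show ?thesis by (simp add: HH_def V_Rc[OF assms(1,2)] algebra_simps)
qed

text \<open>Moving the potential term to the right leaves the free exterior problem, whose solution
  is unique. Applying \<open>v'\<close> to that solution shows that \<open>U (v' y)\<close>
  satisfies the equation defining \<open>NN\<close>.\<close>

lemma Rc_unique:
  assumes \<kappa>: "0 < Re \<kappa>" and g: "g \<in> ell2" and y: "y \<in> ell2" "\<And>x. x \<notin> exterior n \<Longrightarrow> y x = 0"
    and eq: "\<And>x. x \<in> exterior n \<Longrightarrow> HH y x + \<kappa>\<^sup>2 * y x = g x"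
  shows "y = Rc \<kappa> g"
proof -
  define k where "k = U (v' y)"
  have Vy: "V y = v k" by (simp add: V_eq ell2_in_linfw y k_def)
  have y_eq: "y = (\<lambda>x. kop (G \<kappa>) g x + (- 1) * kop (G \<kappa>) (v k) x)"
  proof -
    have "y = kop (G \<kappa>) (\<lambda>x. g x + (- 1) * v k x)"
    proof (rule ext_green_left_inverse[OF \<kappa> y, where ?E0.0=E0 and r=r])
      show "(\<lambda>x. g x + (- 1) * v k x) \<in> ell2" by (intro ell2_add ell2_scale g v_ell2)
      show "H0 E0 r y x + \<kappa>\<^sup>2 * y x = g x + (- 1) * v k x" if "x \<in> exterior n" for x
        using eq[OF that] by (simp add: HH_def Vy algebra_simps)
    qed
    then show ?thesis by (simp only: G_lin[OF \<kappa> g v_ell2])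
  qed
  have "v' y = v' (kop (G \<kappa>) g) + scaleC (- 1) (v' (kop (G \<kappa>) (v k)))"
    by (subst y_eq, rule v'_lin) (intro ell2_in_linfw G_ell2 \<kappa> g v_ell2)+
  then have "U k + DD \<kappa> k = v' (kop (G \<kappa>) g)" by (simp add: k_def DD_def scaleC_minus_one eq_diff_eq)
  then have "k = NN \<kappa> (v' (kop (G \<kappa>) g))" by (rule NN_unique[OF \<kappa>])
  then show ?thesis using y_eq by (simp add: Rc_def)
qed

end

section \<open>Expansion of the exterior resolvent in \<kappa>\<close>

lemma half_disc_Re: "\<kappa> \<in> half_disc \<delta> \<Longrightarrow> 0 < Re \<kappa>"
  by (simp add: half_disc_def)

lemma gexp_power:
  assumes "0 < \<delta>" "\<delta> \<le> 1"
  shows "gexp \<delta> J (\<lambda>_::unit. 1) (\<lambda>_. 1) (\<lambda>_ \<kappa>. \<kappa> ^ m :: complex)"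
proof (induction m arbitrary: J)
  case 0 then show ?case by (simp, intro gexp_const[where c=1]) auto
next
  case (Suc m)
  have bd: "norm (\<kappa> ^ m :: complex) \<le> 1" if "\<kappa> \<in> half_disc \<delta>" for \<kappa> m
    unfolding norm_power using that assms by (intro power_le_one) (auto simp: half_disc_def)
  show ?case
  proof (cases J)
    case 0 then show ?thesis
      by (intro gexpI[where b="\<lambda>_ _. 0" and C=1]) (use bd in \<open>auto simp del: power_Suc\<close>)
  next
    case (Suc K)
    show ?thesis unfolding \<open>J = Suc K\<close>
    proof (rule gexp_shift[where h="\<lambda>_ \<kappa>. \<kappa> ^ m" and ?f0.0="\<lambda>_. 0" and D=1])
      show "gexp \<delta> K (\<lambda>_::unit. 1 * 1) (\<lambda>_. 1) (\<lambda>_ \<kappa>. \<kappa> ^ m :: complex)" using Suc.IH by simp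
    qed (use bd in \<open>auto simp del: power_Suc simp: power_Suc[symmetric]\<close>)
  qed
qed

context schroedinger
begin

text \<open>At order \<open>J'\<close> the kernel grows like \<open>wt y ^ Suc J'\<close> in the
  source variable, the additional power being the amplitude. A source of weight \<open>b\<close>
  therefore allows the order b - 1.\<close>

lemma gexp_G_apply:
  fixes g :: "'i \<Rightarrow> ('k, 'a) gfun"
  assumes \<delta>: "0 < \<delta>" and g: "\<And>i. g i \<in> l1w (real b)" and B: "\<And>i. l1w_norm (real b) (g i) \<le> B i"
  shows "gexp \<delta> (b - 1) (\<lambda>(i, x). B i) (\<lambda>(i, x). wt x) (\<lambda>(i, x) \<kappa>. kop (G \<kappa>) (g i) x)"
proof -
  have le: "min (wt x) (wt y) * (wt x * wt y) ^ J' * norm (g i y) \<le> wt x ^ J' * (wt y ^ b * norm (g i y))"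
    if "J' \<le> b - 1" for J' i and x y :: "('k, 'a) vertex"
  proof -
    have "min (wt x) (wt y) * (wt x * wt y) ^ J' \<le> wt y * (wt x * wt y) ^ J'"
      by (intro mult_right_mono zero_le_power mult_nonneg_nonneg wt_nonneg) auto
    also have "\<dots> = wt x ^ J' * wt y ^ Suc J'" by (simp add: power_mult_distrib)
    also have "\<dots> \<le> wt x ^ J' * wt y ^ b"
      using that b4 by (intro mult_left_mono wt_power_mono zero_le_power wt_nonneg) auto
    finally show ?thesis by (simp add: mult_right_mono flip: mult.assoc)
  qed
  have s: "(\<lambda>y. wt x ^ J' * (wt y ^ b * norm (g i y))) summable_on UNIV" for J' i and x :: "('k, 'a) vertex"
    using g[of i] unfolding l1w_nat by (rule summable_on_cmult_right)
  have nn: "0 \<le> min (wt x) (wt y) * (wt x * wt y) ^ J' * norm (g i y)" for J' i and x y :: "('k, 'a) vertex"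
    by (intro mult_nonneg_nonneg zero_le_power) (auto simp: wt_nonneg)
  have B0: "0 \<le> B i" for i using B[of i] l1w_norm_nonneg[of b "g i"] by linarith
  have "gexp \<delta> (b - 1) (\<lambda>i. B (fst i)) (\<lambda>i. wt (snd i)) (\<lambda>i \<kappa>. \<Sum>\<^sub>\<infinity>y. G \<kappa> (snd i) y * g (fst i) y)"
  proof (rule gexp_infsum[where f="\<lambda>((i, x), y) \<kappa>. G \<kappa> x y" and Q="\<lambda>((i, x), y). min (wt x) (wt y)"
      and P="\<lambda>((i, x), y). wt x * wt y" and g="\<lambda>i. g (fst i)", unfolded case_prod_unfold fst_conv snd_conv])
    show "gexp \<delta> (b - 1) (\<lambda>p. min (wt (snd (fst p))) (wt (snd p))) (\<lambda>p. wt (snd (fst p)) * wt (snd p))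
        (\<lambda>p \<kappa>. G \<kappa> (snd (fst p :: 'i \<times> _)) (snd p))"
      using gexp_reindex[OF gexp_ext_green[OF \<delta>, of "b - 1" n], where g="\<lambda>p. (snd (fst p :: 'i \<times> _), snd p)"]
      by (simp add: case_prod_unfold)
    fix i :: "'i \<times> ('k, 'a) vertex" and J' assume J: "J' \<le> b - 1"
    show S: "(\<lambda>x. min (wt (snd i)) (wt x) * (wt (snd i) * wt x) ^ J' * norm (g (fst i) x)) summable_on UNIV"
      by (rule summable_on_comparison_test[OF s le[OF J] nn])
    have "(\<Sum>\<^sub>\<infinity>x. min (wt (snd i)) (wt x) * (wt (snd i) * wt x) ^ J' * norm (g (fst i) x))
      \<le> (\<Sum>\<^sub>\<infinity>y. wt (snd i) ^ J' * (wt y ^ b * norm (g (fst i) y)))"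
      by (rule infsum_mono[OF S s le[OF J]])
    also have "\<dots> = wt (snd i) ^ J' * l1w_norm (real b) (g (fst i))" by (simp only: infsum_cmult_right' l1w_norm_nat)
    also have "\<dots> \<le> wt (snd i) ^ J' * B (fst i)" by (intro mult_left_mono B zero_le_power wt_nonneg)
    finally show "(\<Sum>\<^sub>\<infinity>x. min (wt (snd i)) (wt x) * (wt (snd i) * wt x) ^ J' * norm (g (fst i) x))
      \<le> B (fst i) * wt (snd i) ^ J'" by (simp only: mult.commute)
  qed (auto simp: \<delta> B0 wt_nonneg)
  then show ?thesis by (simp only: case_prod_unfold kop_def)
qed

text \<open>Growth up to weight \<open>b\<close> is absorbed by the adjoint, so the point
  \<open>x\<close> disappears from both amplitude and scale.\<close>

lemma gexp_v':
  fixes f :: "'i \<times> ('k, 'a) vertex \<Rightarrow> complex \<Rightarrow> complex"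
  assumes f: "gexp \<delta> J Q P f" and \<delta>: "0 < \<delta>"
    and le: "\<And>i x J'. J' \<le> J \<Longrightarrow> Q (i, x) * P (i, x) ^ J' \<le> Q' i * P' i ^ J' * wt x ^ b"
    and pos: "\<And>i. 0 \<le> Q' i" "\<And>i. 0 \<le> P' i"
  shows "gexp \<delta> J Q' P' (\<lambda>i \<kappa>. v' (\<lambda>x. f (i, x) \<kappa>))"
proof -
  have "gexp \<delta> J (\<lambda>i. Cv * Q' i) P' (\<lambda>i \<kappa>. v' (\<lambda>x. f (i, x) \<kappa>))"
  proof (rule gexp_functional[OF f \<delta>, where X="\<lambda>_. linfw (real b)" and T="\<lambda>_. v'"])
    fix i J' A and u :: "('k, 'a) gfun"
    assume J: "J' \<le> J" and A: "0 \<le> A" and u: "\<And>x. norm (u x) \<le> A * Q (i, x) * P (i, x) ^ J'"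
    have u': "norm (u x) \<le> (A * (Q' i * P' i ^ J')) * wt x ^ b" for x
      using mult_left_mono[OF le[OF J, of i x] A] u[of x] by (simp add: mult.assoc)
    have "norm (v' u) \<le> Cv * (A * (Q' i * P' i ^ J'))"
      by (rule v'_norm[OF u']) (use A pos in simp)
    then show "u \<in> linfw (real b) \<and> norm (v' u) \<le> A * (Cv * Q' i) * P' i ^ J'"
      using linfwI[OF u'] by (simp add: mult_ac)
  qed (use Cv pos in \<open>auto simp: linfw_lin v'_lin\<close>)
  then show ?thesis by (rule gexp_mono[where c=Cv and d=1]) (use pos Cv in auto)
qed

lemma gexp_v'_G:
  fixes g :: "'i \<Rightarrow> ('k, 'a) gfun"
  assumes \<delta>: "0 < \<delta>" and g: "\<And>i. g i \<in> l1w (real b)" and B: "\<And>i. l1w_norm (real b) (g i) \<le> B i"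
  shows "gexp \<delta> (b - 1) B (\<lambda>_. 1) (\<lambda>i \<kappa>. v' (kop (G \<kappa>) (g i)))"
proof -
  have B0: "0 \<le> B i" for i using B[of i] l1w_norm_nonneg[of b "g i"] by linarith
  have "gexp \<delta> (b - 1) B (\<lambda>_. 1) (\<lambda>i \<kappa>. v' (\<lambda>x. kop (G \<kappa>) (g (fst (i, x))) (snd (i, x))))"
  proof (rule gexp_v'[OF gexp_G_apply[OF \<delta> g B, unfolded case_prod_unfold] \<delta>])
    fix i J' and x :: "('k, 'a) vertex" assume "J' \<le> b - 1"
    then show "B (fst (i, x)) * wt (snd (i, x)) ^ J' \<le> B i * 1 ^ J' * wt x ^ b"
      using B0 by (auto intro!: mult_left_mono wt_power_mono)
  qed (use B0 in auto)
  then show ?thesis by simp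
qed

text \<open>With the source at a point, the amplitude is charged to \<open>x\<close>, where
  \<open>v'\<close> absorbs it, and only the scale \<open>wt y\<close> is left.\<close>

lemma gexp_v'_G_delta:
  assumes \<delta>: "0 < \<delta>"
  shows "gexp \<delta> (b - 1) (\<lambda>_. 1) wt (\<lambda>y \<kappa>. v' (kop (G \<kappa>) (delta y)))"
proof -
  have 1: "gexp \<delta> (b - 1) (\<lambda>p. min (wt (snd p)) (wt (fst p))) (\<lambda>p. wt (snd p) * wt (fst p)) (\<lambda>p \<kappa>. G \<kappa> (snd p) (fst p))"
    using gexp_reindex[OF gexp_ext_green[OF \<delta>, of "b - 1" n], where g="\<lambda>p. (snd p, fst p)"]
    by (simp add: case_prod_unfold)
  have "gexp \<delta> (b - 1) (\<lambda>_. 1) wt (\<lambda>y \<kappa>. v' (\<lambda>x. G \<kappa> (snd (y, x)) (fst (y, x))))"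
  proof (rule gexp_v'[OF 1 \<delta>])
    fix y x :: "('k, 'a) vertex" and J' assume J: "J' \<le> b - 1"
    have "min (wt (snd (y, x))) (wt (fst (y, x))) * (wt (snd (y, x)) * wt (fst (y, x))) ^ J' \<le> wt x * (wt x * wt y) ^ J'"
      unfolding fst_conv snd_conv by (intro mult_right_mono zero_le_power mult_nonneg_nonneg wt_nonneg) auto
    also have "\<dots> = wt y ^ J' * wt x ^ Suc J'" by (simp add: power_mult_distrib)
    also have "\<dots> \<le> wt y ^ J' * wt x ^ b"
      using J b4 by (intro mult_left_mono wt_power_mono zero_le_power wt_nonneg) auto
    finally show "min (wt (snd (y, x))) (wt (fst (y, x))) * (wt (snd (y, x)) * wt (fst (y, x))) ^ J' \<le> 1 * wt y ^ J' * wt x ^ b"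
      by simp
  qed (auto simp: wt_nonneg)
  then show ?thesis by (simp only: fst_conv snd_conv kop_delta[abs_def])
qed

lemma gexp_DD: "0 < \<delta> \<Longrightarrow> gexp \<delta> (b - 1) norm (\<lambda>_. 1) (\<lambda>k \<kappa>. DD \<kappa> k)"
proof -
  assume \<delta>: "0 < \<delta>"
  have "gexp \<delta> (b - 1) (\<lambda>k. Cv * norm k) (\<lambda>_. 1) (\<lambda>k \<kappa>. DD \<kappa> k)"
    unfolding DD_def by (rule gexp_v'_G[OF \<delta> v_l1w v_norm])
  then show ?thesis by (rule gexp_mono[where c=Cv and d=1]) (use Cv in auto)
qed

text \<open>Bootstrapping the identity \<open>N \<kappa> = N 0 - \<kappa> N \<kappa> D1 \<kappa> N 0\<close>, with \<open>D \<kappa> = D 0 + \<kappa> D1 \<kappa>\<close>.\<close>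

lemma gexp_NN:
  assumes \<delta>: "0 < \<delta>"
  shows "gexp \<delta> (b - 1) norm (\<lambda>_. 1) (\<lambda>k \<kappa>. NN \<kappa> k)"
proof -
  have b: "b - 1 = Suc (b - 2)" using b4 by simp
  obtain D0 C where
    D1: "gexp \<delta> (b - 2) (\<lambda>k. norm k * 1) (\<lambda>_. 1) (\<lambda>k \<kappa>. scaleC (1/\<kappa>) (DD \<kappa> k - D0 k))"
    and C: "0 \<le> C" and D0: "\<And>k \<kappa>. \<kappa> \<in> half_disc \<delta> \<Longrightarrow> norm (DD \<kappa> k - D0 k) \<le> C * norm k * (1 * norm \<kappa>)"
    using gexp_DD[OF \<delta>] unfolding b by (rule gexp_unshift[OF _ \<delta>]) (rule that)
  \<comment> \<open>The value at 0 is a limit along positive reals; linearity and the bound 1/2 pass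
    to it, which makes the inverse \<open>N0\<close> available.\<close>
  have lim: "((\<lambda>t. DD (of_real t) k) \<longlongrightarrow> D0 k) (at_right 0)" for k
  proof (rule Lim_null[THEN iffD2], rule Lim_null_comparison)
    show "\<forall>\<^sub>F t in at_right 0. norm (DD (of_real t) k - D0 k) \<le> C * norm k * t"
      using eventually_at_right_real[OF \<delta>]
    proof eventually_elim
      case (elim t)
      then show ?case using D0[OF half_disc_of_real, of t k] by simp
    qed
    show "((\<lambda>t. C * norm k * t) \<longlongrightarrow> 0) (at_right 0)"
      by (rule tendsto_mult_right_zero, rule tendsto_ident_at)
  qed
  have ev: "\<forall>\<^sub>F t in at_right 0. 0 < Re (of_real t)" by (auto simp: eventually_at_filter)
  have D0_lin: "D0 (h + scaleC c k) = D0 h + scaleC c (D0 k)" for h c k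
  proof (rule tendsto_unique[OF _ lim])
    have sc: "((\<lambda>t. scaleC c (DD (of_real t) k)) \<longlongrightarrow> scaleC c (D0 k)) (at_right 0)"
    proof (rule Lim_null[THEN iffD2], rule Lim_null_comparison)
      show "\<forall>\<^sub>F t in at_right 0. norm (scaleC c (DD (of_real t) k) - scaleC c (D0 k)) \<le> norm c * norm (DD (of_real t) k - D0 k)"
        by (simp flip: scaleC_diff_right)
      show "((\<lambda>t. norm c * norm (DD (of_real t) k - D0 k)) \<longlongrightarrow> 0) (at_right 0)"
        using lim[of k] by (intro tendsto_mult_right_zero tendsto_norm_zero) (simp add: Lim_null[symmetric])
    qed
    show "((\<lambda>t. DD (of_real t) (h + scaleC c k)) \<longlongrightarrow> D0 h + scaleC c (D0 k)) (at_right 0)"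
      by (rule Lim_transform_eventually[OF tendsto_add[OF lim sc]])
        (use ev in eventually_elim, simp add: DD_lin)
  qed simp
  have D0_norm: "norm (D0 h) \<le> norm h / 2" for h
  proof (rule tendsto_upperbound[OF tendsto_norm[OF lim]])
    show "\<forall>\<^sub>F t in at_right 0. norm (DD (of_real t) h) \<le> norm h / 2"
      using ev by eventually_elim (rule DD_norm)
  qed simp
  define N0 where "N0 h = (THE k. U k + D0 k = h)" for h
  have N0: "U (N0 h) + D0 (N0 h) = h" for h
    unfolding N0_def by (rule theI', rule U_plus_small_bij[OF D0_lin D0_norm])
  have N0_norm: "norm (N0 h) \<le> 2 * norm h" for h
    by (rule norm_le_U_plus_small[of D0, OF D0_norm N0])
  define D1 where "D1 \<kappa> k = scaleC (1/\<kappa>) (DD \<kappa> k - D0 k)" for \<kappa> k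
  have step: "NN \<kappa> k = N0 k + scaleC \<kappa> (scaleC (- 1) (NN \<kappa> (D1 \<kappa> (N0 k))))" if "\<kappa> \<in> half_disc \<delta>" for \<kappa> k
  proof -
    note \<kappa> = half_disc_Re[OF that] half_disc_nz[OF that]
    have "U (N0 k) + DD \<kappa> (N0 k) = k + scaleC \<kappa> (D1 \<kappa> (N0 k))"
      using N0[of k] \<kappa> by (simp add: D1_def scaleC_scaleC algebra_simps)
    then have "N0 k = NN \<kappa> (k + scaleC \<kappa> (D1 \<kappa> (N0 k)))" by (rule NN_unique[OF \<kappa>(1)])
    then have "N0 k = NN \<kappa> k + scaleC \<kappa> (NN \<kappa> (D1 \<kappa> (N0 k)))" by (simp only: NN_lin[OF \<kappa>(1)])
    then show ?thesis by (simp add: scaleC_minus_one scaleC_minus_right eq_diff_eq)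
  qed
  have "J \<le> b - 1 \<Longrightarrow> gexp \<delta> J norm (\<lambda>_. 1) (\<lambda>k \<kappa>. NN \<kappa> k)" for J
  proof (induction J)
    case 0 show ?case
      by (rule gexpI[where b="\<lambda>_ _. 0" and C=2]) (auto intro: NN_norm dest: half_disc_Re)
  next
    case (Suc J)
    have IH: "gexp \<delta> J norm (\<lambda>_. 1) (\<lambda>k \<kappa>. NN \<kappa> k)" using Suc by simp
    have D1': "gexp \<delta> J norm (\<lambda>_. 1) (\<lambda>k \<kappa>. D1 \<kappa> k)"
      using gexp_restrict[OF D1, of J \<delta>] Suc.prems b by (simp add: D1_def)
    have D1N0: "gexp \<delta> J norm (\<lambda>_. 1) (\<lambda>k \<kappa>. D1 \<kappa> (N0 k))"
      by (rule gexp_mono[OF gexp_reindex[OF D1', where g=N0], where c=2 and d=1]) (auto intro: N0_norm)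
    have "gexp \<delta> J (\<lambda>k. 1 * norm k) (\<lambda>_. 1) (\<lambda>k \<kappa>. NN \<kappa> (D1 \<kappa> (N0 k)))"
    proof (rule gexp_apply[OF _ _ _ D1N0 \<delta>])
      show "gexp \<delta> J (\<lambda>(i::'h, k). 1 * norm k) (\<lambda>(i, k). 1) (\<lambda>(i, k) \<kappa>. NN \<kappa> k)"
        using gexp_reindex[OF IH, where g=snd] by (simp add: case_prod_unfold)
    qed (auto dest: half_disc_Re simp: NN_add NN_scale)
    from gexp_apply[OF _ _ _ this \<delta>, of "\<lambda>_. 1" "\<lambda>_ _. scaleC (- 1)"]
    have "gexp \<delta> J (\<lambda>k. 1 * (1 * norm k)) (\<lambda>_. 1) (\<lambda>k \<kappa>. scaleC (- 1) (NN \<kappa> (D1 \<kappa> (N0 k))))"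
      using gexp_const[of "\<lambda>(i::'h, k::'h). scaleC (- 1) k" 1 "\<lambda>(i::'h, k). norm k" "\<lambda>_. 1" \<delta> J]
      by (simp add: scaleC_add_right scaleC_scaleC case_prod_unfold)
    then have 1: "gexp \<delta> J (\<lambda>k. norm k * 1) (\<lambda>_. 1) (\<lambda>k \<kappa>. scaleC (- 1) (NN \<kappa> (D1 \<kappa> (N0 k))))" by simp
    show ?case
      by (rule gexp_shift[OF 1 step, where D=2]) (auto intro: NN_norm dest: half_disc_Re)
  qed
  then show ?thesis by simp
qed

lemma gexp_G_v_NN:
  assumes \<delta>: "0 < \<delta>"
  shows "gexp \<delta> (b - 1) (\<lambda>(x, h). norm h) (\<lambda>(x, h). wt x) (\<lambda>(x, h) \<kappa>. kop (G \<kappa>) (v (NN \<kappa> h)) x)"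
proof -
  have "gexp \<delta> (b - 1) (\<lambda>(k, x). Cv * norm k) (\<lambda>(k, x). wt x) (\<lambda>(k, x) \<kappa>. kop (G \<kappa>) (v k) x)"
    by (rule gexp_G_apply[OF \<delta> v_l1w v_norm])
  from gexp_reindex[OF this, where g="\<lambda>p :: (('k, 'a) vertex \<times> 'h) \<times> 'h. (snd p, fst (fst p))"]
  have "gexp \<delta> (b - 1) (\<lambda>p :: (('k, 'a) vertex \<times> 'h) \<times> 'h. Cv * norm (snd p)) (\<lambda>p. wt (fst (fst p)))
     (\<lambda>p \<kappa>. kop (G \<kappa>) (v (snd p)) (fst (fst p)))" by (simp add: case_prod_unfold)
  then have 1: "gexp \<delta> (b - 1) (\<lambda>p :: (('k, 'a) vertex \<times> 'h) \<times> 'h. 1 * norm (snd p)) (\<lambda>p. wt (fst (fst p)))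
     (\<lambda>p \<kappa>. kop (G \<kappa>) (v (snd p)) (fst (fst p)))"
    by (rule gexp_mono[where c=Cv and d=1]) (use Cv in \<open>auto simp: wt_nonneg\<close>)
  have 2: "gexp \<delta> (b - 1) (\<lambda>p :: ('k, 'a) vertex \<times> 'h. norm (snd p)) (\<lambda>p. wt (fst p)) (\<lambda>p \<kappa>. NN \<kappa> (snd p))"
    by (rule gexp_mono[OF gexp_reindex[OF gexp_NN[OF \<delta>], where g=snd], where c=1 and d=1]) (auto simp: wt_ge_1 wt_nonneg)
  have "gexp \<delta> (b - 1) (\<lambda>p. 1 * norm (snd p)) (\<lambda>p. wt (fst p)) (\<lambda>p \<kappa>. kop (G \<kappa>) (v (NN \<kappa> (snd p))) (fst p))"
  proof (rule gexp_apply[OF _ _ _ 2 \<delta>, where N="\<lambda>p \<kappa> k. kop (G \<kappa>) (v k) (fst p)"])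
    fix i :: "('k, 'a) vertex \<times> 'h" and \<kappa> c and x y :: 'h assume "\<kappa> \<in> half_disc \<delta>"
    note \<kappa> = half_disc_Re[OF this]
    have v0: "v 0 = (\<lambda>_. 0)" using v_lin[of 0 "-1" 0] by auto
    have *: "kop (G \<kappa>) (v (x + scaleC c y)) (fst i) = kop (G \<kappa>) (v x) (fst i) + c * kop (G \<kappa>) (v y) (fst i)" for x c y
      using G_lin[OF \<kappa> v_ell2[of x] v_ell2[of y], of c] by (simp flip: v_lin)
    show "kop (G \<kappa>) (v (x + y)) (fst i) = kop (G \<kappa>) (v x) (fst i) + kop (G \<kappa>) (v y) (fst i)"
      using *[of x 1 y] by simp
    show "kop (G \<kappa>) (v (scaleC c x)) (fst i) = scaleC c (kop (G \<kappa>) (v x) (fst i))"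
      using *[of 0 c x] by (simp add: v0 kop_def)
  qed (use 1 in \<open>auto simp: case_prod_unfold\<close>)
  then show ?thesis by (simp add: case_prod_unfold)
qed

lemma gexp_Rc_correction:
  fixes e :: "'i \<Rightarrow> complex \<Rightarrow> 'h"
  assumes \<delta>: "0 < \<delta>" and e: "gexp \<delta> (b - 1) Q P e" and P: "\<And>i. wt (x i) \<le> P i"
  shows "gexp \<delta> (b - 1) Q P (\<lambda>i \<kappa>. kop (G \<kappa>) (v (NN \<kappa> (e i \<kappa>))) (x i))"
proof -
  have P0: "0 \<le> P i" for i using P[of i] wt_nonneg[of "x i"] by linarith
  have 1: "gexp \<delta> (b - 1) (\<lambda>p. 1 * norm (snd p)) (\<lambda>p. P (fst p)) (\<lambda>p \<kappa>. kop (G \<kappa>) (v (NN \<kappa> (snd p))) (x (fst p)))"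
  proof (rule gexp_mono[where c=1 and d=1])
    show "gexp \<delta> (b - 1) (\<lambda>p. norm (snd p)) (\<lambda>p. wt (x (fst p))) (\<lambda>p \<kappa>. kop (G \<kappa>) (v (NN \<kappa> (snd p))) (x (fst p)))"
      using gexp_reindex[OF gexp_G_v_NN[OF \<delta>], where g="\<lambda>p. (x (fst p), snd p)"] by (simp add: case_prod_unfold)
  qed (use P P0 in auto)
  have "gexp \<delta> (b - 1) (\<lambda>i. 1 * Q i) P (\<lambda>i \<kappa>. kop (G \<kappa>) (v (NN \<kappa> (e i \<kappa>))) (x i))"
  proof (rule gexp_apply[OF _ _ _ e \<delta>, where N="\<lambda>i \<kappa> k. kop (G \<kappa>) (v (NN \<kappa> k)) (x i)"])
    fix i \<kappa> c and h k :: 'h assume "\<kappa> \<in> half_disc \<delta>"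
    note \<kappa> = half_disc_Re[OF this]
    have v0: "v 0 = (\<lambda>_. 0)" using v_lin[of 0 "-1" 0] by auto
    have *: "kop (G \<kappa>) (v (NN \<kappa> (h + scaleC c k))) (x i) = kop (G \<kappa>) (v (NN \<kappa> h)) (x i) + c * kop (G \<kappa>) (v (NN \<kappa> k)) (x i)" for h c k
      using G_lin[OF \<kappa> v_ell2[of "NN \<kappa> h"] v_ell2[of "NN \<kappa> k"], of c] by (simp add: NN_lin[OF \<kappa>] flip: v_lin)
    show "kop (G \<kappa>) (v (NN \<kappa> (h + k))) (x i) = kop (G \<kappa>) (v (NN \<kappa> h)) (x i) + kop (G \<kappa>) (v (NN \<kappa> k)) (x i)"
      using *[of h 1 k] by simp
    show "kop (G \<kappa>) (v (NN \<kappa> (scaleC c h))) (x i) = scaleC c (kop (G \<kappa>) (v (NN \<kappa> h)) (x i))"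
      using *[of 0 c h] by (simp add: NN_zero[OF \<kappa>] v0 kop_def)
  qed (use 1 in \<open>auto simp: case_prod_unfold\<close>)
  then show ?thesis by simp
qed

lemma gexp_minus:
  fixes f :: "'i \<Rightarrow> complex \<Rightarrow> complex"
  assumes "gexp \<delta> J Q P f" "0 < \<delta>"
  shows "gexp \<delta> J Q P (\<lambda>i \<kappa>. - f i \<kappa>)"
proof -
  have "gexp \<delta> J (\<lambda>_. 1) P (\<lambda>i \<kappa>. - 1 :: complex)"
    by (rule gexp_const[where c=1]) (use gexp_nonneg[OF assms(1)] in auto)
  from gexp_mult[OF this assms] show ?thesis by simp
qed

lemma gexp_Rc:
  fixes g :: "'i \<Rightarrow> ('k, 'a) gfun"
  assumes \<delta>: "0 < \<delta>" and g: "\<And>i. g i \<in> l1w (real b)" and B: "\<And>i. l1w_norm (real b) (g i) \<le> B i"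
  shows "gexp \<delta> (b - 1) (\<lambda>(i, x). B i) (\<lambda>(i, x). wt x) (\<lambda>(i, x) \<kappa>. Rc \<kappa> (g i) x)"
proof -
  have B0: "0 \<le> B i" for i using B[of i] l1w_norm_nonneg[of b "g i"] by linarith
  have e: "gexp \<delta> (b - 1) (\<lambda>p. B (fst p)) (\<lambda>p :: 'i \<times> ('k, 'a) vertex. wt (snd p)) (\<lambda>p \<kappa>. v' (kop (G \<kappa>) (g (fst p))))"
    by (rule gexp_mono[OF gexp_reindex[OF gexp_v'_G[OF \<delta> g B], where g=fst], where c=1 and d=1])
      (auto simp: B0 wt_ge_1 wt_nonneg)
  from gexp_add[OF gexp_G_apply[OF \<delta> g B, unfolded case_prod_unfold]
      gexp_minus[OF gexp_Rc_correction[OF \<delta> e, where x=snd] \<delta>]]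
  show ?thesis by (simp add: Rc_def case_prod_unfold)
qed

text \<open>The kernel version, with both points free. The correction term has amplitude 1, which is
  below the smaller of the two weights.\<close>

lemma gexp_Rc_delta:
  assumes \<delta>: "0 < \<delta>"
  shows "gexp \<delta> (b - 1) (\<lambda>(x, y). min (wt x) (wt y)) (\<lambda>(x, y). wt x * wt y) (\<lambda>(x, y) \<kappa>. Rc \<kappa> (delta y) x)"
proof -
  have le: "wt x \<le> wt x * wt y" "wt y \<le> wt x * wt y" for x y :: "('k, 'a) vertex"
    using wt_ge_1[of x] wt_ge_1[of y] by (auto simp: mult_le_cancel_left1 mult_le_cancel_right1)
  have e: "gexp \<delta> (b - 1) (\<lambda>p. min (wt (fst p)) (wt (snd p))) (\<lambda>p :: ('k, 'a) vertex \<times> ('k, 'a) vertex. wt (fst p) * wt (snd p))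
     (\<lambda>p \<kappa>. v' (kop (G \<kappa>) (delta (snd p))))"
    by (rule gexp_mono[OF gexp_reindex[OF gexp_v'_G_delta[OF \<delta>], where g=snd], where c=1 and d=1])
      (auto simp: wt_ge_1 wt_nonneg le)
  from gexp_add[OF gexp_ext_green[OF \<delta>, unfolded case_prod_unfold]
      gexp_minus[OF gexp_Rc_correction[OF \<delta> e, where x=fst] \<delta>]]
  show ?thesis by (simp add: Rc_def case_prod_unfold le)
qed

end

section \<open>The Schur complement\<close>

context schroedinger
begin

abbreviation F :: "('k, 'a) vertex set" where
  "F \<equiv> - exterior n"

lemma finite_F: "finite F"
  by (rule finite_core_region)

text \<open>A column of the full operator: the potential couples the vertex to the exterior as well
  as the edges do.\<close>

definition gg :: "('k, 'a) vertex \<Rightarrow> ('k, 'a) gfun" where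
  "gg y = HH (delta y)"

lemma H0_finite_support: "finite {x. H0 E0 r (delta y) x \<noteq> 0}"
proof -
  have "{x. H0 E0 r (delta y) x \<noteq> 0} \<subseteq> nbhd y"
    using h0_outside[of _ y E0 r] h0_sym[of E0 r] unfolding h0_def by (metis (mono_tags, lifting) mem_Collect_eq subsetI)
  then show ?thesis by (rule finite_subset[OF _ finite_nbhd])
qed

lemma gg_l1w: "gg y \<in> l1w (real b)"
  unfolding gg_def HH_def
  by (intro l1w_add l1w_finite_support[OF H0_finite_support] V_l1w ell2_in_linfw ell2_delta) auto

lemma gg_ell2: "gg y \<in> ell2"
  by (rule l1w_ell2[OF gg_l1w])

lemma pairing_gg: "u \<in> ell2 \<Longrightarrow> pairing (gg y) u = HH u y"
  unfolding gg_def using HH_symmetric[of "delta y" u] by simp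

definition SS :: "complex \<Rightarrow> ('k, 'a) vertex \<Rightarrow> ('k, 'a) vertex \<Rightarrow> complex" where
  "SS \<kappa> i j = gg j i + \<kappa>\<^sup>2 * delta j i - pairing (gg i) (Rc \<kappa> (gg j))"

definition LL :: "complex \<Rightarrow> ('k, 'a) vertex \<Rightarrow> ('k, 'a) gfun" where
  "LL \<kappa> i = (\<lambda>x. delta i x - Rc \<kappa> (gg i) x)"

lemma LL_ell2: "0 < Re \<kappa> \<Longrightarrow> LL \<kappa> i \<in> ell2"
  unfolding LL_def by (intro ell2_diff ell2_delta Rc_ell2 gg_ell2)

lemma LL_F: "j \<in> F \<Longrightarrow> LL \<kappa> i j = delta i j"
  by (simp add: LL_def Rc_outside)

text \<open>\<open>LL \<kappa> i\<close> solves the exterior problem with boundary data at \<open>i\<close>, and \<open>SS\<close> is the resulting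
  Schur complement.\<close>

lemma HH_LL:
  assumes \<kappa>: "0 < Re \<kappa>" and i: "i \<in> F"
  shows "HH (LL \<kappa> i) x + \<kappa>\<^sup>2 * LL \<kappa> i x = (if x \<in> F then SS \<kappa> x i else 0)"
proof -
  have R: "Rc \<kappa> (gg i) \<in> ell2" by (intro Rc_ell2 \<kappa> gg_ell2)
  have h: "HH (LL \<kappa> i) x = gg i x - HH (Rc \<kappa> (gg i)) x"
    unfolding LL_def gg_def
    using HH_lin[OF ell2_in_linfw[OF ell2_delta] ell2_in_linfw[OF R], of i "-1" x] by (simp add: gg_def)
  have l: "LL \<kappa> i x = delta i x - Rc \<kappa> (gg i) x" by (simp add: LL_def)
  show ?thesis
  proof (cases "x \<in> F")
    case True
    then show ?thesis using Rc_outside[of x \<kappa> "gg i"] pairing_gg[OF R, of x] by (simp add: h l SS_def)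
  next
    case False
    then have "delta i x = 0" using i by (auto simp: delta_def)
    then show ?thesis using Rc_eq[OF \<kappa> gg_ell2, of x i] False by (simp add: h l algebra_simps)
  qed
qed

lemma HH_LL_sum:
  assumes \<kappa>: "0 < Re \<kappa>"
  shows "HH (\<lambda>x. \<Sum>i\<in>F. a i * LL \<kappa> i x) x + \<kappa>\<^sup>2 * (\<Sum>i\<in>F. a i * LL \<kappa> i x)
    = (if x \<in> F then \<Sum>i\<in>F. SS \<kappa> x i * a i else 0)"
proof -
  have "HH (\<lambda>x. \<Sum>i\<in>F. a i * LL \<kappa> i x) x + \<kappa>\<^sup>2 * (\<Sum>i\<in>F. a i * LL \<kappa> i x)
    = (\<Sum>i\<in>F. a i * (HH (LL \<kappa> i) x + \<kappa>\<^sup>2 * LL \<kappa> i x))"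
    by (subst HH_sum[OF finite_F LL_ell2[OF \<kappa>]]) (simp add: sum_distrib_left sum.distrib algebra_simps)
  also have "\<dots> = (\<Sum>i\<in>F. a i * (if x \<in> F then SS \<kappa> x i else 0))"
    by (intro sum.cong refl) (simp add: HH_LL[OF \<kappa>])
  finally show ?thesis by (simp add: mult.commute)
qed

lemma LL_sum_F: "j \<in> F \<Longrightarrow> (\<Sum>i\<in>F. a i * LL \<kappa> i j) = a j"
  using finite_F by (simp add: LL_F delta_def if_distrib[of "(*) _"] cong: if_cong)

text \<open>On the diagonal ray \<kappa>^2 = i t^2, while the pairing of \<open>w\<close> with its
  image under \<open>HH\<close> is real. So the imaginary part of the pairing with \<open>f\<close>
  is t^2 times the squared norm of \<open>w\<close>.\<close>

lemma apriori_ell2: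
  assumes t: "0 < t" and w: "w \<in> ell2" and f: "f \<in> ell2"
    and eq: "\<And>x. HH w x + (of_real t * cis (pi / 4))\<^sup>2 * w x = f x"
  shows "sqn w \<le> sqn f / t ^ 4"
proof -
  have k2: "(of_real t * cis (pi / 4))\<^sup>2 = of_real (t\<^sup>2) * \<i>"
    by (simp add: power_mult_distrib power2_eq_square cis_mult)
  have "f = (\<lambda>x. HH w x + of_real (t\<^sup>2) * \<i> * w x)" using eq unfolding k2 by auto
  then have "pairing w f = pairing w (HH w) + of_real (t\<^sup>2) * \<i> * pairing w w"
    using pairing_add_right[OF ell2_pairing_summable[OF w HH_ell2[OF w]] ell2_pairing_summable[OF w ell2_scale(1)[OF w]]]
    by (simp only: pairing_scale_right)
  moreover have "Im (pairing w (HH w)) = 0"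
  proof -
    have "pairing w (HH w) = cnj (pairing w (HH w))"
      using HH_symmetric[OF w w] pairing_cnj[of "HH w" w] by simp
    then have "Im (pairing w (HH w)) = Im (cnj (pairing w (HH w)))" by (rule arg_cong)
    then show ?thesis by simp
  qed
  ultimately have "Im (pairing w f) = t\<^sup>2 * sqn w" by (simp add: pairing_self[OF w])
  then have "t\<^sup>2 * sqn w \<le> norm (pairing w f)" by (metis abs_Im_le_cmod abs_le_D1)
  \<comment> \<open>The parameter t^2 makes the first term half of the left side, so it can be
    absorbed.\<close>
  also have "\<dots> \<le> t\<^sup>2 / 2 * sqn w + 1 / (2 * t\<^sup>2) * sqn f"
    by (rule norm_pairing_le[OF w f]) (use t in simp)
  finally have le: "t\<^sup>2 * sqn w \<le> t\<^sup>2 / 2 * sqn w + 1 / (2 * t\<^sup>2) * sqn f" .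
  define q where "q = t\<^sup>2"
  have q: "0 < q" using t by (simp add: q_def)
  have "2 * (q * (q * sqn w)) \<le> 2 * (q * (q / 2 * sqn w + 1 / (2 * q) * sqn f))"
    using mult_left_mono[OF le, of q] q unfolding q_def[symmetric] by simp
  also have "\<dots> = q * (q * sqn w) + sqn f" using q by (simp add: distrib_left)
  finally have "sqn w * (q * q) \<le> sqn f" by (simp only: mult_ac)
  moreover have "t ^ 4 = q * q" unfolding q_def by (simp only: power2_eq_square power4_eq_xxxx mult.assoc)
  ultimately show ?thesis using q by (simp add: pos_le_divide_eq)
qed

text \<open>The combination of the lifts \<open>LL\<close> has the values \<open>a\<close> on the
  removed vertices, and H + \<kappa>^2 maps it to the Schur complement applied to \<open>a\<close>,
  supported there. The estimate for the full operator thus passes to the matrix.\<close>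

lemma SS_apriori:
  assumes t: "0 < t" and j: "j \<in> F"
  shows "norm (a j) \<le> 1 / t\<^sup>2 * (\<Sum>i\<in>F. norm (\<Sum>l\<in>F. SS (of_real t * cis (pi / 4)) i l * a l))"
proof -
  define \<kappa> where "\<kappa> = of_real t * cis (pi / 4)"
  have \<kappa>: "0 < Re \<kappa>" using t by (simp add: \<kappa>_def cos_45)
  define w where "w = (\<lambda>x. \<Sum>i\<in>F. a i * LL \<kappa> i x)"
  define f where "f = (\<lambda>x. if x \<in> F then \<Sum>l\<in>F. SS \<kappa> x l * a l else 0)"
  define N where "N = (\<Sum>i\<in>F. norm (\<Sum>l\<in>F. SS \<kappa> i l * a l))"
  have w: "w \<in> ell2" unfolding w_def by (intro ell2_sum finite_F ell2_scale LL_ell2 \<kappa>)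
  have hs: "((\<lambda>x. norm (f x)) has_sum N) UNIV"
    by (rule has_sum_finite_neutralI[OF finite_F]) (auto simp: f_def N_def)
  note l1 = l1_imp_ell2[OF has_sum_imp_summable[OF hs]]
  have N: "0 \<le> N" by (simp add: N_def sum_nonneg)
  have "sqn w \<le> sqn f / t ^ 4"
    by (rule apriori_ell2[OF t w l1(1)]) (use HH_LL_sum[OF \<kappa>, of a] in \<open>simp add: w_def f_def \<kappa>_def\<close>)
  also have "\<dots> \<le> N\<^sup>2 / t ^ 4" using l1(2) t unfolding infsumI[OF hs] by (intro divide_right_mono) auto
  also have "\<dots> = (1 / t\<^sup>2 * N)\<^sup>2" by (simp add: power_divide flip: power_mult)
  finally have "(norm (w j))\<^sup>2 \<le> (1 / t\<^sup>2 * N)\<^sup>2" using norm_le_sqn[OF w, of j] by linarith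
  then have "norm (w j) \<le> 1 / t\<^sup>2 * N" by (rule power2_le_imp_le) (use N in simp)
  moreover have "w j = a j" unfolding w_def by (rule LL_sum_F[OF j])
  ultimately show ?thesis by (simp add: N_def \<kappa>_def)
qed

definition BB :: "('k, 'a) vertex \<Rightarrow> real" where
  "BB i = l1w_norm (real b) (gg i)"

lemma BB_nonneg: "0 \<le> BB i" unfolding BB_def by (rule l1w_norm_nonneg)

lemma gexp_Rc_gg: "0 < \<delta> \<Longrightarrow> gexp \<delta> (b - 1) (\<lambda>(i, x). BB i) (\<lambda>(i, x). wt x) (\<lambda>(i, x) \<kappa>. Rc \<kappa> (gg i) x)"
  by (rule gexp_Rc[OF _ gg_l1w]) (auto simp: BB_def)

text \<open>Both columns have full weight \<open>b\<close>, so both position variables are summed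
  away and the scale is 1.\<close>

lemma gexp_SS:
  assumes \<delta>: "0 < \<delta>" "\<delta> \<le> 1"
  shows "gexp \<delta> (b - 1) (\<lambda>_::unit. 1) (\<lambda>_. 1) (\<lambda>_ \<kappa>. SS \<kappa> i j)"
proof -
  have s: "(\<lambda>x. wt x ^ J' * norm (cnj (gg i x))) summable_on UNIV"
    "(\<Sum>\<^sub>\<infinity>x. wt x ^ J' * norm (cnj (gg i x))) \<le> BB i" if J: "J' \<le> b - 1" for J'
  proof -
    have B: "(\<lambda>x. wt x ^ b * norm (gg i x)) summable_on UNIV" using gg_l1w[of i] by (simp add: l1w_nat)
    have le: "wt x ^ J' * norm (gg i x) \<le> wt x ^ b * norm (gg i x)" for x
      using J by (intro mult_right_mono wt_power_mono) auto
    have S: "(\<lambda>x. wt x ^ J' * norm (gg i x)) summable_on UNIV"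
      by (rule summable_on_comparison_test[OF B le]) (auto intro!: mult_nonneg_nonneg zero_le_power wt_nonneg)
    show "(\<lambda>x. wt x ^ J' * norm (cnj (gg i x))) summable_on UNIV" using S by simp
    show "(\<Sum>\<^sub>\<infinity>x. wt x ^ J' * norm (cnj (gg i x))) \<le> BB i"
      using infsum_mono[OF S B le] by (simp add: BB_def l1w_norm_nat)
  qed
  have "gexp \<delta> (b - 1) (\<lambda>_::unit. BB j * BB i) (\<lambda>_. 1) (\<lambda>_ \<kappa>. \<Sum>\<^sub>\<infinity>x. Rc \<kappa> (gg j) x * cnj (gg i x))"
  proof (rule gexp_infsum[where f="\<lambda>p \<kappa>. Rc \<kappa> (gg j) (snd p)" and Q="\<lambda>_. BB j" and P="\<lambda>p. wt (snd p)"
        and g="\<lambda>_ x. cnj (gg i x)", unfolded snd_conv])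
    show "gexp \<delta> (b - 1) (\<lambda>_. BB j) (\<lambda>p. wt (snd p)) (\<lambda>p \<kappa>. Rc \<kappa> (gg j) (snd (p :: unit \<times> _)))"
      using gexp_reindex[OF gexp_Rc_gg[OF \<delta>(1)], where g="\<lambda>p :: unit \<times> _. (j, snd p)"] by simp
    fix J' assume J: "J' \<le> b - 1"
    show "(\<lambda>x. BB j * wt x ^ J' * norm (cnj (gg i x))) summable_on UNIV"
      unfolding mult.assoc by (rule summable_on_cmult_right[OF s(1)[OF J]])
    have "(\<Sum>\<^sub>\<infinity>x. BB j * wt x ^ J' * norm (cnj (gg i x))) = BB j * (\<Sum>\<^sub>\<infinity>x. wt x ^ J' * norm (cnj (gg i x)))"
      unfolding mult.assoc by (rule infsum_cmult_right')
    then show "(\<Sum>\<^sub>\<infinity>x. BB j * wt x ^ J' * norm (cnj (gg i x))) \<le> BB j * BB i * 1 ^ J'"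
      using mult_left_mono[OF s(2)[OF J] BB_nonneg[of j]] by simp
  qed (use BB_nonneg \<delta> in auto)
  then have "gexp \<delta> (b - 1) (\<lambda>_::unit. BB j * BB i) (\<lambda>_. 1) (\<lambda>_ \<kappa>. pairing (gg i) (Rc \<kappa> (gg j)))"
    by (simp add: pairing_def mult.commute)
  then have 1: "gexp \<delta> (b - 1) (\<lambda>_::unit. 1) (\<lambda>_. 1) (\<lambda>_ \<kappa>. - pairing (gg i) (Rc \<kappa> (gg j)))"
    by (intro gexp_minus[OF _ \<delta>(1)] gexp_mono[where c="BB j * BB i" and d=1 and Q'="\<lambda>_. 1" and P'="\<lambda>_. 1" and P="\<lambda>_. 1" and Q="\<lambda>_. BB j * BB i"])
      (auto simp: BB_nonneg)
  have c: "gexp \<delta> (b - 1) (\<lambda>_::unit. 1) (\<lambda>_. 1) (\<lambda>_ _. c)" for c :: complex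
    by (rule gexp_const[where c="norm c"]) auto
  have 2: "gexp \<delta> (b - 1) (\<lambda>_::unit. 1) (\<lambda>_. 1) (\<lambda>_ \<kappa>. \<kappa>\<^sup>2 * delta j i)"
    using gexp_mult[OF gexp_power[OF \<delta>, of "b - 1" 2] c[of "delta j i"] \<delta>(1)] by simp
  show ?thesis using gexp_add[OF gexp_add[OF c[of "gg j i"] 2] 1] by (simp add: SS_def)
qed

lemma gexp_LL:
  assumes \<delta>: "0 < \<delta>"
  shows "gexp \<delta> (b - 1) (\<lambda>_. 1) wt (\<lambda>x \<kappa>. LL \<kappa> i x)"
proof -
  have "gexp \<delta> (b - 1) (\<lambda>x. BB i) wt (\<lambda>x \<kappa>. Rc \<kappa> (gg i) x)"
    using gexp_reindex[OF gexp_Rc_gg[OF \<delta>], where g="\<lambda>x. (i, x)"] by simp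
  then have 1: "gexp \<delta> (b - 1) (\<lambda>x. 1) wt (\<lambda>x \<kappa>. - Rc \<kappa> (gg i) x)"
    by (intro gexp_minus[OF _ \<delta>], elim gexp_mono[where c="BB i" and d=1]) (auto simp: BB_nonneg wt_nonneg)
  have 2: "gexp \<delta> (b - 1) (\<lambda>x. 1) wt (\<lambda>x \<kappa>. delta i x)"
    by (rule gexp_const[where c=1]) (auto simp: delta_def wt_nonneg)
  show ?thesis using gexp_add[OF 2 1] by (simp add: LL_def)
qed

text \<open>Dual to \<open>LL\<close>: the kernel of the map that takes a source to its effective
  value at the removed vertex \<open>j\<close>.\<close>

definition MM :: "complex \<Rightarrow> ('k, 'a) vertex \<Rightarrow> ('k, 'a) vertex \<Rightarrow> complex" where
  "MM \<kappa> j y = delta y j - pairing (gg j) (Rc \<kappa> (delta y))"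

lemma gexp_MM:
  assumes \<delta>: "0 < \<delta>"
  shows "gexp \<delta> (b - 1) (\<lambda>_. 1) wt (\<lambda>y \<kappa>. MM \<kappa> j y)"
proof -
  have B: "(\<lambda>x. wt x ^ b * norm (gg j x)) summable_on UNIV" using gg_l1w[of j] by (simp add: l1w_nat)
  have le: "min (wt x) (wt y) * (wt x * wt y) ^ J' * norm (cnj (gg j x)) \<le> wt y ^ J' * (wt x ^ b * norm (gg j x))"
    if "J' \<le> b - 1" for J' and x y :: "('k, 'a) vertex"
  proof -
    have "min (wt x) (wt y) * (wt x * wt y) ^ J' \<le> wt x * (wt x * wt y) ^ J'"
      by (intro mult_right_mono zero_le_power mult_nonneg_nonneg wt_nonneg) auto
    also have "\<dots> = wt y ^ J' * wt x ^ Suc J'" by (simp add: power_mult_distrib)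
    also have "\<dots> \<le> wt y ^ J' * wt x ^ b"
      using that b4 by (intro mult_left_mono wt_power_mono zero_le_power wt_nonneg) auto
    finally show ?thesis by (simp add: mult_right_mono flip: mult.assoc)
  qed
  have s: "(\<lambda>x. wt y ^ J' * (wt x ^ b * norm (gg j x))) summable_on UNIV" for J' and y :: "('k, 'a) vertex"
    by (rule summable_on_cmult_right[OF B])
  have nn: "0 \<le> min (wt x) (wt y) * (wt x * wt y) ^ J' * norm (cnj (gg j x))" for J' and x y :: "('k, 'a) vertex"
    by (intro mult_nonneg_nonneg zero_le_power) (auto simp: wt_nonneg)
  have "gexp \<delta> (b - 1) (\<lambda>y. BB j) wt (\<lambda>y \<kappa>. \<Sum>\<^sub>\<infinity>x. Rc \<kappa> (delta y) x * cnj (gg j x))"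
  proof (rule gexp_infsum[where f="\<lambda>p \<kappa>. Rc \<kappa> (delta (fst p)) (snd p)" and Q="\<lambda>p. min (wt (snd p)) (wt (fst p))"
        and P="\<lambda>p. wt (snd p) * wt (fst p)" and g="\<lambda>_ x. cnj (gg j x)", unfolded fst_conv snd_conv])
    show "gexp \<delta> (b - 1) (\<lambda>p. min (wt (snd p)) (wt (fst p))) (\<lambda>p. wt (snd p) * wt (fst p)) (\<lambda>p \<kappa>. Rc \<kappa> (delta (fst p)) (snd p))"
      using gexp_reindex[OF gexp_Rc_delta[OF \<delta>], where g="\<lambda>p. (snd p, fst p)"] by simp
    fix y :: "('k, 'a) vertex" and J' assume J: "J' \<le> b - 1"
    show S: "(\<lambda>x. min (wt x) (wt y) * (wt x * wt y) ^ J' * norm (cnj (gg j x))) summable_on UNIV"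
      by (rule summable_on_comparison_test[OF s le[OF J] nn])
    have "(\<Sum>\<^sub>\<infinity>x. min (wt x) (wt y) * (wt x * wt y) ^ J' * norm (cnj (gg j x)))
       \<le> (\<Sum>\<^sub>\<infinity>x. wt y ^ J' * (wt x ^ b * norm (gg j x)))" by (rule infsum_mono[OF S s le[OF J]])
    also have "\<dots> = wt y ^ J' * BB j" by (simp only: infsum_cmult_right' BB_def l1w_norm_nat)
    finally show "(\<Sum>\<^sub>\<infinity>x. min (wt x) (wt y) * (wt x * wt y) ^ J' * norm (cnj (gg j x))) \<le> BB j * wt y ^ J'"
      by (simp only: mult.commute)
  qed (auto simp: BB_nonneg wt_nonneg \<delta>)
  then have "gexp \<delta> (b - 1) (\<lambda>y. BB j) wt (\<lambda>y \<kappa>. pairing (gg j) (Rc \<kappa> (delta y)))"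
    by (simp add: pairing_def mult.commute)
  then have 1: "gexp \<delta> (b - 1) (\<lambda>y. 1) wt (\<lambda>y \<kappa>. - pairing (gg j) (Rc \<kappa> (delta y)))"
    by (intro gexp_minus[OF _ \<delta>], elim gexp_mono[where c="BB j" and d=1]) (auto simp: BB_nonneg wt_nonneg)
  have 2: "gexp \<delta> (b - 1) (\<lambda>y. 1) wt (\<lambda>y \<kappa>. delta y j)"
    by (rule gexp_const[where c=1]) (auto simp: delta_def wt_nonneg)
  show ?thesis using gexp_add[OF 2 1] by (simp add: MM_def)
qed

text \<open>The entries expand to order b - 1, which is at least 3 because \<beta> \<ge> 4; this is
  enough to survive a double pole.\<close>

lemma SS_inverse_exists:
  obtains \<delta> X where "0 < \<delta>" "\<delta> \<le> 1"
    "\<And>\<kappa> i j. \<kappa> \<in> half_disc \<delta> \<Longrightarrow> i \<in> F \<Longrightarrow> j \<in> F \<Longrightarrow> (\<Sum>l\<in>F. SS \<kappa> i l * X \<kappa> l j) = (if i = j then 1 else 0)"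
    "\<And>\<kappa> i j. \<kappa> \<in> half_disc \<delta> \<Longrightarrow> i \<in> F \<Longrightarrow> j \<in> F \<Longrightarrow> (\<Sum>l\<in>F. X \<kappa> i l * SS \<kappa> l j) = (if i = j then 1 else 0)"
    "\<And>i j. i \<in> F \<Longrightarrow> j \<in> F \<Longrightarrow> gexp \<delta> (b - 1 - 2) (\<lambda>_::unit. 1) (\<lambda>_. 1) (\<lambda>_ \<kappa>. \<kappa>\<^sup>2 * X \<kappa> i j)"
proof -
  have J: "3 \<le> b - 1" using b4 by simp
  have w: "norm (cis (pi / 4)) = 1" "0 < Re (cis (pi / 4))" by (auto simp: cos_45)
  have S: "gexp 1 (b - 1) (\<lambda>_::unit. 1) (\<lambda>_. 1) (\<lambda>_ \<kappa>. SS \<kappa> i j)" if "i \<in> F" "j \<in> F" for i j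
    by (rule gexp_SS) auto
  have ap: "norm (a j) \<le> 1 / t\<^sup>2 * (\<Sum>i\<in>F. norm (\<Sum>l\<in>F. SS (of_real t * cis (pi / 4)) i l * a l))"
    if "0 < t" "t < 1" "j \<in> F" for t a j using that(1,3) by (rule SS_apriori)
  show thesis
    by (rule matrix_inverse_expansion[OF finite_F zero_less_one J w, where S=SS and C=1];
        (rule S | rule ap | rule that); assumption)
qed

end

locale schroedinger_inverse = schroedinger E0 r V b v v' U Cv n
  for E0 :: "'k::finite set set" and r :: "'a::finite \<Rightarrow> 'k"
    and V :: "('k, 'a) gfun \<Rightarrow> ('k, 'a) gfun" and b :: nat
    and v :: "'h::chilbert_space \<Rightarrow> ('k, 'a) gfun" and v' :: "('k, 'a) gfun \<Rightarrow> 'h" and U :: "'h \<Rightarrow> 'h"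
    and Cv :: real and n :: nat +
  fixes \<delta> :: real and X :: "complex \<Rightarrow> ('k, 'a) vertex \<Rightarrow> ('k, 'a) vertex \<Rightarrow> complex"
  assumes \<delta>: "0 < \<delta>" "\<delta> \<le> 1"
    and X_right: "\<And>\<kappa> i j. \<kappa> \<in> half_disc \<delta> \<Longrightarrow> i \<in> F \<Longrightarrow> j \<in> F \<Longrightarrow> (\<Sum>l\<in>F. SS \<kappa> i l * X \<kappa> l j) = (if i = j then 1 else 0)"
    and X_left: "\<And>\<kappa> i j. \<kappa> \<in> half_disc \<delta> \<Longrightarrow> i \<in> F \<Longrightarrow> j \<in> F \<Longrightarrow> (\<Sum>l\<in>F. X \<kappa> i l * SS \<kappa> l j) = (if i = j then 1 else 0)"
    and gexp_X: "\<And>i j. i \<in> F \<Longrightarrow> j \<in> F \<Longrightarrow> gexp \<delta> (b - 3) (\<lambda>_::unit. 1) (\<lambda>_. 1) (\<lambda>_ \<kappa>. \<kappa>\<^sup>2 * X \<kappa> i j)"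
begin

section \<open>The full resolvent by block inversion, and its kernel\<close>

definition RR_coeff :: "complex \<Rightarrow> ('k, 'a) gfun \<Rightarrow> ('k, 'a) vertex \<Rightarrow> complex" where
  "RR_coeff \<kappa> u i = (\<Sum>j\<in>F. X \<kappa> i j * (u j - pairing (gg j) (Rc \<kappa> u)))"

text \<open>Block inversion: solve outside with Dirichlet data, send the defect on the removed
  vertices through the inverse Schur complement, and lift the result by \<open>LL\<close>.\<close>

definition RR :: "complex \<Rightarrow> ('k, 'a) gfun \<Rightarrow> ('k, 'a) gfun" where
  "RR \<kappa> u = (\<lambda>x. Rc \<kappa> u x + (\<Sum>i\<in>F. RR_coeff \<kappa> u i * LL \<kappa> i x))"

lemma LL_sum_ell2: "0 < Re \<kappa> \<Longrightarrow> (\<lambda>x. \<Sum>i\<in>F. a i * LL \<kappa> i x) \<in> ell2"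
  by (intro ell2_sum finite_F ell2_scale LL_ell2)

lemma RR_ell2: "0 < Re \<kappa> \<Longrightarrow> u \<in> ell2 \<Longrightarrow> RR \<kappa> u \<in> ell2"
  unfolding RR_def by (intro ell2_add Rc_ell2 LL_sum_ell2)

lemma RR_eq:
  assumes \<kappa>: "\<kappa> \<in> half_disc \<delta>" and u: "u \<in> ell2"
  shows "HH (RR \<kappa> u) x + \<kappa>\<^sup>2 * RR \<kappa> u x = u x"
proof -
  note \<kappa>' = half_disc_Re[OF \<kappa>]
  note R = Rc_ell2[OF \<kappa>' u]
  let ?a = "RR_coeff \<kappa> u"
  have "HH (RR \<kappa> u) x + \<kappa>\<^sup>2 * RR \<kappa> u x = (HH (Rc \<kappa> u) x + \<kappa>\<^sup>2 * Rc \<kappa> u x)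
     + (HH (\<lambda>x. \<Sum>i\<in>F. ?a i * LL \<kappa> i x) x + \<kappa>\<^sup>2 * (\<Sum>i\<in>F. ?a i * LL \<kappa> i x))"
    unfolding RR_def
    using HH_lin[OF ell2_in_linfw[OF R] ell2_in_linfw[OF LL_sum_ell2[OF \<kappa>', of ?a]], of 1 x]
    by (simp add: algebra_simps)
  also have "\<dots> = u x"
  proof (cases "x \<in> F")
    case False
    then show ?thesis using Rc_eq[OF \<kappa>' u, of x] by (simp add: HH_LL_sum[OF \<kappa>'])
  next
    case True
    have "(\<Sum>i\<in>F. SS \<kappa> x i * ?a i) = (\<Sum>j\<in>F. (\<Sum>i\<in>F. SS \<kappa> x i * X \<kappa> i j) * (u j - pairing (gg j) (Rc \<kappa> u)))"
      unfolding RR_coeff_def sum_distrib_left sum_distrib_right mult.assoc by (rule sum.swap)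
    also have "\<dots> = (\<Sum>j\<in>F. if x = j then u j - pairing (gg j) (Rc \<kappa> u) else 0)"
      using True by (intro sum.cong refl) (simp add: X_right[OF \<kappa>])
    also have "\<dots> = u x - pairing (gg x) (Rc \<kappa> u)" using True finite_F by simp
    finally show ?thesis
      using True Rc_outside[of x \<kappa> u] by (simp add: HH_LL_sum[OF \<kappa>'] pairing_gg[OF R])
  qed
  finally show ?thesis .
qed

text \<open>Subtracting the lift of its values on the removed vertices turns \<open>d\<close> into a
  solution of the homogeneous exterior problem, which is 0. The Schur complement then annihilates
  these values, and its left inverse finishes.\<close>

lemma HH_injective:
  assumes \<kappa>: "\<kappa> \<in> half_disc \<delta>" and d: "d \<in> ell2" and eq: "\<And>x. HH d x + \<kappa>\<^sup>2 * d x = 0"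
  shows "d x = 0"
proof -
  note \<kappa>' = half_disc_Re[OF \<kappa>]
  define e where "e = (\<lambda>x. d x + (- 1) * (\<Sum>i\<in>F. d i * LL \<kappa> i x))"
  have e: "e \<in> ell2" unfolding e_def by (intro ell2_add ell2_scale d LL_sum_ell2 \<kappa>')
  have HHe: "HH e x + \<kappa>\<^sup>2 * e x = - (if x \<in> F then \<Sum>i\<in>F. SS \<kappa> x i * d i else 0)" for x
  proof -
    let ?l = "\<lambda>x. \<Sum>i\<in>F. d i * LL \<kappa> i x"
    have h: "HH e x = HH d x + (- 1) * HH ?l x"
      unfolding e_def by (rule HH_lin[OF ell2_in_linfw[OF d] ell2_in_linfw[OF LL_sum_ell2[OF \<kappa>']]])
    have "HH e x + \<kappa>\<^sup>2 * e x = (HH d x + \<kappa>\<^sup>2 * d x) - (HH ?l x + \<kappa>\<^sup>2 * ?l x)"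
      unfolding h by (simp add: e_def algebra_simps)
    then show ?thesis unfolding eq HH_LL_sum[OF \<kappa>'] by simp
  qed
  have "e = Rc \<kappa> (\<lambda>_. 0)"
  proof (rule Rc_unique[OF \<kappa>' ell2_zero e])
    show "e x = 0" if "x \<notin> exterior n" for x
      using LL_sum_F[of x d \<kappa>] that by (simp add: e_def)
    show "HH e x + \<kappa>\<^sup>2 * e x = 0" if "x \<in> exterior n" for x using HHe[of x] that by simp
  qed
  moreover have "(\<lambda>_. 0) = Rc \<kappa> (\<lambda>_. 0)"
    by (rule Rc_unique[OF \<kappa>' ell2_zero ell2_zero]) (auto simp: HH_zero)
  ultimately have e0: "e = (\<lambda>_. 0)" by simp
  have Sd: "(\<Sum>i\<in>F. SS \<kappa> x i * d i) = 0" if "x \<in> F" for x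
    using HHe[of x] that unfolding e0 by (simp add: HH_zero)
  have d0: "d j = 0" if j: "j \<in> F" for j
  proof -
    have "(\<Sum>i\<in>F. X \<kappa> j i * (\<Sum>l\<in>F. SS \<kappa> i l * d l)) = (\<Sum>l\<in>F. (\<Sum>i\<in>F. X \<kappa> j i * SS \<kappa> i l) * d l)"
      unfolding sum_distrib_left sum_distrib_right mult.assoc by (rule sum.swap)
    also have "\<dots> = (\<Sum>l\<in>F. if j = l then d l else 0)"
      using j by (intro sum.cong refl) (simp add: X_left[OF \<kappa>])
    also have "\<dots> = d j" using j finite_F by simp
    finally show ?thesis using Sd by simp
  qed
  have "(\<Sum>i\<in>F. d i * LL \<kappa> i x) = 0" by (intro sum.neutral) (simp add: d0)
  then show "d x = 0" using fun_cong[OF e0, of x] by (simp add: e_def)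
qed

lemma RR_unique:
  assumes \<kappa>: "\<kappa> \<in> half_disc \<delta>" and w: "w \<in> ell2" and u: "u \<in> ell2" and eq: "\<And>x. HH w x + \<kappa>\<^sup>2 * w x = u x"
  shows "w = RR \<kappa> u"
proof
  fix x
  note \<kappa>' = half_disc_Re[OF \<kappa>]
  note R = RR_ell2[OF \<kappa>' u]
  have "(\<lambda>x. w x + (- 1) * RR \<kappa> u x) x = 0"
  proof (rule HH_injective[OF \<kappa>])
    show "(\<lambda>x. w x + (- 1) * RR \<kappa> u x) \<in> ell2" by (intro ell2_add ell2_scale w R)
    fix x
    have "HH (\<lambda>x. w x + (- 1) * RR \<kappa> u x) x = HH w x + (- 1) * HH (RR \<kappa> u) x"
      by (rule HH_lin[OF ell2_in_linfw[OF w] ell2_in_linfw[OF R]])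
    then have "HH (\<lambda>x. w x + (- 1) * RR \<kappa> u x) x + \<kappa>\<^sup>2 * (w x + (- 1) * RR \<kappa> u x)
      = (HH w x + \<kappa>\<^sup>2 * w x) - (HH (RR \<kappa> u) x + \<kappa>\<^sup>2 * RR \<kappa> u x)"
      by (simp only:) (simp add: algebra_simps)
    then show "HH (\<lambda>x. w x + (- 1) * RR \<kappa> u x) x + \<kappa>\<^sup>2 * (w x + (- 1) * RR \<kappa> u x) = 0"
      unfolding eq RR_eq[OF \<kappa> u] by simp
  qed
  then show "w x = RR \<kappa> u x" by simp
qed

text \<open>By symmetry of H, the adjoint of the resolvent at \<kappa> is the resolvent at the
  conjugate; any solution of the conjugate equation can stand for the latter.\<close>

lemma RR_pairing:
  assumes \<kappa>: "\<kappa> \<in> half_disc \<delta>" and f: "f \<in> ell2" and u: "u \<in> ell2"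
    and w: "w \<in> ell2" and eq: "\<And>x. HH w x + (cnj \<kappa>)\<^sup>2 * w x = f x"
  shows "pairing w u = pairing f (RR \<kappa> u)"
proof -
  note R = RR_ell2[OF half_disc_Re[OF \<kappa>] u]
  have "pairing w u = pairing w (\<lambda>x. HH (RR \<kappa> u) x + \<kappa>\<^sup>2 * RR \<kappa> u x)" by (simp only: RR_eq[OF \<kappa> u])
  also have "\<dots> = pairing w (HH (RR \<kappa> u)) + \<kappa>\<^sup>2 * pairing w (RR \<kappa> u)"
    by (subst pairing_add_right) (auto intro!: ell2_pairing_summable HH_ell2 ell2_scale R w simp: pairing_scale_right)
  also have "\<dots> = pairing (HH w) (RR \<kappa> u) + cnj ((cnj \<kappa>)\<^sup>2) * pairing w (RR \<kappa> u)"
    by (simp add: HH_symmetric[OF w R])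
  also have "\<dots> = pairing (\<lambda>x. HH w x + (cnj \<kappa>)\<^sup>2 * w x) (RR \<kappa> u)"
    by (rule pairing_add_left[symmetric]) (auto intro!: ell2_pairing_summable HH_ell2 R w)
  finally show ?thesis by (simp only: eq)
qed

lemma half_disc_cnj: "\<kappa> \<in> half_disc \<delta> \<Longrightarrow> cnj \<kappa> \<in> half_disc \<delta>"
  by (simp add: half_disc_def)

definition KK :: "complex \<Rightarrow> ('k, 'a) vertex \<Rightarrow> ('k, 'a) vertex \<Rightarrow> complex" where
  "KK \<kappa> x y = RR \<kappa> (delta y) x"

text \<open>The row of the kernel at \<open>x\<close> is the conjugate of the resolvent at conjugate
  \<kappa> applied to \<open>delta x\<close>. Being square-summable, it makes the sum converge
  absolutely.\<close>

lemma RR_has_sum_KK: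
  assumes \<kappa>: "\<kappa> \<in> half_disc \<delta>" and u: "u \<in> ell2"
  shows "((\<lambda>y. KK \<kappa> x y * u y) has_sum RR \<kappa> u x) UNIV"
proof -
  define w where "w = RR (cnj \<kappa>) (delta x)"
  have w: "w \<in> ell2" unfolding w_def using half_disc_Re[OF \<kappa>] by (intro RR_ell2) auto
  have eq: "HH w z + (cnj \<kappa>)\<^sup>2 * w z = delta x z" for z
    unfolding w_def by (rule RR_eq[OF half_disc_cnj[OF \<kappa>] ell2_delta])
  have K: "KK \<kappa> x y = cnj (w y)" for y
  proof -
    have "cnj (w y) = pairing w (delta y)" using pairing_cnj[of w "delta y"] by simp
    also have "\<dots> = KK \<kappa> x y" unfolding KK_def using RR_pairing[OF \<kappa> ell2_delta ell2_delta w eq, of y] by simp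
    finally show ?thesis by simp
  qed
  have "((\<lambda>y. cnj (w y) * u y) has_sum pairing w u) UNIV"
    unfolding pairing_def by (rule has_sum_infsum[OF abs_summable_summable[OF ell2_pairing_summable[OF w u]]])
  moreover have "pairing w u = RR \<kappa> u x" using RR_pairing[OF \<kappa> ell2_delta u w eq] by simp
  ultimately show ?thesis by (simp add: K)
qed

text \<open>The finite-rank part carries the whole pole. Its factors have amplitude 1, so a
  coefficient of order i is bounded by the i-th power of the scale without additional
  weight.\<close>

lemma gexp_KK_pole:
  "gexp \<delta> (b - 3) (\<lambda>_. 1) (\<lambda>(x, y). wt x * wt y)
     (\<lambda>(x, y) \<kappa>. \<Sum>i\<in>F. (\<Sum>j\<in>F. \<kappa>\<^sup>2 * X \<kappa> i j * MM \<kappa> j y) * LL \<kappa> i x)"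
proof -
  have le: "wt x \<le> 1 * (wt x * wt y)" "wt y \<le> 1 * (wt x * wt y)" for x y :: "('k, 'a) vertex"
    using wt_ge_1[of x] wt_ge_1[of y] by (auto simp: mult_le_cancel_left1 mult_le_cancel_right1)
  have L: "gexp \<delta> (b - 3) (\<lambda>p. 1) (\<lambda>p. wt (fst p) * wt (snd p)) (\<lambda>p \<kappa>. LL \<kappa> i (fst (p :: _ \<times> ('k, 'a) vertex)))" for i
    using gexp_restrict[OF gexp_reindex[OF gexp_LL[OF \<delta>(1), of i], where g=fst], of "b - 3" \<delta>]
    by (rule gexp_mono[where c=1 and d=1]) (auto simp: wt_nonneg le[simplified])
  have M: "gexp \<delta> (b - 3) (\<lambda>p. 1) (\<lambda>p. wt (fst p) * wt (snd p)) (\<lambda>p \<kappa>. MM \<kappa> j (snd (p :: ('k, 'a) vertex \<times> _)))" for j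
    using gexp_restrict[OF gexp_reindex[OF gexp_MM[OF \<delta>(1), of j], where g=snd], of "b - 3" \<delta>]
    by (rule gexp_mono[where c=1 and d=1]) (auto simp: wt_nonneg le[simplified])
  have Xg: "gexp \<delta> (b - 3) (\<lambda>p. 1) (\<lambda>p. wt (fst p) * wt (snd p)) (\<lambda>(p :: ('k, 'a) vertex \<times> ('k, 'a) vertex) \<kappa>. \<kappa>\<^sup>2 * X \<kappa> i j)"
    if "i \<in> F" "j \<in> F" for i j
    using gexp_reindex[OF gexp_X[OF that]]
    by (rule gexp_mono[where c=1 and d=1])
      (auto simp: wt_nonneg wt_ge_1 intro: order_trans[OF wt_ge_1 le(1)[simplified]])
  have sum: "gexp \<delta> (b - 3) (\<lambda>_. 1) (\<lambda>p. wt (fst p) * wt (snd p)) (\<lambda>p \<kappa>. \<Sum>i\<in>A. f i p \<kappa>)"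
    if "finite A" "\<And>i. i \<in> A \<Longrightarrow> gexp \<delta> (b - 3) (\<lambda>_. 1) (\<lambda>p. wt (fst p) * wt (snd p)) (f i)"
    for A and f :: "('k, 'a) vertex \<Rightarrow> ('k, 'a) vertex \<times> ('k, 'a) vertex \<Rightarrow> complex \<Rightarrow> complex"
    using that
  proof (induction A)
    case empty
    show ?case by (simp, rule gexp_const[where c=1]) (auto simp: wt_nonneg)
  next
    case (insert i A) then show ?case by (simp add: gexp_add)
  qed
  have m: "gexp \<delta> (b - 3) (\<lambda>_. 1) P (\<lambda>p \<kappa>. f p \<kappa> * g p \<kappa>)"
    if "gexp \<delta> (b - 3) (\<lambda>_. 1) P f" "gexp \<delta> (b - 3) (\<lambda>_. 1) P g"
    for P and f g :: "('k, 'a) vertex \<times> ('k, 'a) vertex \<Rightarrow> complex \<Rightarrow> complex"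
    using gexp_mult[OF that \<delta>(1)] by simp
  show ?thesis unfolding case_prod_unfold
    by (intro sum m finite_F L M Xg)
qed

lemma KK_split:
  "\<kappa>\<^sup>2 * KK \<kappa> x y = \<kappa>\<^sup>2 * Rc \<kappa> (delta y) x + (\<Sum>i\<in>F. (\<Sum>j\<in>F. \<kappa>\<^sup>2 * X \<kappa> i j * MM \<kappa> j y) * LL \<kappa> i x)"
  by (simp add: KK_def RR_def RR_coeff_def MM_def distrib_left sum_distrib_left sum_distrib_right mult.assoc)

text \<open>After multiplication by \<kappa>^2 the exterior resolvent enters at order 2 only. Its
  amplitude, at most \<open>wt x * wt y\<close>, is outweighed by this shift of two orders, so both
  parts obey the same bound.\<close>

lemma kernel_expansion:
  obtains g C where "0 \<le> C"
    "\<And>i x y. i < b - 3 \<Longrightarrow> norm (g i x y) \<le> C * (wt x * wt y) ^ i"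
    "\<And>\<kappa> x y. \<kappa> \<in> half_disc \<delta> \<Longrightarrow>
       norm (\<kappa>\<^sup>2 * KK \<kappa> x y - (\<Sum>i<b - 3. \<kappa> ^ i * g i x y)) \<le> C * (wt x * wt y) ^ (b - 2) * norm \<kappa> ^ (b - 3)"
proof -
  obtain q C where q: "gexp_coeff \<delta> (b - 3) (\<lambda>_. 1) (\<lambda>(x, y). wt x * wt y)
     (\<lambda>(x, y) \<kappa>. \<Sum>i\<in>F. (\<Sum>j\<in>F. \<kappa>\<^sup>2 * X \<kappa> i j * MM \<kappa> j y) * LL \<kappa> i x) q C"
    by (rule gexpE[OF gexp_KK_pole \<delta>(1)])
  obtain \<rho> D where \<rho>: "gexp_coeff \<delta> (b - 1) (\<lambda>(x, y). min (wt x) (wt y)) (\<lambda>(x, y). wt x * wt y)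
     (\<lambda>(x, y) \<kappa>. Rc \<kappa> (delta y) x) \<rho> D"
    by (rule gexpE[OF gexp_Rc_delta[OF \<delta>(1)] \<delta>(1)])
  note q' = gexp_coeffD[OF q] and \<rho>' = gexp_coeffD[OF \<rho>]
  have P1: "1 \<le> wt x * wt y" for x y :: "('k, 'a) vertex"
    using mult_mono[of 1 "wt x" 1 "wt y"] wt_ge_1[of x] wt_ge_1[of y] by simp
  have minP: "min (wt x) (wt y) \<le> wt x * wt y" for x y :: "('k, 'a) vertex"
    using wt_ge_1[of x] wt_ge_1[of y] by (simp add: min.coboundedI1 mult_le_cancel_left1)
  have Pm: "(wt x * wt y) ^ i \<le> (wt x * wt y) ^ j" if "i \<le> j" for i j and x y :: "('k, 'a) vertex"
    using that P1 by (rule power_increasing)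
  define g where "g i x y = (if 2 \<le> i then \<rho> (i - 2) (x, y) else 0) + q i (x, y)" for i x y
  show thesis
  proof (rule that[of "C + D" g])
    show "0 \<le> C + D" using q'(1) \<rho>'(1) by simp
    fix x y :: "('k, 'a) vertex"
    let ?P = "wt x * wt y"
    have P0: "0 \<le> ?P" using P1[of x y] by linarith
    show "norm (g i x y) \<le> (C + D) * ?P ^ i" if i: "i < b - 3" for i
    proof -
      have "norm (if 2 \<le> i then \<rho> (i - 2) (x, y) else 0) \<le> D * ?P ^ i"
      proof (cases "2 \<le> i")
        case True
        have "norm (\<rho> (i - 2) (x, y)) \<le> D * min (wt x) (wt y) * ?P ^ (i - 2)"
          using \<rho>'(3)[of "i - 2" "(x, y)"] i by simp
        also have "\<dots> \<le> D * ?P * ?P ^ (i - 2)"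
          using \<rho>'(1) P0 by (intro mult_right_mono mult_left_mono minP) auto
        also have "\<dots> = D * ?P ^ Suc (i - 2)" by simp
        also have "\<dots> \<le> D * ?P ^ i" using \<rho>'(1) True by (intro mult_left_mono Pm) auto
        finally show ?thesis using True by simp
      qed (use \<rho>'(1) P0 in simp)
      moreover have "norm (q i (x, y)) \<le> C * ?P ^ i" using q'(3)[OF i, of "(x, y)"] by simp
      ultimately show ?thesis unfolding g_def by (intro norm_triangle_le) (simp add: distrib_right)
    qed
    fix \<kappa> assume \<kappa>: "\<kappa> \<in> half_disc \<delta>"
    have k1: "norm \<kappa> \<le> 1" using \<kappa> \<delta> by (simp add: half_disc_def)
    have pw: "\<kappa> ^ i = \<kappa>\<^sup>2 * \<kappa> ^ (i - 2)" if "2 \<le> i" for i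
      using that by (metis le_add_diff_inverse power_add)
    have "(\<Sum>i<b - 3. \<kappa> ^ i * (if 2 \<le> i then \<rho> (i - 2) (x, y) else 0)) = \<kappa>\<^sup>2 * (\<Sum>l<b - 5. \<kappa> ^ l * \<rho> l (x, y))"
    proof -
      have "(\<Sum>i<b - 3. \<kappa> ^ i * (if 2 \<le> i then \<rho> (i - 2) (x, y) else 0)) = (\<Sum>i\<in>{2..<b - 3}. \<kappa> ^ i * \<rho> (i - 2) (x, y))"
        by (rule sum.mono_neutral_cong_right) auto
      also have "\<dots> = (\<Sum>l<b - 5. \<kappa>\<^sup>2 * (\<kappa> ^ l * \<rho> l (x, y)))"
        by (rule sum.reindex_bij_witness[of _ "\<lambda>l. l + 2" "\<lambda>i. i - 2"])
          (auto simp: pw[symmetric] simp flip: mult.assoc)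
      finally show ?thesis by (simp add: sum_distrib_left)
    qed
    then have eq: "\<kappa>\<^sup>2 * KK \<kappa> x y - (\<Sum>i<b - 3. \<kappa> ^ i * g i x y)
      = \<kappa>\<^sup>2 * (Rc \<kappa> (delta y) x - (\<Sum>l<b - 5. \<kappa> ^ l * \<rho> l (x, y)))
      + ((\<Sum>i\<in>F. (\<Sum>j\<in>F. \<kappa>\<^sup>2 * X \<kappa> i j * MM \<kappa> j y) * LL \<kappa> i x) - (\<Sum>i<b - 3. \<kappa> ^ i * q i (x, y)))"
      unfolding KK_split g_def distrib_left sum.distrib by (simp add: algebra_simps)
    have 1: "norm (\<kappa>\<^sup>2 * (Rc \<kappa> (delta y) x - (\<Sum>l<b - 5. \<kappa> ^ l * \<rho> l (x, y)))) \<le> D * ?P ^ (b - 2) * norm \<kappa> ^ (b - 3)"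
    proof -
      have "norm (\<kappa>\<^sup>2 * (Rc \<kappa> (delta y) x - (\<Sum>l<b - 5. \<kappa> ^ l * \<rho> l (x, y))))
        \<le> norm \<kappa> ^ 2 * (D * min (wt x) (wt y) * (?P * norm \<kappa>) ^ (b - 5))"
        unfolding norm_mult norm_power using \<rho>'(2)[OF _ \<kappa>, of "b - 5" "(x, y)"]
        by (intro mult_left_mono) auto
      also have "\<dots> \<le> norm \<kappa> ^ 2 * (D * ?P * (?P * norm \<kappa>) ^ (b - 5))"
        using \<rho>'(1) P0 by (intro mult_right_mono mult_left_mono minP) auto
      also have "\<dots> = D * ?P ^ Suc (b - 5) * norm \<kappa> ^ (2 + (b - 5))"
        by (simp add: power_mult_distrib power_add power2_eq_square mult_ac)
      also have "\<dots> \<le> D * ?P ^ (b - 2) * norm \<kappa> ^ (b - 3)"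
      proof (rule mult_mono)
        show "D * ?P ^ Suc (b - 5) \<le> D * ?P ^ (b - 2)"
          using \<rho>'(1) b4 by (intro mult_left_mono Pm) auto
        \<comment> \<open>Subtraction is truncated: for b = 4 the exponents are 2 and 1, so only an
          inequality holds.\<close>
        show "norm \<kappa> ^ (2 + (b - 5)) \<le> norm \<kappa> ^ (b - 3)"
          using k1 by (intro power_decreasing) auto
        show "0 \<le> D * ?P ^ (b - 2)" by (rule mult_nonneg_nonneg[OF \<rho>'(1) zero_le_power[OF P0]])
      qed simp
      finally show ?thesis .
    qed
    have 2: "norm ((\<Sum>i\<in>F. (\<Sum>j\<in>F. \<kappa>\<^sup>2 * X \<kappa> i j * MM \<kappa> j y) * LL \<kappa> i x) - (\<Sum>i<b - 3. \<kappa> ^ i * q i (x, y)))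
       \<le> C * ?P ^ (b - 2) * norm \<kappa> ^ (b - 3)"
    proof -
      have "norm ((\<Sum>i\<in>F. (\<Sum>j\<in>F. \<kappa>\<^sup>2 * X \<kappa> i j * MM \<kappa> j y) * LL \<kappa> i x) - (\<Sum>i<b - 3. \<kappa> ^ i * q i (x, y)))
        \<le> C * (?P ^ (b - 3) * norm \<kappa> ^ (b - 3))"
        using q'(2)[OF _ \<kappa>, of "b - 3" "(x, y)"] by (simp add: power_mult_distrib)
      also have "\<dots> \<le> C * (?P ^ (b - 2) * norm \<kappa> ^ (b - 3))"
        using q'(1) by (intro mult_left_mono mult_right_mono Pm) auto
      finally show ?thesis by (simp add: mult.assoc)
    qed
    show "norm (\<kappa>\<^sup>2 * KK \<kappa> x y - (\<Sum>i<b - 3. \<kappa> ^ i * g i x y)) \<le> (C + D) * ?P ^ (b - 2) * norm \<kappa> ^ (b - 3)"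
      unfolding eq using norm_triangle_mono[OF 1 2] by (simp add: algebra_simps)
  qed
qed

end

section \<open>Asymptotics of generalized null vectors\<close>

lemma linear_bound_imp_zero:
  fixes a :: complex
  assumes "0 < \<delta>" and le: "\<And>t. 0 < t \<Longrightarrow> t < \<delta> \<Longrightarrow> norm a \<le> K * t"
  shows "a = 0"
proof -
  have "norm a \<le> 0"
  proof (rule tendsto_lowerbound[where F="at_right 0" and f="\<lambda>t. K * t"])
    show "((\<lambda>t. K * t) \<longlongrightarrow> 0) (at_right 0)"
      by (rule tendsto_mult_right_zero, rule tendsto_ident_at)
    show "\<forall>\<^sub>F t in at_right 0. norm a \<le> K * t"
      using eventually_at_right_real[OF \<open>0 < \<delta>\<close>] by eventually_elim (use le in auto)
  qed simp
  then show ?thesis by simp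
qed

lemma ray_const_simps [simp]:
  "ray_const c (Core x :: ('b, 'a::finite) vertex) = 0" "ray_const c (Ray \<alpha> m :: ('b, 'a) vertex) = c \<alpha>"
proof -
  have "(\<Sum>\<alpha>\<in>A. F \<alpha>) y = (\<Sum>\<alpha>\<in>A. F \<alpha> y)" for A and F :: "'a \<Rightarrow> ('b, 'a) gfun" and y
    by (induction A rule: infinite_finite_induct) auto
  then have e: "ray_const c y = (\<Sum>\<alpha>\<in>UNIV. c \<alpha> * ray_one \<alpha> y)" for y :: "('b, 'a) vertex"
    unfolding ray_const_def cscale_def by simp
  show "ray_const c (Core x :: ('b, 'a) vertex) = 0" by (simp add: e)
  have "(\<Sum>\<alpha>'\<in>UNIV. c \<alpha>' * ray_one \<alpha>' (Ray \<alpha> m :: ('b, 'a) vertex)) = (\<Sum>\<alpha>'\<in>UNIV. if \<alpha>' = \<alpha> then c \<alpha>' else 0)"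
    by (intro sum.cong) auto
  then show "ray_const c (Ray \<alpha> m :: ('b, 'a) vertex) = c \<alpha>" by (simp add: e)
qed

text \<open>Discrete integration from infinity costs one weight: after exchanging the sums, the k-th
  increment is counted once for every m \<le> k, that is k + 1 times.\<close>

lemma summable_remainder_telescope:
  fixes g e :: "nat \<Rightarrow> complex"
  assumes ge: "\<And>m. g (Suc m) - g m = e m" and s: "summable (\<lambda>m. (real m + 1) ^ Suc s * norm (e m))"
  shows "\<exists>c. summable (\<lambda>m. (real m + 1) ^ s * norm (g m - c))"
proof -
  define B where "B = (\<Sum>m. (real m + 1) ^ Suc s * norm (e m))"
  have ns: "summable (\<lambda>m. norm (e m))"
  proof (rule summable_comparison_test'[OF s])
    fix m :: nat
    have "1 * norm (e m) \<le> (real m + 1) ^ Suc s * norm (e m)"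
      by (intro mult_right_mono one_le_power) auto
    then show "norm (norm (e m)) \<le> (real m + 1) ^ Suc s * norm (e m)" by simp
  qed
  have gsum: "g M - g m = (\<Sum>k\<in>{m..<M}. e k)" if "m \<le> M" for m M
    using sum_Suc_diff'[OF that, of g] by (simp add: ge)
  have gM: "g 0 + (\<Sum>k<M. e k) = g M" for M using gsum[of 0 M] by (simp add: atLeast0LessThan algebra_simps)
  have "(\<lambda>M. g 0 + (\<Sum>k<M. e k)) \<longlonglongrightarrow> g 0 + suminf e"
    by (rule tendsto_add[OF tendsto_const summable_LIMSEQ[OF summable_norm_cancel[OF ns]]])
  then have lim: "g \<longlonglongrightarrow> g 0 + suminf e" by (simp only: gM)
  define c where "c = g 0 + suminf e"
  \<comment> \<open>The limit is first replaced by a late value of \<open>g\<close>, so that all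
    sums are finite; the bound does not depend on how late.\<close>
  have fin: "(\<Sum>m<M. (real m + 1) ^ s * norm (g m - g M')) \<le> B" if "M \<le> M'" for M M'
  proof -
    have "(\<Sum>m<M. (real m + 1) ^ s * norm (g m - g M'))
      \<le> (\<Sum>m<M. \<Sum>k<M'. if m \<le> k then (real m + 1) ^ s * norm (e k) else 0)"
    proof (rule sum_mono)
      fix m assume m: "m \<in> {..<M}"
      have "norm (g m - g M') = norm (\<Sum>k\<in>{m..<M'}. e k)"
        using gsum[of m M'] m that by (simp add: norm_minus_commute)
      also have "\<dots> \<le> (\<Sum>k\<in>{m..<M'}. norm (e k))" by (rule norm_sum)
      finally have "(real m + 1) ^ s * norm (g m - g M') \<le> (\<Sum>k\<in>{m..<M'}. (real m + 1) ^ s * norm (e k))"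
        unfolding sum_distrib_left[symmetric] by (intro mult_left_mono) auto
      also have "\<dots> = (\<Sum>k<M'. if m \<le> k then (real m + 1) ^ s * norm (e k) else 0)"
        by (rule sum.mono_neutral_cong_left) auto
      finally show "(real m + 1) ^ s * norm (g m - g M') \<le> (\<Sum>k<M'. if m \<le> k then (real m + 1) ^ s * norm (e k) else 0)" .
    qed
    also have "\<dots> = (\<Sum>k<M'. \<Sum>m<M. if m \<le> k then (real m + 1) ^ s * norm (e k) else 0)" by (rule sum.swap)
    also have "\<dots> \<le> (\<Sum>k<M'. (real k + 1) ^ Suc s * norm (e k))"
    proof (rule sum_mono)
      fix k
      have "(\<Sum>m<M. if m \<le> k then (real m + 1) ^ s * norm (e k) else 0) \<le> (\<Sum>m\<le>k. (real k + 1) ^ s * norm (e k))"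
      proof -
        have "(\<Sum>m<M. if m \<le> k then (real m + 1) ^ s * norm (e k) else 0) = (\<Sum>m\<in>{..<M} \<inter> {..k}. (real m + 1) ^ s * norm (e k))"
          by (rule sum.mono_neutral_cong_right) auto
        also have "\<dots> \<le> (\<Sum>m\<in>{..<M} \<inter> {..k}. (real k + 1) ^ s * norm (e k))"
          by (intro sum_mono mult_right_mono power_mono) auto
        also have "\<dots> \<le> (\<Sum>m\<le>k. (real k + 1) ^ s * norm (e k))" by (intro sum_mono2) auto
        finally show ?thesis .
      qed
      then show "(\<Sum>m<M. if m \<le> k then (real m + 1) ^ s * norm (e k) else 0) \<le> (real k + 1) ^ Suc s * norm (e k)"
        by (simp add: algebra_simps)
    qed
    also have "\<dots> \<le> B" unfolding B_def by (intro sum_le_suminf s) auto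
    finally show ?thesis .
  qed
  have "(\<Sum>m<M. (real m + 1) ^ s * norm (g m - c)) \<le> B" for M
  proof (rule LIMSEQ_le_const2)
    show "(\<lambda>M'. \<Sum>m<M. (real m + 1) ^ s * norm (g m - g M')) \<longlonglongrightarrow> (\<Sum>m<M. (real m + 1) ^ s * norm (g m - c))"
      unfolding c_def by (intro tendsto_intros lim)
    show "\<exists>N. \<forall>M'\<ge>N. (\<Sum>m<M. (real m + 1) ^ s * norm (g m - g M')) \<le> B" using fin by blast
  qed
  then have "summable (\<lambda>m. (real m + 1) ^ s * norm (g m - c))" by (intro summableI_nonneg_bounded) auto
  then show ?thesis ..
qed

text \<open>The second difference is summed twice, with slope and constant as integration constants.
  The slope multiplies \<open>Suc m\<close>, the true position of the m-th vertex.\<close>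

lemma ray_asymptotics:
  fixes f q :: "nat \<Rightarrow> complex"
  assumes eq: "\<And>m. 2 * f (Suc m) - f (Suc (Suc m)) - f m = q (Suc m)"
    and s: "summable (\<lambda>m. (real m + 1) ^ Suc (Suc s) * norm (q m))"
  shows "\<exists>a c. summable (\<lambda>m. (real m + 1) ^ s * norm (f m - (a * of_nat (Suc m) + c)))"
proof -
  define d where "d m = f (Suc m) - f m" for m
  have de: "d (Suc m) - d m = - q (Suc m)" for m using eq[of m] by (simp add: d_def algebra_simps)
  have sq: "summable (\<lambda>m. (real m + 1) ^ Suc (Suc s) * norm (- q (Suc m)))"
  proof (rule summable_comparison_test')
    show "summable (\<lambda>m. (real (Suc m) + 1) ^ Suc (Suc s) * norm (q (Suc m)))"
      using s by (subst summable_Suc_iff)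
    show "norm ((real m + 1) ^ Suc (Suc s) * norm (- q (Suc m))) \<le> (real (Suc m) + 1) ^ Suc (Suc s) * norm (q (Suc m))" for m
      by (simp add: norm_mult norm_power mult_right_mono power_mono del: power_Suc)
  qed
  from summable_remainder_telescope[OF de sq]
  obtain a where a: "summable (\<lambda>m. (real m + 1) ^ Suc s * norm (d m - a))" ..
  define g where "g m = f m - a * of_nat (Suc m)" for m
  have "g (Suc m) - g m = d m - a" for m by (simp add: g_def d_def algebra_simps)
  from summable_remainder_telescope[OF this a] obtain c where "summable (\<lambda>m. (real m + 1) ^ s * norm (g m - c))" ..
  then show ?thesis by (intro exI[of _ a] exI[of _ c]) (simp add: g_def diff_diff_eq)
qed

context schroedinger
begin

lemma HH_alt: "HH = (\<lambda>u. H0 E0 r u + V u)"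
  by (simp add: HH_def fun_eq_iff)

abbreviation gen where "gen \<equiv> gen_space HH (real b)"
abbreviation bound where "bound \<equiv> bound_space HH (real b)"
abbreviation res where "res \<equiv> res_space HH (real b)"

lemma real_b2: "real b - 2 = real (b - 2)"
  using b4 by simp

lemma genD: "\<Psi> \<in> gen \<Longrightarrow> \<Psi> \<in> linfw (real b)" "\<Psi> \<in> gen \<Longrightarrow> HH \<Psi> x = 0"
  by (auto simp: gen_space_def)

lemma bound_iff: "\<Psi> \<in> bound \<longleftrightarrow> \<Psi> \<in> gen \<and> \<Psi> \<in> l1w (real (b - 2))"
  by (simp add: bound_space_def real_b2)

lemma bound_ell2: "\<Psi> \<in> bound \<Longrightarrow> \<Psi> \<in> ell2"
  using l1w_ell2 by (auto simp: bound_iff)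

lemma genI: "\<Psi> \<in> linfw (real b) \<Longrightarrow> (\<And>x. HH \<Psi> x = 0) \<Longrightarrow> \<Psi> \<in> gen"
  by (auto simp: gen_space_def)

lemma H0_gen: "\<Psi> \<in> gen \<Longrightarrow> H0 E0 r \<Psi> x = - V \<Psi> x"
  using genD(2)[of \<Psi> x] by (simp add: HH_def eq_neg_iff_add_eq_0)

lemma gen_asymptotics:
  assumes "\<Psi> \<in> gen"
  obtains a c where
    "\<And>\<alpha>. summable (\<lambda>m. (real m + 1) ^ (b - 2) * norm (\<Psi> (Ray \<alpha> m) - (a \<alpha> * of_nat (Suc m) + c \<alpha>)))"
proof -
  define Q where "Q \<alpha> a c \<longleftrightarrow> summable (\<lambda>m. (real m + 1) ^ (b - 2) * norm (\<Psi> (Ray \<alpha> m) - (a * of_nat (Suc m) + c)))" for \<alpha> a c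
  have "\<exists>a c. Q \<alpha> a c" for \<alpha>
    unfolding Q_def
  proof (rule ray_asymptotics)
    show "2 * \<Psi> (Ray \<alpha> (Suc m)) - \<Psi> (Ray \<alpha> (Suc (Suc m))) - \<Psi> (Ray \<alpha> m) = - V \<Psi> (Ray \<alpha> (Suc m))" for m
      using H0_gen[OF assms, of "Ray \<alpha> (Suc m)"] by simp
    have "Suc (Suc (b - 2)) = b" using b4 by simp
    then show "summable (\<lambda>m. (real m + 1) ^ Suc (Suc (b - 2)) * norm (- V \<Psi> (Ray \<alpha> m)))"
      using V_l1w[OF genD(1)[OF assms]] unfolding l1w_Ray_iff by simp
  qed
  then obtain a c where "\<And>\<alpha>. Q \<alpha> (a \<alpha>) (c \<alpha>)" by metis
  then have s: "\<And>\<alpha>. summable (\<lambda>m. (real m + 1) ^ (b - 2) * norm (\<Psi> (Ray \<alpha> m) - (a \<alpha> * of_nat (Suc m) + c \<alpha>)))"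
    unfolding Q_def .
  show ?thesis by (rule that[OF s])
qed

lemma summable_weighted_imp_LIMSEQ:
  fixes f :: "nat \<Rightarrow> complex"
  assumes "summable (\<lambda>m. (real m + 1) ^ s * norm (f m))" "k \<le> s"
  shows "(\<lambda>m. of_nat (Suc m) ^ k * f m) \<longlonglongrightarrow> 0"
proof (rule Lim_null_comparison)
  show "(\<lambda>m. (real m + 1) ^ s * norm (f m)) \<longlonglongrightarrow> 0" by (rule summable_LIMSEQ_zero[OF assms(1)])
  have "norm (of_nat (Suc m) ^ k * f m) \<le> (real m + 1) ^ s * norm (f m)" for m
  proof -
    have "norm (of_nat (Suc m) ^ k * f m) = (real m + 1) ^ k * norm (f m)"
      by (simp only: norm_mult norm_power norm_of_nat) (simp add: add.commute)
    also have "\<dots> \<le> (real m + 1) ^ s * norm (f m)" using assms(2) by (intro mult_right_mono power_increasing) auto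
    finally show ?thesis .
  qed
  then show "\<forall>\<^sub>F m in sequentially. norm (of_nat (Suc m) ^ k * f m) \<le> (real m + 1) ^ s * norm (f m)" by simp
qed

lemma gen_differences:
  fixes \<Psi> :: "nat \<Rightarrow> complex"
  assumes "summable (\<lambda>m. (real m + 1) ^ s * norm (\<Psi> m - (a * of_nat (Suc m) + c)))"
  shows "(\<lambda>m. \<Psi> (Suc m) - \<Psi> m) \<longlonglongrightarrow> a"
proof -
  define \<phi> where "\<phi> m = \<Psi> m - (a * of_nat (Suc m) + c)" for m
  have \<phi>: "\<phi> \<longlonglongrightarrow> 0"
    using summable_weighted_imp_LIMSEQ[OF assms, of 0] by (simp add: \<phi>_def[abs_def])
  have "(\<lambda>m. \<phi> (Suc m) - \<phi> m + a) \<longlonglongrightarrow> 0 - 0 + a"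
    by (intro tendsto_intros \<phi> LIMSEQ_Suc)
  moreover have "\<phi> (Suc m) - \<phi> m + a = \<Psi> (Suc m) - \<Psi> m" for m by (simp add: \<phi>_def algebra_simps)
  ultimately show ?thesis by simp
qed

lemma gen_slope_zero_res:
  assumes "\<Psi> \<in> gen" and "\<And>\<alpha>. (\<lambda>m. \<Psi> (Ray \<alpha> (Suc m)) - \<Psi> (Ray \<alpha> m)) \<longlonglongrightarrow> 0"
  obtains c where "(\<lambda>x. \<Psi> x - ray_const c x) \<in> l1w (real (b - 2))"
proof -
  obtain a c where s: "\<And>\<alpha>. summable (\<lambda>m. (real m + 1) ^ (b - 2) * norm (\<Psi> (Ray \<alpha> m) - (a \<alpha> * of_nat (Suc m) + c \<alpha>)))"
    by (rule gen_asymptotics[OF assms(1)]) (rule that)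
  have "a \<alpha> = 0" for \<alpha> using LIMSEQ_unique[OF gen_differences[OF s[of \<alpha>]] assms(2)] .
  then have "(\<lambda>x. \<Psi> x - ray_const c x) \<in> l1w (real (b - 2))"
    unfolding l1w_Ray_iff using s by simp
  then show ?thesis by (rule that)
qed

text \<open>Square-summability makes the values tend to 0 along each half-line, which removes first
  the slope and then the constant of the asymptotics.\<close>

lemma gen_ell2_bound:
  assumes "\<Psi> \<in> gen" "\<Psi> \<in> ell2"
  shows "\<Psi> \<in> bound"
proof -
  have t0: "(\<lambda>m. \<Psi> (Ray \<alpha> m)) \<longlonglongrightarrow> 0" for \<alpha>
  proof -
    have "summable (\<lambda>m. (norm (\<Psi> (Ray \<alpha> m)))\<^sup>2)"
      using assms(2) unfolding ell2_summable by (intro summable_on_imp_summable summable_on_ray)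
    then have "(\<lambda>m. (norm (\<Psi> (Ray \<alpha> m)))\<^sup>2) \<longlonglongrightarrow> 0" by (rule summable_LIMSEQ_zero)
    then have "(\<lambda>m. sqrt ((norm (\<Psi> (Ray \<alpha> m)))\<^sup>2)) \<longlonglongrightarrow> sqrt 0" by (rule tendsto_real_sqrt)
    then show ?thesis by (simp add: tendsto_norm_zero_iff)
  qed
  have "(\<lambda>m. \<Psi> (Ray \<alpha> (Suc m)) - \<Psi> (Ray \<alpha> m)) \<longlonglongrightarrow> 0" for \<alpha>
    using tendsto_diff[OF LIMSEQ_Suc[OF t0] t0] by simp
  then obtain c where c: "(\<lambda>x. \<Psi> x - ray_const c x) \<in> l1w (real (b - 2))"
    using gen_slope_zero_res[OF assms(1)] by blast
  have "c \<alpha> = 0" for \<alpha>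
  proof -
    have "summable (\<lambda>m. (real m + 1) ^ (b - 2) * norm (\<Psi> (Ray \<alpha> m) - c \<alpha>))"
      using c unfolding l1w_Ray_iff by simp
    from summable_weighted_imp_LIMSEQ[OF this, of 0] have "(\<lambda>m. \<Psi> (Ray \<alpha> m) - c \<alpha>) \<longlonglongrightarrow> 0" by simp
    from tendsto_diff[OF t0[of \<alpha>] this] have "(\<lambda>m. c \<alpha>) \<longlonglongrightarrow> 0" by simp
    then show ?thesis by (simp add: LIMSEQ_const_iff)
  qed
  then have "ray_const c x = 0" for x :: "('k, 'a) vertex" by (cases x) auto
  then show ?thesis using c assms(1) by (simp add: bound_iff)
qed

text \<open>Evaluation at one vertex involves finitely many neighbours and a bounded map into a
  weighted summable space, so it is continuous for the growth norm, with a constant depending on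
  \<open>x\<close>.\<close>

lemma HH_pointwise_bound:
  "\<exists>K\<ge>0. \<forall>A d. 0 \<le> A \<longrightarrow> (\<forall>x. norm (d x) \<le> A * wt x ^ b) \<longrightarrow> norm (HH d x) \<le> K * A"
proof (intro exI conjI allI impI)
  define K where "K = (\<Sum>y\<in>nbhd x. norm (h0 E0 r x y) * wt y ^ b) + Cv\<^sup>2"
  show "0 \<le> K" unfolding K_def by (intro add_nonneg_nonneg sum_nonneg mult_nonneg_nonneg zero_le_power wt_nonneg) (use Cv in auto)
  fix A :: real and d :: "('k, 'a) gfun" assume A: "0 \<le> A" and d: "\<forall>x. norm (d x) \<le> A * wt x ^ b"
  have "norm (H0 E0 r d x) \<le> (\<Sum>y\<in>nbhd x. norm (h0 E0 r x y) * wt y ^ b * A)"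
    unfolding H0_eq_sum
  proof (rule sum_norm_le)
    fix y
    show "norm (h0 E0 r x y * d y) \<le> norm (h0 E0 r x y) * wt y ^ b * A"
      using mult_left_mono[OF d[rule_format, of y], of "norm (h0 E0 r x y)"] by (simp add: norm_mult mult_ac)
  qed
  moreover have "norm (V d x) \<le> Cv\<^sup>2 * A"
  proof -
    have V: "V d \<in> l1w (real b)" by (rule V_l1w[OF linfwI]) (use d in blast)
    have "norm (V d x) \<le> wt x ^ b * norm (V d x)" using mult_right_mono[of 1 "wt x ^ b" "norm (V d x)"] wt_ge_1[of x] by simp
    also have "\<dots> \<le> l1w_norm (real b) (V d)"
      using finite_sum_le_infsum[of "\<lambda>x. wt x ^ b * norm (V d x)" UNIV "{x}"] V
      by (simp add: l1w_norm_nat l1w_nat wt_nonneg)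
    also have "\<dots> \<le> Cv\<^sup>2 * A" using V_norm[of d A] d A by blast
    finally show ?thesis .
  qed
  ultimately show "norm (HH d x) \<le> K * A"
    unfolding HH_def K_def distrib_right sum_distrib_right by (intro norm_triangle_mono)
qed

text \<open>The equation passes to the limit vertex by vertex. Both later scalings are covered,
  \<kappa>^2 and \<kappa> times the resolvent, since their right sides tend to 0.\<close>

lemma limit_in_gen:
  assumes "0 < \<delta>" "\<delta> \<le> 1"
    and W: "\<And>t x. 0 < t \<Longrightarrow> t < \<delta> \<Longrightarrow> norm (W t x - \<Theta> x) \<le> A * wt x ^ b * t" and A: "0 \<le> A"
    and Wb: "\<And>t. 0 < t \<Longrightarrow> t < \<delta> \<Longrightarrow> W t \<in> linfw (real b)" and \<Theta>: "\<Theta> \<in> linfw (real b)"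
    and eq: "\<And>t x. 0 < t \<Longrightarrow> t < \<delta> \<Longrightarrow> HH (W t) x + (of_real t)\<^sup>2 * W t x = c t * u x"
    and c: "\<And>t. 0 < t \<Longrightarrow> t < \<delta> \<Longrightarrow> norm (c t) \<le> t"
  shows "\<Theta> \<in> gen"
proof (rule genI[OF \<Theta>])
  fix x
  obtain K where K: "0 \<le> K" "\<And>A d. 0 \<le> A \<Longrightarrow> (\<And>x. norm (d x) \<le> A * wt x ^ b) \<Longrightarrow> norm (HH d x) \<le> K * A"
    using HH_pointwise_bound[of x] by blast
  show "HH \<Theta> x = 0"
  proof (rule linear_bound_imp_zero[OF assms(1)])
    fix t assume t: "0 < t" "t < \<delta>"
    have t1: "t \<le> 1" "t\<^sup>2 \<le> t" using t assms(2) by (auto simp: power2_eq_square mult_left_le_one_le)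
    define d where "d = (\<lambda>x. \<Theta> x + (- 1) * W t x)"
    have "HH d x = HH \<Theta> x + (- 1) * HH (W t) x" unfolding d_def by (rule HH_lin[OF \<Theta> Wb[OF t]])
    moreover have "HH (W t) x = c t * u x - (of_real t)\<^sup>2 * W t x"
      using eq[OF t, of x] by (simp add: eq_diff_eq)
    ultimately have *: "HH \<Theta> x = HH d x + c t * u x - (of_real t)\<^sup>2 * W t x" by simp
    have d: "norm (HH d x) \<le> K * (A * t)"
    proof (rule K(2))
      show "norm (d y) \<le> A * t * wt y ^ b" for y
        using W[OF t, of y] by (simp add: d_def norm_minus_commute mult_ac)
    qed (use A t in simp)
    have "norm (W t x) \<le> norm (\<Theta> x) + A * wt x ^ b"
    proof -
      have "norm (W t x) \<le> norm (\<Theta> x) + norm (W t x - \<Theta> x)" using norm_triangle_ineq[of "\<Theta> x" "W t x - \<Theta> x"] by simp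
      also have "norm (W t x - \<Theta> x) \<le> A * wt x ^ b * 1"
        using A by (intro order_trans[OF W[OF t]] mult_left_mono t1 mult_nonneg_nonneg zero_le_power wt_nonneg)
      finally show ?thesis by simp
    qed
    then have "norm ((of_real t)\<^sup>2 * W t x) \<le> t * (norm (\<Theta> x) + A * wt x ^ b)"
      unfolding norm_mult norm_power using t t1 by (intro mult_mono) auto
    moreover have "norm (c t * u x) \<le> t * norm (u x)"
      unfolding norm_mult by (intro mult_right_mono c t) auto
    moreover have "norm (HH \<Theta> x) \<le> norm (HH d x) + norm (c t * u x) + norm ((of_real t)\<^sup>2 * W t x)"
      unfolding * by (intro order_trans[OF norm_triangle_ineq4] add_right_mono norm_triangle_ineq)
    ultimately show "norm (HH \<Theta> x) \<le> (K * A + norm (u x) + (norm (\<Theta> x) + A * wt x ^ b)) * t"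
      using d by (simp add: algebra_simps)
  qed
qed

text \<open>Uniform in \<kappa> with only unweighted summability of \<open>u\<close>, at the price
  of linear growth in \<open>x\<close>. This is what squeezes a bound state that lives in the
  exterior to 0.\<close>

lemma Rc_bound:
  assumes \<kappa>: "0 < Re \<kappa>" and u: "u \<in> l1w (real 0)"
  shows "norm (Rc \<kappa> u x) \<le> (1 + 2 * Cv\<^sup>2) * l1w_norm (real 0) u * wt x"
proof -
  have G: "norm (kop (G \<kappa>) f x) \<le> l1w_norm (real 0) f * wt x" if "f \<in> l1w (real 0)" for f x
  proof -
    have s: "(\<lambda>y. norm (f y)) summable_on UNIV" by (rule l1w_l1[OF that])
    have le: "norm (G \<kappa> x y * f y) \<le> wt x * norm (f y)" for y
      unfolding norm_mult by (intro mult_right_mono ext_green_bound(1) \<kappa>) auto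
    have s': "(\<lambda>y. wt x * norm (f y)) summable_on UNIV" by (rule summable_on_cmult_right[OF s])
    have 1: "(\<lambda>y. norm (G \<kappa> x y * f y)) summable_on UNIV" by (rule summable_on_comparison_test[OF s' le]) auto
    have "norm (kop (G \<kappa>) f x) \<le> (\<Sum>\<^sub>\<infinity>y. norm (G \<kappa> x y * f y))" unfolding kop_def by (rule norm_infsum_bound[OF 1])
    also have "\<dots> \<le> (\<Sum>\<^sub>\<infinity>y. wt x * norm (f y))" by (rule infsum_mono[OF 1 s' le])
    finally show ?thesis by (simp add: infsum_cmult_right' l1w_norm_nat[of 0, simplified] mult.commute)
  qed
  define N where "N = l1w_norm (real 0) u"
  have N: "0 \<le> N" unfolding N_def by (rule l1w_norm_nonneg)
  define h where "h = NN \<kappa> (v' (kop (G \<kappa>) u))"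
  have "norm (v' (kop (G \<kappa>) u)) \<le> Cv * N"
  proof (rule v'_norm)
    fix x
    have "norm (kop (G \<kappa>) u x) \<le> N * wt x ^ 1" using G[OF u] by (simp add: N_def)
    also have "\<dots> \<le> N * wt x ^ b" using N b4 by (intro mult_left_mono wt_power_mono) auto
    finally show "norm (kop (G \<kappa>) u x) \<le> N * wt x ^ b" .
  qed (rule N)
  then have h: "norm h \<le> 2 * (Cv * N)" unfolding h_def using NN_norm[OF \<kappa>, of "v' (kop (G \<kappa>) u)"] by linarith
  have "l1w_norm (real 0) (v h) \<le> l1w_norm (real b) (v h)"
    unfolding l1w_norm_nat
    by (rule infsum_mono[OF l1w_nat[THEN iffD1, OF l1w_mono[OF v_l1w le0]] l1w_nat[THEN iffD1, OF v_l1w]])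
      (rule mult_right_mono[OF wt_power_mono[OF le0] norm_ge_zero])
  also have "\<dots> \<le> Cv * norm h" by (rule v_norm)
  also have "\<dots> \<le> Cv * (2 * (Cv * N))" using Cv h by (intro mult_left_mono) auto
  finally have vh: "l1w_norm (real 0) (v h) \<le> 2 * Cv\<^sup>2 * N" by (simp add: power2_eq_square mult_ac)
  have "norm (Rc \<kappa> u x) \<le> norm (kop (G \<kappa>) u x) + norm (kop (G \<kappa>) (v h) x)"
    unfolding Rc_def h_def by (rule norm_triangle_ineq4)
  also have "\<dots> \<le> N * wt x + 2 * Cv\<^sup>2 * N * wt x"
  proof (rule add_mono)
    show "norm (kop (G \<kappa>) u x) \<le> N * wt x" unfolding N_def by (rule G[OF u])
    have "norm (kop (G \<kappa>) (v h) x) \<le> l1w_norm (real 0) (v h) * wt x"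
      by (rule G) (rule l1w_mono[OF v_l1w], simp)
    also have "\<dots> \<le> 2 * Cv\<^sup>2 * N * wt x" by (rule mult_right_mono[OF vh wt_nonneg])
    finally show "norm (kop (G \<kappa>) (v h) x) \<le> 2 * Cv\<^sup>2 * N * wt x" .
  qed
  finally show ?thesis by (simp add: N_def algebra_simps)
qed

end

section \<open>The leading coefficient\<close>

lemma l1w_norm_mono:
  assumes "u \<in> l1w (real n)" "m \<le> n"
  shows "l1w_norm (real m) u \<le> l1w_norm (real n) u"
  unfolding l1w_norm_nat
  by (rule infsum_mono[OF l1w_nat[THEN iffD1, OF l1w_mono[OF assms]] l1w_nat[THEN iffD1, OF assms(1)]])
    (rule mult_right_mono[OF wt_power_mono[OF assms(2)] norm_ge_zero])

lemma ell2_limit: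
  fixes W :: "real \<Rightarrow> 'g \<Rightarrow> complex"
  assumes \<delta>: "0 < \<delta>" and W: "\<And>t. 0 < t \<Longrightarrow> t < \<delta> \<Longrightarrow> W t \<in> ell2" "\<And>t. 0 < t \<Longrightarrow> t < \<delta> \<Longrightarrow> sqn (W t) \<le> B"
    and lim: "\<And>x. ((\<lambda>t. W t x) \<longlongrightarrow> \<Theta> x) (at_right 0)"
  shows "\<Theta> \<in> ell2"
  unfolding ell2_summable
proof (rule nonneg_bdd_above_summable_on)
  show "bdd_above (sum (\<lambda>x. (norm (\<Theta> x))\<^sup>2) ` {A. A \<subseteq> UNIV \<and> finite A})"
  proof (rule bdd_aboveI2)
    fix A :: "'g set" assume "A \<in> {A. A \<subseteq> UNIV \<and> finite A}"
    then have A: "finite A" by simp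
    show "(\<Sum>x\<in>A. (norm (\<Theta> x))\<^sup>2) \<le> B"
    proof (rule tendsto_upperbound[where F="at_right 0" and f="\<lambda>t. \<Sum>x\<in>A. (norm (W t x))\<^sup>2"])
      show "((\<lambda>t. \<Sum>x\<in>A. (norm (W t x))\<^sup>2) \<longlongrightarrow> (\<Sum>x\<in>A. (norm (\<Theta> x))\<^sup>2)) (at_right 0)"
        by (intro tendsto_sum tendsto_power tendsto_norm lim)
      show "\<forall>\<^sub>F t in at_right 0. (\<Sum>x\<in>A. (norm (W t x))\<^sup>2) \<le> B"
        using eventually_at_right_real[OF \<delta>]
      proof eventually_elim
        case (elim t)
        then have t: "0 < t" "t < \<delta>" by auto
        have "(\<Sum>x\<in>A. (norm (W t x))\<^sup>2) \<le> sqn (W t)"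
          unfolding sqn_def by (rule finite_sum_le_infsum) (use W(1)[OF t] A in \<open>auto simp: ell2_summable\<close>)
        then show ?case using W(2)[OF t] by linarith
      qed
    qed simp
  qed
qed simp

lemma linear_bound_imp_tendsto:
  fixes f :: "real \<Rightarrow> complex"
  assumes \<delta>: "0 < \<delta>" and le: "\<And>t. 0 < t \<Longrightarrow> t < \<delta> \<Longrightarrow> norm (f t - a) \<le> K * t"
  shows "(f \<longlongrightarrow> a) (at_right 0)"
proof -
  have "((\<lambda>t. f t - a) \<longlongrightarrow> 0) (at_right 0)"
  proof (rule Lim_null_comparison)
    show "\<forall>\<^sub>F t in at_right 0. norm (f t - a) \<le> K * t"
      using eventually_at_right_real[OF \<delta>] by eventually_elim (use le in auto)
    show "((\<lambda>t. K * t) \<longlongrightarrow> 0) (at_right 0)" by (rule tendsto_mult_right_zero, rule tendsto_ident_at)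
  qed
  then show ?thesis using LIM_zero_cancel by blast
qed

locale schroedinger_kernel = schroedinger_inverse E0 r V b v v' U Cv n \<delta> X
  for E0 :: "'k::finite set set" and r :: "'a::finite \<Rightarrow> 'k"
    and V :: "('k, 'a) gfun \<Rightarrow> ('k, 'a) gfun" and b :: nat
    and v :: "'h::chilbert_space \<Rightarrow> ('k, 'a) gfun" and v' :: "('k, 'a) gfun \<Rightarrow> 'h" and U :: "'h \<Rightarrow> 'h"
    and Cv :: real and n :: nat and \<delta> :: real
    and X :: "complex \<Rightarrow> ('k, 'a) vertex \<Rightarrow> ('k, 'a) vertex \<Rightarrow> complex" +
  fixes g :: "nat \<Rightarrow> ('k, 'a) vertex \<Rightarrow> ('k, 'a) vertex \<Rightarrow> complex" and C :: real
  assumes C: "0 \<le> C"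
    and g_bound: "\<And>i x y. i < b - 3 \<Longrightarrow> norm (g i x y) \<le> C * (wt x * wt y) ^ i"
    and g_expansion: "\<And>\<kappa> x y. \<kappa> \<in> half_disc \<delta> \<Longrightarrow>
       norm (\<kappa>\<^sup>2 * KK \<kappa> x y - (\<Sum>i<b - 3. \<kappa> ^ i * g i x y)) \<le> C * (wt x * wt y) ^ (b - 2) * norm \<kappa> ^ (b - 3)"
begin

text \<open>Indexed from the pole: \<open>Gi i\<close> is the coefficient of \<kappa>^i in
  \<kappa>^2 times the resolvent, hence of order i - 2 in the resolvent.\<close>

definition Gi :: "nat \<Rightarrow> ('k, 'a) gfun \<Rightarrow> ('k, 'a) gfun" where
  "Gi i = kop (g i)"

lemma Gi_bound:
  assumes i: "i < b - 3" and u: "u \<in> l1w (real i)"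
  shows "(\<lambda>y. norm (g i x y * u y)) summable_on UNIV"
    "norm (Gi i u x) \<le> C * wt x ^ i * l1w_norm (real i) u"
proof -
  have s: "(\<lambda>y. C * wt x ^ i * (wt y ^ i * norm (u y))) summable_on UNIV"
    using u unfolding l1w_nat by (rule summable_on_cmult_right)
  have le: "norm (g i x y * u y) \<le> C * wt x ^ i * (wt y ^ i * norm (u y))" for y
    using mult_right_mono[OF g_bound[OF i, of x y] norm_ge_zero[of "u y"]]
    by (simp add: norm_mult power_mult_distrib mult_ac)
  show 1: "(\<lambda>y. norm (g i x y * u y)) summable_on UNIV" by (rule summable_on_comparison_test[OF s le]) auto
  have "norm (Gi i u x) \<le> (\<Sum>\<^sub>\<infinity>y. norm (g i x y * u y))" unfolding Gi_def kop_def by (rule norm_infsum_bound[OF 1])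
  also have "\<dots> \<le> (\<Sum>\<^sub>\<infinity>y. C * wt x ^ i * (wt y ^ i * norm (u y)))" by (rule infsum_mono[OF 1 s le])
  finally show "norm (Gi i u x) \<le> C * wt x ^ i * l1w_norm (real i) u"
    by (simp add: infsum_cmult_right' l1w_norm_nat)
qed

lemma Gi_has_sum:
  assumes "i < b - 3" "u \<in> l1w (real i)"
  shows "((\<lambda>y. g i x y * u y) has_sum Gi i u x) UNIV"
  unfolding Gi_def kop_def by (rule has_sum_infsum[OF abs_summable_summable[OF Gi_bound(1)[OF assms]]])

lemma Gi_linfw: "i < b - 3 \<Longrightarrow> u \<in> l1w (real i) \<Longrightarrow> Gi i u \<in> linfw (real i)"
  by (rule linfwI[of _ "C * l1w_norm (real i) u"]) (use Gi_bound(2)[of i u] in \<open>simp add: mult_ac\<close>)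

lemma Gi_lin:
  assumes i: "i < b - 3" and u: "u \<in> l1w (real i)" and w: "w \<in> l1w (real i)"
  shows "Gi i (\<lambda>y. u y + c * w y) x = Gi i u x + c * Gi i w x"
proof -
  have "((\<lambda>y. g i x y * (u y + c * w y)) has_sum (Gi i u x + c * Gi i w x)) UNIV"
    using has_sum_add[OF Gi_has_sum[OF i u] has_sum_cmult_right[OF Gi_has_sum[OF i w], of c]]
    by (simp add: algebra_simps)
  moreover have "((\<lambda>y. g i x y * (u y + c * w y)) has_sum Gi i (\<lambda>y. u y + c * w y) x) UNIV"
    by (rule Gi_has_sum[OF i l1w_add[OF u l1w_scale[OF w]]])
  ultimately show ?thesis using has_sum_unique by metis
qed

lemma RR_remainder:
  assumes \<kappa>: "\<kappa> \<in> half_disc \<delta>" and u: "u \<in> l1w (real (b - 2))"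
  shows "norm (\<kappa>\<^sup>2 * RR \<kappa> u x - (\<Sum>i<b - 3. \<kappa> ^ i * Gi i u x))
    \<le> C * wt x ^ (b - 2) * norm \<kappa> ^ (b - 3) * l1w_norm (real (b - 2)) u"
proof -
  let ?k = "\<lambda>y. \<kappa>\<^sup>2 * KK \<kappa> x y - (\<Sum>i<b - 3. \<kappa> ^ i * g i x y)"
  let ?C = "C * wt x ^ (b - 2) * norm \<kappa> ^ (b - 3)"
  have ui: "u \<in> l1w (real i)" if "i < b - 3" for i by (rule l1w_mono[OF u]) (use that in simp)
  have S: "((\<lambda>y. \<Sum>i<b - 3. \<kappa> ^ i * (g i x y * u y)) has_sum (\<Sum>i<b - 3. \<kappa> ^ i * Gi i u x)) UNIV"
    by (rule has_sum_finite_combination) (auto intro: Gi_has_sum ui)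
  have "((\<lambda>y. \<kappa>\<^sup>2 * (KK \<kappa> x y * u y) + - (\<Sum>i<b - 3. \<kappa> ^ i * (g i x y * u y)))
      has_sum (\<kappa>\<^sup>2 * RR \<kappa> u x + - (\<Sum>i<b - 3. \<kappa> ^ i * Gi i u x))) UNIV"
    by (rule has_sum_add[OF has_sum_cmult_right[OF RR_has_sum_KK[OF \<kappa> l1w_ell2[OF u]]] has_sum_uminusI[OF S]])
  moreover have "\<kappa>\<^sup>2 * (KK \<kappa> x y * u y) + - (\<Sum>i<b - 3. \<kappa> ^ i * (g i x y * u y)) = ?k y * u y" for y
    by (simp add: left_diff_distrib sum_distrib_right mult.assoc)
  ultimately have hs: "((\<lambda>y. ?k y * u y) has_sum (\<kappa>\<^sup>2 * RR \<kappa> u x - (\<Sum>i<b - 3. \<kappa> ^ i * Gi i u x))) UNIV" by simp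
  have s: "(\<lambda>y. ?C * (wt y ^ (b - 2) * norm (u y))) summable_on UNIV"
    using u unfolding l1w_nat by (rule summable_on_cmult_right)
  have le: "norm (?k y * u y) \<le> ?C * (wt y ^ (b - 2) * norm (u y))" for y
    using mult_right_mono[OF g_expansion[OF \<kappa>, of x y] norm_ge_zero[of "u y"]]
    by (simp add: norm_mult power_mult_distrib mult_ac)
  have 1: "(\<lambda>y. norm (?k y * u y)) summable_on UNIV" by (rule summable_on_comparison_test[OF s le]) auto
  have "norm (\<Sum>\<^sub>\<infinity>y. ?k y * u y) \<le> (\<Sum>\<^sub>\<infinity>y. norm (?k y * u y))" by (rule norm_infsum_bound[OF 1])
  also have "\<dots> \<le> (\<Sum>\<^sub>\<infinity>y. ?C * (wt y ^ (b - 2) * norm (u y)))" by (rule infsum_mono[OF 1 s le])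
  finally show ?thesis unfolding infsumI[OF hs] by (simp add: infsum_cmult_right' l1w_norm_nat)
qed

text \<open>The factor \<open>real b\<close> pays for the at most b - 3 terms dropped by a
  truncation and for the remainder.\<close>

definition KA :: "('k, 'a) gfun \<Rightarrow> real" where
  "KA u = real b * C * l1w_norm (real (b - 2)) u"

lemma KA_nonneg: "0 \<le> KA u"
  unfolding KA_def by (intro mult_nonneg_nonneg C l1w_norm_nonneg) auto

lemma RR_truncate:
  assumes \<kappa>: "\<kappa> \<in> half_disc \<delta>" and u: "u \<in> l1w (real (b - 2))" and m: "m \<le> b - 3"
  shows "norm (\<kappa>\<^sup>2 * RR \<kappa> u x - (\<Sum>i<m. \<kappa> ^ i * Gi i u x)) \<le> KA u * wt x ^ (b - 2) * norm \<kappa> ^ m"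
proof -
  let ?N = "l1w_norm (real (b - 2)) u"
  let ?T = "C * wt x ^ (b - 2) * ?N * norm \<kappa> ^ m"
  have k1: "norm \<kappa> \<le> 1" using \<kappa> \<delta> by (simp add: half_disc_def)
  have N: "0 \<le> ?N" by (rule l1w_norm_nonneg)
  have T: "0 \<le> C * wt x ^ (b - 2) * ?N" by (intro mult_nonneg_nonneg C N zero_le_power wt_nonneg)
  have split: "(\<Sum>i<b - 3. \<kappa> ^ i * Gi i u x) = (\<Sum>i<m. \<kappa> ^ i * Gi i u x) + (\<Sum>i\<in>{m..<b - 3}. \<kappa> ^ i * Gi i u x)"
    using m by (subst sum.atLeastLessThan_concat[of 0 m "b - 3", symmetric, simplified lessThan_atLeast0[symmetric]]) auto
  have summand: "norm (\<kappa> ^ i * Gi i u x) \<le> ?T" if "i \<in> {m..<b - 3}" for i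
  proof -
    have i: "i < b - 3" "m \<le> i" "i \<le> b - 2" using that by auto
    have "norm (Gi i u x) \<le> C * wt x ^ i * l1w_norm (real i) u" by (rule Gi_bound(2)[OF i(1) l1w_mono[OF u i(3)]])
    also have "\<dots> \<le> C * wt x ^ (b - 2) * ?N"
      by (intro mult_mono[OF mult_left_mono[OF wt_power_mono[OF i(3)] C] l1w_norm_mono[OF u i(3)]]
          mult_nonneg_nonneg C zero_le_power wt_nonneg l1w_norm_nonneg)
    finally have G: "norm (Gi i u x) \<le> C * wt x ^ (b - 2) * ?N" .
    have "norm \<kappa> ^ i \<le> norm \<kappa> ^ m" using i k1 by (intro power_decreasing) auto
    from mult_mono[OF G this T] show ?thesis by (simp add: norm_mult norm_power mult.commute)
  qed
  have "norm (\<Sum>i\<in>{m..<b - 3}. \<kappa> ^ i * Gi i u x) \<le> real (card {m..<b - 3}) * ?T" by (rule sum_norm_bound[OF summand])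
  moreover have "C * wt x ^ (b - 2) * norm \<kappa> ^ (b - 3) * ?N \<le> ?T"
    using mult_left_mono[OF power_decreasing[OF m, of "norm \<kappa>"] T] k1 by (simp add: mult_ac)
  moreover have "norm (\<kappa>\<^sup>2 * RR \<kappa> u x - (\<Sum>i<m. \<kappa> ^ i * Gi i u x))
    \<le> norm (\<Sum>i\<in>{m..<b - 3}. \<kappa> ^ i * Gi i u x) + norm (\<kappa>\<^sup>2 * RR \<kappa> u x - (\<Sum>i<b - 3. \<kappa> ^ i * Gi i u x))"
    unfolding split by (rule order_trans[OF _ norm_triangle_ineq]) simp
  ultimately have "norm (\<kappa>\<^sup>2 * RR \<kappa> u x - (\<Sum>i<m. \<kappa> ^ i * Gi i u x)) \<le> real (card {m..<b - 3}) * ?T + ?T"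
    using RR_remainder[OF \<kappa> u, of x] by linarith
  also have "\<dots> = real (card {m..<b - 3} + 1) * ?T" by (simp add: distrib_right)
  also have "\<dots> \<le> real b * ?T"
    using b4 T by (intro mult_right_mono) auto
  finally show ?thesis by (simp add: KA_def mult_ac)
qed

lemma RR_G0:
  assumes "\<kappa> \<in> half_disc \<delta>" "u \<in> l1w (real (b - 2))"
  shows "norm (\<kappa>\<^sup>2 * RR \<kappa> u x - Gi 0 u x) \<le> KA u * wt x ^ (b - 2) * norm \<kappa>"
  using RR_truncate[OF assms, of 1 x] b4 by simp

text \<open>Once the double pole is absent on \<open>u\<close>, division by \<kappa> leaves a
  bounded family. The index 1 belongs to the expansion from b = 5 on.\<close>

lemma RR_G1:
  assumes \<kappa>: "\<kappa> \<in> half_disc \<delta>" and u: "u \<in> l1w (real (b - 2))" and b5: "5 \<le> b" and G0: "Gi 0 u = (\<lambda>_. 0)"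
  shows "norm (\<kappa> * RR \<kappa> u x - Gi 1 u x) \<le> KA u * wt x ^ (b - 2) * norm \<kappa>"
proof -
  have nz: "0 < norm \<kappa>" using half_disc_nz[OF \<kappa>] by simp
  have "{..<2::nat} = {0, 1}" by auto
  then have "norm (\<kappa>\<^sup>2 * RR \<kappa> u x - \<kappa> * Gi 1 u x) \<le> KA u * wt x ^ (b - 2) * norm \<kappa> ^ 2"
    using RR_truncate[OF \<kappa> u, of 2 x] b5 G0 by simp
  moreover have "\<kappa>\<^sup>2 * RR \<kappa> u x - \<kappa> * Gi 1 u x = \<kappa> * (\<kappa> * RR \<kappa> u x - Gi 1 u x)"
    by (simp add: power2_eq_square algebra_simps)
  ultimately have "norm \<kappa> * norm (\<kappa> * RR \<kappa> u x - Gi 1 u x) \<le> norm \<kappa> * (KA u * wt x ^ (b - 2) * norm \<kappa>)"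
    by (simp add: norm_mult power2_eq_square mult_ac)
  then show ?thesis using nz by (simp only: mult_le_cancel_left_pos)
qed

lemma bound_l1w: "\<Psi> \<in> bound \<Longrightarrow> \<Psi> \<in> l1w (real (b - 2))"
  by (simp add: bound_iff)

text \<open>On a null vector H + \<kappa>^2 is multiplication by \<kappa>^2. Comparing this exact
  value with the expansion gives \<open>G0_bound\<close> and \<open>G1_bound\<close>.\<close>

lemma RR_bound:
  assumes \<kappa>: "\<kappa> \<in> half_disc \<delta>" and \<Psi>: "\<Psi> \<in> bound"
  shows "\<kappa>\<^sup>2 * RR \<kappa> \<Psi> x = \<Psi> x"
proof -
  note l = bound_ell2[OF \<Psi>] and nz = half_disc_nz[OF \<kappa>]
  have gen: "\<Psi> \<in> gen" using \<Psi> by (simp add: bound_iff)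
  have "(\<lambda>x. 1 / \<kappa>\<^sup>2 * \<Psi> x) = RR \<kappa> \<Psi>"
  proof (rule RR_unique[OF \<kappa> ell2_scale(1)[OF l] l])
    fix x
    have "HH (\<lambda>x. 0 + 1 / \<kappa>\<^sup>2 * \<Psi> x) x = HH (\<lambda>x. 0) x + 1 / \<kappa>\<^sup>2 * HH \<Psi> x"
      by (rule HH_lin[OF ell2_in_linfw[OF ell2_zero] genD(1)[OF gen]])
    then have "HH (\<lambda>x. 1 / \<kappa>\<^sup>2 * \<Psi> x) x = 0" by (simp add: HH_zero genD(2)[OF gen])
    then show "HH (\<lambda>x. 1 / \<kappa>\<^sup>2 * \<Psi> x) x + \<kappa>\<^sup>2 * (1 / \<kappa>\<^sup>2 * \<Psi> x) = \<Psi> x" using nz by simp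
  qed
  then have "RR \<kappa> \<Psi> x = 1 / \<kappa>\<^sup>2 * \<Psi> x" by metis
  then show ?thesis using nz by simp
qed

lemma G0_bound:
  assumes \<Psi>: "\<Psi> \<in> bound"
  shows "Gi 0 \<Psi> = \<Psi>"
proof
  fix x
  have "\<Psi> x - Gi 0 \<Psi> x = 0"
  proof (rule linear_bound_imp_zero[OF \<delta>(1)])
    fix t assume t: "0 < t" "t < \<delta>"
    show "norm (\<Psi> x - Gi 0 \<Psi> x) \<le> KA \<Psi> * wt x ^ (b - 2) * t"
      using RR_G0[OF half_disc_of_real[OF t] bound_l1w[OF \<Psi>], of x] RR_bound[OF half_disc_of_real[OF t] \<Psi>, of x] t by simp
  qed
  then show "Gi 0 \<Psi> x = \<Psi> x" by simp
qed

lemma G1_bound: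
  assumes \<Psi>: "\<Psi> \<in> bound" and b5: "5 \<le> b"
  shows "Gi 1 \<Psi> x = 0"
proof (rule linear_bound_imp_zero[OF \<delta>(1)])
  fix t assume t: "0 < t" "t < \<delta>"
  have "{..<2::nat} = {0, 1}" by auto
  then have "norm (of_real t * Gi 1 \<Psi> x) \<le> KA \<Psi> * wt x ^ (b - 2) * t ^ 2"
    using RR_truncate[OF half_disc_of_real[OF t] bound_l1w[OF \<Psi>], of 2 x] RR_bound[OF half_disc_of_real[OF t] \<Psi>, of x] t b5
    by (simp add: G0_bound[OF \<Psi>])
  then have "t * norm (Gi 1 \<Psi> x) \<le> t * (KA \<Psi> * wt x ^ (b - 2) * t)"
    using t by (simp add: norm_mult power2_eq_square mult_ac)
  then show "norm (Gi 1 \<Psi> x) \<le> KA \<Psi> * wt x ^ (b - 2) * t" using t by (simp only: mult_le_cancel_left_pos)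
qed

lemma wt_b2: "wt x ^ (b - 2) \<le> wt x ^ b"
  by (rule wt_power_mono) simp

lemma KA_b: "0 \<le> t \<Longrightarrow> KA u * wt x ^ (b - 2) * t \<le> KA u * wt x ^ b * t"
  by (intro mult_right_mono mult_left_mono wt_b2 KA_nonneg)

lemma u_l1w: "u \<in> l1w (real (b - 2)) \<Longrightarrow> i \<le> b - 2 \<Longrightarrow> u \<in> l1w (real i)"
  by (rule l1w_mono)

text \<open>Two directions of approach are combined. Along the positive reals the limit is seen to
  be annihilated by H; along the diagonal ray \<kappa>^2 times the resolvent does not increase the
  norm, so the limit is square-summable.\<close>

lemma G0_in_bound:
  assumes u: "u \<in> l1w (real (b - 2))"
  shows "Gi 0 u \<in> bound"
proof (rule gen_ell2_bound)
  note ue = l1w_ell2[OF u]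
  have lin: "Gi 0 u \<in> linfw (real b)"
    by (rule linfw_mono[OF Gi_linfw[of 0]]) (use b4 u_l1w[OF u, of 0] in auto)
  show "Gi 0 u \<in> gen"
  proof (rule limit_in_gen[OF \<delta>, where W="\<lambda>t x. (of_real t)\<^sup>2 * RR (of_real t) u x" and c="\<lambda>t. (of_real t)\<^sup>2" and u=u and A="KA u"])
    fix t x assume t: "0 < t" "t < \<delta>"
    note k = half_disc_of_real[OF t]
    show "norm ((of_real t)\<^sup>2 * RR (of_real t) u x - Gi 0 u x) \<le> KA u * wt x ^ b * t"
      using order_trans[OF RR_G0[OF k u, of x] KA_b] t by simp
    have R: "RR (of_real t) u \<in> ell2" by (rule RR_ell2[OF _ ue]) (use t in simp)
    have "HH (\<lambda>x. 0 + (of_real t)\<^sup>2 * RR (of_real t) u x) x = HH (\<lambda>x. 0) x + (of_real t)\<^sup>2 * HH (RR (of_real t) u) x"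
      by (rule HH_lin[OF ell2_in_linfw[OF ell2_zero] ell2_in_linfw[OF R]])
    then have "HH (\<lambda>x. (of_real t)\<^sup>2 * RR (of_real t) u x) x + (of_real t)\<^sup>2 * ((of_real t)\<^sup>2 * RR (of_real t) u x)
      = (of_real t)\<^sup>2 * (HH (RR (of_real t) u) x + (of_real t)\<^sup>2 * RR (of_real t) u x)"
      by (simp only: HH_zero) (simp add: algebra_simps)
    then show "HH (\<lambda>x. (of_real t)\<^sup>2 * RR (of_real t) u x) x + (of_real t)\<^sup>2 * ((of_real t)\<^sup>2 * RR (of_real t) u x)
      = (of_real t)\<^sup>2 * u x" unfolding RR_eq[OF k ue] .
  next
    fix t assume t: "0 < t" "t < \<delta>"
    show "(\<lambda>x. (of_real t)\<^sup>2 * RR (of_real t) u x) \<in> linfw (real b)"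
      by (rule ell2_in_linfw, rule ell2_scale(1), rule RR_ell2[OF _ ue]) (use t in simp)
    show "norm ((complex_of_real t)\<^sup>2) \<le> t"
      using t \<delta> by (simp add: norm_power power2_eq_square norm_mult mult_left_le_one_le)
  qed (rule KA_nonneg, rule lin)
  define k where "k t = of_real t * cis (pi / 4)" for t
  have nk: "norm (k t) = \<bar>t\<bar>" for t by (simp add: k_def norm_mult)
  have kd: "k t \<in> half_disc \<delta>" if "0 < t" "t < \<delta>" for t
    using that nk[of t] by (simp add: half_disc_def k_def cos_45)
  show "Gi 0 u \<in> ell2"
  proof (rule ell2_limit[OF \<delta>(1), where W="\<lambda>t x. (k t)\<^sup>2 * RR (k t) u x" and B="sqn u"])
    fix t assume t: "0 < t" "t < \<delta>"
    have R: "RR (k t) u \<in> ell2" by (rule RR_ell2[OF half_disc_Re[OF kd[OF t]] ue])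
    show "(\<lambda>x. (k t)\<^sup>2 * RR (k t) u x) \<in> ell2" by (rule ell2_scale(1)[OF R])
    have "sqn (RR (k t) u) \<le> sqn u / t ^ 4"
      by (rule apriori_ell2[OF t(1) R ue]) (use RR_eq[OF kd[OF t] ue] in \<open>simp add: k_def\<close>)
    then have "t ^ 4 * sqn (RR (k t) u) \<le> sqn u" using t by (simp add: field_simps)
    then show "sqn (\<lambda>x. (k t)\<^sup>2 * RR (k t) u x) \<le> sqn u"
      unfolding ell2_scale(2) norm_power nk using t by (simp add: power_mult[symmetric])
  next
    fix x
    show "((\<lambda>t. (k t)\<^sup>2 * RR (k t) u x) \<longlongrightarrow> Gi 0 u x) (at_right 0)"
    proof (rule linear_bound_imp_tendsto[OF \<delta>(1)])
      fix t assume t: "0 < t" "t < \<delta>"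
      show "norm ((k t)\<^sup>2 * RR (k t) u x - Gi 0 u x) \<le> KA u * wt x ^ (b - 2) * t"
        using RR_G0[OF kd[OF t] u, of x] t by (simp add: nk)
    qed
  qed
qed

lemma pairing_limit:
  assumes \<Psi>: "\<Psi> \<in> l1w (real (b - 2))"
    and W: "\<And>t x. 0 < t \<Longrightarrow> t < \<delta> \<Longrightarrow> norm (W t x - \<Theta> x) \<le> A * wt x ^ (b - 2) * t"
    and Wb: "\<And>t. 0 < t \<Longrightarrow> t < \<delta> \<Longrightarrow> W t \<in> ell2" and \<Theta>: "\<Theta> \<in> linfw (real (b - 2))"
    and eq: "\<And>t. 0 < t \<Longrightarrow> t < \<delta> \<Longrightarrow> pairing \<Psi> (W t) = a"
  shows "pairing \<Psi> \<Theta> = a"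
proof -
  have sm: "(\<lambda>x. norm (cnj (\<Psi> x) * w x)) summable_on UNIV" if w: "w \<in> linfw (real (b - 2))" for w
  proof -
    obtain B where "0 \<le> B" and B: "\<And>x. norm (w x) \<le> B * wt x ^ (b - 2)" by (rule linfwE[OF w]) (rule that)
    have "(\<lambda>x. norm (cnj (w x) * \<Psi> x)) summable_on UNIV" by (rule l1w_linfw_product(1)[OF B \<Psi>])
    then show ?thesis by (simp add: norm_mult mult.commute)
  qed
  have "a - pairing \<Psi> \<Theta> = 0"
  proof (rule linear_bound_imp_zero[OF \<delta>(1)])
    fix t assume t: "0 < t" "t < \<delta>"
    have "a - pairing \<Psi> \<Theta> = pairing \<Psi> (\<lambda>x. W t x - \<Theta> x)"
      unfolding eq[OF t, symmetric] by (rule pairing_diff_right[OF sm sm, symmetric, OF ell2_in_linfw[OF Wb[OF t]] \<Theta>])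
    also have "norm \<dots> = norm (pairing (\<lambda>x. W t x - \<Theta> x) \<Psi>)" by (subst pairing_cnj) simp
    also have "\<dots> \<le> A * t * l1w_norm (real (b - 2)) \<Psi>"
      by (rule l1w_linfw_product(2)[OF _ \<Psi>]) (use W[OF t] in \<open>simp add: mult_ac\<close>)
    finally show "norm (a - pairing \<Psi> \<Theta>) \<le> A * l1w_norm (real (b - 2)) \<Psi> * t" by (simp add: mult_ac)
  qed
  then show ?thesis by simp
qed

lemma pairing_bound_RR:
  assumes \<Psi>: "\<Psi> \<in> bound" and \<kappa>: "\<kappa> \<in> half_disc \<delta>" and u: "u \<in> ell2"
  shows "\<kappa>\<^sup>2 * pairing \<Psi> (RR \<kappa> u) = pairing \<Psi> u"
proof -
  have gen: "\<Psi> \<in> gen" using \<Psi> by (simp add: bound_iff)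
  have "pairing \<Psi> u = pairing (\<lambda>x. (cnj \<kappa>)\<^sup>2 * \<Psi> x) (RR \<kappa> u)"
    by (rule RR_pairing[OF \<kappa> ell2_scale(1)[OF bound_ell2[OF \<Psi>]] u bound_ell2[OF \<Psi>]]) (simp add: genD(2)[OF gen])
  then show ?thesis by (simp add: pairing_scale_left)
qed

text \<open>Symmetry moves the resolvent onto the bound state, where it acts as \<kappa>^-2.
  Together with \<open>G0_in_bound\<close> this characterises the leading coefficient as the
  orthogonal projection.\<close>

lemma pairing_G0:
  assumes \<Psi>: "\<Psi> \<in> bound" and u: "u \<in> l1w (real (b - 2))"
  shows "pairing \<Psi> (Gi 0 u) = pairing \<Psi> u"
proof (rule pairing_limit[where W="\<lambda>t x. (of_real t)\<^sup>2 * RR (of_real t) u x" and A="KA u"])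
  show "\<Psi> \<in> l1w (real (b - 2))" by (rule bound_l1w[OF \<Psi>])
  show "Gi 0 u \<in> linfw (real (b - 2))"
    by (rule linfw_mono[OF Gi_linfw[of 0]]) (use b4 u_l1w[OF u, of 0] in auto)
  fix t assume t: "0 < t" "t < \<delta>"
  note k = half_disc_of_real[OF t]
  show "norm ((of_real t)\<^sup>2 * RR (of_real t) u x - Gi 0 u x) \<le> KA u * wt x ^ (b - 2) * t" for x
    using RR_G0[OF k u, of x] t by simp
  show "(\<lambda>x. (of_real t)\<^sup>2 * RR (of_real t) u x) \<in> ell2"
    by (rule ell2_scale(1)[OF RR_ell2[OF half_disc_Re[OF k] l1w_ell2[OF u]]])
  show "pairing \<Psi> (\<lambda>x. (of_real t)\<^sup>2 * RR (of_real t) u x) = pairing \<Psi> u"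
    unfolding pairing_scale_right by (rule pairing_bound_RR[OF \<Psi> k l1w_ell2[OF u]])
qed

end

section \<open>The subleading coefficient\<close>

fun ray_poly :: "('a \<Rightarrow> complex) \<Rightarrow> (nat \<Rightarrow> complex) \<Rightarrow> ('k, 'a) vertex \<Rightarrow> complex" where
  "ray_poly c f (Core x) = 0"
| "ray_poly c f (Ray \<alpha> m) = c \<alpha> * f (Suc m)"

lemma ray_const_eq_ray_poly: "(ray_const c :: ('k, 'a::finite) gfun) = ray_poly c (\<lambda>_. 1)"
proof
  fix x :: "('k, 'a) vertex"
  show "ray_const c x = ray_poly c (\<lambda>_. 1) x" by (cases x) auto
qed

lemma ray_poly_bound:
  fixes c :: "'a::finite \<Rightarrow> complex" and x :: "('k, 'a) vertex"
  assumes "\<And>l. norm (f l) \<le> A * real l ^ k" "0 \<le> A" "k \<le> s"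
  shows "norm (ray_poly c f x) \<le> (\<Sum>\<alpha>\<in>UNIV. norm (c \<alpha>)) * A * wt x ^ s"
proof (cases x)
  case (Core y)
  then show ?thesis using assms(2) by (simp add: sum_nonneg)
next
  case (Ray \<alpha> m)
  have c: "norm (c \<alpha>) \<le> (\<Sum>\<alpha>\<in>UNIV. norm (c \<alpha>))" by (rule member_le_sum) auto
  have "real m + 1 \<le> wt (Ray \<alpha> m :: ('k, 'a) vertex)" by (rule wt_Ray(1))
  then have "real (Suc m) ^ k \<le> wt (Ray \<alpha> m :: ('k, 'a) vertex) ^ k" by (intro power_mono) auto
  also have "\<dots> \<le> wt x ^ s" using wt_power_mono[OF assms(3)] Ray by blast
  finally have "norm (f (Suc m)) \<le> A * wt x ^ s"
    using assms(1)[of "Suc m"] assms(2) by (meson mult_left_mono order_trans)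
  from mult_mono[OF c this sum_nonneg] show ?thesis by (simp add: Ray norm_mult mult.assoc)
qed

lemma ray_poly_lin: "ray_poly c (\<lambda>l. f l + a * h l) x = ray_poly c f x + a * ray_poly c h x"
  by (cases x) (auto simp: algebra_simps)

text \<open>Taylor estimates of z^l at \<kappa> = 0 with explicit growth in l. The derivative there
  is -l, because z - 1 = - \<kappa> s with s close to 1.\<close>

lemma decay_power_bounds:
  fixes \<kappa> :: complex
  assumes \<kappa>: "0 < Re \<kappa>"
  defines "z \<equiv> (decay_root \<kappa>)\<^sup>2"
  shows "norm (z ^ l - 1) \<le> norm \<kappa> * real l" "norm ((z ^ l - 1) / \<kappa> + of_nat l) \<le> norm \<kappa> * real l ^ 2"
proof -
  define s where "s = decay_root \<kappa>"
  note d = decay_root[OF \<kappa>, folded s_def]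
  have nz: "\<kappa> \<noteq> 0" using \<kappa> by auto
  have s1: "norm (s ^ k) \<le> 1" for k unfolding norm_power using d(2) by (intro power_le_one) auto
  have z: "z = s\<^sup>2" "z - 1 = - \<kappa> * s" using d(1) by (auto simp: z_def s_def algebra_simps)
  have geo: "z ^ l - 1 = - \<kappa> * (\<Sum>k<l. s * z ^ k)"
    using power_diff_1_eq[of z l] by (simp add: z(2) sum_distrib_left mult.assoc)
  have sz: "s * z ^ k = s ^ (2 * k + 1)" for k by (simp add: z(1) power_mult[symmetric])
  have "norm (\<Sum>k<l. s * z ^ k) \<le> (\<Sum>k<l. 1)" by (rule sum_norm_le) (simp only: sz s1)
  then show "norm (z ^ l - 1) \<le> norm \<kappa> * real l"
    unfolding geo norm_mult norm_minus_cancel by (intro mult_left_mono) auto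
  \<comment> \<open>From (1 - s)(1 + s) = \<kappa> s and |1 + s| \<ge> 1, the latter because Re s >
    0.\<close>
  have 1: "norm (1 - s) \<le> norm \<kappa>"
  proof -
    have "(1 - s) * (1 + s) = 1 - s\<^sup>2" by (simp add: algebra_simps power2_eq_square)
    also have "\<dots> = \<kappa> * s" using d(1) by (simp add: algebra_simps)
    finally have e: "(1 - s) * (1 + s) = \<kappa> * s" .
    have "norm (1 - s) * norm (1 + s) = norm \<kappa> * norm s" unfolding norm_mult[symmetric] e ..
    also have "\<dots> \<le> norm \<kappa> * 1" using d(2) by (intro mult_left_mono) auto
    finally have "norm (1 - s) * norm (1 + s) \<le> norm \<kappa>" by simp
    moreover have "1 \<le> norm (1 + s)" using abs_Re_le_cmod[of "1 + s"] d(3) by simp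
    ultimately show ?thesis using mult_left_mono[of 1 "norm (1 + s)" "norm (1 - s)"] by simp
  qed
  have p: "norm (1 - s ^ k) \<le> real k * norm \<kappa>" for k
  proof -
    have "1 - s ^ k = (1 - s) * (\<Sum>j<k. s ^ j)" using power_diff_1_eq[of s k] by (simp add: algebra_simps)
    also have "norm \<dots> \<le> norm \<kappa> * (\<Sum>j<k. 1)"
      unfolding norm_mult by (rule mult_mono[OF 1 sum_norm_le]) (auto simp: s1)
    finally show ?thesis by (simp add: mult.commute)
  qed
  have "(z ^ l - 1) / \<kappa> + of_nat l = (\<Sum>k<l. 1 - s ^ (2 * k + 1))"
    unfolding geo sz using nz by (simp add: sum_subtractf)
  also have "norm \<dots> \<le> (\<Sum>k<l. real (2 * k + 1) * norm \<kappa>)" by (rule sum_norm_le) (rule p)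
  also have "\<dots> = (\<Sum>k<l. real (2 * k + 1)) * norm \<kappa>" by (rule sum_distrib_right[symmetric])
  \<comment> \<open>The odd numbers sum to a square, hence the quadratic growth.\<close>
  also have "(\<Sum>k<l. real (2 * k + 1)) = real l ^ 2"
    by (induction l) (auto simp: power2_eq_square algebra_simps)
  finally show "norm ((z ^ l - 1) / \<kappa> + of_nat l) \<le> norm \<kappa> * real l ^ 2" by (simp add: mult.commute)
qed

text \<open>The value that z^l would take at the missing point 0 is 1 for every \<kappa>. So the
  decaying function leaves the same defect at the first vertex as the constant one, independently of
  \<kappa>.\<close>

lemma H0_ray_poly_decay:
  fixes E0 :: "'k::finite set set" and r :: "'a::finite \<Rightarrow> 'k" and c :: "'a \<Rightarrow> complex"
  assumes \<kappa>: "0 < Re \<kappa>"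
  defines "\<zeta> \<equiv> ray_poly c (\<lambda>l. ((decay_root \<kappa>)\<^sup>2) ^ l)"
  shows "H0 E0 r \<zeta> x + \<kappa>\<^sup>2 * \<zeta> x = H0 E0 r (ray_const c) x"
proof -
  define z where "z = (decay_root \<kappa>)\<^sup>2"
  have z: "1 + z\<^sup>2 = (2 + \<kappa>\<^sup>2) * z" using decay_sq[OF \<kappa>] unfolding z_def by blast
  have \<zeta>: "\<zeta> = ray_poly c (\<lambda>l. z ^ l)" by (simp add: \<zeta>_def z_def)
  show ?thesis
  proof (cases x)
    case (Core y)
    then show ?thesis by (simp add: \<zeta>)
  next
    case (Ray \<alpha> m)
    have 1: "1 = (2 + \<kappa>\<^sup>2) * z - z\<^sup>2" using z by (metis add_diff_cancel_right')
    show ?thesis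
    proof (cases m)
      case 0
      have "2 * (c \<alpha> * z) - c \<alpha> * z\<^sup>2 + \<kappa>\<^sup>2 * (c \<alpha> * z) = c \<alpha> * ((2 + \<kappa>\<^sup>2) * z - z\<^sup>2)" by (simp add: algebra_simps)
      then show ?thesis unfolding 1[symmetric] by (simp add: Ray 0 \<zeta> power2_eq_square)
    next
      case (Suc k)
      have "2 * (c \<alpha> * z ^ Suc (Suc k)) - c \<alpha> * z ^ Suc (Suc (Suc k)) - c \<alpha> * z ^ Suc k + \<kappa>\<^sup>2 * (c \<alpha> * z ^ Suc (Suc k))
        = c \<alpha> * z ^ Suc k * (((2 + \<kappa>\<^sup>2) * z - z\<^sup>2) - 1)" by (simp add: algebra_simps power2_eq_square)
      then show ?thesis unfolding 1[symmetric] by (simp add: Ray Suc \<zeta> del: power_Suc)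
    qed
  qed
qed

lemma ray_poly_decay_ell2:
  fixes c :: "'a::finite \<Rightarrow> complex"
  assumes \<kappa>: "0 < Re \<kappa>"
  shows "(ray_poly c (\<lambda>l. ((decay_root \<kappa>)\<^sup>2) ^ l) :: ('k::finite, 'a) gfun) \<in> ell2"
proof -
  define z where "z = (decay_root \<kappa>)\<^sup>2"
  have z: "norm z < 1" using decay_sq[OF \<kappa>] unfolding z_def by blast
  have "summable (\<lambda>m. (real m + 1) ^ 0 * norm (ray_poly c (\<lambda>l. z ^ l) (Ray \<alpha> m :: ('k, 'a) vertex)))" for \<alpha>
  proof -
    have "summable (\<lambda>m. norm (c \<alpha> * z) * norm z ^ m)" using z by (intro summable_mult summable_geometric) simp
    then show ?thesis by (simp add: norm_mult norm_power mult.assoc)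
  qed
  then have "ray_poly c (\<lambda>l. z ^ l) \<in> (l1w (real 0) :: ('k, 'a) gfun set)" unfolding l1w_Ray_iff by blast
  then show ?thesis unfolding z_def by (rule l1w_ell2)
qed

text \<open>Summation by parts against the two free solutions, the constant and the position; the
  boundary terms at \<open>M\<close> carry slope and constant of the asymptotics.\<close>

lemma sum_H0_ray:
  shows "(\<Sum>m<Suc M. H0 E0 r \<Theta> (Ray \<alpha> m)) = \<Theta> (Ray \<alpha> 0) - (\<Theta> (Ray \<alpha> (Suc M)) - \<Theta> (Ray \<alpha> M))"
    and "(\<Sum>m<Suc M. of_nat (Suc m) * H0 E0 r \<Theta> (Ray \<alpha> m))
      = \<Theta> (Ray \<alpha> M) - of_nat (Suc M) * (\<Theta> (Ray \<alpha> (Suc M)) - \<Theta> (Ray \<alpha> M))"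
proof -
  show "(\<Sum>m<Suc M. H0 E0 r \<Theta> (Ray \<alpha> m)) = \<Theta> (Ray \<alpha> 0) - (\<Theta> (Ray \<alpha> (Suc M)) - \<Theta> (Ray \<alpha> M))"
    by (induction M) (auto simp: algebra_simps)
  show "(\<Sum>m<Suc M. of_nat (Suc m) * H0 E0 r \<Theta> (Ray \<alpha> m))
      = \<Theta> (Ray \<alpha> M) - of_nat (Suc M) * (\<Theta> (Ray \<alpha> (Suc M)) - \<Theta> (Ray \<alpha> M))"
    by (induction M) (auto simp: algebra_simps)
qed

lemma pairing_ray_poly_sums:
  fixes q :: "('k::finite, 'a::finite) gfun"
  assumes q: "\<And>\<alpha>. (\<lambda>m. cnj (f (Suc m)) * q (Ray \<alpha> m)) sums L \<alpha>"
    and s: "(\<lambda>x. norm (cnj (ray_poly (\<lambda>_. 1) f x) * q x)) summable_on UNIV"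
  shows "pairing (ray_poly c f) q = (\<Sum>\<alpha>\<in>UNIV. cnj (c \<alpha>) * L \<alpha>)"
proof -
  have hs: "((\<lambda>m. cnj (f (Suc m)) * q (Ray \<alpha> m)) has_sum L \<alpha>) UNIV" for \<alpha>
  proof -
    have "(\<lambda>m. cnj (f (Suc m)) * q (Ray \<alpha> m)) summable_on UNIV"
      using summable_on_ray[OF abs_summable_summable[OF s], of \<alpha>] by simp
    from has_sum_infsum[OF this] obtain S where S: "((\<lambda>m. cnj (f (Suc m)) * q (Ray \<alpha> m)) has_sum S) UNIV" ..
    from sums_unique2[OF has_sum_imp_sums[OF S] q] S show ?thesis by simp
  qed
  have "((\<lambda>x. cnj (ray_poly c f x) * q x) has_sum ((\<Sum>x\<in>UNIV. cnj (ray_poly c f (Core x)) * q (Core x)) + (\<Sum>\<alpha>\<in>UNIV. cnj (c \<alpha>) * L \<alpha>))) UNIV"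
  proof (rule has_sum_vertex)
    fix \<alpha>
    show "((\<lambda>m. cnj (ray_poly c f (Ray \<alpha> m)) * q (Ray \<alpha> m)) has_sum cnj (c \<alpha>) * L \<alpha>) UNIV"
      using has_sum_cmult_right[OF hs, of "cnj (c \<alpha>)" \<alpha>] by (simp add: mult.assoc)
  qed
  then show ?thesis unfolding pairing_def by (simp add: infsumI)
qed

context schroedinger_kernel
begin

lemma ray_poly_linfw:
  assumes "\<And>l. norm (f l) \<le> A * real l ^ k" "0 \<le> A" "k \<le> s"
  shows "ray_poly c f \<in> (linfw (real s) :: ('k, 'a) gfun set)"
  by (rule linfwI[OF ray_poly_bound[OF assms]])

text \<open>The potential maps functions of growth \<open>b\<close> boundedly into the dual weighted
  space, so convergence of both factors in the growth norm is enough even if the limits are not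
  square-summable.\<close>

lemma pairing_V_limit:
  assumes D: "\<And>t x. 0 < t \<Longrightarrow> t < \<delta> \<Longrightarrow> norm (D t x - D0 x) \<le> A * wt x ^ b * t" "0 \<le> A"
    and W: "\<And>t x. 0 < t \<Longrightarrow> t < \<delta> \<Longrightarrow> norm (W t x - \<Theta> x) \<le> B * wt x ^ b * t" "0 \<le> B"
    and D0: "D0 \<in> linfw (real b)" and \<Theta>: "\<Theta> \<in> linfw (real b)"
  shows "((\<lambda>t. pairing (D t) (V (W t))) \<longlongrightarrow> pairing D0 (V \<Theta>)) (at_right 0)"
proof -
  obtain M where M: "0 \<le> M" "\<And>x. norm (D0 x) \<le> M * wt x ^ b" by (rule linfwE[OF D0]) (rule that)
  obtain N where N: "0 \<le> N" "\<And>x. norm (\<Theta> x) \<le> N * wt x ^ b" by (rule linfwE[OF \<Theta>]) (rule that)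
  show ?thesis
  proof (rule linear_bound_imp_tendsto[OF \<delta>(1)])
    fix t assume t: "0 < t" "t < \<delta>"
    have t1: "t \<le> 1" using t \<delta> by simp
    have Wb: "norm (W t x) \<le> (N + B) * wt x ^ b" for x
    proof -
      have "norm (W t x) \<le> norm (\<Theta> x) + norm (W t x - \<Theta> x)" using norm_triangle_ineq[of "\<Theta> x" "W t x - \<Theta> x"] by simp
      also have "norm (W t x - \<Theta> x) \<le> B * wt x ^ b * 1"
        using W(2) by (intro order_trans[OF W(1)[OF t]] mult_left_mono t1 mult_nonneg_nonneg zero_le_power wt_nonneg)
      finally show ?thesis using N(2)[of x] by (simp add: distrib_right)
    qed
    have Wl: "W t \<in> linfw (real b)" by (rule linfwI[OF Wb])
    have VW: "l1w_norm (real b) (V (W t)) \<le> Cv\<^sup>2 * (N + B)" using V_norm[OF Wb] N W(2) by simp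
    have Vd: "l1w_norm (real b) (V (\<lambda>x. W t x + (- 1) * \<Theta> x)) \<le> Cv\<^sup>2 * (B * t)"
      by (rule V_norm) (use W(1)[OF t] W(2) t in \<open>auto simp: mult_ac\<close>)
    have dl: "(\<lambda>x. W t x + (- 1) * \<Theta> x) \<in> linfw (real b)" by (rule linfw_lin[OF Wl \<Theta>])
    have Db: "norm (D t x - D0 x) \<le> A * t * wt x ^ b" for x using D(1)[OF t, of x] by (simp add: mult_ac)
    have s1: "(\<lambda>x. norm (cnj (D t x - D0 x) * V (W t) x)) summable_on UNIV"
      by (rule l1w_linfw_product(1)[OF Db V_l1w[OF Wl]])
    have s2: "(\<lambda>x. norm (cnj (D0 x) * w x)) summable_on UNIV" if "w \<in> l1w (real b)" for w
      by (rule l1w_linfw_product(1)[OF M(2) that])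
    have "pairing (\<lambda>x. (D t x - D0 x) + 1 * D0 x) (V (W t)) = pairing (\<lambda>x. D t x - D0 x) (V (W t)) + cnj 1 * pairing D0 (V (W t))"
      by (rule pairing_add_left[OF s1 s2[OF V_l1w[OF Wl]]])
    then have e1: "pairing (D t) (V (W t)) = pairing (\<lambda>x. D t x - D0 x) (V (W t)) + pairing D0 (V (W t))" by simp
    have "V (\<lambda>x. W t x + (- 1) * \<Theta> x) = (\<lambda>x. V (W t) x - V \<Theta> x)"
      using V_lin[OF Wl \<Theta>, of "- 1"] by (simp add: fun_eq_iff)
    then have e2: "pairing D0 (V (\<lambda>x. W t x + (- 1) * \<Theta> x)) = pairing D0 (V (W t)) - pairing D0 (V \<Theta>)"
      by (simp only: pairing_diff_right[OF s2[OF V_l1w[OF Wl]] s2[OF V_l1w[OF \<Theta>]]])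
    have "pairing (D t) (V (W t)) - pairing D0 (V \<Theta>)
      = pairing (\<lambda>x. D t x - D0 x) (V (W t)) + pairing D0 (V (\<lambda>x. W t x + (- 1) * \<Theta> x))"
      unfolding e1 e2 by simp
    also have "norm \<dots> \<le> A * t * l1w_norm (real b) (V (W t)) + M * l1w_norm (real b) (V (\<lambda>x. W t x + (- 1) * \<Theta> x))"
      by (rule norm_triangle_mono[OF l1w_linfw_product(2)[OF Db V_l1w[OF Wl]] l1w_linfw_product(2)[OF M(2) V_l1w[OF dl]]])
    also have "\<dots> \<le> A * t * (Cv\<^sup>2 * (N + B)) + M * (Cv\<^sup>2 * (B * t))"
      using D(2) t M(1) by (intro add_mono mult_left_mono VW Vd) auto
    finally show "norm (pairing (D t) (V (W t)) - pairing D0 (V \<Theta>)) \<le> (A * (Cv\<^sup>2 * (N + B)) + M * Cv\<^sup>2 * B) * t"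
      by (simp add: algebra_simps)
  qed
qed

definition zeta :: "('a \<Rightarrow> complex) \<Rightarrow> real \<Rightarrow> ('k, 'a) gfun" where
  "zeta c t = ray_poly c (\<lambda>l. ((decay_root (of_real t))\<^sup>2) ^ l)"

lemma zeta_diff_bound:
  assumes "0 < t"
  shows "norm (zeta c t x - ray_const c x) \<le> (\<Sum>\<alpha>\<in>UNIV. norm (c \<alpha>)) * t * wt x ^ 1"
proof -
  have "zeta c t x - ray_const c x = ray_poly c (\<lambda>l. ((decay_root (of_real t))\<^sup>2) ^ l + (- 1) * 1) x"
    unfolding ray_poly_lin zeta_def ray_const_eq_ray_poly by simp
  also have "norm \<dots> \<le> (\<Sum>\<alpha>\<in>UNIV. norm (c \<alpha>)) * t * wt x ^ 1"
    by (rule ray_poly_bound[where k=1]) (use decay_power_bounds(1)[of "of_real t"] assms in auto)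
  finally show ?thesis .
qed

lemma zeta_ell2: "0 < t \<Longrightarrow> zeta c t \<in> ell2"
  unfolding zeta_def by (rule ray_poly_decay_ell2) simp

lemma ray_const_linfw: "ray_const c \<in> (linfw (real s) :: ('k, 'a) gfun set)"
  unfolding ray_const_eq_ray_poly by (rule ray_poly_linfw[where A=1 and k=0]) auto

text \<open>Here \<open>u0\<close> has no bound part, so \<kappa> times the resolvent has a limit on
  it; \<open>\<Theta>\<close> is this limit and \<open>W t\<close> the approximating family.\<close>

context
  fixes u0 :: "('k, 'a) gfun"
  assumes u0: "u0 \<in> l1w (real (b - 2))" and G0u0: "Gi 0 u0 = (\<lambda>_. 0)" and b5: "5 \<le> b"
begin

abbreviation (input) \<Theta> where "\<Theta> \<equiv> Gi 1 u0"
abbreviation (input) W where "W t \<equiv> (\<lambda>x. of_real t * RR (of_real t) u0 x)"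

lemma u0_ell2: "u0 \<in> ell2" by (rule l1w_ell2[OF u0])

lemma Theta_linfw: "1 \<le> s \<Longrightarrow> \<Theta> \<in> linfw (real s)"
  by (rule linfw_mono[OF Gi_linfw[of 1]]) (use b5 u_l1w[OF u0, of 1] in auto)

lemma W_limit:
  assumes "0 < t" "t < \<delta>"
  shows "norm (W t x - \<Theta> x) \<le> KA u0 * wt x ^ (b - 2) * t" "norm (W t x - \<Theta> x) \<le> KA u0 * wt x ^ b * t"
proof -
  show 1: "norm (W t x - \<Theta> x) \<le> KA u0 * wt x ^ (b - 2) * t"
    using RR_G1[OF half_disc_of_real[OF assms] u0 b5 G0u0, of x] assms by simp
  show "norm (W t x - \<Theta> x) \<le> KA u0 * wt x ^ b * t"
    by (rule order_trans[OF 1 KA_b]) (use assms in simp)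
qed

lemma W_ell2: "0 < t \<Longrightarrow> W t \<in> ell2"
  by (rule ell2_scale(1)[OF RR_ell2[OF _ u0_ell2]]) simp

lemma W_eq:
  assumes "0 < t" "t < \<delta>"
  shows "HH (W t) x + (of_real t)\<^sup>2 * W t x = of_real t * u0 x"
proof -
  note k = half_disc_of_real[OF assms]
  have R: "RR (of_real t) u0 \<in> ell2" by (rule RR_ell2[OF _ u0_ell2]) (use assms in simp)
  have "HH (\<lambda>x. 0 + of_real t * RR (of_real t) u0 x) x = HH (\<lambda>x. 0) x + of_real t * HH (RR (of_real t) u0) x"
    by (rule HH_lin[OF ell2_in_linfw[OF ell2_zero] ell2_in_linfw[OF R]])
  then have "HH (W t) x + (of_real t)\<^sup>2 * W t x = of_real t * (HH (RR (of_real t) u0) x + (of_real t)\<^sup>2 * RR (of_real t) u0 x)"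
    by (simp only: HH_zero) (simp add: algebra_simps)
  then show ?thesis unfolding RR_eq[OF k u0_ell2] .
qed

lemma Theta_gen: "\<Theta> \<in> gen"
proof (rule limit_in_gen[OF \<delta>, where W="W" and c="\<lambda>t. of_real t" and u=u0 and A="KA u0"])
  show "\<And>t. 0 < t \<Longrightarrow> t < \<delta> \<Longrightarrow> W t \<in> linfw (real b)" by (rule ell2_in_linfw[OF W_ell2])
  show "\<Theta> \<in> linfw (real b)" by (rule Theta_linfw) (use b5 in simp)
  show "\<And>t x. 0 < t \<Longrightarrow> t < \<delta> \<Longrightarrow> norm (W t x - \<Theta> x) \<le> KA u0 * wt x ^ b * t" by (rule W_limit(2))
  show "\<And>t x. 0 < t \<Longrightarrow> t < \<delta> \<Longrightarrow> HH (W t) x + (of_real t)\<^sup>2 * W t x = of_real t * u0 x" by (rule W_eq)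
qed (auto intro: KA_nonneg)

lemma pairing_bound_Theta:
  assumes \<Psi>: "\<Psi> \<in> bound"
  shows "pairing \<Psi> \<Theta> = 0"
proof (rule pairing_limit[OF bound_l1w[OF \<Psi>] W_limit(1) W_ell2])
  show "\<Theta> \<in> linfw (real (b - 2))" by (rule Theta_linfw) (use b5 in simp)
  fix t assume t: "0 < t" "t < \<delta>"
  have "pairing \<Psi> u0 = pairing \<Psi> (Gi 0 u0)" by (rule pairing_G0[OF \<Psi> u0, symmetric])
  also have "\<dots> = 0" by (simp add: G0u0 pairing_def)
  finally have "(of_real t)\<^sup>2 * pairing \<Psi> (RR (of_real t) u0) = 0"
    using pairing_bound_RR[OF \<Psi> half_disc_of_real[OF t] u0_ell2] by simp
  then show "pairing \<Psi> (W t) = 0" unfolding pairing_scale_right using t by simp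
qed

lemma Theta_l1: "V \<Theta> \<in> l1w (real b)"
  by (rule V_l1w[OF genD(1)[OF Theta_gen]])

text \<open>On each half-line the potential term equals minus the free operator applied to
  \<open>\<Theta>\<close>, so the pairing is a limit of sums that \<open>sum_H0_ray\<close>
  evaluates.\<close>

lemma pairing_ray_Theta:
  assumes k: "k \<le> b" and f: "\<And>l. norm (f l) \<le> real l ^ k"
    and L: "\<And>\<alpha>. (\<lambda>M. \<Sum>m<Suc M. cnj (f (Suc m)) * H0 E0 r \<Theta> (Ray \<alpha> m)) \<longlonglongrightarrow> L \<alpha>"
  shows "pairing (ray_poly c f) (V \<Theta>) = - (\<Sum>\<alpha>\<in>UNIV. cnj (c \<alpha>) * L \<alpha>)"
proof -
  have "pairing (ray_poly c f) (V \<Theta>) = (\<Sum>\<alpha>\<in>UNIV. cnj (c \<alpha>) * - L \<alpha>)"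
  proof (rule pairing_ray_poly_sums)
    fix \<alpha>
    have "(\<lambda>M. - (\<Sum>m<Suc M. cnj (f (Suc m)) * H0 E0 r \<Theta> (Ray \<alpha> m))) \<longlonglongrightarrow> - L \<alpha>" by (rule tendsto_minus[OF L])
    then have "(\<lambda>M. \<Sum>m<Suc M. cnj (f (Suc m)) * V \<Theta> (Ray \<alpha> m)) \<longlonglongrightarrow> - L \<alpha>"
      by (simp only: H0_gen[OF Theta_gen] mult_minus_right sum_negf minus_minus)
    then show "(\<lambda>m. cnj (f (Suc m)) * V \<Theta> (Ray \<alpha> m)) sums - L \<alpha>"
      unfolding sums_def by (rule LIMSEQ_imp_Suc)
  next
    show "(\<lambda>x. norm (cnj (ray_poly (\<lambda>_. 1) f x) * V \<Theta> x)) summable_on UNIV"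
      by (rule l1w_linfw_product(1)[OF ray_poly_bound[where A=1 and k=k and s=b] Theta_l1]) (use k f in auto)
  qed
  then show ?thesis by (simp add: sum_negf)
qed

text \<open>The sum of \<open>V \<Theta>\<close> over the half-line is computed twice. Testing the
  equation with the decaying function gives minus the first value of \<open>\<Theta>\<close>;
  summation by parts gives the same plus the slope. So the slope is 0.\<close>

lemma Theta_slope: "(\<lambda>m. \<Theta> (Ray \<alpha> (Suc m)) - \<Theta> (Ray \<alpha> m)) \<longlonglongrightarrow> 0"
proof -
  obtain a c' where s: "\<And>\<alpha>. summable (\<lambda>m. (real m + 1) ^ (b - 2) * norm (\<Theta> (Ray \<alpha> m) - (a \<alpha> * of_nat (Suc m) + c' \<alpha>)))"
    by (rule gen_asymptotics[OF Theta_gen]) (rule that)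
  note df = gen_differences[OF s]
  define c :: "'a \<Rightarrow> complex" where "c \<alpha>' = (if \<alpha>' = \<alpha> then 1 else 0)" for \<alpha>'
  have sumc: "(\<Sum>\<alpha>'\<in>UNIV. cnj (c \<alpha>') * L \<alpha>') = L \<alpha>" for L
  proof -
    have "(\<Sum>\<alpha>'\<in>UNIV. cnj (c \<alpha>') * L \<alpha>') = (\<Sum>\<alpha>'\<in>UNIV. if \<alpha>' = \<alpha> then L \<alpha>' else 0)"
      by (rule sum.cong) (auto simp: c_def)
    then show ?thesis by simp
  qed
  \<comment> \<open>A constant on one half-line violates the free equation only at the first vertex,
    whose missing neighbour would have to carry the value 1.\<close>
  have H0c: "H0 E0 r (ray_const c) = delta (Ray \<alpha> 0)"
  proof
    fix x
    show "H0 E0 r (ray_const c) x = delta (Ray \<alpha> 0) x"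
    proof (cases x)
      case (Ray \<beta> m) then show ?thesis by (cases m) (auto simp: delta_def c_def)
    qed (auto simp: delta_def)
  qed
  \<comment> \<open>The defect of the decaying function is a unit mass at the first vertex, so the
    free part contributes only the value of \<open>W t\<close> there.\<close>
  have key: "pairing (zeta c t) (V (W t)) = of_real t * pairing (zeta c t) u0 - W t (Ray \<alpha> 0)" if t: "0 < t" "t < \<delta>" for t
  proof -
    define w where "w = W t"
    define y where "y = zeta c t"
    have y2: "y \<in> ell2" unfolding y_def by (rule zeta_ell2[OF t(1)])
    have w2: "w \<in> ell2" unfolding w_def by (rule W_ell2[OF t(1)])
    have eq: "H0 E0 r w x + V w x + (of_real t)\<^sup>2 * w x = of_real t * u0 x" for x
      using W_eq[OF t, of x] unfolding w_def HH_def .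
    have "V w = (\<lambda>x. of_real t * u0 x - (H0 E0 r w x + (of_real t)\<^sup>2 * w x))"
      using eq by (auto simp: fun_eq_iff eq_diff_eq algebra_simps)
    then have "pairing y (V w) = pairing y (\<lambda>x. of_real t * u0 x - (H0 E0 r w x + (of_real t)\<^sup>2 * w x))" by simp
    also have "\<dots> = pairing y (\<lambda>x. of_real t * u0 x) - pairing y (\<lambda>x. H0 E0 r w x + (of_real t)\<^sup>2 * w x)"
      by (rule pairing_diff_right[OF ell2_pairing_summable[OF y2 ell2_scale(1)[OF u0_ell2]]
            ell2_pairing_summable[OF y2 ell2_add(1)[OF H0_ell2[OF w2] ell2_scale(1)[OF w2]]]])
    also have "pairing y (\<lambda>x. H0 E0 r w x + (of_real t)\<^sup>2 * w x) = pairing y (H0 E0 r w) + (of_real t)\<^sup>2 * pairing y w"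
      using pairing_add_right[OF ell2_pairing_summable[OF y2 H0_ell2[OF w2]] ell2_pairing_summable[OF y2 ell2_scale(1)[OF w2]]]
      by (simp only: pairing_scale_right)
    also have "\<dots> = pairing (H0 E0 r y) w + cnj ((of_real t)\<^sup>2) * pairing y w"
      by (simp add: H0_symmetric[OF y2 w2])
    also have "\<dots> = pairing (\<lambda>x. H0 E0 r y x + (of_real t)\<^sup>2 * y x) w"
      by (rule pairing_add_left[OF ell2_pairing_summable[OF H0_ell2[OF y2] w2] ell2_pairing_summable[OF y2 w2], symmetric])
    also have "(\<lambda>x. H0 E0 r y x + (of_real t)\<^sup>2 * y x) = delta (Ray \<alpha> 0)"
      unfolding y_def zeta_def H0c[symmetric] by (rule ext, rule H0_ray_poly_decay) (use t in simp)
    finally show ?thesis unfolding y_def w_def pairing_scale_right pairing_delta_left .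
  qed
  have 1: "((\<lambda>t. pairing (zeta c t) (V (W t))) \<longlongrightarrow> pairing (ray_const c) (V \<Theta>)) (at_right 0)"
  proof (rule pairing_V_limit)
    fix t and x :: "('k, 'a) vertex" assume t: "0 < t" "t < \<delta>"
    have "(\<Sum>\<alpha>\<in>UNIV. norm (c \<alpha>)) * t * wt x ^ 1 \<le> (\<Sum>\<alpha>\<in>UNIV. norm (c \<alpha>)) * t * wt x ^ b"
      using t b4 by (intro mult_left_mono wt_power_mono mult_nonneg_nonneg sum_nonneg) auto
    then show "norm (zeta c t x - ray_const c x) \<le> (\<Sum>\<alpha>\<in>UNIV. norm (c \<alpha>)) * wt x ^ b * t"
      using zeta_diff_bound[OF t(1), of c x] by (simp add: mult_ac)
  next
    show "\<And>t x. 0 < t \<Longrightarrow> t < \<delta> \<Longrightarrow> norm (W t x - \<Theta> x) \<le> KA u0 * wt x ^ b * t" by (rule W_limit(2))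
    show "\<Theta> \<in> linfw (real b)" by (rule genD(1)[OF Theta_gen])
    show "(ray_const c :: ('k, 'a) gfun) \<in> linfw (real b)" by (rule ray_const_linfw)
  qed (auto intro: sum_nonneg KA_nonneg)
  have 2: "((\<lambda>t. of_real t * pairing (zeta c t) u0) \<longlongrightarrow> 0) (at_right 0)"
  proof (rule linear_bound_imp_tendsto[OF \<delta>(1)])
    fix t assume t: "0 < t" "t < \<delta>"
    have "norm (((decay_root (of_real t))\<^sup>2) ^ l) \<le> 1 * real l ^ 0" for l
      using decay_root(2)[of "of_real t"] t by (simp add: norm_power power_le_one)
    then have "norm (zeta c t x) \<le> (\<Sum>\<alpha>\<in>UNIV. norm (c \<alpha>)) * 1 * wt x ^ 0" for x
      unfolding zeta_def by (rule ray_poly_bound) auto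
    then have "norm (pairing (zeta c t) u0) \<le> (\<Sum>\<alpha>\<in>UNIV. norm (c \<alpha>)) * 1 * l1w_norm (real 0) u0"
      by (rule l1w_linfw_product(2)) (rule l1w_mono[OF u0], simp)
    then show "norm (of_real t * pairing (zeta c t) u0 - 0) \<le> (\<Sum>\<alpha>\<in>UNIV. norm (c \<alpha>)) * 1 * l1w_norm (real 0) u0 * t"
      using t by (simp add: norm_mult mult.commute mult_left_mono)
  qed
  have 3: "((\<lambda>t. W t (Ray \<alpha> 0)) \<longlongrightarrow> \<Theta> (Ray \<alpha> 0)) (at_right 0)"
    by (rule linear_bound_imp_tendsto[OF \<delta>(1)]) (rule W_limit(1))
  have "((\<lambda>t. pairing (zeta c t) (V (W t))) \<longlongrightarrow> 0 - \<Theta> (Ray \<alpha> 0)) (at_right 0)"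
  proof (rule Lim_transform_eventually[OF tendsto_diff[OF 2 3]])
    show "\<forall>\<^sub>F t in at_right 0. of_real t * pairing (zeta c t) u0 - W t (Ray \<alpha> 0) = pairing (zeta c t) (V (W t))"
      using eventually_at_right_real[OF \<delta>(1)] by eventually_elim (rule key[symmetric], auto)
  qed
  from tendsto_unique[OF _ 1 this] have p1: "pairing (ray_const c) (V \<Theta>) = - \<Theta> (Ray \<alpha> 0)" by simp
  have "pairing (ray_poly c (\<lambda>_. 1)) (V \<Theta>) = - (\<Sum>\<alpha>'\<in>UNIV. cnj (c \<alpha>') * (\<Theta> (Ray \<alpha>' 0) - a \<alpha>'))"
  proof (rule pairing_ray_Theta[where k=0])
    show "(\<lambda>M. \<Sum>m<Suc M. cnj 1 * H0 E0 r \<Theta> (Ray \<alpha>' m)) \<longlonglongrightarrow> \<Theta> (Ray \<alpha>' 0) - a \<alpha>'" for \<alpha>'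
      unfolding complex_cnj_one mult_1_left sum_H0_ray(1) by (intro tendsto_intros df)
  qed auto
  then have "a \<alpha> = 0" using p1 unfolding sumc ray_const_eq_ray_poly by simp
  then show ?thesis using df[of \<alpha>] by simp
qed

text \<open>A resonance need not be square-summable, so its constant part is replaced by the
  decaying function before the pairing is transferred to the resolvent. In the limit only the
  \<kappa>-derivative of that function, minus the position, is paired with
  \<open>V \<Theta>\<close>, and summation by parts reads off the constants of
  \<open>\<Theta>\<close>.\<close>

lemma pairing_res_Theta:
  assumes \<Phi>: "\<Phi> \<in> gen" and \<phi>: "(\<lambda>x. \<Phi> x - ray_const c x) \<in> l1w (real (b - 2))"
    and c': "(\<lambda>x. \<Theta> x - ray_const c' x) \<in> l1w (real (b - 2))"
  shows "pairing \<Phi> u0 = (\<Sum>\<alpha>\<in>UNIV. cnj (c \<alpha>) * c' \<alpha>)"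
proof -
  define \<phi> where "\<phi> = (\<lambda>x. \<Phi> x - ray_const c x)"
  note \<phi> = \<phi>[folded \<phi>_def]
  \<comment> \<open>The difference quotient in \<kappa> of the decaying function; its limit is minus
    the position.\<close>
  define D where "D t = (ray_poly c (\<lambda>l. (((decay_root (of_real t))\<^sup>2) ^ l - 1) / of_real t) :: ('k, 'a) gfun)" for t
  define N where "N = (ray_poly c (\<lambda>l. - of_nat l) :: ('k, 'a) gfun)"
  let ?c = "\<Sum>\<alpha>\<in>UNIV. norm (c \<alpha>)"
  have c0: "0 \<le> ?c" by (simp add: sum_nonneg)
  have ND: "norm (D t x - N x) \<le> ?c * wt x ^ b * t" if t: "0 < t" for t x
  proof -
    have "D t x - N x = D t x + (- 1) * N x" by simp
    also have "\<dots> = ray_poly c (\<lambda>l. (((decay_root (of_real t))\<^sup>2) ^ l - 1) / of_real t + (- 1) * (- of_nat l)) x"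
      unfolding D_def N_def ray_poly_lin ..
    also have "norm \<dots> \<le> ?c * t * wt x ^ b"
      by (rule ray_poly_bound[where k=2]) (use decay_power_bounds(2)[of "of_real t"] t b4 in auto)
    finally show ?thesis by (simp add: mult_ac)
  qed
  have Nl: "N \<in> linfw (real b)"
    unfolding N_def by (rule ray_poly_linfw[where A=1 and k=1]) (use b4 in auto)
  have zD: "zeta c t x = ray_const c x + of_real t * D t x" if "t \<noteq> 0" for t x
    unfolding zeta_def D_def ray_const_eq_ray_poly ray_poly_lin[symmetric] using that by simp
  have Dl: "D t \<in> linfw (real b)" if t: "0 < t" for t
  proof -
    have "(\<lambda>x. D t x + - 1 * N x) \<in> linfw (real b)"
      by (rule linfwI[of _ "?c * t"]) (use ND[OF t] in \<open>simp add: mult_ac\<close>)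
    from linfw_lin[OF this Nl, of 1] show ?thesis by simp
  qed
  have key: "pairing \<Phi> u0 + pairing (\<lambda>x. zeta c t x - ray_const c x) u0
    = pairing (D t) (V (W t)) + of_real t * pairing \<phi> (W t)" if t: "0 < t" "t < \<delta>" for t
  proof -
    note k = half_disc_of_real[OF t]
    define R where "R = RR (of_real t) u0"
    have R2: "R \<in> ell2" unfolding R_def by (rule RR_ell2[OF _ u0_ell2]) (use t in simp)
    have Rl: "R \<in> linfw (real b)" by (rule ell2_in_linfw[OF R2])
    define y where "y = (\<lambda>x. zeta c t x + \<phi> x)"
    have y2: "y \<in> ell2" unfolding y_def by (rule ell2_add(1)[OF zeta_ell2[OF t(1)] l1w_ell2[OF \<phi>]])
    have yD: "y = (\<lambda>x. \<Phi> x + of_real t * D t x)" using zD t by (simp add: y_def \<phi>_def fun_eq_iff)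
    define f where "f = (\<lambda>x. of_real t * (V (D t) x + of_real t * \<phi> x))"
    have V2: "V (D t) \<in> ell2" by (rule l1w_ell2[OF V_l1w[OF Dl[OF t(1)]]])
    have f2: "f \<in> ell2" unfolding f_def by (intro ell2_scale(1) ell2_add(1) V2 l1w_ell2[OF \<phi>])
    have eq: "HH y x + (cnj (of_real t))\<^sup>2 * y x = f x" for x
    proof -
      have H: "HH y x = of_real t * HH (D t) x"
        unfolding yD HH_lin[OF genD(1)[OF \<Phi>] Dl[OF t(1)]] by (simp add: genD(2)[OF \<Phi>])
      have "H0 E0 r (zeta c t) x + (of_real t)\<^sup>2 * zeta c t x = H0 E0 r (ray_const c) x"
        unfolding zeta_def by (rule H0_ray_poly_decay) (use t in simp)
      moreover have "H0 E0 r (zeta c t) x = H0 E0 r (ray_const c) x + of_real t * H0 E0 r (D t) x"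
      proof -
        have "zeta c t = (\<lambda>x. ray_const c x + of_real t * D t x)" using zD[of t] t(1) by (intro ext) simp
        then show ?thesis by (simp only: H0_lin)
      qed
      \<comment> \<open>The defect of the decaying function does not depend on t, so the free terms
        cancel and the right side \<open>f\<close> is of order t.\<close>
      ultimately have 0: "of_real t * H0 E0 r (D t) x + (of_real t)\<^sup>2 * zeta c t x = 0" by simp
      have Hd: "HH (D t) x = H0 E0 r (D t) x + V (D t) x" by (simp add: HH_def)
      have yx: "y x = zeta c t x + \<phi> x" by (simp add: y_def)
      have "HH y x + (of_real t)\<^sup>2 * y x = (of_real t * H0 E0 r (D t) x + (of_real t)\<^sup>2 * zeta c t x) + f x"
        unfolding H Hd yx f_def by (simp add: algebra_simps power2_eq_square)
      then show ?thesis unfolding 0 by simp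
    qed
    have s: "(\<lambda>x. norm (cnj (w x) * u0 x)) summable_on UNIV" if w: "w \<in> linfw (real (b - 2))" for w
    proof -
      obtain B where B: "0 \<le> B" "\<And>x. norm (w x) \<le> B * wt x ^ (b - 2)" by (rule linfwE[OF w]) (rule that)
      show ?thesis by (rule l1w_linfw_product(1)[OF B(2) u0])
    qed
    have cl: "ray_const c \<in> (linfw (real (b - 2)) :: ('k, 'a) gfun set)" by (rule ray_const_linfw)
    have "(\<lambda>x. \<phi> x + 1 * ray_const c x) \<in> linfw (real (b - 2))"
      by (rule linfw_lin[OF ell2_in_linfw[OF l1w_ell2[OF \<phi>]] cl])
    then have \<Phi>l: "\<Phi> \<in> linfw (real (b - 2))" by (simp add: \<phi>_def)
    have zl: "(\<lambda>x. zeta c t x + (- 1) * ray_const c x) \<in> linfw (real (b - 2))"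
      by (rule linfw_lin[OF ell2_in_linfw[OF zeta_ell2[OF t(1)]] cl])
    have "pairing (\<lambda>x. \<Phi> x + 1 * (zeta c t x - ray_const c x)) u0 = pairing \<Phi> u0 + cnj 1 * pairing (\<lambda>x. zeta c t x - ray_const c x) u0"
      by (rule pairing_add_left[OF s[OF \<Phi>l] s]) (use zl in simp)
    moreover have "(\<lambda>x. \<Phi> x + 1 * (zeta c t x - ray_const c x)) = y" by (simp add: y_def \<phi>_def fun_eq_iff)
    ultimately have "pairing \<Phi> u0 + pairing (\<lambda>x. zeta c t x - ray_const c x) u0 = pairing y u0" by simp
    also have "\<dots> = pairing f R" unfolding R_def by (rule RR_pairing[OF k f2 u0_ell2 y2 eq])
    also have "\<dots> = of_real t * pairing (\<lambda>x. V (D t) x + of_real t * \<phi> x) R"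
      unfolding f_def pairing_scale_left by simp
    also have "pairing (\<lambda>x. V (D t) x + of_real t * \<phi> x) R = pairing (V (D t)) R + cnj (of_real t) * pairing \<phi> R"
      by (rule pairing_add_left[OF ell2_pairing_summable[OF V2 R2] ell2_pairing_summable[OF l1w_ell2[OF \<phi>] R2]])
    also have "pairing (V (D t)) R = pairing (D t) (V R)" by (rule V_symmetric[OF Dl[OF t(1)] Rl, symmetric])
    also have "of_real t * (pairing (D t) (V R) + cnj (of_real t) * pairing \<phi> R)
      = pairing (D t) (\<lambda>x. of_real t * V R x) + of_real t * pairing \<phi> (\<lambda>x. of_real t * R x)"
      unfolding pairing_scale_right by (simp add: algebra_simps)
    also have "(\<lambda>x. of_real t * V R x) = V (\<lambda>x. of_real t * R x)"
    proof
      fix x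
      have z: "(\<lambda>_. 0) \<in> linfw (real b)" by (rule ell2_in_linfw[OF ell2_zero])
      have "V (\<lambda>_. 0) x = 0" using V_lin[OF z z, of "- 1" x] by simp
      then show "of_real t * V R x = V (\<lambda>x. of_real t * R x) x"
        using V_lin[OF z Rl, of "of_real t" x] by simp
    qed
    finally show ?thesis unfolding R_def .
  qed
  have 1: "((\<lambda>t. pairing (D t) (V (W t))) \<longlongrightarrow> pairing N (V \<Theta>)) (at_right 0)"
    by (rule pairing_V_limit[OF ND c0 W_limit(2) KA_nonneg Nl genD(1)[OF Theta_gen]])
  have 2: "((\<lambda>t. of_real t * pairing \<phi> (W t)) \<longlongrightarrow> 0) (at_right 0)"
  proof -
    have "\<Theta> \<in> linfw (real (b - 2))" by (rule Theta_linfw) (use b5 in simp)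
    then obtain M where M: "0 \<le> M" "\<And>x. norm (\<Theta> x) \<le> M * wt x ^ (b - 2)" by (rule linfwE) (rule that)
    show ?thesis
    proof (rule linear_bound_imp_tendsto[OF \<delta>(1)])
      fix t assume t: "0 < t" "t < \<delta>"
      have t1: "t \<le> 1" using t \<delta> by simp
      have "norm (W t x) \<le> (M + KA u0) * wt x ^ (b - 2)" for x
      proof -
        have "norm (W t x) \<le> norm (\<Theta> x) + norm (W t x - \<Theta> x)" using norm_triangle_ineq[of "\<Theta> x" "W t x - \<Theta> x"] by simp
        also have "norm (W t x - \<Theta> x) \<le> KA u0 * wt x ^ (b - 2) * 1"
          by (intro order_trans[OF W_limit(1)[OF t]] mult_left_mono t1 mult_nonneg_nonneg zero_le_power wt_nonneg KA_nonneg)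
        finally show ?thesis using M(2)[of x] by (simp add: distrib_right)
      qed
      then have "norm (pairing (W t) \<phi>) \<le> (M + KA u0) * l1w_norm (real (b - 2)) \<phi>"
        by (rule l1w_linfw_product(2)) (rule \<phi>)
      moreover have "norm (pairing \<phi> (W t)) = norm (pairing (W t) \<phi>)" by (subst pairing_cnj) simp
      ultimately show "norm (of_real t * pairing \<phi> (W t) - 0) \<le> (M + KA u0) * l1w_norm (real (b - 2)) \<phi> * t"
        using t by (simp add: norm_mult mult.commute mult_left_mono)
    qed
  qed
  have 3: "((\<lambda>t. pairing (\<lambda>x. zeta c t x - ray_const c x) u0) \<longlongrightarrow> 0) (at_right 0)"
  proof (rule linear_bound_imp_tendsto[OF \<delta>(1)])
    fix t assume t: "0 < t" "t < \<delta>"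
    have "norm (pairing (\<lambda>x. zeta c t x - ray_const c x) u0) \<le> ?c * t * l1w_norm (real 1) u0"
      by (rule l1w_linfw_product(2)[OF zeta_diff_bound[OF t(1)]]) (rule l1w_mono[OF u0], use b4 in simp)
    then show "norm (pairing (\<lambda>x. zeta c t x - ray_const c x) u0 - 0) \<le> ?c * l1w_norm (real 1) u0 * t"
      by (simp add: mult_ac)
  qed
  have "((\<lambda>t. pairing (D t) (V (W t)) + of_real t * pairing \<phi> (W t)) \<longlongrightarrow> pairing \<Phi> u0 + 0) (at_right 0)"
  proof (rule Lim_transform_eventually[OF tendsto_add[OF tendsto_const 3]])
    show "\<forall>\<^sub>F t in at_right 0. pairing \<Phi> u0 + pairing (\<lambda>x. zeta c t x - ray_const c x) u0
      = pairing (D t) (V (W t)) + of_real t * pairing \<phi> (W t)"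
      using eventually_at_right_real[OF \<delta>(1)] by eventually_elim (rule key, auto)
  qed
  from tendsto_unique[OF _ this tendsto_add[OF 1 2]] have "pairing \<Phi> u0 = pairing N (V \<Theta>)" by simp
  also have "\<dots> = - (\<Sum>\<alpha>\<in>UNIV. cnj (c \<alpha>) * - c' \<alpha>)"
    unfolding N_def
  proof (rule pairing_ray_Theta[where k=1])
    fix \<alpha>
    have s: "summable (\<lambda>m. (real m + 1) ^ (b - 2) * norm (\<Theta> (Ray \<alpha> m) - c' \<alpha>))"
      using c' unfolding l1w_Ray_iff by simp
    define \<theta> where "\<theta> m = \<Theta> (Ray \<alpha> m) - c' \<alpha>" for m
    have l0: "\<theta> \<longlonglongrightarrow> 0" using summable_weighted_imp_LIMSEQ[OF s, of 0] by (simp add: \<theta>_def[abs_def])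
    have l1: "(\<lambda>m. of_nat (Suc m) * \<theta> m) \<longlonglongrightarrow> 0"
      using summable_weighted_imp_LIMSEQ[OF s, of 1] b4 by (simp add: \<theta>_def[abs_def])
    \<comment> \<open>The boundary term is rewritten through the decaying part \<theta>, whose
      product with the position still tends to 0 because the weight b - 2 is at least 1.\<close>
    have "(\<lambda>M. - (\<theta> M + c' \<alpha> - (of_nat (Suc (Suc M)) * \<theta> (Suc M) - \<theta> (Suc M) - of_nat (Suc M) * \<theta> M))) \<longlonglongrightarrow> - (0 + c' \<alpha> - (0 - 0 - 0))"
      by (intro tendsto_intros l0 l1 LIMSEQ_Suc[OF l0] LIMSEQ_Suc[OF l1])
    moreover have "(\<Sum>m<Suc M. cnj (- of_nat (Suc m)) * H0 E0 r \<Theta> (Ray \<alpha> m))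
      = - (\<theta> M + c' \<alpha> - (of_nat (Suc (Suc M)) * \<theta> (Suc M) - \<theta> (Suc M) - of_nat (Suc M) * \<theta> M))" for M
    proof -
      have "(\<Sum>m<Suc M. cnj (- of_nat (Suc m)) * H0 E0 r \<Theta> (Ray \<alpha> m)) = - (\<Sum>m<Suc M. of_nat (Suc m) * H0 E0 r \<Theta> (Ray \<alpha> m))"
        by (simp only: complex_cnj_minus complex_cnj_of_nat mult_minus_left sum_negf)
      then show ?thesis unfolding sum_H0_ray(2) \<theta>_def by (simp add: algebra_simps)
    qed
    ultimately show "(\<lambda>M. \<Sum>m<Suc M. cnj (- of_nat (Suc m)) * H0 E0 r \<Theta> (Ray \<alpha> m)) \<longlonglongrightarrow> - c' \<alpha>" by simp
  qed (use b4 in auto)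
  finally show ?thesis by (simp add: sum_negf)
qed

end

text \<open>Removing the bound part does not change \<open>Gi 1 u\<close>, and it makes the leading
  coefficient vanish since \<open>Gi 0\<close> is idempotent. The analysis of \<kappa> times the
  resolvent then applies.\<close>

lemma G1_in_res:
  assumes "5 \<le> b" "u \<in> l1w (real (b - 2))"
  obtains c where "Gi 1 u \<in> gen" "(\<lambda>x. Gi 1 u x - ray_const c x) \<in> l1w (real (b - 2))"
    "\<And>\<Psi>. \<Psi> \<in> bound \<Longrightarrow> pairing \<Psi> (Gi 1 u) = 0"
    "\<And>\<Phi> c'. \<Phi> \<in> gen \<Longrightarrow> (\<lambda>x. \<Phi> x - ray_const c' x) \<in> l1w (real (b - 2)) \<Longrightarrow>
       pairing \<Phi> (\<lambda>x. u x - Gi 0 u x) = (\<Sum>\<alpha>\<in>UNIV. cnj (c' \<alpha>) * c \<alpha>)"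
proof -
  define u0 where "u0 = (\<lambda>x. u x + (- 1) * Gi 0 u x)"
  note b5 = assms(1) and u = assms(2)
  have B: "Gi 0 u \<in> bound" by (rule G0_in_bound[OF u])
  note Bl = bound_l1w[OF B]
  have u0: "u0 \<in> l1w (real (b - 2))" unfolding u0_def by (intro l1w_add u l1w_scale Bl)
  have "Gi 0 u0 x = Gi 0 u x + (- 1) * Gi 0 (Gi 0 u) x" for x
    unfolding u0_def by (rule Gi_lin) (use b5 u_l1w[OF u, of 0] u_l1w[OF Bl, of 0] in auto)
  then have 0: "Gi 0 u0 = (\<lambda>_. 0)" by (simp add: G0_bound[OF B] fun_eq_iff)
  have "Gi 1 u0 x = Gi 1 u x + (- 1) * Gi 1 (Gi 0 u) x" for x
    unfolding u0_def by (rule Gi_lin) (use b5 u_l1w[OF u, of 1] u_l1w[OF Bl, of 1] in auto)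
  then have 1: "Gi 1 u0 = Gi 1 u" by (simp add: G1_bound[OF B b5] fun_eq_iff del: One_nat_def)
  note h = u0 0 b5
  obtain c where c: "(\<lambda>x. Gi 1 u0 x - ray_const c x) \<in> l1w (real (b - 2))"
    by (rule gen_slope_zero_res[OF Theta_gen[OF h] Theta_slope[OF h]]) (rule that)
  show thesis
  proof (rule that[of c])
    show "Gi 1 u \<in> gen" using Theta_gen[OF h] unfolding 1 .
    show "(\<lambda>x. Gi 1 u x - ray_const c x) \<in> l1w (real (b - 2))" using c unfolding 1 .
    show "pairing \<Psi> (Gi 1 u) = 0" if "\<Psi> \<in> bound" for \<Psi> using pairing_bound_Theta[OF h that] unfolding 1 .
    show "pairing \<Phi> (\<lambda>x. u x - Gi 0 u x) = (\<Sum>\<alpha>\<in>UNIV. cnj (c' \<alpha>) * c \<alpha>)"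
      if "\<Phi> \<in> gen" "(\<lambda>x. \<Phi> x - ray_const c' x) \<in> l1w (real (b - 2))" for \<Phi> c'
      using pairing_res_Theta[OF h that c] by (simp add: u0_def)
  qed
qed

end

section \<open>Orthonormal bases and projections\<close>

lemma sum_cscale: "(\<Sum>e\<in>B. cscale (a e) (f e)) = (\<lambda>x. \<Sum>e\<in>B. a e * f e x)"
  by (induction B rule: infinite_finite_induct) (auto simp: cscale_def fun_eq_iff)

lemma linear_on_sum:
  fixes X :: "('g \<Rightarrow> complex) set"
  assumes X0: "(\<lambda>_. 0) \<in> X" and Xlin: "\<And>u w c. u \<in> X \<Longrightarrow> w \<in> X \<Longrightarrow> (\<lambda>x. u x + c * w x) \<in> X"
    and B: "finite B" "B \<subseteq> X"
  shows "(\<lambda>x. \<Sum>e\<in>B. a e * e x) \<in> X"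
    and "(\<And>u w c. u \<in> X \<Longrightarrow> w \<in> X \<Longrightarrow> J (\<lambda>x. u x + c * w x) = J u + c * J w) \<Longrightarrow>
      J (\<lambda>x. \<Sum>e\<in>B. a e * e x) = (\<Sum>e\<in>B. a e * (J e :: complex))"
proof -
  have "(\<lambda>x. \<Sum>e\<in>B. a e * e x) \<in> X \<and>
    ((\<forall>u\<in>X. \<forall>w\<in>X. \<forall>c. J (\<lambda>x. u x + c * w x) = J u + c * J w) \<longrightarrow>
      J (\<lambda>x. \<Sum>e\<in>B. a e * e x) = (\<Sum>e\<in>B. a e * J e))"
    using B
  proof (induction B)
    case empty
    have "J (\<lambda>_. 0) = 0" if J: "\<forall>u\<in>X. \<forall>w\<in>X. \<forall>c. J (\<lambda>x. u x + c * w x) = J u + c * J w"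
      using J[rule_format, OF X0 X0, of "- 1"] by simp
    then show ?case using X0 by simp
  next
    case (insert e B)
    have e: "e \<in> X" using insert.prems by simp
    have IH: "(\<lambda>x. \<Sum>e\<in>B. a e * e x) \<in> X"
      "(\<forall>u\<in>X. \<forall>w\<in>X. \<forall>c. J (\<lambda>x. u x + c * w x) = J u + c * J w) \<Longrightarrow>
      J (\<lambda>x. \<Sum>e\<in>B. a e * e x) = (\<Sum>e\<in>B. a e * J e)"
      using insert by auto
    have eq: "(\<lambda>x. \<Sum>e\<in>insert e B. a e * e x) = (\<lambda>x. (\<Sum>e\<in>B. a e * e x) + a e * e x)"
      using insert.hyps by (simp add: add.commute)
    show ?case unfolding eq
    proof (intro conjI impI)
      show "(\<lambda>x. (\<Sum>e\<in>B. a e * e x) + a e * e x) \<in> X" by (rule Xlin[OF IH(1) e])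
      assume J: "\<forall>u\<in>X. \<forall>w\<in>X. \<forall>c. J (\<lambda>x. u x + c * w x) = J u + c * J w"
      show "J (\<lambda>x. (\<Sum>e\<in>B. a e * e x) + a e * e x) = (\<Sum>e\<in>insert e B. a e * J e)"
        unfolding J[rule_format, OF IH(1) e] IH(2)[OF J] sum.insert[OF insert.hyps] by (rule add.commute)
    qed
  qed
  then show "(\<lambda>x. \<Sum>e\<in>B. a e * e x) \<in> X"
    and "(\<And>u w c. u \<in> X \<Longrightarrow> w \<in> X \<Longrightarrow> J (\<lambda>x. u x + c * w x) = J u + c * J w) \<Longrightarrow>
      J (\<lambda>x. \<Sum>e\<in>B. a e * e x) = (\<Sum>e\<in>B. a e * J e)"
    by blast+
qed

text \<open>Gram-Schmidt driven by functionals instead of a dimension count: passing to the kernel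
  of one functional uses it up, and at most one vector has to be added back. It serves bound states,
  separated by their values on the removed vertices, and resonances, separated by their constants at
  infinity.\<close>

lemma orthonormal_basis_exists:
  fixes X :: "('g \<Rightarrow> complex) set" and q :: "('g \<Rightarrow> complex) \<Rightarrow> ('g \<Rightarrow> complex) \<Rightarrow> complex"
  assumes "finite I"
    and "(\<lambda>_. 0) \<in> X" "\<And>u w c. u \<in> X \<Longrightarrow> w \<in> X \<Longrightarrow> (\<lambda>x. u x + c * w x) \<in> X"
    and "\<And>u w w' c. u \<in> X \<Longrightarrow> w \<in> X \<Longrightarrow> w' \<in> X \<Longrightarrow> q u (\<lambda>x. w x + c * w' x) = q u w + c * q u w'"
    and "\<And>u w. u \<in> X \<Longrightarrow> w \<in> X \<Longrightarrow> q w u = cnj (q u w)"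
    and "\<And>u. u \<in> X \<Longrightarrow> u \<noteq> (\<lambda>_. 0) \<Longrightarrow> \<exists>a>0. q u u = of_real a"
    and "\<And>i u w c. i \<in> I \<Longrightarrow> u \<in> X \<Longrightarrow> w \<in> X \<Longrightarrow> J i (\<lambda>x. u x + c * w x) = J i u + c * (J i w :: complex)"
    and "\<And>u. u \<in> X \<Longrightarrow> (\<forall>i\<in>I. J i u = 0) \<Longrightarrow> u = (\<lambda>_. 0)"
  shows "\<exists>B. finite B \<and> B \<subseteq> X \<and> (\<forall>e\<in>B. \<forall>e'\<in>B. q e e' = (if e = e' then 1 else 0)) \<and>
    (\<forall>u\<in>X. u = (\<lambda>x. \<Sum>e\<in>B. q e u * e x))"
  using assms
proof (induction I arbitrary: X)
  case empty
  have "u = (\<lambda>_. 0)" if "u \<in> X" for u using empty.prems(7)[OF that] by simp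
  then show ?case by (intro exI[of _ "{}"]) simp
next
  case (insert i I)
  note X0 = insert.prems(1) and Xlin = insert.prems(2) and qlin = insert.prems(3) and qcnj = insert.prems(4)
    and qpos = insert.prems(5) and Jlin = insert.prems(6) and Jinj = insert.prems(7)
  have J0: "J i (\<lambda>_. 0) = 0" using Jlin[of i, OF _ X0 X0, of "- 1"] by simp
  define X' where "X' = {u \<in> X. J i u = 0}"
  have "\<exists>B. finite B \<and> B \<subseteq> X' \<and> (\<forall>e\<in>B. \<forall>e'\<in>B. q e e' = (if e = e' then 1 else 0)) \<and>
    (\<forall>u\<in>X'. u = (\<lambda>x. \<Sum>e\<in>B. q e u * e x))"
  proof (rule insert.IH)
    show "(\<lambda>_. 0) \<in> X'" using X0 J0 by (simp add: X'_def)
    show "(\<lambda>x. u x + c * w x) \<in> X'" if "u \<in> X'" "w \<in> X'" for u w c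
      using that Xlin[of u w c] Jlin[of i u w c] by (simp add: X'_def)
    show "u = (\<lambda>_. 0)" if "u \<in> X'" "\<forall>i\<in>I. J i u = 0" for u
      using that Jinj[of u] by (simp add: X'_def)
    show "q u (\<lambda>x. w x + c * w' x) = q u w + c * q u w'" if "u \<in> X'" "w \<in> X'" "w' \<in> X'" for u w w' c
      by (rule qlin) (use that in \<open>auto simp: X'_def\<close>)
    show "q w u = cnj (q u w)" if "u \<in> X'" "w \<in> X'" for u w
      by (rule qcnj) (use that in \<open>auto simp: X'_def\<close>)
    show "\<exists>a>0. q u u = of_real a" if "u \<in> X'" "u \<noteq> (\<lambda>_. 0)" for u
      by (rule qpos) (use that in \<open>auto simp: X'_def\<close>)
    show "J j (\<lambda>x. u x + c * w x) = J j u + c * J j w" if "j \<in> I" "u \<in> X'" "w \<in> X'" for j u w c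
      by (rule Jlin) (use that in \<open>auto simp: X'_def\<close>)
  qed
  then obtain B where B: "finite B" "B \<subseteq> X'" and on: "\<And>e e'. e \<in> B \<Longrightarrow> e' \<in> B \<Longrightarrow> q e e' = (if e = e' then 1 else 0)"
    and rep: "\<And>u. u \<in> X' \<Longrightarrow> u = (\<lambda>x. \<Sum>e\<in>B. q e u * e x)" by blast
  have BX: "B \<subseteq> X" and BJ: "\<And>e. e \<in> B \<Longrightarrow> J i e = 0" using B(2) by (auto simp: X'_def)
  show ?case
  proof (cases "X' = X")
    case True
    then show ?thesis using B on rep by (intro exI[of _ B]) auto
  next
    case False
    then obtain x0 where x0: "x0 \<in> X" "J i x0 \<noteq> 0" by (auto simp: X'_def)
    define p where "p = (\<lambda>x. \<Sum>e\<in>B. q e x0 * e x)"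
    have p: "p \<in> X" unfolding p_def by (rule linear_on_sum(1)[OF X0 Xlin B(1) BX])
    have Jp: "J i p = 0"
      unfolding p_def by (subst linear_on_sum(2)[OF X0 Xlin B(1) BX]) (auto intro: Jlin simp: BJ)
    have qp: "q e p = q e x0" if "e \<in> B" for e
    proof -
      have eX: "e \<in> X" using that BX by blast
      have "q e p = (\<Sum>e'\<in>B. q e' x0 * q e e')"
        unfolding p_def by (rule linear_on_sum(2)[OF X0 Xlin B(1) BX]) (auto intro: qlin eX)
      also have "\<dots> = (\<Sum>e'\<in>B. if e' = e then q e' x0 else 0)" by (rule sum.cong) (use on[OF that] in auto)
      finally show ?thesis using that B(1) by simp
    qed
    \<comment> \<open>The part of \<open>x0\<close> orthogonal to \<open>B\<close>. Since
      \<open>B\<close> lies in the kernel of \<open>J i\<close>, this functional is still nonzero on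
      it.\<close>
    define y where "y = (\<lambda>x. x0 x + (- 1) * p x)"
    have y: "y \<in> X" unfolding y_def by (rule Xlin[OF x0(1) p])
    have Jy: "J i y \<noteq> 0" unfolding y_def using Jlin[of i, OF _ x0(1) p, of "- 1"] Jp x0(2) by simp
    have qy: "q e y = 0" if "e \<in> B" for e
    proof -
      have "e \<in> X" using that BX by blast
      from qlin[OF this x0(1) p, of "- 1"] show ?thesis unfolding y_def by (simp add: qp[OF that])
    qed
    have "y \<noteq> (\<lambda>_. 0)" using Jy J0 by auto
    then obtain a where a: "0 < a" "q y y = of_real a" using qpos[OF y] by blast
    define s where "s = complex_of_real (1 / sqrt a)"
    have scale: "(\<lambda>x. s * w x) \<in> X" "u \<in> X \<Longrightarrow> q u (\<lambda>x. s * w x) = s * q u w" "J i (\<lambda>x. s * w x) = s * J i w" if "w \<in> X" for u w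
    proof -
      show "(\<lambda>x. s * w x) \<in> X" using Xlin[OF X0 that, of s] by simp
      show "J i (\<lambda>x. s * w x) = s * J i w" using Jlin[of i, OF _ X0 that, of s] J0 by simp
      assume u: "u \<in> X"
      have "q u (\<lambda>_. 0) = 0" using qlin[OF u X0 X0, of "- 1"] by simp
      then show "q u (\<lambda>x. s * w x) = s * q u w" using qlin[OF u X0 that, of s] by simp
    qed
    define z where "z = (\<lambda>x. s * y x)"
    have z: "z \<in> X" unfolding z_def by (rule scale(1)[OF y])
    have Jz: "J i z \<noteq> 0" unfolding z_def scale(3)[OF y] using Jy a by (simp add: s_def)
    have qz: "q e z = 0" "q z e = 0" if "e \<in> B" for e
    proof -
      have eX: "e \<in> X" using that BX by blast
      show "q e z = 0" unfolding z_def using scale(2)[OF y eX] qy[OF that] by simp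
      then show "q z e = 0" using qcnj[OF eX z] by simp
    qed
    have "q z z = s * q z y" using scale(2)[OF y z] by (simp add: z_def)
    also have "q z y = cnj (q y z)" by (rule qcnj[OF y z])
    also have "q y z = s * of_real a" using scale(2)[OF y y] a by (simp add: z_def)
    finally have qzz: "q z z = 1"
      using a(1) by (simp add: s_def flip: of_real_mult)
    have zB: "z \<notin> B" using BJ Jz by blast
    show ?thesis
    proof (intro exI[of _ "insert z B"] conjI ballI)
      show "finite (insert z B)" "insert z B \<subseteq> X" using B(1) BX z by auto
      show "q e e' = (if e = e' then 1 else 0)" if "e \<in> insert z B" "e' \<in> insert z B" for e e'
        using that on qz qzz zB by auto
      fix u assume u: "u \<in> X"
      \<comment> \<open>The functional determines the coefficient of the new vector; it agrees with
        \<open>q z u\<close> because the rest is spanned by \<open>B\<close>, which is orthogonal to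
        \<open>z\<close>.\<close>
      define t where "t = J i u / J i z"
      define w where "w = (\<lambda>x. u x + (- t) * z x)"
      have wX: "w \<in> X" unfolding w_def by (rule Xlin[OF u z])
      have "J i w = 0" unfolding w_def using Jlin[of i, OF _ u z, of "- t"] Jz by (simp add: t_def)
      then have wr: "w = (\<lambda>x. \<Sum>e\<in>B. q e w * e x)" by (intro rep) (simp add: X'_def wX)
      have uw: "u = (\<lambda>x. w x + t * z x)" by (simp add: w_def)
      have qw: "q e w = q e u" if "e \<in> B" for e
      proof -
        have "e \<in> X" using that BX by blast
        from qlin[OF this wX z, of t] show ?thesis using qz(1)[OF that] by (simp flip: uw)
      qed
      have "q z w = (\<Sum>e\<in>B. q e w * q z e)"
        by (subst wr, rule linear_on_sum(2)[OF X0 Xlin B(1) BX]) (auto intro: qlin z)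
      also have "\<dots> = 0" using qz(2) by simp
      finally have qu: "q z u = t" using qlin[OF z wX z, of t] qzz by (simp flip: uw)
      have "u x = (\<Sum>e\<in>insert z B. q e u * e x)" for x
      proof -
        have "u x = w x + t * z x" by (simp add: w_def)
        also have "w x = (\<Sum>e\<in>B. q e u * e x)" by (subst wr) (simp add: qw)
        finally show ?thesis using zB B(1) by (simp add: qu)
      qed
      then show "u = (\<lambda>x. \<Sum>e\<in>insert z B. q e u * e x)" by auto
    qed
  qed
qed

lemma ketbra_sum: "(\<Sum>\<Psi>\<in>B. ketbra \<Psi> \<Psi> u) = (\<lambda>x. \<Sum>\<Psi>\<in>B. pairing \<Psi> u * \<Psi> x)"
  unfolding ketbra_def by (rule sum_cscale)

lemma ketbra_sum_Bs:
  fixes B :: "('k, 'a) gfun set"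
  assumes B: "finite B" "\<And>\<Psi>. \<Psi> \<in> B \<Longrightarrow> \<Psi> \<in> linfw (real 1)"
  shows "(\<lambda>u. \<Sum>\<Psi>\<in>B. ketbra \<Psi> \<Psi> u) \<in> Bs (real 1)"
proof -
  define A where "A \<Psi> = linfw_norm (real 1) \<Psi>" for \<Psi> :: "('k, 'a) gfun"
  have A: "norm (\<Psi> x) \<le> A \<Psi> * wt x ^ 1" "0 \<le> A \<Psi>" if "\<Psi> \<in> B" for \<Psi> x
    unfolding A_def by (rule linfw_norm_bound[OF B(2)[OF that]], rule linfw_norm_nonneg[OF B(2)[OF that]])
  have p: "norm (pairing \<Psi> u) \<le> A \<Psi> * l1w_norm (real 1) u" if "\<Psi> \<in> B" "u \<in> l1w (real 1)" for \<Psi> u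
    by (rule l1w_linfw_product(2)[OF A(1)[OF that(1)] that(2)])
  have s: "(\<lambda>x. norm (cnj (\<Psi> x) * u x)) summable_on UNIV" if "\<Psi> \<in> B" "u \<in> l1w (real 1)" for \<Psi> u
    by (rule l1w_linfw_product(1)[OF A(1)[OF that(1)] that(2)])
  have bd: "norm ((\<Sum>\<Psi>\<in>B. ketbra \<Psi> \<Psi> u) x) \<le> (\<Sum>\<Psi>\<in>B. A \<Psi> * A \<Psi>) * l1w_norm (real 1) u * wt x ^ 1"
    if u: "u \<in> l1w (real 1)" for u x
  proof -
    have "norm ((\<Sum>\<Psi>\<in>B. ketbra \<Psi> \<Psi> u) x) \<le> (\<Sum>\<Psi>\<in>B. (A \<Psi> * l1w_norm (real 1) u) * (A \<Psi> * wt x ^ 1))"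
      unfolding ketbra_sum
    proof (rule sum_norm_le)
      fix \<Psi> assume P: "\<Psi> \<in> B"
      show "norm (pairing \<Psi> u * \<Psi> x) \<le> (A \<Psi> * l1w_norm (real 1) u) * (A \<Psi> * wt x ^ 1)"
        unfolding norm_mult
        by (rule mult_mono[OF p[OF P u] A(1)[OF P] mult_nonneg_nonneg[OF A(2)[OF P] l1w_norm_nonneg] norm_ge_zero])
    qed
    also have "\<dots> = (\<Sum>\<Psi>\<in>B. A \<Psi> * A \<Psi>) * l1w_norm (real 1) u * wt x ^ 1"
      unfolding sum_distrib_right by (intro sum.cong) (auto simp: mult_ac)
    finally show ?thesis .
  qed
  show ?thesis unfolding Bs_def bounded_op_def
  proof (intro CollectI conjI ballI allI)
    show "(\<lambda>u. \<Sum>\<Psi>\<in>B. ketbra \<Psi> \<Psi> u) ` l1w (real 1) \<subseteq> linfw (real 1)"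
      by (rule image_subsetI, rule linfwI, rule bd)
    show "(\<Sum>\<Psi>\<in>B. ketbra \<Psi> \<Psi> (u + w)) = (\<Sum>\<Psi>\<in>B. ketbra \<Psi> \<Psi> u) + (\<Sum>\<Psi>\<in>B. ketbra \<Psi> \<Psi> w)"
      if u: "u \<in> l1w (real 1)" and w: "w \<in> l1w (real 1)" for u w
    proof -
      have "pairing \<Psi> (u + w) = pairing \<Psi> u + pairing \<Psi> w" if "\<Psi> \<in> B" for \<Psi>
        using pairing_add_right[OF s[OF that u] s[OF that w]] by (simp add: plus_fun_def)
      then show ?thesis unfolding ketbra_sum
        by (simp add: fun_eq_iff distrib_right sum.distrib)
    qed
    show "(\<Sum>\<Psi>\<in>B. ketbra \<Psi> \<Psi> (cscale c u)) = cscale c (\<Sum>\<Psi>\<in>B. ketbra \<Psi> \<Psi> u)" for c u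
      unfolding ketbra_sum cscale_def pairing_scale_right by (simp add: sum_distrib_left mult.assoc)
    show "\<exists>C. \<forall>u\<in>l1w (real 1). linfw_norm (real 1) (\<Sum>\<Psi>\<in>B. ketbra \<Psi> \<Psi> u) \<le> C * l1w_norm (real 1) u"
      by (rule exI[of _ "\<Sum>\<Psi>\<in>B. A \<Psi> * A \<Psi>"], rule ballI, rule linfw_norm_le, rule bd)
  qed
qed

lemma delta_l1w: "(delta y :: ('k, 'a) gfun) \<in> l1w (real n)"
  by (rule l1w_finite_support[of "{y}"]) (auto simp: delta_def)

text \<open>A unit mass at \<open>y\<close> is mapped to the combination of the basis whose
  coefficients are the conjugate values at \<open>y\<close>, and \<open>y\<close> is chosen so that
  one of them is nonzero.\<close>

lemma ketbra_sum_nonzero: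
  fixes B :: "('k, 'a) gfun set"
  assumes B: "finite B" "cfun.independent B" "B \<noteq> {}"
  shows "\<exists>u\<in>l1w (real n). (\<Sum>\<Psi>\<in>B. ketbra \<Psi> \<Psi> u) \<noteq> 0"
proof -
  obtain \<Phi> where \<Phi>: "\<Phi> \<in> B" using B(3) by blast
  have "\<Phi> \<noteq> 0" using \<Phi> B(2) cfun.dependent_zero by blast
  then obtain y where y: "\<Phi> y \<noteq> 0" by (auto simp: fun_eq_iff)
  have pd: "pairing \<Psi> (delta y) = cnj (\<Psi> y)" for \<Psi> :: "('k, 'a) gfun"
    using pairing_cnj[of \<Psi> "delta y"] by simp
  have "(\<Sum>\<Psi>\<in>B. cscale (cnj (\<Psi> y)) \<Psi>) \<noteq> 0"
  proof
    assume "(\<Sum>\<Psi>\<in>B. cscale (cnj (\<Psi> y)) \<Psi>) = 0"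
    then have "cfun.dependent B" unfolding cfun.dependent_finite[OF B(1)]
      using \<Phi> y by (intro exI[of _ "\<lambda>\<Psi>. cnj (\<Psi> y)"]) auto
    then show False using B(2) by blast
  qed
  then have "(\<Sum>\<Psi>\<in>B. ketbra \<Psi> \<Psi> (delta y)) \<noteq> 0" by (simp add: ketbra_def pd)
  then show ?thesis using delta_l1w by blast
qed

context schroedinger_kernel
begin

section \<open>The space of bound states\<close>

lemma gen_lin: "u \<in> gen \<Longrightarrow> w \<in> gen \<Longrightarrow> (\<lambda>x. u x + c * w x) \<in> gen"
  by (rule genI) (auto intro: linfw_lin genD simp: HH_lin genD)

lemma gen_zero: "(\<lambda>_. 0) \<in> gen"
  by (rule genI) (auto intro: ell2_in_linfw simp: HH_zero)

lemma bound_lin: "u \<in> bound \<Longrightarrow> w \<in> bound \<Longrightarrow> (\<lambda>x. u x + c * w x) \<in> bound"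
  by (auto simp: bound_iff intro: gen_lin l1w_add l1w_scale)

lemma bound_zero: "(\<lambda>_. 0) \<in> bound"
  using gen_zero l1w_finite_support[of "{}" "\<lambda>_. 0"] by (simp add: bound_iff)

text \<open>Such a bound state solves the exterior problem with right side t^2 \<Psi>, so it equals
  the exterior resolvent of that and is small with t by \<open>Rc_bound\<close>. Hence finitely many
  values determine a bound state.\<close>

lemma bound_F_zero:
  assumes \<Psi>: "\<Psi> \<in> bound" and F: "\<And>i. i \<in> F \<Longrightarrow> \<Psi> i = 0"
  shows "\<Psi> x = 0"
proof (rule linear_bound_imp_zero[OF \<delta>(1)])
  fix t assume t: "0 < t" "t < \<delta>"
  note l = bound_ell2[OF \<Psi>]
  have gen: "\<Psi> \<in> gen" using \<Psi> by (simp add: bound_iff)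
  have u: "\<Psi> \<in> l1w (real 0)" by (rule l1w_mono[OF bound_l1w[OF \<Psi>]]) simp
  define f where "f = (\<lambda>x. (of_real t)\<^sup>2 * \<Psi> x)"
  have "\<Psi> = Rc (of_real t) f"
    unfolding f_def by (rule Rc_unique) (use t l F in \<open>auto intro: ell2_scale(1) simp: genD(2)[OF gen]\<close>)
  then have "norm (\<Psi> x) = norm (Rc (of_real t) f x)" by simp
  also have "\<dots> \<le> (1 + 2 * Cv\<^sup>2) * l1w_norm (real 0) f * wt x"
    unfolding f_def by (rule Rc_bound[OF _ l1w_scale[OF u]]) (use t in simp)
  also have "l1w_norm (real 0) f = t\<^sup>2 * l1w_norm (real 0) \<Psi>"
    unfolding l1w_norm_nat f_def by (simp add: norm_mult norm_power infsum_cmult_right')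
  also have "(1 + 2 * Cv\<^sup>2) * (t\<^sup>2 * l1w_norm (real 0) \<Psi>) * wt x \<le> (1 + 2 * Cv\<^sup>2) * (t * l1w_norm (real 0) \<Psi>) * wt x"
    using t \<delta> by (intro mult_right_mono[OF mult_left_mono[OF mult_right_mono[OF _ l1w_norm_nonneg]] wt_nonneg])
      (auto simp: power2_eq_square mult_left_le_one_le)
  finally show "norm (\<Psi> x) \<le> (1 + 2 * Cv\<^sup>2) * l1w_norm (real 0) \<Psi> * wt x * t" by (simp add: mult_ac)
qed

text \<open>An auxiliary basis showing that the space of bound states is finite-dimensional and that
  the choice in \<open>bound_projection\<close> can be made.\<close>

definition bb :: "('k, 'a) gfun set" where
  "bb = (SOME B. finite B \<and> B \<subseteq> bound \<and> (\<forall>e\<in>B. \<forall>e'\<in>B. pairing e e' = (if e = e' then 1 else 0)) \<and>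
    (\<forall>u\<in>bound. u = (\<lambda>x. \<Sum>e\<in>B. pairing e u * e x)))"

lemma pairing_lin_right:
  assumes "u \<in> ell2" "w \<in> ell2" "w' \<in> ell2"
  shows "pairing u (\<lambda>x. w x + c * w' x) = pairing u w + c * pairing u w'"
  using pairing_add_right[OF ell2_pairing_summable[OF assms(1,2)] ell2_pairing_summable[OF assms(1) ell2_scale(1)[OF assms(3)]]]
  by (simp only: pairing_scale_right)

lemma bb: "finite bb" "bb \<subseteq> bound" "\<And>e e'. e \<in> bb \<Longrightarrow> e' \<in> bb \<Longrightarrow> pairing e e' = (if e = e' then 1 else 0)"
  "\<And>u. u \<in> bound \<Longrightarrow> u = (\<lambda>x. \<Sum>e\<in>bb. pairing e u * e x)"
proof -
  have "\<exists>B. finite B \<and> B \<subseteq> bound \<and> (\<forall>e\<in>B. \<forall>e'\<in>B. pairing e e' = (if e = e' then 1 else 0)) \<and>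
    (\<forall>u\<in>bound. u = (\<lambda>x. \<Sum>e\<in>B. pairing e u * e x))"
  proof (rule orthonormal_basis_exists[where I=F and J="\<lambda>i u. u i"])
    show "\<exists>a>0. pairing u u = complex_of_real a" if u: "u \<in> bound" "u \<noteq> (\<lambda>_. 0)" for u
    proof -
      have "sqn u \<noteq> 0" using sqn_eq_0[OF bound_ell2[OF u(1)]] u(2) by blast
      then have "0 < sqn u" using sqn_nonneg[of u] by linarith
      then show ?thesis using pairing_self[OF bound_ell2[OF u(1)]] by blast
    qed
    show "u = (\<lambda>_. 0)" if "u \<in> bound" "\<forall>i\<in>F. u i = 0" for u using bound_F_zero[OF that(1)] that(2) by blast
    show "pairing w u = cnj (pairing u w)" for u w :: "('k, 'a) gfun" by (rule pairing_cnj)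
  qed (auto intro: finite_F bound_zero bound_lin pairing_lin_right bound_ell2)
  from someI_ex[OF this, folded bb_def] show "finite bb" "bb \<subseteq> bound"
    "\<And>e e'. e \<in> bb \<Longrightarrow> e' \<in> bb \<Longrightarrow> pairing e e' = (if e = e' then 1 else 0)"
    "\<And>u. u \<in> bound \<Longrightarrow> u = (\<lambda>x. \<Sum>e\<in>bb. pairing e u * e x)" by blast+
qed

lemma span_combination:
  assumes "finite B"
  shows "(\<lambda>x. \<Sum>e\<in>B. a e * e x) \<in> cfun.span B" "w \<in> cfun.span B \<Longrightarrow> \<exists>a. w = (\<lambda>x. \<Sum>e\<in>B. a e * e x)"
proof -
  have *: "cfun.span B = range (\<lambda>a x. \<Sum>e\<in>B. a e * e x)"
    unfolding cfun.span_finite[OF assms] sum_cscale ..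
  show "(\<lambda>x. \<Sum>e\<in>B. a e * e x) \<in> cfun.span B" unfolding * by (rule range_eqI[of _ _ a]) simp
  show "\<exists>a. w = (\<lambda>x. \<Sum>e\<in>B. a e * e x)" if "w \<in> cfun.span B"
    using that unfolding * by (rule rangeE) (rule exI)
qed

lemma span_bb: "cfun.span bb = bound"
proof
  show "cfun.span bb \<subseteq> bound"
  proof
    fix w assume "w \<in> cfun.span bb"
    then obtain a where a: "w = (\<lambda>x. \<Sum>e\<in>bb. a e * e x)" using span_combination(2)[OF bb(1)] by blast
    show "w \<in> bound" unfolding a by (rule linear_on_sum(1)[OF bound_zero bound_lin bb(1,2)])
  qed
  show "bound \<subseteq> cfun.span bb"
  proof
    fix u assume "u \<in> bound"
    then show "u \<in> cfun.span bb" by (subst bb(4), assumption) (rule span_combination(1)[OF bb(1)])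
  qed
qed

lemma pairing_combination:
  assumes B: "finite B" "B \<subseteq> bound" and on: "\<And>e e'. e \<in> B \<Longrightarrow> e' \<in> B \<Longrightarrow> pairing e e' = (if e' = e then 1 else 0)"
    and e: "e \<in> B"
  shows "pairing e (\<lambda>x. \<Sum>e'\<in>B. a e' * e' x) = a e"
proof -
  have eb: "e \<in> ell2" using e B(2) bound_ell2 by blast
  have "pairing e (\<lambda>x. \<Sum>e'\<in>B. a e' * e' x) = (\<Sum>e'\<in>B. a e' * pairing e e')"
    by (rule linear_on_sum(2)[OF bound_zero bound_lin B]) (auto intro: pairing_lin_right eb bound_ell2)
  also have "\<dots> = (\<Sum>e'\<in>B. if e' = e then a e' else 0)" by (rule sum.cong) (use on[OF e] in auto)
  finally show ?thesis using e B(1) by simp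
qed

lemma bb_orthonormal: "orthonormal_bound_basis HH (real b) bb"
  unfolding orthonormal_bound_basis_def
proof (intro conjI ballI)
  show "cfun.independent bb"
    unfolding cfun.dependent_finite[OF bb(1)] sum_cscale
  proof safe
    fix a e assume *: "(\<lambda>x. \<Sum>e\<in>bb. a e * e x) = 0" "e \<in> bb" "a e \<noteq> 0"
    have "pairing e (\<lambda>x. \<Sum>e\<in>bb. a e * e x) = a e" by (rule pairing_combination[OF bb(1,2) _ *(2)]) (simp add: bb(3))
    then show False using * by (simp add: pairing_def)
  qed
  show "cfun.span bb = bound" by (rule span_bb)
  fix \<Phi> \<Psi> assume e: "\<Phi> \<in> bb" "\<Psi> \<in> bb"
  then have l: "\<Phi> \<in> ell2" "\<Psi> \<in> ell2" using bb(2) bound_ell2 by blast+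
  show "pairing \<Psi> \<Phi> = (if \<Phi> = \<Psi> then 1 else 0)" using bb(3)[OF e(2,1)] by auto
  show "(\<lambda>x. cnj (\<Psi> x) * \<Phi> x) \<in> l1w 0"
    using l1w_nat[of "\<lambda>x. cnj (\<Psi> x) * \<Phi> x" 0] ell2_pairing_summable[OF l(2,1)] by simp
qed

text \<open>The basis chosen inside \<open>bound_projection\<close>, known only through its defining
  properties.\<close>

definition bound_basis :: "('k, 'a) gfun set" where
  "bound_basis = (SOME B. orthonormal_bound_basis HH (real b) B)"

lemma bound_basis:
  shows "orthonormal_bound_basis HH (real b) bound_basis" "cfun.independent bound_basis" "cfun.span bound_basis = bound"
    "finite bound_basis" "bound_basis \<subseteq> bound"
    "\<And>e e'. e \<in> bound_basis \<Longrightarrow> e' \<in> bound_basis \<Longrightarrow> pairing e e' = (if e' = e then 1 else 0)"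
proof -
  show 1: "orthonormal_bound_basis HH (real b) bound_basis"
    unfolding bound_basis_def by (rule someI[where P="orthonormal_bound_basis HH (real b)", OF bb_orthonormal])
  then show 2: "cfun.independent bound_basis" "cfun.span bound_basis = bound"
    and "\<And>e e'. e \<in> bound_basis \<Longrightarrow> e' \<in> bound_basis \<Longrightarrow> pairing e e' = (if e' = e then 1 else 0)"
    unfolding orthonormal_bound_basis_def by blast+
  show 3: "bound_basis \<subseteq> bound" using 2(2) cfun.span_superset by blast
  then show "finite bound_basis"
    using cfun.independent_span_bound[OF bb(1) 2(1)] unfolding span_bb by blast
qed

lemma bound_projection_sum: "bound_projection HH (real b) u = (\<Sum>\<Psi>\<in>bound_basis. ketbra \<Psi> \<Psi> u)"
  unfolding bound_projection_def bound_basis_def ..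

text \<open>Both sides are bound states with the same pairings against the basis, by
  \<open>pairing_G0\<close>.\<close>

lemma bound_projection_eq:
  assumes u: "u \<in> l1w (real (b - 2))"
  shows "bound_projection HH (real b) u = Gi 0 u"
proof -
  have "Gi 0 u \<in> cfun.span bound_basis" unfolding bound_basis(3) by (rule G0_in_bound[OF u])
  then obtain a where a: "Gi 0 u = (\<lambda>x. \<Sum>e\<in>bound_basis. a e * e x)"
    using span_combination(2)[OF bound_basis(4)] by blast
  have "pairing e u = a e" if e: "e \<in> bound_basis" for e
  proof -
    have "e \<in> bound" using e bound_basis(5) by blast
    then have "pairing e u = pairing e (Gi 0 u)" by (rule pairing_G0[OF _ u, symmetric])
    also have "\<dots> = a e" unfolding a by (rule pairing_combination[OF bound_basis(4,5,6) e])
    finally show ?thesis .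
  qed
  then show ?thesis unfolding bound_projection_sum ketbra_sum a by (intro ext sum.cong) auto
qed

end

section \<open>Resonances and their constants at infinity\<close>

lemma ray_const_lin: "ray_const (\<lambda>\<alpha>. a \<alpha> + c * a' \<alpha>) x = ray_const a x + c * ray_const a' (x :: ('k, 'a::finite) vertex)"
  by (cases x) auto

context schroedinger_kernel
begin

text \<open>Weighted summability makes the difference to the constant tend to 0 along each
  half-line, which pins the constant down.\<close>

lemma ray_const_coeff_unique:
  fixes \<Phi> :: "('k, 'a) gfun"
  assumes "(\<lambda>x. \<Phi> x - ray_const c x) \<in> l1w (real (b - 2))" "(\<lambda>x. \<Phi> x - ray_const c' x) \<in> l1w (real (b - 2))"
  shows "c = c'"
proof
  fix \<alpha>
  have lim: "(\<lambda>m. \<Phi> (Ray \<alpha> m) - c \<alpha>) \<longlonglongrightarrow> 0" if "(\<lambda>x. \<Phi> x - ray_const c x) \<in> l1w (real (b - 2))" for c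
  proof -
    have "summable (\<lambda>m. (real m + 1) ^ (b - 2) * norm (\<Phi> (Ray \<alpha> m) - c \<alpha>))"
      using that unfolding l1w_Ray_iff by simp
    from summable_weighted_imp_LIMSEQ[OF this, of 0] show ?thesis by simp
  qed
  from tendsto_diff[OF lim[OF assms(2)] lim[OF assms(1)]] have "(\<lambda>m::nat. c \<alpha> - c' \<alpha>) \<longlonglongrightarrow> 0" by simp
  then show "c \<alpha> = c' \<alpha>" by (simp add: LIMSEQ_const_iff)
qed

definition cc :: "('k, 'a) gfun \<Rightarrow> 'a \<Rightarrow> complex" where
  "cc \<Phi> = (SOME c. (\<lambda>x. \<Phi> x - ray_const c x) \<in> l1w (real (b - 2)))"

lemma cc_eq:
  assumes "(\<lambda>x. \<Phi> x - ray_const c x) \<in> l1w (real (b - 2))"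
  shows "cc \<Phi> = c"
  unfolding cc_def
  by (rule ray_const_coeff_unique[OF someI[where P="\<lambda>c. (\<lambda>x. \<Phi> x - ray_const c x) \<in> l1w (real (b - 2))", OF assms] assms])

lemma res_iff: "\<Phi> \<in> res \<longleftrightarrow> \<Phi> \<in> gen \<and> (\<exists>c. (\<lambda>x. \<Phi> x - ray_const c x) \<in> l1w (real (b - 2)))"
proof -
  have "(\<exists>c u. \<Phi> = ray_const c + u \<and> u \<in> l1w (real (b - 2))) \<longleftrightarrow> (\<exists>c. (\<lambda>x. \<Phi> x - ray_const c x) \<in> l1w (real (b - 2)))"
  proof
    assume "\<exists>c u. \<Phi> = ray_const c + u \<and> u \<in> l1w (real (b - 2))"
    then obtain c u where "\<Phi> = ray_const c + u" "u \<in> l1w (real (b - 2))" by blast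
    then show "\<exists>c. (\<lambda>x. \<Phi> x - ray_const c x) \<in> l1w (real (b - 2))" by (intro exI[of _ c]) simp
  next
    assume "\<exists>c. (\<lambda>x. \<Phi> x - ray_const c x) \<in> l1w (real (b - 2))"
    then obtain c where "(\<lambda>x. \<Phi> x - ray_const c x) \<in> l1w (real (b - 2))" by blast
    then show "\<exists>c u. \<Phi> = ray_const c + u \<and> u \<in> l1w (real (b - 2))"
      by (intro exI[of _ c] exI[of _ "\<lambda>x. \<Phi> x - ray_const c x"]) (auto simp: fun_eq_iff)
  qed
  then show ?thesis unfolding res_space_def real_b2 by simp
qed

lemma cc_l1w: "\<Phi> \<in> res \<Longrightarrow> (\<lambda>x. \<Phi> x - ray_const (cc \<Phi>) x) \<in> l1w (real (b - 2))"
  unfolding res_iff cc_def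
  by (erule conjE) (rule someI_ex[where P="\<lambda>c. (\<lambda>x. \<Phi> x - ray_const c x) \<in> l1w (real (b - 2))"])

lemma res_gen: "\<Phi> \<in> res \<Longrightarrow> \<Phi> \<in> gen"
  by (simp add: res_iff)

lemma res_lin_aux:
  assumes "u \<in> res" "w \<in> res"
  shows "(\<lambda>x. (u x + c * w x) - ray_const (\<lambda>\<alpha>. cc u \<alpha> + c * cc w \<alpha>) x) \<in> l1w (real (b - 2))"
  using l1w_add[OF cc_l1w[OF assms(1)] l1w_scale[OF cc_l1w[OF assms(2)], of c]]
  unfolding ray_const_lin by (simp add: algebra_simps)

lemma res_lin: "u \<in> res \<Longrightarrow> w \<in> res \<Longrightarrow> (\<lambda>x. u x + c * w x) \<in> res"
  unfolding res_iff[of "\<lambda>x. u x + c * w x"]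
  by (intro conjI exI[of _ "\<lambda>\<alpha>. cc u \<alpha> + c * cc w \<alpha>"] gen_lin res_gen res_lin_aux)

lemma cc_lin: "u \<in> res \<Longrightarrow> w \<in> res \<Longrightarrow> cc (\<lambda>x. u x + c * w x) = (\<lambda>\<alpha>. cc u \<alpha> + c * cc w \<alpha>)"
  by (rule cc_eq[OF res_lin_aux])

lemma bound_res_cc: "\<Psi> \<in> bound \<Longrightarrow> (\<lambda>x. \<Psi> x - ray_const (\<lambda>_. 0) x) \<in> l1w (real (b - 2))"
proof -
  assume "\<Psi> \<in> bound"
  moreover have "ray_const (\<lambda>_. 0) x = 0" for x :: "('k, 'a) vertex" by (cases x) auto
  ultimately show ?thesis by (simp add: bound_iff)
qed

lemma bound_subset_res: "\<Psi> \<in> bound \<Longrightarrow> \<Psi> \<in> res"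
  unfolding res_iff using bound_res_cc by (auto simp: bound_iff)

lemma cc_bound: "\<Psi> \<in> bound \<Longrightarrow> cc \<Psi> = (\<lambda>_. 0)"
  by (rule cc_eq[OF bound_res_cc])

lemma res_cc_zero: "\<Phi> \<in> res \<Longrightarrow> cc \<Phi> = (\<lambda>_. 0) \<Longrightarrow> \<Phi> \<in> bound"
proof -
  assume "\<Phi> \<in> res" "cc \<Phi> = (\<lambda>_. 0)"
  moreover have "ray_const (\<lambda>_. 0) x = 0" for x :: "('k, 'a) vertex" by (cases x) auto
  ultimately show ?thesis using cc_l1w[of \<Phi>] by (simp add: bound_iff res_gen)
qed

lemma res_linfw:
  assumes "\<Phi> \<in> res"
  shows "\<Phi> \<in> linfw (real s)"
proof -
  have "(\<lambda>x. (\<Phi> x - ray_const (cc \<Phi>) x) + 1 * ray_const (cc \<Phi>) x) \<in> linfw (real s)"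
    by (rule linfw_lin[OF ell2_in_linfw[OF l1w_ell2[OF cc_l1w[OF assms]]] ray_const_linfw])
  then show ?thesis by simp
qed

lemma res_bound_summable:
  assumes "\<Psi> \<in> bound" "\<Phi> \<in> linfw (real (b - 2))"
  shows "(\<lambda>x. norm (cnj (\<Phi> x) * \<Psi> x)) summable_on UNIV" "(\<lambda>x. norm (cnj (\<Psi> x) * \<Phi> x)) summable_on UNIV"
proof -
  obtain A where A: "0 \<le> A" "\<And>x. norm (\<Phi> x) \<le> A * wt x ^ (b - 2)" by (rule linfwE[OF assms(2)]) (rule that)
  show 1: "(\<lambda>x. norm (cnj (\<Phi> x) * \<Psi> x)) summable_on UNIV" by (rule l1w_linfw_product(1)[OF A(2) bound_l1w[OF assms(1)]])
  then show "(\<lambda>x. norm (cnj (\<Psi> x) * \<Phi> x)) summable_on UNIV" by (simp add: norm_mult mult.commute)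
qed

lemma linfw_scale: "\<Phi> \<in> linfw (real s) \<Longrightarrow> (\<lambda>x. c * \<Phi> x) \<in> linfw (real s)"
  using linfw_lin[OF ell2_in_linfw[OF ell2_zero], where w=\<Phi> and c=c] by simp

lemma pairing_bound_lin:
  assumes "\<Psi> \<in> bound" "u \<in> linfw (real (b - 2))" "w \<in> linfw (real (b - 2))"
  shows "pairing \<Psi> (\<lambda>x. u x + c * w x) = pairing \<Psi> u + c * pairing \<Psi> w"
  using pairing_add_right[OF res_bound_summable(2)[OF assms(1,2)] res_bound_summable(2)[OF assms(1) linfw_scale[OF assms(3)]]]
  by (simp only: pairing_scale_right)

lemma pairing_res_lin:
  assumes "\<Phi> \<in> linfw (real (b - 2))" "u \<in> bound" "w \<in> bound"
  shows "pairing \<Phi> (\<lambda>x. u x + c * w x) = pairing \<Phi> u + c * pairing \<Phi> w"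
proof -
  have "(\<lambda>x. c * w x) \<in> bound" using bound_lin[OF bound_zero assms(3), of c] by simp
  from pairing_add_right[OF res_bound_summable(1)[OF assms(2,1)] res_bound_summable(1)[OF this assms(1)]]
  show ?thesis by (simp only: pairing_scale_right)
qed

text \<open>Representatives of resonances modulo bound states, normalised as the definition of a
  resonance basis asks.\<close>

definition rperp :: "('k, 'a) gfun set" where
  "rperp = {\<Phi> \<in> res. \<forall>\<Psi>\<in>bound. pairing \<Psi> \<Phi> = 0}"

text \<open>The inner product of the constants at infinity. It is definite on \<open>rperp\<close>:
  a resonance with zero constants is a bound state, and in \<open>rperp\<close> it is orthogonal to
  itself.\<close>

definition rq :: "('k, 'a) gfun \<Rightarrow> ('k, 'a) gfun \<Rightarrow> complex" where
  "rq \<Phi> \<Phi>' = (\<Sum>\<alpha>\<in>UNIV. cnj (cc \<Phi> \<alpha>) * cc \<Phi>' \<alpha>)"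

lemma rq_lin: "w \<in> res \<Longrightarrow> w' \<in> res \<Longrightarrow> rq u (\<lambda>x. w x + c * w' x) = rq u w + c * rq u w'"
  by (simp add: rq_def cc_lin sum.distrib sum_distrib_left algebra_simps)

lemma self_orthogonal_zero:
  assumes "\<Psi> \<in> bound" "pairing \<Psi> \<Psi> = 0"
  shows "\<Psi> = (\<lambda>_. 0)"
proof
  fix x
  have "sqn \<Psi> = 0" using pairing_self[OF bound_ell2[OF assms(1)]] assms(2) by simp
  then show "\<Psi> x = 0" by (rule sqn_eq_0[OF bound_ell2[OF assms(1)]])
qed

lemma rperp_zero: "(\<lambda>_. 0) \<in> rperp"
  unfolding rperp_def using bound_subset_res[OF bound_zero] by (simp add: pairing_def)

lemma rperp_lin:
  assumes "u \<in> rperp" "w \<in> rperp"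
  shows "(\<lambda>x. u x + c * w x) \<in> rperp"
proof -
  have r: "u \<in> res" "w \<in> res" using assms by (auto simp: rperp_def)
  have "pairing \<Psi> (\<lambda>x. u x + c * w x) = 0" if "\<Psi> \<in> bound" for \<Psi>
    using pairing_bound_lin[OF that res_linfw[OF r(1)] res_linfw[OF r(2)], of c] assms that by (simp add: rperp_def)
  then show ?thesis using res_lin[OF r] by (simp add: rperp_def)
qed

lemma rperp_inj:
  assumes "u \<in> rperp" "\<forall>\<alpha>\<in>UNIV. cc u \<alpha> = 0"
  shows "u = (\<lambda>_. 0)"
proof -
  have "cc u = (\<lambda>_. 0)" using assms(2) by (simp add: fun_eq_iff)
  then have "u \<in> bound" using res_cc_zero assms(1) by (simp add: rperp_def)
  then show ?thesis using self_orthogonal_zero assms(1) by (simp add: rperp_def)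
qed

definition rb :: "('k, 'a) gfun set" where
  "rb = (SOME B. finite B \<and> B \<subseteq> rperp \<and> (\<forall>e\<in>B. \<forall>e'\<in>B. rq e e' = (if e = e' then 1 else 0)) \<and>
    (\<forall>u\<in>rperp. u = (\<lambda>x. \<Sum>e\<in>B. rq e u * e x)))"

lemma rb: "finite rb" "rb \<subseteq> rperp" "\<And>e e'. e \<in> rb \<Longrightarrow> e' \<in> rb \<Longrightarrow> rq e e' = (if e = e' then 1 else 0)"
  "\<And>u. u \<in> rperp \<Longrightarrow> u = (\<lambda>x. \<Sum>e\<in>rb. rq e u * e x)"
proof -
  have "\<exists>B. finite B \<and> B \<subseteq> rperp \<and> (\<forall>e\<in>B. \<forall>e'\<in>B. rq e e' = (if e = e' then 1 else 0)) \<and>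
    (\<forall>u\<in>rperp. u = (\<lambda>x. \<Sum>e\<in>B. rq e u * e x))"
  proof (rule orthonormal_basis_exists[where I=UNIV and J="\<lambda>\<alpha> u. cc u \<alpha>"])
    show "\<exists>a>0. rq u u = complex_of_real a" if u: "u \<in> rperp" "u \<noteq> (\<lambda>_. 0)" for u
    proof -
      obtain \<alpha> where \<alpha>: "cc u \<alpha> \<noteq> 0" using rperp_inj[OF u(1)] u(2) by blast
      have "0 < (norm (cc u \<alpha>))\<^sup>2" using \<alpha> by simp
      also have "\<dots> \<le> (\<Sum>\<alpha>\<in>UNIV. (norm (cc u \<alpha>))\<^sup>2)" by (rule member_le_sum) auto
      finally have "0 < (\<Sum>\<alpha>\<in>UNIV. (norm (cc u \<alpha>))\<^sup>2)" .
      moreover have "rq u u = of_real (\<Sum>\<alpha>\<in>UNIV. (norm (cc u \<alpha>))\<^sup>2)"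
        unfolding rq_def of_real_sum by (intro sum.cong refl) (simp only: complex_norm_square mult.commute)
      ultimately show ?thesis by blast
    qed
    show "u = (\<lambda>_. 0)" if "u \<in> rperp" "\<forall>\<alpha>\<in>UNIV. cc u \<alpha> = 0" for u by (rule rperp_inj[OF that])
    show "rq w u = cnj (rq u w)" for u w by (simp add: rq_def mult.commute)
    show "rq u (\<lambda>x. w x + c * w' x) = rq u w + c * rq u w'" if "w \<in> rperp" "w' \<in> rperp" for u w w' c
      by (rule rq_lin) (use that in \<open>auto simp: rperp_def\<close>)
    show "cc (\<lambda>x. u x + c * w x) \<alpha> = cc u \<alpha> + c * cc w \<alpha>" if "u \<in> rperp" "w \<in> rperp" for \<alpha> u w c
      using cc_lin[of u w c] that by (simp add: rperp_def)
    show "(\<lambda>x. u x + c * w x) \<in> rperp" if "u \<in> rperp" "w \<in> rperp" for u w c by (rule rperp_lin[OF that])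
  qed (auto intro: rperp_zero)
  from someI_ex[OF this, folded rb_def] show "finite rb" "rb \<subseteq> rperp"
    "\<And>e e'. e \<in> rb \<Longrightarrow> e' \<in> rb \<Longrightarrow> rq e e' = (if e = e' then 1 else 0)"
    "\<And>u. u \<in> rperp \<Longrightarrow> u = (\<lambda>x. \<Sum>e\<in>rb. rq e u * e x)" by blast+
qed

lemma rq_combination:
  assumes B: "finite B" "B \<subseteq> res" and on: "\<And>e e'. e \<in> B \<Longrightarrow> e' \<in> B \<Longrightarrow> rq e e' = (if e = e' then 1 else 0)"
    and e: "e \<in> B"
  shows "rq e (\<lambda>x. \<Sum>e'\<in>B. a e' * e' x) = a e"
proof -
  have "rq e (\<lambda>x. \<Sum>e'\<in>B. a e' * e' x) = (\<Sum>e'\<in>B. a e' * rq e e')"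
    by (rule linear_on_sum(2)[OF bound_subset_res[OF bound_zero] res_lin B]) (assumption, assumption, rule rq_lin)
  also have "\<dots> = (\<Sum>e'\<in>B. if e' = e then a e' else 0)" by (rule sum.cong) (use on[OF e] in auto)
  finally show ?thesis using e B(1) by simp
qed

text \<open>Subtracting the projection to the bound states leaves a resonance orthogonal to all of
  them, which \<open>rb\<close> spans. The pairings converge because resonances are bounded
  functions and bound states are summable.\<close>

lemma res_decomposition:
  assumes \<Psi>: "\<Psi> \<in> res"
  shows "\<exists>\<Phi>\<in>cfun.span rb. \<Psi> - \<Phi> \<in> bound"
proof -
  define P where "P = (\<lambda>x. \<Sum>e\<in>bb. pairing e \<Psi> * e x)"
  have P: "P \<in> bound" unfolding P_def by (rule linear_on_sum(1)[OF bound_zero bound_lin bb(1,2)])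
  define Q where "Q = (\<lambda>x. \<Psi> x + (- 1) * P x)"
  have Q: "Q \<in> res" unfolding Q_def by (rule res_lin[OF \<Psi> bound_subset_res[OF P]])
  have eQ: "pairing Q e = 0" if e: "e \<in> bb" for e
  proof -
    have eb: "e \<in> bound" using e bb(2) by blast
    have "pairing e P = pairing e \<Psi>"
      unfolding P_def by (rule pairing_combination[OF bb(1,2) _ e]) (simp add: bb(3))
    then have "pairing e Q = 0"
      unfolding Q_def using pairing_bound_lin[OF eb res_linfw[OF \<Psi>] res_linfw[OF bound_subset_res[OF P]], of "- 1"] by simp
    then show ?thesis using pairing_cnj[of Q e] by simp
  qed
  have "pairing \<Psi>0 Q = 0" if P0: "\<Psi>0 \<in> bound" for \<Psi>0
  proof -
    define a where "a e = pairing e \<Psi>0" for e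
    have "pairing Q \<Psi>0 = pairing Q (\<lambda>x. \<Sum>e\<in>bb. a e * e x)" unfolding a_def using bb(4)[OF P0] by simp
    also have "\<dots> = (\<Sum>e\<in>bb. a e * pairing Q e)"
      by (rule linear_on_sum(2)[OF bound_zero bound_lin bb(1,2)]) (assumption, assumption, rule pairing_res_lin[OF res_linfw[OF Q]])
    also have "\<dots> = 0" by (simp add: eQ)
    finally show ?thesis using pairing_cnj[of \<Psi>0 Q] by simp
  qed
  then have "Q \<in> rperp" using Q by (simp add: rperp_def)
  then have "Q \<in> cfun.span rb" by (subst rb(4), assumption) (rule span_combination(1)[OF rb(1)])
  moreover have "\<Psi> - Q = P" by (simp add: Q_def fun_eq_iff)
  ultimately show ?thesis using P by (intro bexI[of _ Q]) simp_all
qed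

lemma rb_res: "rb \<subseteq> res"
  using rb(2) by (auto simp: rperp_def)

lemma rb_orthonormal: "orthonormal_resonance_basis HH (real b) rb"
  unfolding orthonormal_resonance_basis_def quotient_basis_def
proof (intro conjI ballI allI impI)
  show "rb \<subseteq> res" by (rule rb_res)
  show "\<exists>\<Phi>\<in>cfun.span rb. \<Psi> - \<Phi> \<in> bound" if "\<Psi> \<in> res" for \<Psi> by (rule res_decomposition[OF that])
  show "a \<Psi> = 0" if S: "finite S \<and> S \<subseteq> rb \<and> (\<Sum>\<Psi>\<in>S. cscale (a \<Psi>) \<Psi>) \<in> bound" and \<Psi>: "\<Psi> \<in> S" for S a \<Psi>
  proof -
    have b: "(\<lambda>x. \<Sum>e\<in>S. a e * e x) \<in> bound" using S by (simp add: sum_cscale)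
    have fin: "finite S" and Sr: "S \<subseteq> res" using S rb_res by auto
    have "rq e e' = (if e = e' then 1 else 0)" if "e \<in> S" "e' \<in> S" for e e' using S that rb(3) by blast
    then have "rq \<Psi> (\<lambda>x. \<Sum>e\<in>S. a e * e x) = a \<Psi>" by (rule rq_combination[OF fin Sr _ \<Psi>])
    then show ?thesis by (simp add: rq_def cc_bound[OF b])
  qed
  fix \<Phi> \<Psi> assume e: "\<Phi> \<in> rb" "\<Psi> \<in> bound"
  show "pairing \<Psi> \<Phi> = 0" using e rb(2) by (auto simp: rperp_def)
  have "\<Phi> \<in> res" using e(1) rb_res by blast
  from res_bound_summable(2)[OF e(2) res_linfw[OF this]] show "(\<lambda>x. cnj (\<Psi> x) * \<Phi> x) \<in> l1w 0"
    using l1w_nat[of "\<lambda>x. cnj (\<Psi> x) * \<Phi> x" 0] by simp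
next
  show "\<exists>c :: ('k, 'a) gfun \<Rightarrow> 'a \<Rightarrow> complex. (\<forall>\<Phi>\<in>rb. \<forall>\<Phi>'\<in>rb. (\<Sum>\<alpha>\<in>UNIV. cnj (c \<Phi> \<alpha>) * c \<Phi>' \<alpha>) = (if \<Phi> = \<Phi>' then 1 else 0)) \<and>
    (\<forall>\<Phi>\<in>rb. \<Phi> - ray_const (c \<Phi>) \<in> l1w (real b - 2))"
  proof (intro exI[of _ cc] conjI ballI)
    fix \<Phi> assume p: "\<Phi> \<in> rb"
    have "\<Phi> \<in> res" using p rb_res by blast
    then show "\<Phi> - ray_const (cc \<Phi>) \<in> l1w (real b - 2)" using cc_l1w[of \<Phi>] by (simp add: fun_diff_def real_b2)
    show "(\<Sum>\<alpha>\<in>UNIV. cnj (cc \<Phi> \<alpha>) * cc \<Phi>' \<alpha>) = (if \<Phi> = \<Phi>' then 1 else 0)" if "\<Phi>' \<in> rb" for \<Phi>'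
      using rb(3)[OF p that] unfolding rq_def .
  qed
qed

definition res_basis :: "('k, 'a) gfun set" where
  "res_basis = (SOME B. orthonormal_resonance_basis HH (real b) B)"

lemma res_basis_orthonormal: "orthonormal_resonance_basis HH (real b) res_basis"
  unfolding res_basis_def by (rule someI[where P="orthonormal_resonance_basis HH (real b)", OF rb_orthonormal])

lemma res_basis:
  shows "res_basis \<subseteq> res" "\<And>\<Psi>. \<Psi> \<in> res \<Longrightarrow> \<exists>\<Phi>\<in>cfun.span res_basis. \<Psi> - \<Phi> \<in> bound"
    "\<And>S a \<Psi>. finite S \<Longrightarrow> S \<subseteq> res_basis \<Longrightarrow> (\<Sum>\<Psi>\<in>S. cscale (a \<Psi>) \<Psi>) \<in> bound \<Longrightarrow> \<Psi> \<in> S \<Longrightarrow> a \<Psi> = 0"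
    "\<And>\<Phi> \<Psi>. \<Phi> \<in> res_basis \<Longrightarrow> \<Psi> \<in> bound \<Longrightarrow> pairing \<Psi> \<Phi> = 0"
    "\<And>\<Phi> \<Phi>'. \<Phi> \<in> res_basis \<Longrightarrow> \<Phi>' \<in> res_basis \<Longrightarrow> rq \<Phi> \<Phi>' = (if \<Phi> = \<Phi>' then 1 else 0)"
proof -
  note R = res_basis_orthonormal[unfolded orthonormal_resonance_basis_def quotient_basis_def]
  show "res_basis \<subseteq> res" using R by blast
  show "\<exists>\<Phi>\<in>cfun.span res_basis. \<Psi> - \<Phi> \<in> bound" if "\<Psi> \<in> res" for \<Psi> using R that by blast
  show "a \<Psi> = 0" if "finite S" "S \<subseteq> res_basis" "(\<Sum>\<Psi>\<in>S. cscale (a \<Psi>) \<Psi>) \<in> bound" "\<Psi> \<in> S" for S a \<Psi>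
    using R that by blast
  show "pairing \<Psi> \<Phi> = 0" if "\<Phi> \<in> res_basis" "\<Psi> \<in> bound" for \<Phi> \<Psi> using R that by blast
  obtain c :: "('k, 'a) gfun \<Rightarrow> 'a \<Rightarrow> complex" where
    on: "\<forall>\<Phi>\<in>res_basis. \<forall>\<Phi>'\<in>res_basis. (\<Sum>\<alpha>\<in>UNIV. cnj (c \<Phi> \<alpha>) * c \<Phi>' \<alpha>) = (if \<Phi> = \<Phi>' then 1 else 0)"
    and c: "\<forall>\<Phi>\<in>res_basis. \<Phi> - ray_const (c \<Phi>) \<in> l1w (real b - 2)"
    by (rule exE[OF R[THEN conjunct2, THEN conjunct2]]) (erule conjE, rule that, assumption+)
  have "cc \<Phi> = c \<Phi>" if "\<Phi> \<in> res_basis" for \<Phi>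
    by (rule cc_eq) (use c that in \<open>simp add: fun_diff_def real_b2\<close>)
  then show "rq \<Phi> \<Phi>' = (if \<Phi> = \<Phi>' then 1 else 0)" if "\<Phi> \<in> res_basis" "\<Phi>' \<in> res_basis" for \<Phi> \<Phi>'
    using on that by (simp add: rq_def)
qed

lemma res_basis_independent: "cfun.independent res_basis"
  unfolding cfun.dependent_explicit
proof safe
  fix S a \<Psi> assume S: "finite S" "S \<subseteq> res_basis" "(\<Sum>\<Psi>\<in>S. cscale (a \<Psi>) \<Psi>) = 0" "\<Psi> \<in> S" "a \<Psi> \<noteq> 0"
  have "(\<Sum>\<Psi>\<in>S. cscale (a \<Psi>) \<Psi>) \<in> bound" unfolding S(3) zero_fun_def by (rule bound_zero)
  from res_basis(3)[OF S(1,2) this S(4)] show False using S(5) by blast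
qed

text \<open>The chosen basis is independent and lies in the span of two finite sets, one for the
  quotient and one for the bound states.\<close>

lemma finite_res_basis: "finite res_basis"
proof -
  have "res_basis \<subseteq> cfun.span (rb \<union> bb)"
  proof
    fix \<Phi> assume "\<Phi> \<in> res_basis"
    then have "\<Phi> \<in> res" using res_basis(1) by blast
    then obtain \<Phi>' where "\<Phi>' \<in> cfun.span rb" "\<Phi> - \<Phi>' \<in> cfun.span bb"
      using res_decomposition unfolding span_bb by blast
    then have "\<Phi>' + (\<Phi> - \<Phi>') \<in> cfun.span (rb \<union> bb)"
      by (intro cfun.span_add) (use cfun.span_mono[of rb "rb \<union> bb"] cfun.span_mono[of bb "rb \<union> bb"] in blast)+
    then show "\<Phi> \<in> cfun.span (rb \<union> bb)" by simp
  qed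
  moreover have "finite (rb \<union> bb)" using rb(1) bb(1) by simp
  ultimately show ?thesis using cfun.independent_span_bound[OF _ res_basis_independent] by blast
qed

lemma res_projection_sum: "res_projection HH (real b) u = (\<Sum>\<Psi>\<in>res_basis. ketbra \<Psi> \<Psi> u)"
  unfolding res_projection_def res_basis_def ..

text \<open>Expand \<open>Gi 1 u\<close> in the basis. The coefficient on e is an inner product of
  constants at infinity, which \<open>G1_in_res\<close> equates with the pairing of e with u minus
  its bound part; that part is orthogonal to e.\<close>

lemma res_projection_eq:
  assumes b5: "5 \<le> b" and u: "u \<in> l1w (real (b - 2))"
  shows "res_projection HH (real b) u = Gi 1 u"
proof -
  obtain c where gen: "Gi 1 u \<in> gen" and c: "(\<lambda>x. Gi 1 u x - ray_const c x) \<in> l1w (real (b - 2))"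
    and orth: "\<And>\<Psi>. \<Psi> \<in> bound \<Longrightarrow> pairing \<Psi> (Gi 1 u) = 0"
    and val: "\<And>\<Phi> c'. \<Phi> \<in> gen \<Longrightarrow> (\<lambda>x. \<Phi> x - ray_const c' x) \<in> l1w (real (b - 2)) \<Longrightarrow>
       pairing \<Phi> (\<lambda>x. u x - Gi 0 u x) = (\<Sum>\<alpha>\<in>UNIV. cnj (c' \<alpha>) * c \<alpha>)"
    by (rule G1_in_res[OF assms]) (rule that)
  define \<Theta> where "\<Theta> = Gi 1 u"
  have \<Theta>: "\<Theta> \<in> res" unfolding res_iff \<Theta>_def using gen c by blast
  have cc\<Theta>: "cc \<Theta> = c" unfolding \<Theta>_def by (rule cc_eq[OF c])
  obtain \<Phi> where \<Phi>: "\<Phi> \<in> cfun.span res_basis" "\<Theta> - \<Phi> \<in> bound" using res_basis(2)[OF \<Theta>] by blast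
  obtain a where a: "\<Phi> = (\<lambda>x. \<Sum>e\<in>res_basis. a e * e x)" using span_combination(2)[OF finite_res_basis \<Phi>(1)] by blast
  have \<Phi>r: "\<Phi> \<in> res" unfolding a
    by (rule linear_on_sum(1)[OF bound_subset_res[OF bound_zero] res_lin finite_res_basis res_basis(1)])
  have o\<Phi>: "pairing \<Psi> \<Phi> = 0" if \<Psi>: "\<Psi> \<in> bound" for \<Psi>
  proof -
    have "pairing \<Psi> \<Phi> = (\<Sum>e\<in>res_basis. a e * pairing \<Psi> e)"
      unfolding a by (rule linear_on_sum(2)[OF bound_subset_res[OF bound_zero] res_lin finite_res_basis res_basis(1)])
        (assumption, assumption, rule pairing_bound_lin[OF \<Psi> res_linfw res_linfw])
    also have "\<dots> = 0" using res_basis(4)[OF _ \<Psi>] by simp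
    finally show ?thesis .
  qed
  \<comment> \<open>The basis spans only modulo bound states. The error is a bound state orthogonal
    to all bound states, itself included, hence 0.\<close>
  define D where "D = (\<lambda>x. \<Theta> x + (- 1) * \<Phi> x)"
  have D: "D \<in> bound" using \<Phi>(2) by (simp add: D_def fun_diff_def)
  have "pairing D D = pairing D \<Theta> + (- 1) * pairing D \<Phi>"
    using pairing_bound_lin[OF D res_linfw[OF \<Theta>] res_linfw[OF \<Phi>r], of "- 1"] by (simp only: D_def[symmetric])
  then have "pairing D D = 0" using orth[OF D] o\<Phi>[OF D] by (simp add: \<Theta>_def)
  from self_orthogonal_zero[OF D this] have \<Theta>\<Phi>: "\<Theta> = \<Phi>" by (simp add: D_def fun_eq_iff)
  have "pairing e u = a e" if e: "e \<in> res_basis" for e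
  proof -
    have er: "e \<in> res" using e res_basis(1) by blast
    have B: "Gi 0 u \<in> bound" by (rule G0_in_bound[OF u])
    have "pairing e (Gi 0 u) = 0" using res_basis(4)[OF e B] pairing_cnj[of e "Gi 0 u"] by simp
    moreover have "pairing e (\<lambda>x. u x - Gi 0 u x) = pairing e u - pairing e (Gi 0 u)"
    proof (rule pairing_diff_right[OF _ res_bound_summable(1)[OF B res_linfw[OF er]]])
      obtain A where A: "0 \<le> A" "\<And>x. norm (e x) \<le> A * wt x ^ (b - 2)" by (rule linfwE[OF res_linfw[OF er]]) (rule that)
      show "(\<lambda>x. norm (cnj (e x) * u x)) summable_on UNIV" by (rule l1w_linfw_product(1)[OF A(2) u])
    qed
    ultimately have "pairing e u = pairing e (\<lambda>x. u x - Gi 0 u x)" by simp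
    also have "\<dots> = rq e \<Theta>"
      unfolding rq_def cc\<Theta> by (rule val[OF res_gen[OF er] cc_l1w[OF er]])
    also have "\<dots> = a e"
      unfolding \<Theta>\<Phi> a by (rule rq_combination[OF finite_res_basis res_basis(1) res_basis(5) e])
    finally show ?thesis .
  qed
  then show ?thesis unfolding res_projection_sum ketbra_sum \<Theta>_def[symmetric] \<Theta>\<Phi> a by (intro ext sum.cong) auto
qed

lemma res_basis_nonempty:
  assumes "bound \<subset> res"
  shows "res_basis \<noteq> {}"
proof
  assume e: "res_basis = {}"
  have "\<Psi> \<in> bound" if "\<Psi> \<in> res" for \<Psi> using res_basis(2)[OF that] unfolding e by simp
  then show False using assms by blast
qed

lemma bound_basis_nonempty:
  assumes "{0} \<subset> bound"
  shows "bound_basis \<noteq> {}"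
  using assms bound_basis(3) by auto

end

section \<open>The resolvent expansion\<close>

text \<open>The norm half of boundedness; linearity of the resolvent is supplied separately by
  \<open>RR_lin\<close>.\<close>

definition sq_bounded :: "(('g \<Rightarrow> complex) \<Rightarrow> 'g \<Rightarrow> complex) \<Rightarrow> bool" where
  "sq_bounded T \<longleftrightarrow> (\<exists>K\<ge>0. \<forall>u\<in>ell2. T u \<in> ell2 \<and> sqn (T u) \<le> K * sqn u)"

lemma sq_bounded_add:
  assumes "sq_bounded S" "sq_bounded T"
  shows "sq_bounded (\<lambda>u x. S u x + T u x)"
proof -
  obtain K where K: "0 \<le> K" "\<And>u. u \<in> ell2 \<Longrightarrow> S u \<in> ell2" "\<And>u. u \<in> ell2 \<Longrightarrow> sqn (S u) \<le> K * sqn u"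
    using assms(1) unfolding sq_bounded_def by blast
  obtain L where L: "0 \<le> L" "\<And>u. u \<in> ell2 \<Longrightarrow> T u \<in> ell2" "\<And>u. u \<in> ell2 \<Longrightarrow> sqn (T u) \<le> L * sqn u"
    using assms(2) unfolding sq_bounded_def by blast
  show ?thesis unfolding sq_bounded_def
  proof (intro exI[of _ "2 * K + 2 * L"] conjI ballI)
    fix u :: "'a \<Rightarrow> complex" assume u: "u \<in> ell2"
    show "(\<lambda>x. S u x + T u x) \<in> ell2" by (rule ell2_add(1)[OF K(2)[OF u] L(2)[OF u]])
    show "sqn (\<lambda>x. S u x + T u x) \<le> (2 * K + 2 * L) * sqn u"
      using ell2_add(2)[OF K(2)[OF u] L(2)[OF u]] K(3)[OF u] L(3)[OF u] by (simp add: distrib_right)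
  qed (use K L in simp)
qed

lemma sq_bounded_sum:
  assumes "finite A" "\<And>i. i \<in> A \<Longrightarrow> sq_bounded (T i)"
  shows "sq_bounded (\<lambda>u x. \<Sum>i\<in>A. T i u x)"
  using assms
proof (induction A)
  case empty
  show ?case unfolding sq_bounded_def by (intro exI[of _ 0]) (simp add: sqn_def)
next
  case (insert i A)
  then show ?case using sq_bounded_add[of "T i" "\<lambda>u x. \<Sum>i\<in>A. T i u x"] by simp
qed

text \<open>With the norm of \<open>u\<close> as parameter, the weighted inequality becomes
  proportional to that norm. The constant (sqn w + 1) / 2 is at least the norm of \<open>w\<close>,
  which is harmless here.\<close>

lemma pairing_sq_le:
  assumes w: "w \<in> ell2" and u: "u \<in> ell2"
  shows "(norm (pairing w u))\<^sup>2 \<le> ((sqn w + 1) / 2)\<^sup>2 * sqn u"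
proof (cases "sqn u = 0")
  case True
  then have "u = (\<lambda>_. 0)" using sqn_eq_0[OF u] by blast
  then show ?thesis by (simp add: pairing_def)
next
  case False
  define s where "s = sqrt (sqn u)"
  have "0 < sqn u" using False sqn_nonneg[of u] by linarith
  then have s: "0 < s" "s\<^sup>2 = sqn u" by (auto simp: s_def)
  have "norm (pairing w u) \<le> s / 2 * sqn w + 1 / (2 * s) * s\<^sup>2"
    unfolding s(2) by (rule norm_pairing_le[OF w u s(1)])
  also have "\<dots> = (sqn w + 1) / 2 * s" using s by (simp add: field_simps power2_eq_square)
  finally have "(norm (pairing w u))\<^sup>2 \<le> ((sqn w + 1) / 2 * s)\<^sup>2" by (intro power_mono) auto
  then show ?thesis unfolding power_mult_distrib s(2) .
qed

lemma sq_bounded_rank_one: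
  assumes "w \<in> ell2" "l \<in> ell2"
  shows "sq_bounded (\<lambda>u x. pairing w u * l x)"
  unfolding sq_bounded_def
proof (intro exI[of _ "((sqn w + 1) / 2)\<^sup>2 * sqn l"] conjI ballI)
  fix u :: "'a \<Rightarrow> complex" assume u: "u \<in> ell2"
  show "(\<lambda>x. pairing w u * l x) \<in> ell2" by (rule ell2_scale(1)[OF assms(2)])
  show "sqn (\<lambda>x. pairing w u * l x) \<le> ((sqn w + 1) / 2)\<^sup>2 * sqn l * sqn u"
    unfolding ell2_scale(2) using mult_right_mono[OF pairing_sq_le[OF assms(1) u] sqn_nonneg[of l]] by (simp add: mult_ac)
qed simp

context schroedinger_kernel
begin

lemma sq_bounded_Rc:
  assumes \<kappa>: "0 < Re \<kappa>"
  shows "sq_bounded (Rc \<kappa>)"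
proof -
  obtain C where C: "schur (G \<kappa>) C" using G_schur[OF \<kappa>] by blast
  note G2 = schur_ell2[OF C]
  have vb: "sqn (v h) \<le> (Cv * norm h)\<^sup>2" for h
  proof -
    have "sqn (v h) \<le> (l1w_norm (real 0) (v h))\<^sup>2"
      using l1_imp_ell2(2)[OF l1w_l1[OF v_l1w]] by (simp add: l1w_norm_nat[of 0, simplified])
    also have "\<dots> \<le> (Cv * norm h)\<^sup>2"
      by (rule power_mono[OF order_trans[OF l1w_norm_mono[OF v_l1w le0] v_norm] l1w_norm_nonneg])
    finally show ?thesis .
  qed
  have v'b: "norm (v' w) \<le> Cv * sqrt (sqn w)" if "w \<in> ell2" for w
    by (rule v'_norm[OF ell2_linfw[OF that]]) simp
  define K where "K = 2 * C\<^sup>2 + 2 * (C\<^sup>2 * ((2 * Cv\<^sup>2)\<^sup>2 * C\<^sup>2))"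
  show ?thesis unfolding sq_bounded_def
  proof (intro exI[of _ K] conjI ballI)
    show "0 \<le> K" unfolding K_def by simp
    fix u :: "('k, 'a) gfun" assume u: "u \<in> ell2"
    show "Rc \<kappa> u \<in> ell2" by (rule Rc_ell2[OF \<kappa> u])
    define w where "w = kop (G \<kappa>) u"
    define h where "h = NN \<kappa> (v' w)"
    have w: "w \<in> ell2" "sqn w \<le> C\<^sup>2 * sqn u" unfolding w_def using G2[OF u] by auto
    have "Cv * norm h \<le> Cv * (2 * (Cv * sqrt (sqn w)))"
      unfolding h_def using Cv NN_norm[OF \<kappa>, of "v' w"] v'b[OF w(1)] by (intro mult_left_mono) linarith+
    then have "(Cv * norm h)\<^sup>2 \<le> (Cv * (2 * (Cv * sqrt (sqn w))))\<^sup>2" using Cv by (intro power_mono) auto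
    also have "\<dots> = (2 * Cv\<^sup>2)\<^sup>2 * sqn w" by (simp add: power_mult_distrib power2_eq_square)
    also have "\<dots> \<le> (2 * Cv\<^sup>2)\<^sup>2 * (C\<^sup>2 * sqn u)" by (intro mult_left_mono w(2)) simp
    finally have "sqn (v h) \<le> (2 * Cv\<^sup>2)\<^sup>2 * (C\<^sup>2 * sqn u)" using vb[of h] by linarith
    then have "C\<^sup>2 * sqn (v h) \<le> C\<^sup>2 * ((2 * Cv\<^sup>2)\<^sup>2 * (C\<^sup>2 * sqn u))" by (intro mult_left_mono) auto
    then have y: "sqn (kop (G \<kappa>) (v h)) \<le> C\<^sup>2 * ((2 * Cv\<^sup>2)\<^sup>2 * (C\<^sup>2 * sqn u))" using G2(2)[OF v_ell2, of h] by linarith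
    have "sqn (Rc \<kappa> u) \<le> 2 * sqn w + 2 * sqn (kop (G \<kappa>) (v h))"
      unfolding Rc_def w_def[symmetric] h_def[symmetric] by (rule ell2_diff(2)[OF w(1) G2(1)[OF v_ell2]])
    then show "sqn (Rc \<kappa> u) \<le> K * sqn u" using w(2) y unfolding K_def by (simp add: algebra_simps)
  qed
qed

lemma RR_at:
  assumes \<kappa>: "\<kappa> \<in> half_disc \<delta>" and u: "u \<in> ell2"
  shows "RR \<kappa> u i = pairing (RR (cnj \<kappa>) (delta i)) u"
proof -
  have w: "RR (cnj \<kappa>) (delta i) \<in> ell2" by (rule RR_ell2[OF half_disc_Re[OF half_disc_cnj[OF \<kappa>]] ell2_delta])
  have "pairing (RR (cnj \<kappa>) (delta i)) u = pairing (delta i) (RR \<kappa> u)"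
    by (rule RR_pairing[OF \<kappa> ell2_delta u w RR_eq[OF half_disc_cnj[OF \<kappa>] ell2_delta]])
  then show ?thesis by simp
qed

text \<open>The coefficients of the finite-rank part are values of the resolvent on the removed
  vertices, and by \<open>RR_at\<close> each is a pairing with a fixed square-summable function. So
  this part is a sum of rank one operators.\<close>

lemma sq_bounded_RR:
  assumes \<kappa>: "\<kappa> \<in> half_disc \<delta>"
  shows "sq_bounded (RR \<kappa>)"
proof -
  note \<kappa>' = half_disc_Re[OF \<kappa>]
  define T where "T u x = Rc \<kappa> u x + (\<Sum>i\<in>F. pairing (RR (cnj \<kappa>) (delta i)) u * LL \<kappa> i x)" for u x
  have T: "sq_bounded T" unfolding T_def
  proof (rule sq_bounded_add[OF sq_bounded_Rc[OF \<kappa>'] sq_bounded_sum[OF finite_F sq_bounded_rank_one]])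
    show "RR (cnj \<kappa>) (delta i) \<in> ell2" for i by (rule RR_ell2[OF half_disc_Re[OF half_disc_cnj[OF \<kappa>]] ell2_delta])
  qed (rule LL_ell2[OF \<kappa>'])
  have e: "RR \<kappa> u = T u" if u: "u \<in> ell2" for u
  proof -
    have "RR \<kappa> u i = RR_coeff \<kappa> u i" if i: "i \<in> F" for i
    proof -
      have "Rc \<kappa> u i = 0" by (rule Rc_outside) (use i in simp)
      then show ?thesis unfolding RR_def LL_sum_F[OF i] by simp
    qed
    then have c: "RR_coeff \<kappa> u i = pairing (RR (cnj \<kappa>) (delta i)) u" if "i \<in> F" for i
      using RR_at[OF \<kappa> u, of i] that by simp
    have "RR \<kappa> u x = T u x" for x
      unfolding T_def by (subst RR_def, rule arg_cong2[where f="(+)", OF refl sum.cong[OF refl]]) (simp only: c)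
    then show ?thesis by blast
  qed
  from T show ?thesis unfolding sq_bounded_def using e by simp
qed

lemma RR_lin:
  assumes \<kappa>: "\<kappa> \<in> half_disc \<delta>" and u: "u \<in> ell2" and w: "w \<in> ell2"
  shows "RR \<kappa> (\<lambda>x. u x + c * w x) = (\<lambda>x. RR \<kappa> u x + c * RR \<kappa> w x)"
proof (rule RR_unique[OF \<kappa>, symmetric])
  note R = RR_ell2[OF half_disc_Re[OF \<kappa>]]
  show "(\<lambda>x. RR \<kappa> u x + c * RR \<kappa> w x) \<in> ell2" by (rule ell2_add(1)[OF R[OF u] ell2_scale(1)[OF R[OF w]]])
  show "(\<lambda>x. u x + c * w x) \<in> ell2" by (rule ell2_add(1)[OF u ell2_scale(1)[OF w]])
  fix x
  have "HH (\<lambda>x. RR \<kappa> u x + c * RR \<kappa> w x) x + \<kappa>\<^sup>2 * (RR \<kappa> u x + c * RR \<kappa> w x)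
    = (HH (RR \<kappa> u) x + \<kappa>\<^sup>2 * RR \<kappa> u x) + c * (HH (RR \<kappa> w) x + \<kappa>\<^sup>2 * RR \<kappa> w x)"
    unfolding HH_lin[OF ell2_in_linfw[OF R[OF u]] ell2_in_linfw[OF R[OF w]]] by (simp add: algebra_simps)
  then show "HH (\<lambda>x. RR \<kappa> u x + c * RR \<kappa> w x) x + \<kappa>\<^sup>2 * (RR \<kappa> u x + c * RR \<kappa> w x) = u x + c * w x"
    unfolding RR_eq[OF \<kappa> u] RR_eq[OF \<kappa> w] .
qed

lemma inverse_RR:
  assumes \<kappa>: "\<kappa> \<in> half_disc \<delta>"
  defines "T \<equiv> \<lambda>u. HH u + cscale (\<kappa>\<^sup>2) u"
  shows "bij_betw T ell2 ell2" "u \<in> ell2 \<Longrightarrow> inv_into ell2 T u = RR \<kappa> u"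
proof -
  have T: "T u = (\<lambda>x. HH u x + \<kappa>\<^sup>2 * u x)" for u by (simp add: T_def cscale_def fun_eq_iff)
  have TR: "T (RR \<kappa> u) = u" if "u \<in> ell2" for u unfolding T using RR_eq[OF \<kappa> that] by blast
  have Tl: "T u \<in> ell2" if "u \<in> ell2" for u unfolding T by (rule ell2_add(1)[OF HH_ell2[OF that] ell2_scale(1)[OF that]])
  have RT: "RR \<kappa> (T u) = u" if "u \<in> ell2" for u
    by (rule RR_unique[OF \<kappa> that Tl[OF that], symmetric]) (simp add: T)
  note R = RR_ell2[OF half_disc_Re[OF \<kappa>]]
  show bij: "bij_betw T ell2 ell2"
    by (rule bij_betw_byWitness[where f'="RR \<kappa>"]) (use TR RT Tl R in auto)
  show "inv_into ell2 T u = RR \<kappa> u" if u: "u \<in> ell2"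
    using inv_into_f_f[OF bij_betw_imp_inj_on[OF bij] R[OF u]] unfolding TR[OF u] .
qed

lemma resolvent_eq: "\<kappa> \<in> half_disc \<delta> \<Longrightarrow> u \<in> ell2 \<Longrightarrow> resolvent HH \<kappa> u = RR \<kappa> u"
  unfolding resolvent_def by (rule inverse_RR(2))

lemma not_in_spectrum:
  assumes \<kappa>: "\<kappa> \<in> half_disc \<delta>"
  shows "- (\<kappa>\<^sup>2) \<notin> spectrum HH"
proof -
  have e: "(\<lambda>u. HH u - cscale (- (\<kappa>\<^sup>2)) u) = (\<lambda>u. HH u + cscale (\<kappa>\<^sup>2) u)"
    by (simp add: cscale_def fun_eq_iff)
  note R = RR_ell2[OF half_disc_Re[OF \<kappa>]]
  obtain K where K: "0 \<le> K" "\<And>u. u \<in> ell2 \<Longrightarrow> sqn (RR \<kappa> u) \<le> K * sqn u"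
    using sq_bounded_RR[OF \<kappa>] unfolding sq_bounded_def by blast
  have "bounded_op ell2 ell2_norm ell2 ell2_norm (inv_into ell2 (\<lambda>u. HH u + cscale (\<kappa>\<^sup>2) u))"
    unfolding bounded_op_def
  proof (intro conjI ballI allI)
    show "inv_into ell2 (\<lambda>u. HH u + cscale (\<kappa>\<^sup>2) u) ` ell2 \<subseteq> ell2"
      by (auto simp: inverse_RR(2)[OF \<kappa>] R)
    show "inv_into ell2 (\<lambda>u. HH u + cscale (\<kappa>\<^sup>2) u) (u + w)
      = inv_into ell2 (\<lambda>u. HH u + cscale (\<kappa>\<^sup>2) u) u + inv_into ell2 (\<lambda>u. HH u + cscale (\<kappa>\<^sup>2) u) w"
      if u: "u \<in> ell2" and w: "w \<in> ell2" for u w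
    proof -
      have uw: "u + w = (\<lambda>x. u x + 1 * w x)" by (simp add: fun_eq_iff)
      have uwl: "u + w \<in> ell2" unfolding uw by (rule ell2_add(1)[OF u ell2_scale(1)[OF w]])
      show ?thesis unfolding inverse_RR(2)[OF \<kappa> uwl] inverse_RR(2)[OF \<kappa> u] inverse_RR(2)[OF \<kappa> w]
        unfolding uw RR_lin[OF \<kappa> u w] by (simp add: fun_eq_iff)
    qed
    show "inv_into ell2 (\<lambda>u. HH u + cscale (\<kappa>\<^sup>2) u) (cscale c u) = cscale c (inv_into ell2 (\<lambda>u. HH u + cscale (\<kappa>\<^sup>2) u) u)"
      if u: "u \<in> ell2" for c u
    proof -
      have cu: "cscale c u = (\<lambda>x. u x + (c - 1) * u x)" by (simp add: cscale_def fun_eq_iff algebra_simps)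
      have cl: "cscale c u \<in> ell2" unfolding cscale_def by (rule ell2_scale(1)[OF u])
      have "RR \<kappa> (cscale c u) = cscale c (RR \<kappa> u)"
        unfolding cu RR_lin[OF \<kappa> u u] by (simp add: cscale_def fun_eq_iff algebra_simps)
      then show ?thesis unfolding inverse_RR(2)[OF \<kappa> cl] inverse_RR(2)[OF \<kappa> u] .
    qed
    show "\<exists>C. \<forall>u\<in>ell2. ell2_norm (inv_into ell2 (\<lambda>u. HH u + cscale (\<kappa>\<^sup>2) u) u) \<le> C * ell2_norm u"
    proof (intro exI[of _ "sqrt K"] ballI)
      fix u :: "('k, 'a) gfun" assume u: "u \<in> ell2"
      show "ell2_norm (inv_into ell2 (\<lambda>u. HH u + cscale (\<kappa>\<^sup>2) u) u) \<le> sqrt K * ell2_norm u"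
        unfolding inverse_RR(2)[OF \<kappa> u] ell2_norm_sqn real_sqrt_mult[symmetric]
        by (rule real_sqrt_le_mono[OF K(2)[OF u]])
    qed
  qed
  then show ?thesis using inverse_RR(1)[OF \<kappa>] unfolding spectrum_def e by simp
qed

lemma Gi_Bs:
  assumes i: "i < b - 3" "i \<le> s"
  shows "Gi i \<in> Bs (real s)"
  unfolding Bs_def bounded_op_def
proof (intro CollectI conjI ballI allI)
  have bd: "norm (Gi i u x) \<le> C * l1w_norm (real s) u * wt x ^ s" if u: "u \<in> l1w (real s)" for u x
  proof -
    have "norm (Gi i u x) \<le> C * wt x ^ i * l1w_norm (real i) u" by (rule Gi_bound(2)[OF i(1) l1w_mono[OF u i(2)]])
    also have "\<dots> \<le> C * wt x ^ s * l1w_norm (real s) u"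
      by (intro mult_mono[OF mult_left_mono[OF wt_power_mono[OF i(2)] C] l1w_norm_mono[OF u i(2)]]
          mult_nonneg_nonneg C zero_le_power wt_nonneg l1w_norm_nonneg)
    finally show ?thesis by (simp add: mult_ac)
  qed
  show "Gi i ` l1w (real s) \<subseteq> linfw (real s)" by (rule image_subsetI, rule linfwI, rule bd)
  have lin: "Gi i (\<lambda>y. u y + c * w y) = (\<lambda>x. Gi i u x + c * Gi i w x)" if "u \<in> l1w (real s)" "w \<in> l1w (real s)" for u w c
    using Gi_lin[OF i(1) l1w_mono[OF that(1) i(2)] l1w_mono[OF that(2) i(2)]] by blast
  show "Gi i (u + w) = Gi i u + Gi i w" if "u \<in> l1w (real s)" "w \<in> l1w (real s)" for u w
    using lin[OF that, of 1] by (simp add: plus_fun_def)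
  show "Gi i (cscale c u) = cscale c (Gi i u)" if "u \<in> l1w (real s)" for c u
  proof -
    have cu: "cscale c u = (\<lambda>x. u x + (c - 1) * u x)" by (simp add: cscale_def fun_eq_iff algebra_simps)
    show ?thesis unfolding cu lin[OF that that] by (simp add: cscale_def fun_eq_iff algebra_simps)
  qed
  show "\<exists>C. \<forall>u\<in>l1w (real s). linfw_norm (real s) (Gi i u) \<le> C * l1w_norm (real s) u"
    by (rule exI[of _ C], rule ballI, rule linfw_norm_le, rule bd)
qed

text \<open>The two leading coefficients are the projections by definition. Agreement with the
  kernel coefficients is established on \<open>l1w (real (b - 2))\<close>, which is all the
  remainder sees, while the projections are wanted on \<open>l1w 1\<close>; and for b = 4 no kernel
  coefficient of index 1 is available.\<close>

definition GG :: "int \<Rightarrow> ('k, 'a) gfun \<Rightarrow> ('k, 'a) gfun" where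
  "GG j = (if j = - 2 then bound_projection HH (real b) else if j = - 1 then res_projection HH (real b) else Gi (nat (j + 2)))"

lemma GG_eq:
  assumes "i < b - 3" "u \<in> l1w (real (b - 2))"
  shows "GG (int i - 2) u = Gi i u"
proof -
  consider "i = 0" | "i = 1" | "2 \<le> i" by linarith
  then show ?thesis
  proof cases
    case 1 then show ?thesis using bound_projection_eq[OF assms(2)] by (simp add: GG_def)
  next
    case 2
    have "res_projection HH (real b) u = Gi 1 u" by (rule res_projection_eq[OF _ assms(2)]) (use assms(1) 2 in simp)
    then show ?thesis using 2 by (simp add: GG_def)
  qed (simp add: GG_def)
qed

definition remainder :: "complex \<Rightarrow> ('k, 'a) gfun \<Rightarrow> ('k, 'a) gfun" where
  "remainder \<kappa> u = resolvent HH \<kappa> u - (\<Sum>j=-2..int b - 6. cscale (\<kappa> powi j) (GG j u))"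

lemma remainder_eq:
  assumes \<kappa>: "\<kappa> \<in> half_disc \<delta>" and u: "u \<in> l1w (real (b - 2))"
  shows "remainder \<kappa> u = (\<lambda>x. RR \<kappa> u x - (\<Sum>i<b - 3. \<kappa> powi (int i - 2) * Gi i u x))"
proof -
  have "(\<Sum>j=-2..int b - 6. cscale (\<kappa> powi j) (GG j u)) = (\<Sum>i<b - 3. cscale (\<kappa> powi (int i - 2)) (GG (int i - 2) u))"
    using b4 by (intro sum.reindex_bij_witness[of _ "\<lambda>i. int i - 2" "\<lambda>j. nat (j + 2)"]) auto
  also have "\<dots> = (\<Sum>i<b - 3. cscale (\<kappa> powi (int i - 2)) (Gi i u))"
    using GG_eq[OF _ u] by (intro sum.cong) auto
  finally show ?thesis unfolding remainder_def resolvent_eq[OF \<kappa> l1w_ell2[OF u]] sum_cscale by (simp add: fun_diff_def)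
qed

text \<open>The estimate for \<kappa>^2 times the resolvent, divided by \<kappa>^2. The exponent b -
  5 is an integer power because it is negative for b = 4.\<close>

lemma remainder_bound:
  assumes \<kappa>: "\<kappa> \<in> half_disc \<delta>" and u: "u \<in> l1w (real (b - 2))"
  shows "norm (remainder \<kappa> u x) \<le> C * norm \<kappa> powi (int b - 5) * l1w_norm (real (b - 2)) u * wt x ^ (b - 2)"
proof -
  have nz: "\<kappa> \<noteq> 0" by (rule half_disc_nz[OF \<kappa>])
  have pw: "y ^ 2 * y powi (int i - 2) = y ^ i" if "y \<noteq> 0" for y :: "'f::field" and i
    using that by (simp add: power_int_diff)
  have "\<kappa>\<^sup>2 * remainder \<kappa> u x = \<kappa>\<^sup>2 * RR \<kappa> u x - (\<Sum>i<b - 3. (\<kappa>\<^sup>2 * \<kappa> powi (int i - 2)) * Gi i u x)"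
    unfolding remainder_eq[OF \<kappa> u] by (simp add: right_diff_distrib sum_distrib_left mult.assoc)
  then have e: "\<kappa>\<^sup>2 * remainder \<kappa> u x = \<kappa>\<^sup>2 * RR \<kappa> u x - (\<Sum>i<b - 3. \<kappa> ^ i * Gi i u x)" unfolding pw[OF nz] .
  have "norm \<kappa> ^ 2 * norm (remainder \<kappa> u x) \<le> C * wt x ^ (b - 2) * norm \<kappa> ^ (b - 3) * l1w_norm (real (b - 2)) u"
    using RR_remainder[OF \<kappa> u, of x] unfolding e[symmetric] by (simp add: norm_mult norm_power)
  also have "norm \<kappa> ^ (b - 3) = norm \<kappa> ^ 2 * norm \<kappa> powi (int b - 5)"
    using pw[of "norm \<kappa>" "b - 3"] nz b4 by (simp add: of_nat_diff)
  finally have "norm \<kappa> ^ 2 * norm (remainder \<kappa> u x)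
    \<le> norm \<kappa> ^ 2 * (C * norm \<kappa> powi (int b - 5) * l1w_norm (real (b - 2)) u * wt x ^ (b - 2))" by (simp add: mult_ac)
  then show ?thesis using nz by (subst (asm) mult_le_cancel_left_pos) auto
qed

lemma remainder_Bs:
  assumes \<kappa>: "\<kappa> \<in> half_disc \<delta>"
  shows "remainder \<kappa> \<in> Bs (real (b - 2))"
    "\<bar>Bs_norm (real (b - 2)) (remainder \<kappa>)\<bar> \<le> C * norm \<kappa> powi (int b - 5)"
proof -
  let ?s = "real (b - 2)"
  let ?K = "C * norm \<kappa> powi (int b - 5)"
  have K: "0 \<le> ?K" using C by simp
  have le: "linfw_norm ?s (remainder \<kappa> u) \<le> ?K * l1w_norm ?s u" if "u \<in> l1w ?s" for u
    by (rule linfw_norm_le[OF remainder_bound[OF \<kappa> that]])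
  have into: "remainder \<kappa> u \<in> linfw ?s" if "u \<in> l1w ?s" for u
    by (rule linfwI[OF remainder_bound[OF \<kappa> that]])
  have lin: "remainder \<kappa> (\<lambda>x. u x + c * w x) = (\<lambda>x. remainder \<kappa> u x + c * remainder \<kappa> w x)"
    if u: "u \<in> l1w ?s" and w: "w \<in> l1w ?s" for u w c
  proof -
    have "Gi i (\<lambda>x. u x + c * w x) x = Gi i u x + c * Gi i w x" if "i < b - 3" for i x
      by (rule Gi_lin[OF that]) (use that u_l1w[OF u, of i] u_l1w[OF w, of i] in auto)
    then have "(\<Sum>i<b - 3. \<kappa> powi (int i - 2) * Gi i (\<lambda>x. u x + c * w x) x)
      = (\<Sum>i<b - 3. \<kappa> powi (int i - 2) * Gi i u x) + c * (\<Sum>i<b - 3. \<kappa> powi (int i - 2) * Gi i w x)" for x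
      by (simp add: sum_distrib_left sum.distrib[symmetric] distrib_left mult_ac)
    then show ?thesis
      unfolding remainder_eq[OF \<kappa> l1w_add[OF u l1w_scale[OF w]]] remainder_eq[OF \<kappa> u] remainder_eq[OF \<kappa> w]
        RR_lin[OF \<kappa> l1w_ell2[OF u] l1w_ell2[OF w]] by (simp add: fun_eq_iff right_diff_distrib)
  qed
  show "remainder \<kappa> \<in> Bs ?s" unfolding Bs_def bounded_op_def
  proof (intro CollectI conjI ballI allI)
    show "remainder \<kappa> ` l1w ?s \<subseteq> linfw ?s" using into by blast
    show "remainder \<kappa> (u + w) = remainder \<kappa> u + remainder \<kappa> w" if "u \<in> l1w ?s" "w \<in> l1w ?s" for u w
      using lin[OF that, of 1] by (simp add: plus_fun_def)
    show "remainder \<kappa> (cscale c u) = cscale c (remainder \<kappa> u)" if "u \<in> l1w ?s" for c u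
    proof -
      have cu: "cscale c u = (\<lambda>x. u x + (c - 1) * u x)" by (simp add: cscale_def fun_eq_iff algebra_simps)
      show ?thesis unfolding cu lin[OF that that] by (simp add: cscale_def fun_eq_iff algebra_simps)
    qed
    show "\<exists>C. \<forall>u\<in>l1w ?s. linfw_norm ?s (remainder \<kappa> u) \<le> C * l1w_norm ?s u" using le by blast
  qed
  have z: "(\<lambda>_. 0) \<in> (l1w ?s :: ('k, 'a) gfun set)" by (rule l1w_finite_support[of "{}"]) auto
  have up: "linfw_norm ?s (remainder \<kappa> u) / l1w_norm ?s u \<le> ?K" if u: "u \<in> l1w ?s" for u
  proof (cases "l1w_norm ?s u = 0")
    case False
    then have "0 < l1w_norm ?s u" using l1w_norm_nonneg[of "b - 2" u] by linarith
    then show ?thesis using le[OF u] by (simp add: divide_le_eq)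
  qed (use K in simp)
  have "Bs_norm ?s (remainder \<kappa>) \<le> ?K" unfolding Bs_norm_def by (rule cSUP_least) (use z up in auto)
  moreover have "0 \<le> Bs_norm ?s (remainder \<kappa>)"
  proof -
    have "linfw_norm ?s (remainder \<kappa> (\<lambda>_. 0)) / l1w_norm ?s ((\<lambda>_. 0) :: ('k, 'a) gfun) \<le> Bs_norm ?s (remainder \<kappa>)"
      unfolding Bs_norm_def by (rule cSUP_upper[where f="\<lambda>u. linfw_norm ?s (remainder \<kappa> u) / l1w_norm ?s u", OF z], rule bdd_aboveI2[of _ _ ?K], rule up)
    moreover have "0 \<le> linfw_norm ?s (remainder \<kappa> (\<lambda>_. 0)) / l1w_norm ?s ((\<lambda>_. 0) :: ('k, 'a) gfun)"
      by (rule divide_nonneg_nonneg[OF linfw_norm_nonneg[OF into[OF z]] l1w_norm_nonneg])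
    ultimately show ?thesis by (rule order_trans[rotated])
  qed
  ultimately show "\<bar>Bs_norm ?s (remainder \<kappa>)\<bar> \<le> ?K" by simp
qed

text \<open>The projections are finite sums over functions of at most linear growth. For j \<ge> 0
  the kernel bound gives the weight j + 2, which is stronger than j + 3 when j is even.\<close>

lemma GG_Bs:
  assumes "j \<in> {- 2..int b - 6}"
  shows "GG j \<in> Bs (real_of_int (if even j then j + 3 else j + 2))"
proof -
  consider "j = - 2" | "j = - 1" | "0 \<le> j" using assms by fastforce
  then show ?thesis
  proof cases
    case 1
    have "GG j = (\<lambda>u. \<Sum>\<Psi>\<in>bound_basis. ketbra \<Psi> \<Psi> u)"
      using 1 by (simp add: GG_def bound_projection_sum fun_eq_iff)
    moreover have "(\<lambda>u. \<Sum>\<Psi>\<in>bound_basis. ketbra \<Psi> \<Psi> u) \<in> Bs (real 1)"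
      by (rule ketbra_sum_Bs[OF bound_basis(4)]) (use bound_basis(5) ell2_in_linfw bound_ell2 in blast)
    ultimately show ?thesis using 1 by simp
  next
    case 2
    have "GG j = (\<lambda>u. \<Sum>\<Psi>\<in>res_basis. ketbra \<Psi> \<Psi> u)"
      using 2 by (simp add: GG_def res_projection_sum fun_eq_iff)
    moreover have "(\<lambda>u. \<Sum>\<Psi>\<in>res_basis. ketbra \<Psi> \<Psi> u) \<in> Bs (real 1)"
      by (rule ketbra_sum_Bs[OF finite_res_basis]) (use res_basis(1) res_linfw in blast)
    ultimately show ?thesis using 2 by simp
  next
    case 3
    define s where "s = nat (if even j then j + 3 else j + 2)"
    have "Gi (nat (j + 2)) \<in> Bs (real s)" by (rule Gi_Bs) (use 3 assms in \<open>auto simp: s_def\<close>)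
    moreover have "real s = real_of_int (if even j then j + 3 else j + 2)" using 3 by (simp add: s_def)
    ultimately show ?thesis using 3 by (simp add: GG_def)
  qed
qed

lemma threshold_expansion:
  assumes "bound \<subset> res" "{0} \<subset> bound"
  shows "(\<forall>\<^sub>F \<kappa> in at 0 within {\<kappa>. Re \<kappa> > 0}. - (\<kappa>\<^sup>2) \<notin> spectrum HH \<and> remainder \<kappa> \<in> Bs (real b - 2))"
    "(\<lambda>\<kappa>. Bs_norm (real b - 2) (remainder \<kappa>)) \<in> O[at 0 within {\<kappa>. Re \<kappa> > 0}](\<lambda>\<kappa>. norm \<kappa> powi (int b - 5))"
    "\<exists>u\<in>l1w 1. GG (- 2) u \<noteq> 0" "\<exists>u\<in>l1w 1. GG (- 1) u \<noteq> 0"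
proof -
  have ev: "\<forall>\<^sub>F \<kappa> in at 0 within {\<kappa>. Re \<kappa> > 0}. \<kappa> \<in> half_disc \<delta>"
    unfolding eventually_at by (rule exI[of _ \<delta>]) (use \<delta> in \<open>auto simp: half_disc_def\<close>)
  show "\<forall>\<^sub>F \<kappa> in at 0 within {\<kappa>. Re \<kappa> > 0}. - (\<kappa>\<^sup>2) \<notin> spectrum HH \<and> remainder \<kappa> \<in> Bs (real b - 2)"
    unfolding real_b2 using ev by eventually_elim (intro conjI not_in_spectrum remainder_Bs(1))
  show "(\<lambda>\<kappa>. Bs_norm (real b - 2) (remainder \<kappa>)) \<in> O[at 0 within {\<kappa>. Re \<kappa> > 0}](\<lambda>\<kappa>. norm \<kappa> powi (int b - 5))"
    unfolding real_b2
  proof (rule bigoI[of _ C])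
    show "\<forall>\<^sub>F \<kappa> in at 0 within {\<kappa>. Re \<kappa> > 0}. norm (Bs_norm (real (b - 2)) (remainder \<kappa>)) \<le> C * norm (norm \<kappa> powi (int b - 5))"
      using ev by eventually_elim (use remainder_Bs(2) in \<open>simp add: power_int_abs\<close>)
  qed
  have "\<exists>u\<in>l1w (real 1). (\<Sum>\<Psi>\<in>bound_basis. ketbra \<Psi> \<Psi> u) \<noteq> 0"
    by (rule ketbra_sum_nonzero[OF bound_basis(4,2) bound_basis_nonempty[OF assms(2)]])
  then show "\<exists>u\<in>l1w 1. GG (- 2) u \<noteq> 0" by (simp add: GG_def bound_projection_sum)
  have "\<exists>u\<in>l1w (real 1). (\<Sum>\<Psi>\<in>res_basis. ketbra \<Psi> \<Psi> u) \<noteq> 0"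
    by (rule ketbra_sum_nonzero[OF finite_res_basis res_basis_independent res_basis_nonempty[OF assms(1)]])
  then show "\<exists>u\<in>l1w 1. GG (- 1) u \<noteq> 0" by (simp add: GG_def res_projection_sum)
qed

end

theorem theorem3p8:
  fixes E0 :: "'k::finite set set"
    and r :: "'a::finite \<Rightarrow> 'k"
    and V H :: "('k, 'a) gfun \<Rightarrow> ('k, 'a) gfun"
    and \<beta> :: int
  assumes graph: "connected_simple_graph E0"
    and beta: "\<beta> \<ge> 4"
    and A: "assumption_A TYPE('h::chilbert_space) (real_of_int \<beta>) V"
    and H: "H = (\<lambda>u. H0 E0 r u + V u)"
    and third_kind: "bound_space H (real_of_int \<beta>) \<subset> res_space H (real_of_int \<beta>)"
      "{0} \<subset> bound_space H (real_of_int \<beta>)"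
  shows "\<exists>G :: int \<Rightarrow> ('k, 'a) gfun \<Rightarrow> ('k, 'a) gfun.
    (\<forall>\<^sub>F \<kappa> in at 0 within {\<kappa>. Re \<kappa> > 0}.
       - (\<kappa>\<^sup>2) \<notin> spectrum H \<and>
       (\<lambda>u. resolvent H \<kappa> u - (\<Sum>j=-2..\<beta>-6. cscale (\<kappa> powi j) (G j u)))
         \<in> Bs (real_of_int \<beta> - 2)) \<and>
    (\<lambda>\<kappa>. Bs_norm (real_of_int \<beta> - 2)
        (\<lambda>u. resolvent H \<kappa> u - (\<Sum>j=-2..\<beta>-6. cscale (\<kappa> powi j) (G j u))))
      \<in> O[at 0 within {\<kappa>. Re \<kappa> > 0}](\<lambda>\<kappa>. norm \<kappa> powi (\<beta> - 5)) \<and>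
    (\<forall>j\<in>{-2..\<beta>-6}. G j \<in> Bs (real_of_int (if even j then j + 3 else j + 2))) \<and>
    (\<forall>u\<in>l1w 1. G (-2) u = bound_projection H (real_of_int \<beta>) u) \<and>
    (\<exists>u\<in>l1w 1. G (-2) u \<noteq> 0) \<and>
    (\<forall>u\<in>l1w 1. G (-1) u = res_projection H (real_of_int \<beta>) u) \<and>
    (\<exists>u\<in>l1w 1. G (-1) u \<noteq> 0)"
proof -
  define b where "b = nat \<beta>"
  have b: "\<beta> = int b" "4 \<le> b" using beta by (auto simp: b_def)
  have rb: "real_of_int \<beta> = real b" by (simp add: b(1))
  obtain v :: "'h \<Rightarrow> ('k, 'a) gfun" and v' U where Vs: "bounded_selfadjoint V" and v: "bounded_into_l1w (real b) v"
    and adj: "is_adjoint (real b) v v'" and U: "selfadjoint_unitary U" and Veq: "\<forall>u\<in>linfw (real b). V u = v (U (v' u))"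
    using A unfolding assumption_A_def rb by blast
  obtain K where K: "\<And>h. l1w_norm (real b) (v h) \<le> K * norm h" using v unfolding bounded_into_l1w_def by blast
  \<comment> \<open>Raised to at least 1 so that the constant is positive.\<close>
  define Cv where "Cv = max K 1"
  have Kv: "l1w_norm (real b) (v h) \<le> Cv * norm h" for h
    by (rule order_trans[OF K mult_right_mono]) (auto simp: Cv_def)
  \<comment> \<open>The half-lines are cut far enough out for the exterior contraction.\<close>
  obtain n :: nat where n: "2 * Cv\<^sup>2 \<le> real n" using real_arch_simple by blast
  interpret S: schroedinger E0 r V b v v' U Cv n
    by unfold_locales (use b(2) Vs v adj U Veq Kv n in \<open>auto simp: bounded_into_l1w_def Cv_def\<close>)
  obtain \<delta> X where \<delta>: "0 < \<delta>" "\<delta> \<le> 1"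
    and X: "\<And>\<kappa> i j. \<kappa> \<in> half_disc \<delta> \<Longrightarrow> i \<in> S.F \<Longrightarrow> j \<in> S.F \<Longrightarrow> (\<Sum>l\<in>S.F. S.SS \<kappa> i l * X \<kappa> l j) = (if i = j then 1 else 0)"
      "\<And>\<kappa> i j. \<kappa> \<in> half_disc \<delta> \<Longrightarrow> i \<in> S.F \<Longrightarrow> j \<in> S.F \<Longrightarrow> (\<Sum>l\<in>S.F. X \<kappa> i l * S.SS \<kappa> l j) = (if i = j then 1 else 0)"
      "\<And>i j. i \<in> S.F \<Longrightarrow> j \<in> S.F \<Longrightarrow> gexp \<delta> (b - 1 - 2) (\<lambda>_::unit. 1) (\<lambda>_. 1) (\<lambda>_ \<kappa>. \<kappa>\<^sup>2 * X \<kappa> i j)"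
    by (rule S.SS_inverse_exists) (rule that)
  interpret I: schroedinger_inverse E0 r V b v v' U Cv n \<delta> X
  proof
    show "gexp \<delta> (b - 3) (\<lambda>_::unit. 1) (\<lambda>_. 1) (\<lambda>_ \<kappa>. \<kappa>\<^sup>2 * X \<kappa> i j)" if "i \<in> S.F" "j \<in> S.F" for i j
    proof -
      have e: "b - 1 - 2 = b - 3" by simp
      show ?thesis using X(3)[OF that] unfolding e .
    qed
  qed (rule \<delta> X; assumption?)+
  obtain g C where g: "0 \<le> C" "\<And>i x y. i < b - 3 \<Longrightarrow> norm (g i x y) \<le> C * (wt x * wt y) ^ i"
    "\<And>\<kappa> x y. \<kappa> \<in> half_disc \<delta> \<Longrightarrow>
       norm (\<kappa>\<^sup>2 * I.KK \<kappa> x y - (\<Sum>i<b - 3. \<kappa> ^ i * g i x y)) \<le> C * (wt x * wt y) ^ (b - 2) * norm \<kappa> ^ (b - 3)"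
    by (rule I.kernel_expansion) (rule that)
  interpret T: schroedinger_kernel E0 r V b v v' U Cv n \<delta> X g C
    by unfold_locales (rule g; assumption?)+
  have HH: "H = S.HH" unfolding H S.HH_alt ..
  note E = T.threshold_expansion[OF third_kind[unfolded rb HH]]
  show ?thesis
    unfolding HH rb unfolding b(1)
  proof (intro exI[of _ T.GG] conjI)
    show "\<forall>\<^sub>F \<kappa> in at 0 within {\<kappa>. Re \<kappa> > 0}. - (\<kappa>\<^sup>2) \<notin> spectrum S.HH \<and>
       (\<lambda>u. resolvent S.HH \<kappa> u - (\<Sum>j=-2..int b-6. cscale (\<kappa> powi j) (T.GG j u))) \<in> Bs (real b - 2)"
      using E(1) unfolding T.remainder_def[abs_def] .
    show "(\<lambda>\<kappa>. Bs_norm (real b - 2) (\<lambda>u. resolvent S.HH \<kappa> u - (\<Sum>j=-2..int b-6. cscale (\<kappa> powi j) (T.GG j u))))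
      \<in> O[at 0 within {\<kappa>. Re \<kappa> > 0}](\<lambda>\<kappa>. norm \<kappa> powi (int b - 5))"
      using E(2) unfolding T.remainder_def[abs_def] .
    show "\<forall>j\<in>{-2..int b-6}. T.GG j \<in> Bs (real_of_int (if even j then j + 3 else j + 2))" using T.GG_Bs by blast
    show "\<forall>u\<in>l1w 1. T.GG (-2) u = bound_projection S.HH (real b) u" by (simp add: T.GG_def)
    show "\<forall>u\<in>l1w 1. T.GG (-1) u = res_projection S.HH (real b) u" by (simp add: T.GG_def)
    show "\<exists>u\<in>l1w 1. T.GG (-2) u \<noteq> 0" by (rule E(3))
    show "\<exists>u\<in>l1w 1. T.GG (-1) u \<noteq> 0" by (rule E(4))
  qed
qed

end
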